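(* Let $L\ge 2$ be an integer. For each $n\ge1$ let \[ f = X^n + \sum_{i=0}^{n-1} \zeta_i X^i, \] where $\zeta_0,\ldots,\zeta_{n-1}$ are independent random variables, each uniformly distributed on $\{1,\ldots,L\}$. Let $G_f$ be the Galois group of the splitting field of $f$ over $\mathbb{Q}$, viewed as a subgroup of $S_n$ via its action on the roots of $f$. Then \[ \lim_{n\to\infty}\mathbb{P}(G_f \text{ is transitive and } G_f\ne A_n,\ G_f\ne S_n)=0. \]
   Context: $A_n$ and $S_n$ denote the alternating and symmetric groups on the $n$ roots of $f$. *)

theory Defs
  imports
    "HOL-Probability.Probability"
    "HOL-Combinatorics.Permutations"
    "HOL-Combinatorics.Orbits"
    "HOL-Algebra.Generated_Fields"
    "HOL-Algebra.Algebraic_Closure_Type"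
begin

definition complex_roots :: "rat poly \<Rightarrow> complex set" where
  "complex_roots f = {z. poly (map_poly of_rat f) z = 0}"

text \<open>The splitting field of \<open>f\<close> over the rationals, realised inside the complex numbers.\<close>

definition splitting_field :: "rat poly \<Rightarrow> complex ring" where
  "splitting_field f =
     ring_of_type_algebra
       \<lparr>carrier := generate_field ring_of_type_algebra (\<rat> \<union> complex_roots f)\<rparr>"

text \<open>Automorphisms are taken to be \<open>undefined\<close> outside the splitting field, so that each
  one is represented by exactly one function.\<close>

definition galois_group :: "rat poly \<Rightarrow> (complex \<Rightarrow> complex) set" where
  "galois_group f =
     {\<sigma> \<in> ring_iso (splitting_field f) (splitting_field f).
        \<sigma> \<in> extensional (carrier (splitting_field f)) \<and> (\<forall>q\<in>\<rat>. \<sigma> q = q)}"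

text \<open>The image of the Galois group in the permutations of the set of roots; as usual for
  \<^const>\<open>permutes\<close>, permutations are extended by the identity outside that set.\<close>

definition galois_perms :: "rat poly \<Rightarrow> (complex \<Rightarrow> complex) set" where
  "galois_perms f = (\<lambda>\<sigma>. perm_restrict \<sigma> (complex_roots f)) ` galois_group f"

definition galois_transitive :: "rat poly \<Rightarrow> bool" where
  "galois_transitive f \<longleftrightarrow>
     (\<forall>x\<in>complex_roots f. \<forall>y\<in>complex_roots f. \<exists>p\<in>galois_perms f. p x = y)"

text \<open>For a polynomial of degree \<open>n\<close>, the groups \<open>S\<^sub>n\<close> and \<open>A\<^sub>n\<close> act on \<open>n\<close> distinct roots.
  The condition on the cardinality matters only if \<open>f\<close> has a repeated root: such an \<open>f\<close> is
  regarded as having Galois group neither \<open>S\<^sub>n\<close> nor \<open>A\<^sub>n\<close>.\<close>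

definition galois_symmetric :: "nat \<Rightarrow> rat poly \<Rightarrow> bool" where
  "galois_symmetric n f \<longleftrightarrow>
     card (complex_roots f) = n \<and> galois_perms f = {p. p permutes complex_roots f}"

definition galois_alternating :: "nat \<Rightarrow> rat poly \<Rightarrow> bool" where
  "galois_alternating n f \<longleftrightarrow>
     card (complex_roots f) = n \<and> galois_perms f = {p. p permutes complex_roots f \<and> evenperm p}"

definition monic_poly :: "nat \<Rightarrow> (nat \<Rightarrow> nat) \<Rightarrow> rat poly" where
  "monic_poly n a = Polynomial.monom 1 n + (\<Sum>i<n. Polynomial.monom (of_nat (a i)) i)"

end

theory Submission
  imports
    Defs
    "Jordan_Normal_Form.Char_Poly"
    "HOL-Combinatorics.Cycles"
    "HOL-Number_Theory.Cong"
    "HOL-Real_Asymp.Real_Asymp"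
begin

text \<open>
  Fix a prime \<open>p\<close> dividing \<open>L\<close>. Modulo \<open>p\<close> the random polynomial is a uniform monic polynomial over
  the field with \<open>p\<close> elements, and a Frobenius element of the Galois group at a place \<open>P\<close> above \<open>p\<close>
  permutes the roots so that every one of its orbits reduces to a power of an irreducible factor;
  only factors of multiplicity at least two give rise to ambiguity, and with high probability these
  have total degree at most \<open>ln n / 10\<close>. With high probability, moreover, some simple factor has prime
  degree \<open>q\<close> with \<open>ln n ^ 3 < q \<le> n / 2\<close>, no two distinct factors have degrees with a
  common divisor above \<open>ln n ^ 3\<close>, there are at least two factors of degree above \<open>n / ln n\<close>, and certain
  sub-multisets of the factors have no total degree close to \<open>j * (n / r)\<close> for small \<open>r\<close> and \<open>j\<close>.
  The last two properties exclude blocks of imprimitivity, so a transitive Galois group is primitive.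
  The stabiliser of the complement of the orbit of length \<open>q\<close> is transitive on that orbit, and Jordan's
  theorem shows that the group contains every even permutation. A transitive Galois group of a
  polynomial with repeated roots would force all factors modulo \<open>p\<close> to be repeated.
\<close>

text \<open>The coefficients are equidistributed only modulo divisors of \<open>L\<close>, so there
  may be a single usable prime and thus a single Frobenius element. A prime at which the reduction
  has repeated factors cannot be traded for a better one, so these factors must be tolerated, and
  every block condition carries an error \<open>e\<close> for the roots in them. A union bound over
  the possible block sizes decides the constants. With at most a power of \<open>ln n\<close>
  blocks, the probability that some product of factors has degree close to \<open>n / r\<close> must
  beat a power of \<open>ln n\<close>. Typically there are about \<open>ln n\<close> factors, so
  about \<open>n powr ln 2\<close> divisors, spread over \<open>n\<close> degrees. As
  \<open>ln 2 < 1\<close> this is rare, and 1.3 ln 2 < 19/20 leaves room for fluctuations. No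
  residue field is formed. Polynomials modulo \<open>p\<close> are integer polynomials up to
  congruence, and the place is a prime ideal in the ring of all algebraic integers, fixed once for
  all \<open>n\<close> and all \<open>f\<close>. The Frobenius element comes out of a congruence
  between polynomials, which avoids decomposition groups and the ideal theory of number
  fields.\<close>

no_notation m_inv  (\<open>(\<open>open_block notation=\<open>prefix inv\<close>\<close>inv\<index> _)\<close> [81] 80)

section \<open>Permutation groups\<close>

locale perm_group =
  fixes G :: "('a \<Rightarrow> 'a) set" and \<Omega> :: "'a set"
  assumes finite_space: "finite \<Omega>"
    and id_mem: "id \<in> G"
    and mem_permutes: "g \<in> G \<Longrightarrow> g permutes \<Omega>"
    and comp_mem: "g \<in> G \<Longrightarrow> h \<in> G \<Longrightarrow> g \<circ> h \<in> G"
    and inv_mem: "g \<in> G \<Longrightarrow> inv g \<in> G"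

text \<open>\<open>permutes\<close> includes fixing every point outside \<open>\<Gamma>\<close>, so
  this is the pointwise stabiliser of the complement, regarded as a group acting on
  \<open>\<Gamma>\<close>.\<close>

definition fixing :: "('a \<Rightarrow> 'a) set \<Rightarrow> 'a set \<Rightarrow> ('a \<Rightarrow> 'a) set" where
  "fixing G \<Gamma> = {g \<in> G. g permutes \<Gamma>}"

definition trans_on :: "('a \<Rightarrow> 'a) set \<Rightarrow> 'a set \<Rightarrow> bool" where
  "trans_on H \<Gamma> \<longleftrightarrow> (\<forall>x\<in>\<Gamma>. \<forall>y\<in>\<Gamma>. \<exists>h\<in>H. h x = y)"

definition ktrans_on :: "nat \<Rightarrow> ('a \<Rightarrow> 'a) set \<Rightarrow> 'a set \<Rightarrow> bool" where
  "ktrans_on k H \<Gamma> \<longleftrightarrow> (\<forall>xs ys. distinct xs \<and> distinct ys \<and> set xs \<subseteq> \<Gamma> \<and> set ys \<subseteq> \<Gamma> \<and>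
     length xs = length ys \<and> length xs \<le> k \<longrightarrow> (\<exists>h\<in>H. map h xs = ys))"

definition block :: "('a \<Rightarrow> 'a) set \<Rightarrow> 'a set \<Rightarrow> bool" where
  "block H B \<longleftrightarrow> (\<forall>h\<in>H. h ` B = B \<or> h ` B \<inter> B = {})"

definition prim_on :: "('a \<Rightarrow> 'a) set \<Rightarrow> 'a set \<Rightarrow> bool" where
  "prim_on H \<Gamma> \<longleftrightarrow> trans_on H \<Gamma> \<and> (\<forall>B\<subseteq>\<Gamma>. block H B \<longrightarrow> card B \<le> 1 \<or> B = \<Gamma>)"

lemma ktrans_onD:
  "\<lbrakk>ktrans_on k H \<Gamma>; distinct xs; distinct ys; set xs \<subseteq> \<Gamma>; set ys \<subseteq> \<Gamma>; length xs = length ys;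
    length xs \<le> k\<rbrakk> \<Longrightarrow> \<exists>h\<in>H. map h xs = ys"
  unfolding ktrans_on_def by blast

lemma ktrans_on_mono: "ktrans_on k H \<Gamma> \<Longrightarrow> l \<le> k \<Longrightarrow> ktrans_on l H \<Gamma>"
  unfolding ktrans_on_def by auto

lemma prim_onD: "prim_on H \<Gamma> \<Longrightarrow> B \<subseteq> \<Gamma> \<Longrightarrow> block H B \<Longrightarrow> card B \<ge> 2 \<Longrightarrow> B = \<Gamma>"
  unfolding prim_on_def by (elim conjE) (drule spec[of _ B], auto)

lemma blockD: "block H B \<Longrightarrow> h \<in> H \<Longrightarrow> x \<in> h ` B \<Longrightarrow> x \<in> B \<Longrightarrow> h ` B = B"
  unfolding block_def by blast

context perm_group
begin

lemma inv_apply: "g \<in> G \<Longrightarrow> inv g (g x) = x" "g \<in> G \<Longrightarrow> g (inv g x) = x"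
  using mem_permutes permutes_inverses by metis+

lemma mem_inj: "g \<in> G \<Longrightarrow> inj g"
  using mem_permutes permutes_inj by blast

lemma mem_in: "g \<in> G \<Longrightarrow> x \<in> \<Omega> \<Longrightarrow> g x \<in> \<Omega>"
  using mem_permutes permutes_in_image by metis

lemma card_image_mem: "g \<in> G \<Longrightarrow> card (g ` A) = card A"
  by (meson card_image inj_on_subset mem_inj subset_UNIV)

lemma funpow_mem: "g \<in> G \<Longrightarrow> g ^^ n \<in> G"
  by (induction n) (auto intro: comp_mem id_mem)

lemma fixing_perm_group: "\<Gamma> \<subseteq> \<Omega> \<Longrightarrow> perm_group (fixing G \<Gamma>) \<Gamma>"
  by unfold_locales
    (auto simp: fixing_def finite_subset[OF _ finite_space] id_mem permutes_id comp_mem inv_mem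
      intro: permutes_compose permutes_inv)

lemma fixing_self: "fixing G \<Omega> = G"
  using mem_permutes by (auto simp: fixing_def)

lemma fixing_mono: "\<Gamma> \<subseteq> \<Delta> \<Longrightarrow> fixing G \<Gamma> \<subseteq> fixing G \<Delta>"
  using permutes_subset by (auto simp: fixing_def)

lemma fixing_conj:
  assumes "g \<in> G" "h \<in> fixing G \<Gamma>"
  shows "g \<circ> h \<circ> inv g \<in> fixing G (g ` \<Gamma>)"
proof -
  have "bij_betw (g \<circ> h \<circ> inv g) (g ` \<Gamma>) (g ` \<Gamma>)"
  proof -
    have *: "inj (g \<circ> h \<circ> inv g)"
      using assms by (intro inj_compose mem_inj) (auto simp: fixing_def inv_mem)
    have "(g \<circ> h \<circ> inv g) ` (g ` \<Gamma>) = g ` (h ` \<Gamma>)"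
      using inv_apply[OF assms(1)] by (auto simp: image_iff)
    also have "h ` \<Gamma> = \<Gamma>" using assms(2) permutes_image by (auto simp: fixing_def)
    finally show ?thesis using * by (metis bij_betw_def inj_on_subset subset_UNIV)
  qed
  moreover have "(g \<circ> h \<circ> inv g) x = x" if "x \<notin> g ` \<Gamma>" for x
  proof -
    have "inv g x \<notin> \<Gamma>" using that inv_apply[OF assms(1)] by (metis imageI)
    then have "h (inv g x) = inv g x" using assms(2) by (auto simp: fixing_def permutes_not_in)
    then show ?thesis using inv_apply[OF assms(1)] by simp
  qed
  ultimately have "(g \<circ> h \<circ> inv g) permutes (g ` \<Gamma>)" by (rule bij_imp_permutes)
  then show ?thesis using assms by (auto simp: fixing_def comp_mem inv_mem)
qed

lemma block_translate:
  assumes "block G B" "g \<in> G" shows "block G (g ` B)"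
  unfolding block_def
proof
  fix h assume h: "h \<in> G"
  have eq: "h ` g ` B = g ` ((inv g \<circ> h \<circ> g) ` B)"
    using inv_apply[OF assms(2)] by (auto simp: image_iff)
  have "(inv g \<circ> h \<circ> g) \<in> G" using assms h by (auto intro: comp_mem inv_mem)
  then consider "(inv g \<circ> h \<circ> g) ` B = B" | "(inv g \<circ> h \<circ> g) ` B \<inter> B = {}"
    using assms(1) unfolding block_def by blast
  then show "h ` g ` B = g ` B \<or> h ` g ` B \<inter> g ` B = {}"
  proof cases
    case 1 then show ?thesis using eq by simp
  next
    case 2
    then have "g ` ((inv g \<circ> h \<circ> g) ` B) \<inter> g ` B = {}"
      using mem_inj[OF assms(2)] by (simp add: image_Int[symmetric])
    then show ?thesis using eq by simp
  qed
qed

text \<open>The translates of a block are equal or disjoint, and transitivity makes them cover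
  \<open>\<Omega>\<close>; all of them have the size of \<open>B\<close>.\<close>

lemma card_block_dvd:
  assumes "trans_on G \<Omega>" "block G B" "B \<subseteq> \<Omega>" "B \<noteq> {}"
  shows "card B dvd card \<Omega>"
proof -
  define C where "C = (\<lambda>g. g ` B) ` G"
  have sub: "C \<subseteq> Pow \<Omega>"
    using assms(3) mem_in by (auto simp: C_def)
  then have "finite C" using finite_space by (meson finite_Pow_iff finite_subset)
  have "\<Union>C = \<Omega>"
  proof
    show "\<Union>C \<subseteq> \<Omega>" using sub by auto
    show "\<Omega> \<subseteq> \<Union>C"
    proof
      fix x assume "x \<in> \<Omega>"
      moreover obtain b where "b \<in> B" using assms(4) by auto
      ultimately obtain g where "g \<in> G" "g b = x" using assms(1,3) unfolding trans_on_def by blast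
      then show "x \<in> \<Union>C" using \<open>b \<in> B\<close> by (auto simp: C_def)
    qed
  qed
  have "card B * card C = card (\<Union>C)"
  proof (rule card_partition)
    show "finite (\<Union>C)" using \<open>\<Union>C = \<Omega>\<close> finite_space by simp
    fix c assume "c \<in> C" then show "card c = card B" by (auto simp: C_def card_image_mem)
  next
    fix c d assume "c \<in> C" "d \<in> C" "c \<noteq> d"
    then obtain g h where gh: "g \<in> G" "h \<in> G" "c = g ` B" "d = h ` B" by (auto simp: C_def)
    have "block G c" using block_translate gh assms by auto
    moreover have "d = (h \<circ> inv g) ` c"
      using inv_apply[OF gh(1)] gh by (auto simp: image_iff)
    ultimately show "c \<inter> d = {}"
      using \<open>c \<noteq> d\<close> gh comp_mem inv_mem unfolding block_def by (metis Int_commute)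
  qed (use \<open>finite C\<close> in auto)
  then show ?thesis using \<open>\<Union>C = \<Omega>\<close> by (metis dvd_triv_left)
qed

text \<open>Rudio's lemma. The points that no translate of \<open>A\<close> separates from
  \<open>a\<close> form a block. If it contained \<open>b\<close> as well, primitivity would make it
  all of \<open>\<Omega>\<close>; then a translate of \<open>A\<close> through \<open>a\<close>
  would contain every point, against \<open>A \<noteq> \<Omega>\<close>.\<close>

lemma prim_on_separating:
  assumes prim: "prim_on G \<Omega>" and A: "A \<subseteq> \<Omega>" "A \<noteq> {}" "A \<noteq> \<Omega>"
    and ab: "a \<in> \<Omega>" "b \<in> \<Omega>" "a \<noteq> b"
  shows "\<exists>h\<in>G. (a \<in> h ` A) \<noteq> (b \<in> h ` A)"
proof (rule ccontr)
  assume "\<not> ?thesis"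
  then have no: "a \<in> h ` A \<longleftrightarrow> b \<in> h ` A" if "h \<in> G" for h using that by blast
  define C where "C = {x \<in> \<Omega>. \<forall>h\<in>G. (a \<in> h ` A) = (x \<in> h ` A)}"
  have finC: "finite C" using finite_space by (auto simp: C_def)
  have move: "k x \<in> h ` A \<longleftrightarrow> x \<in> (inv k \<circ> h) ` A" if "k \<in> G" for k h x
    using inv_apply[OF that] by (auto simp: image_iff) metis+
  have "block G C"
    unfolding block_def
  proof
    fix k assume k: "k \<in> G"
    show "k ` C = C \<or> k ` C \<inter> C = {}"
    proof (cases "k ` C \<inter> C = {}")
      case False
      then obtain x where x: "x \<in> C" "k x \<in> C" by auto
      have "k z \<in> C" if z: "z \<in> C" for z
      proof -
        have "(a \<in> h ` A) = (k z \<in> h ` A)" if h: "h \<in> G" for h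
        proof -
          have m: "inv k \<circ> h \<in> G" using k h by (auto intro: comp_mem inv_mem)
          have "(a \<in> h ` A) = (k x \<in> h ` A)" using x(2) h by (auto simp: C_def)
          also have "\<dots> = (a \<in> (inv k \<circ> h) ` A)" using x(1) m move[OF k] by (auto simp: C_def)
          also have "\<dots> = (k z \<in> h ` A)" using z m move[OF k] by (auto simp: C_def)
          finally show ?thesis .
        qed
        then show ?thesis using z mem_in[OF k] by (auto simp: C_def)
      qed
      then have "k ` C \<subseteq> C" by auto
      then show ?thesis using finC by (simp add: card_image_mem[OF k] card_subset_eq)
    qed simp
  qed
  moreover have "C \<subseteq> \<Omega>" "{a, b} \<subseteq> C" using ab no by (auto simp: C_def)
  moreover have "card {a, b} = 2" using ab by simp
  ultimately have "C = \<Omega>"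
    using prim_onD[OF prim] finC card_mono[of C "{a,b}"] by simp
  obtain x where "x \<in> A" using A by auto
  then obtain h where h: "h \<in> G" "h x = a"
    using prim A ab unfolding prim_on_def trans_on_def by blast
  then have "\<Omega> \<subseteq> h ` A" using \<open>C = \<Omega>\<close> \<open>x \<in> A\<close> by (auto simp: C_def)
  then have "card \<Omega> \<le> card A"
    using A(1) finite_space by (metis card_image_mem card_mono finite_imageI finite_subset h(1))
  then show False using A finite_space by (metis card_seteq)
qed

section \<open>From a primitive stabiliser to multiple transitivity (Jordan)\<close>

lemma ktrans_on_prim_on:
  assumes "ktrans_on 2 G \<Omega>" shows "prim_on G \<Omega>"
  unfolding prim_on_def
proof (intro conjI allI impI)
  show "trans_on G \<Omega>"
    unfolding trans_on_def
  proof (intro ballI)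
    fix x y assume "x \<in> \<Omega>" "y \<in> \<Omega>"
    then show "\<exists>h\<in>G. h x = y" using ktrans_onD[OF assms, of "[x]" "[y]"] by auto
  qed
  fix B assume B: "B \<subseteq> \<Omega>" "block G B"
  show "card B \<le> 1 \<or> B = \<Omega>"
  proof (rule ccontr)
    assume neg: "\<not> ?thesis"
    then obtain a b where ab: "a \<in> B" "b \<in> B" "a \<noteq> b"
      by (metis card.empty card_1_singleton_iff card_eq_0_iff is_singletonI' is_singleton_altdef le_numeral_extra(4) zero_le_one)
    from neg B obtain z where z: "z \<in> \<Omega>" "z \<notin> B" by auto
    have "a \<noteq> z" "a \<in> \<Omega>" "b \<in> \<Omega>" using ab z B by auto
    then obtain h where h: "h \<in> G" "h a = a" "h b = z"
      using ktrans_onD[OF assms, of "[a,b]" "[a,z]"] ab z by auto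
    then have "h ` B = B" using blockD[OF B(2) h(1)] ab(1) by (metis imageI)
    then show False using h ab z by blast
  qed
qed

text \<open>Among the translates of \<open>\<Gamma>\<close> that meet \<open>\<Gamma>\<close>
  without being equal to it, one with the largest overlap leaves \<open>\<Gamma>\<close> in just one
  point. If it left in two points, Rudio's lemma inside the translate would give a group element
  separating them, and that element would produce a larger overlap.\<close>

lemma prim_on_grow:
  assumes prim: "prim_on G \<Omega>" and \<Gamma>: "\<Gamma> \<subseteq> \<Omega>" "\<Gamma> \<noteq> \<Omega>" "card \<Gamma> \<ge> 2"
    and prim\<Gamma>: "prim_on (fixing G \<Gamma>) \<Gamma>"
  shows "\<exists>g\<in>G. \<exists>\<beta>\<in>\<Omega> - \<Gamma>. \<beta> \<in> g ` \<Gamma> \<and> g ` \<Gamma> \<subseteq> insert \<beta> \<Gamma>"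
proof -
  have finG: "finite \<Gamma>" using \<Gamma>(1) finite_space finite_subset by blast
  define good where "good = (\<lambda>g. g \<in> G \<and> g ` \<Gamma> \<noteq> \<Gamma> \<and> g ` \<Gamma> \<inter> \<Gamma> \<noteq> {})"
  have "\<not> block G \<Gamma>" using prim_onD[OF prim] \<Gamma> by blast
  then have "\<exists>g. good g" unfolding block_def good_def by blast
  moreover have "\<forall>g. good g \<longrightarrow> card (g ` \<Gamma> \<inter> \<Gamma>) < Suc (card \<Gamma>)"
    using finG by (auto intro!: card_mono le_imp_less_Suc)
  ultimately obtain g where g: "good g"
    and mx: "\<And>h. good h \<Longrightarrow> card (h ` \<Gamma> \<inter> \<Gamma>) \<le> card (g ` \<Gamma> \<inter> \<Gamma>)"
    using Lattices_Big.ex_has_greatest_nat[of good _ "\<lambda>g. card (g ` \<Gamma> \<inter> \<Gamma>)" "Suc (card \<Gamma>)"] by blast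
  define \<Delta> where "\<Delta> = g ` \<Gamma>"
  define A where "A = \<Delta> \<inter> \<Gamma>"
  have gG: "g \<in> G" using g by (auto simp: good_def)
  have \<Delta>: "\<Delta> \<subseteq> \<Omega>" "finite \<Delta>" "card \<Delta> = card \<Gamma>"
    using gG \<Gamma>(1) mem_in finG by (auto simp: \<Delta>_def card_image_mem)
  have A: "A \<subseteq> \<Delta>" "A \<noteq> {}" "A \<noteq> \<Delta>"
    using g \<Delta> finG by (auto simp: A_def good_def \<Delta>_def) (metis card_subset_eq card_image_mem gG inf.absorb_iff1)
  have "\<Delta> - \<Gamma> \<noteq> {}" using A by (auto simp: A_def)
  then obtain \<beta> where \<beta>: "\<beta> \<in> \<Delta>" "\<beta> \<notin> \<Gamma>" by auto
  have "\<Delta> \<subseteq> insert \<beta> \<Gamma>"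
  proof (rule ccontr)
    assume "\<not> ?thesis"
    then obtain \<gamma> where \<gamma>: "\<gamma> \<in> \<Delta>" "\<gamma> \<notin> \<Gamma>" "\<gamma> \<noteq> \<beta>" by auto
    define a b where "a = inv g \<beta>" and "b = inv g \<gamma>"
    have ab: "g a = \<beta>" "g b = \<gamma>" "a \<in> \<Gamma>" "b \<in> \<Gamma>" "a \<noteq> b"
      using \<beta> \<gamma> inv_apply[OF gG] by (auto simp: a_def b_def \<Delta>_def)
    define A' where "A' = inv g ` A"
    have A': "A' \<subseteq> \<Gamma>" "A' \<noteq> {}" "A' \<noteq> \<Gamma>" "g ` A' = A"
      using A inv_apply[OF gG] by (auto simp: A'_def \<Delta>_def image_iff)
    interpret F: perm_group "fixing G \<Gamma>" \<Gamma> using fixing_perm_group[OF \<Gamma>(1)] .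
    \<comment> \<open>Rudio's lemma is applied to the primitive group on \<open>\<Gamma>\<close>;
      conjugation by \<open>g\<close> carries the separating element over to
      \<open>\<Delta>\<close>.\<close>
    obtain h where h: "h \<in> fixing G \<Gamma>" "(a \<in> h ` A') \<noteq> (b \<in> h ` A')"
      using F.prim_on_separating[OF prim\<Gamma> A'(1-3) ab(3-5)] by blast
    define k where "k = g \<circ> h \<circ> inv g"
    have k: "k \<in> fixing G \<Delta>" unfolding k_def \<Delta>_def by (rule fixing_conj[OF gG h(1)])
    then have kG: "k \<in> G" and kp: "k permutes \<Delta>" by (auto simp: fixing_def)
    have "k ` A = g ` (h ` A')"
      using inv_apply[OF gG] by (auto simp: k_def A'_def image_iff)
    then have sep: "(\<beta> \<in> k ` A) \<noteq> (\<gamma> \<in> k ` A)"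
      using h(2) ab mem_inj[OF gG] by (metis inj_image_mem_iff)
    have kA: "k ` A \<subseteq> \<Delta>" using A(1) kp permutes_image by blast
    have finA: "finite A" using A(1) \<Delta>(2) finite_subset by blast
    \<comment> \<open>\<open>\<beta>\<close> and \<open>\<gamma>\<close> both lie in
      \<open>\<Delta> - A\<close>, but only one of them lies in the image of \<open>A\<close> under
      \<open>k\<close>, so the inclusion is strict.\<close>
    have sub1: "k ` A - A \<subset> \<Delta> - A"
      using kA sep \<beta> \<gamma> by (auto simp: A_def)
    have card1: "card (k ` A - A) < card (\<Delta> - A)"
      using sub1 \<Delta>(2) by (simp add: psubset_card_mono)
    have "card (k ` A) = card A" using card_image_mem kG by blast
    then have "card (A - k ` A) = card (k ` A - A)"
      using card_Diff_subset_Int[of A "k ` A"] card_Diff_subset_Int[of "k ` A" A] finA by (simp add: Int_commute)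
    then have card2: "card (A - k ` A) < card (\<Delta> - A)" using card1 by simp
    have img: "(k \<circ> g) ` \<Gamma> = \<Delta>" using permutes_image[OF kp] by (auto simp: \<Delta>_def image_comp)
    \<comment> \<open>\<open>k\<close> fixes everything outside \<open>\<Delta>\<close>, so all of
      \<open>\<Gamma> - \<Delta>\<close> joins the overlap, and only the points of \<open>A\<close>
      that are not in its image are lost. By the strict inclusion the gain of
      \<open>card (\<Delta> - A)\<close> points exceeds the loss.\<close>
    have sup: "(\<Gamma> - \<Delta>) \<union> (k ` A \<inter> A) \<subseteq> k ` \<Gamma> \<inter> \<Gamma>"
    proof -
      have "\<Gamma> - \<Delta> \<subseteq> k ` \<Gamma>" using permutes_not_in[OF kp] by (force simp: image_iff)
      moreover have "k ` A \<subseteq> k ` \<Gamma>" by (auto simp: A_def)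
      ultimately show ?thesis by (auto simp: A_def)
    qed
    have "card (\<Gamma> - \<Delta>) + card (k ` A \<inter> A) = card ((\<Gamma> - \<Delta>) \<union> (k ` A \<inter> A))"
      using finG finA A(1) by (subst card_Un_disjoint) auto
    also have "\<dots> \<le> card (k ` \<Gamma> \<inter> \<Gamma>)" using sup finG by (intro card_mono) auto
    finally have ge: "card (\<Gamma> - \<Delta>) + card (k ` A \<inter> A) \<le> card (k ` \<Gamma> \<inter> \<Gamma>)" .
    have "card (\<Gamma> - \<Delta>) = card (\<Delta> - A)"
    proof -
      have "card (\<Gamma> - \<Delta>) = card \<Gamma> - card A"
        using card_Diff_subset_Int[of \<Gamma> \<Delta>] finA by (simp add: A_def Int_commute)
      moreover have "card (\<Delta> - A) = card \<Delta> - card A" using A(1) finA card_Diff_subset by blast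
      ultimately show ?thesis using \<Delta>(3) by simp
    qed
    moreover have "card A = card (A - k ` A) + card (k ` A \<inter> A)"
      using finA by (metis Diff_Int_distrib2 Int_commute add.commute card_Diff_subset_Int card_Int_Diff finite_Int)
    ultimately have lt: "card A < card (k ` \<Gamma> \<inter> \<Gamma>)" using ge card2 by linarith
    have "k ` \<Gamma> \<noteq> \<Gamma>"
    proof
      assume "k ` \<Gamma> = \<Gamma>"
      then have "k ` A = A"
        using permutes_image[OF kp] mem_inj[OF kG] by (simp add: A_def image_Int)
      then show False using sep \<beta> \<gamma> by (auto simp: A_def)
    qed
    moreover have "k ` \<Gamma> \<inter> \<Gamma> \<noteq> {}" using lt by (metis card.empty not_less_zero)
    ultimately have "good k" using kG by (auto simp: good_def)
    then show False using mx[OF \<open>good k\<close>] lt by (simp add: A_def \<Delta>_def)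
  qed
  then show ?thesis
    using gG \<beta> \<Delta>(1) by (intro bexI[of _ g] bexI[of _ \<beta>]) (auto simp: \<Delta>_def)
qed

text \<open>Jordan's induction. When a point \<open>\<beta>\<close> is added,
  \<open>fixing G \<Gamma>\<close> becomes a subgroup of the stabiliser of \<open>\<beta>\<close>,
  and a transitive group whose point stabiliser is k-transitive on the other points is
  (k+1)-transitive. Double transitivity then restores primitivity for the next round.\<close>

lemma jordan_chain:
  assumes prim: "prim_on G \<Omega>" and \<Gamma>0: "\<Gamma>0 \<subseteq> \<Omega>" "card \<Gamma>0 \<ge> 2" "prim_on (fixing G \<Gamma>0) \<Gamma>0"
    and "i \<le> card \<Omega> - card \<Gamma>0"
  shows "\<exists>\<Gamma>\<subseteq>\<Omega>. card \<Gamma> = card \<Gamma>0 + i \<and> ktrans_on (Suc i) (fixing G \<Gamma>) \<Gamma> \<and> prim_on (fixing G \<Gamma>) \<Gamma>"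
  using assms(5)
proof (induction i)
  case 0
  have tr: "trans_on (fixing G \<Gamma>0) \<Gamma>0" using \<Gamma>0(3) by (simp add: prim_on_def)
  have "ktrans_on 1 (fixing G \<Gamma>0) \<Gamma>0"
    unfolding ktrans_on_def
  proof (intro allI impI, elim conjE)
    fix xs ys assume xs: "set xs \<subseteq> \<Gamma>0" "set ys \<subseteq> \<Gamma>0" "length xs = length ys" "length xs \<le> 1"
    show "\<exists>h\<in>fixing G \<Gamma>0. map h xs = ys"
    proof (cases xs)
      case Nil
      then show ?thesis using xs id_mem by (intro bexI[of _ id]) (auto simp: fixing_def permutes_id)
    next
      case (Cons x xs')
      then obtain y where "xs = [x]" "ys = [y]" using xs by (cases ys) auto
      then show ?thesis using xs tr unfolding trans_on_def by auto
    qed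
  qed
  then show ?case using \<Gamma>0 by auto
next
  case (Suc i)
  then obtain \<Gamma> where \<Gamma>: "\<Gamma> \<subseteq> \<Omega>" "card \<Gamma> = card \<Gamma>0 + i" "ktrans_on (Suc i) (fixing G \<Gamma>) \<Gamma>"
    "prim_on (fixing G \<Gamma>) \<Gamma>" by auto
  have "\<Gamma> \<noteq> \<Omega>" "card \<Gamma> \<ge> 2" using Suc.prems \<Gamma> \<Gamma>0 by auto
  then obtain g \<beta> where g: "g \<in> G" "\<beta> \<in> \<Omega>" "\<beta> \<notin> \<Gamma>" "\<beta> \<in> g ` \<Gamma>" "g ` \<Gamma> \<subseteq> insert \<beta> \<Gamma>"
    using prim_on_grow[OF prim \<Gamma>(1)] \<Gamma>(4) by blast
  define \<Delta> where "\<Delta> = insert \<beta> \<Gamma>"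
  have \<Delta>: "\<Delta> \<subseteq> \<Omega>" "card \<Delta> = Suc (card \<Gamma>)" "finite \<Delta>"
    using g \<Gamma>(1) finite_subset[OF \<Gamma>(1) finite_space] by (auto simp: \<Delta>_def)
  interpret F: perm_group "fixing G \<Delta>" \<Delta> using fixing_perm_group[OF \<Delta>(1)] .
  have sub: "fixing G \<Gamma> \<subseteq> fixing G \<Delta>" "fixing G (g ` \<Gamma>) \<subseteq> fixing G \<Delta>"
    using g by (auto simp: \<Delta>_def intro!: fixing_mono)
  have tr: "trans_on (fixing G \<Gamma>) \<Gamma>" using \<Gamma>(4) by (simp add: prim_on_def)
  have to\<beta>: "\<exists>h\<in>fixing G \<Delta>. h x = \<beta>" if x: "x \<in> \<Delta>" for x
  proof (cases "x = \<beta>")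
    case True
    then show ?thesis using F.id_mem by (intro bexI[of _ id]) simp_all
  next
    case False
    then have x\<Gamma>: "x \<in> \<Gamma>" using x by (auto simp: \<Delta>_def)
    \<comment> \<open>\<open>u\<close> is chosen so that \<open>g u\<close> lies in
      \<open>\<Gamma>\<close> too: \<open>x\<close> travels inside \<open>\<Gamma>\<close> to
      \<open>g u\<close>, and the conjugate of \<open>h2\<close> then takes it inside the translate
      to \<open>g v = \<beta>\<close>.\<close>
    have "\<not> g ` \<Gamma> \<subseteq> {\<beta>}"
      using \<open>card \<Gamma> \<ge> 2\<close> card_image_mem[OF g(1), of \<Gamma>] card_mono[of "{\<beta>}" "g ` \<Gamma>"] by auto
    then obtain u where u: "u \<in> \<Gamma>" "g u \<noteq> \<beta>" by auto
    then have gu: "g u \<in> \<Gamma>" using g(5) by auto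
    obtain v where v: "v \<in> \<Gamma>" "g v = \<beta>" using g(4) by auto
    obtain h1 where h1: "h1 \<in> fixing G \<Gamma>" "h1 x = g u" using tr x\<Gamma> gu unfolding trans_on_def by blast
    obtain h2 where h2: "h2 \<in> fixing G \<Gamma>" "h2 u = v" using tr u v unfolding trans_on_def by blast
    have "(g \<circ> h2 \<circ> inv g) \<circ> h1 \<in> fixing G \<Delta>"
      using fixing_conj[OF g(1) h2(1)] h1(1) sub F.comp_mem by blast
    moreover have "((g \<circ> h2 \<circ> inv g) \<circ> h1) x = \<beta>"
      using h1 h2 v inv_apply(1)[OF g(1)] by simp
    ultimately show ?thesis by blast
  qed
  have kt: "ktrans_on (Suc (Suc i)) (fixing G \<Delta>) \<Delta>"
    unfolding ktrans_on_def
  proof (intro allI impI, elim conjE)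
    fix xs ys assume xs: "distinct xs" "distinct ys" "set xs \<subseteq> \<Delta>" "set ys \<subseteq> \<Delta>"
      "length xs = length ys" "length xs \<le> Suc (Suc i)"
    show "\<exists>h\<in>fixing G \<Delta>. map h xs = ys"
    proof (cases xs)
      case Nil
      then show ?thesis using xs F.id_mem by auto
    next
      case (Cons x xs')
      then obtain y ys' where ys: "ys = y # ys'" using xs by (cases ys) auto
      \<comment> \<open>Both heads are moved to \<open>\<beta>\<close>. The tails then lie in
        \<open>\<Gamma>\<close>, where the induction hypothesis matches them by an \<open>h\<close>
        that fixes \<open>\<beta>\<close>.\<close>
      obtain h1 where h1: "h1 \<in> fixing G \<Delta>" "h1 x = \<beta>" using to\<beta> xs Cons by auto
      obtain h2 where h2: "h2 \<in> fixing G \<Delta>" "h2 y = \<beta>" using to\<beta> xs ys by auto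
      have 1: "set (map h zs) \<subseteq> \<Gamma> \<and> distinct (map h zs)"
        if "h \<in> fixing G \<Delta>" "h z = \<beta>" "distinct (z # zs)" "set (z # zs) \<subseteq> \<Delta>" for h z zs
      proof -
        have inj: "inj h" using F.mem_inj that by blast
        have "h ` set zs \<subseteq> \<Delta>" using that F.mem_in by auto
        moreover have "\<beta> \<notin> h ` set zs" using inj that by (auto dest: injD)
        ultimately show ?thesis
          using inj that by (auto simp: \<Delta>_def distinct_map inj_on_def inj_def)
      qed
      obtain h where h: "h \<in> fixing G \<Gamma>" "map h (map h1 xs') = map h2 ys'"
        using ktrans_onD[OF \<Gamma>(3), of "map h1 xs'" "map h2 ys'"] 1[OF h1, of xs'] 1[OF h2, of ys'] xs Cons ys
        by auto
      have h\<beta>: "h \<beta> = \<beta>" using h(1) g(3) by (auto simp: fixing_def permutes_not_in)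
      have "inv h2 \<circ> h \<circ> h1 \<in> fixing G \<Delta>"
        using h(1) sub h1 h2 F.comp_mem F.inv_mem by (meson subsetD)
      moreover have "map (inv h2 \<circ> h \<circ> h1) xs = ys"
      proof -
        have "map (inv h2 \<circ> h \<circ> h1) xs' = map (inv h2) (map h (map h1 xs'))" by simp
        also have "\<dots> = ys'" unfolding h(2) using F.inv_apply(1)[OF h2(1)] by (simp add: map_idI)
        finally show ?thesis
          using Cons ys h1(2) h2(2) h\<beta> F.inv_apply(1)[OF h2(1), of y] by simp
      qed
      ultimately show ?thesis by blast
    qed
  qed
  then have "prim_on (fixing G \<Delta>) \<Delta>"
    using F.ktrans_on_prim_on[OF ktrans_on_mono[OF kt, of 2]] by simp
  then show ?case using kt \<Delta> \<Gamma>(2) by (intro exI[of _ \<Delta>]) auto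
qed

lemma trans_on_prime_prim_on:
  assumes "trans_on G \<Omega>" "Factorial_Ring.prime (card \<Omega>)"
  shows "prim_on G \<Omega>"
  unfolding prim_on_def
proof (intro conjI allI impI assms(1))
  fix B assume B: "B \<subseteq> \<Omega>" "block G B"
  show "card B \<le> 1 \<or> B = \<Omega>"
  proof (cases "B = {}")
    case False
    then have "card B dvd card \<Omega>" using card_block_dvd[OF assms(1) B(2,1)] by blast
    then have "card B = 1 \<or> card B = card \<Omega>" using assms(2) by (metis prime_nat_iff)
    then show ?thesis using B(1) finite_space card_subset_eq by auto
  qed simp
qed

text \<open>\<open>B\<close> meets \<open>\<Gamma>\<close> in a block of the stabiliser, so by
  primitivity in all of \<open>\<Gamma>\<close> or in one point \<open>c\<close>. In the latter case
  \<open>B\<close> has a point \<open>b\<close> outside \<open>\<Gamma>\<close>, which the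
  stabiliser fixes; hence it preserves \<open>B\<close> while moving \<open>c\<close> through all of
  \<open>\<Gamma>\<close>.\<close>

lemma block_contains_cycle:
  assumes \<Gamma>: "\<Gamma> \<subseteq> \<Omega>" "prim_on (fixing G \<Gamma>) \<Gamma>" and B: "block G B" "B \<inter> \<Gamma> \<noteq> {}" "card B \<ge> 2"
  shows "\<Gamma> \<subseteq> B"
proof -
  interpret F: perm_group "fixing G \<Gamma>" \<Gamma> using fixing_perm_group[OF \<Gamma>(1)] .
  have img: "h ` (B \<inter> \<Gamma>) = h ` B \<inter> \<Gamma>" if "h \<in> fixing G \<Gamma>" for h
    using F.mem_inj[OF that] permutes_image[OF F.mem_permutes[OF that]] by (simp add: image_Int)
  have "block (fixing G \<Gamma>) (B \<inter> \<Gamma>)"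
    unfolding block_def
  proof
    fix h assume h: "h \<in> fixing G \<Gamma>"
    then have "h ` B = B \<or> h ` B \<inter> B = {}" using B(1) by (auto simp: block_def fixing_def)
    then show "h ` (B \<inter> \<Gamma>) = B \<inter> \<Gamma> \<or> h ` (B \<inter> \<Gamma>) \<inter> (B \<inter> \<Gamma>) = {}"
      unfolding img[OF h] by blast
  qed
  then have "card (B \<inter> \<Gamma>) \<le> 1 \<or> B \<inter> \<Gamma> = \<Gamma>"
    using \<Gamma>(2) unfolding prim_on_def by (elim conjE allE[of _ "B \<inter> \<Gamma>"]) auto
  then consider "card (B \<inter> \<Gamma>) \<le> 1" | "B \<inter> \<Gamma> = \<Gamma>" by blast
  then show ?thesis
  proof cases
    case 1
    have "finite (B \<inter> \<Gamma>)" using F.finite_space by auto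
    then have "card B \<noteq> card (B \<inter> \<Gamma>)" "B \<inter> \<Gamma> \<noteq> B" using 1 B(3) by auto
    then obtain b where b: "b \<in> B" "b \<notin> \<Gamma>" by blast
    obtain c where c: "c \<in> B" "c \<in> \<Gamma>" using B(2) by auto
    show ?thesis
    proof
      fix x assume x: "x \<in> \<Gamma>"
      then obtain h where h: "h \<in> fixing G \<Gamma>" "h c = x"
        using \<Gamma>(2) c unfolding prim_on_def trans_on_def by blast
      then have "h b = b" using b by (auto simp: fixing_def permutes_not_in)
      then have "h ` B = B" using blockD[OF B(1), of h b] h(1) b by (force simp: fixing_def)
      then show "x \<in> B" using h c by blast
    qed
  qed auto
qed

text \<open>An even permutation is a product of pairs of transpositions, and every such pair is a
  product of at most two 3-cycles. The induction over transpositions carries along a claim for odd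
  permutations, which become members after one more transposition.\<close>

lemma three_cycles_alternating:
  assumes c3: "\<And>x y z. \<lbrakk>x \<in> \<Omega>; y \<in> \<Omega>; z \<in> \<Omega>; x \<noteq> y; y \<noteq> z; x \<noteq> z\<rbrakk> \<Longrightarrow>
      Transposition.transpose x y \<circ> Transposition.transpose y z \<in> G"
    and "\<pi> permutes \<Omega>" "evenperm \<pi>"
  shows "\<pi> \<in> G"
proof -
  have c3': "Transposition.transpose x y \<circ> Transposition.transpose u v \<in> G"
    if "x \<in> \<Omega>" "y \<in> \<Omega>" "u \<in> \<Omega>" "v \<in> \<Omega>" "x \<noteq> y" "u \<noteq> v" "y = u \<or> y = v \<or> x = u \<or> x = v" for x y u v
  proof -
    consider "{x, y} = {u, v}" | "{x, y} \<noteq> {u, v}" by blast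
    then show ?thesis
    proof cases
      case 1
      then have "Transposition.transpose x y = Transposition.transpose u v"
        by (auto simp: doubleton_eq_iff transpose_commute)
      then show ?thesis using id_mem by (simp only: transpose_comp_involutory)
    next
      case 2
      have "x \<noteq> v" if "y = u" using 2 that by blast
      moreover have "x \<noteq> u" if "y = v" using 2 that by blast
      moreover have "y \<noteq> v" if "x = u" using 2 that by blast
      moreover have "y \<noteq> u" if "x = v" using 2 that by blast
      ultimately show ?thesis using that c3[of x y v] c3[of x y u] c3[of y x v] c3[of y x u]
        by (metis transpose_commute)
    qed
  qed
  have tt: "Transposition.transpose x y \<circ> Transposition.transpose u v \<in> G"
    if "x \<in> \<Omega>" "y \<in> \<Omega>" "u \<in> \<Omega>" "v \<in> \<Omega>" "x \<noteq> y" "u \<noteq> v" for x y u v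
  proof (cases "y = u")
    case False
    \<comment> \<open>Inserting the transposition of \<open>y\<close> and \<open>u\<close> twice
      yields two products, in each of which the transpositions share a point.\<close>
    have "Transposition.transpose x y \<circ> Transposition.transpose u v =
      (Transposition.transpose x y \<circ> Transposition.transpose y u) \<circ>
      (Transposition.transpose y u \<circ> Transposition.transpose u v)"
      by (simp add: fun_eq_iff)
    then show ?thesis using c3'[of x y y u] c3'[of y u u v] that False comp_mem by metis
  qed (use c3' that in blast)
  have "(evenperm \<pi> \<longrightarrow> \<pi> \<in> G) \<and> (\<not> evenperm \<pi> \<longrightarrow>
    (\<forall>a\<in>\<Omega>. \<forall>b\<in>\<Omega>. a \<noteq> b \<longrightarrow> Transposition.transpose a b \<circ> \<pi> \<in> G))"
    using assms(2) finite_space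
  proof (induction rule: permutes_induct)
    case id
    then show ?case using id_mem by (simp add: id_def)
  next
    case (swap a b p)
    have "permutation p" using swap finite_space permutation_permutes by blast
    then have ev: "evenperm (Transposition.transpose a b \<circ> p) \<longleftrightarrow> \<not> evenperm p"
      using swap by (simp add: evenperm_comp permutation_swap_id evenperm_swap)
    show ?case
    proof (intro conjI impI ballI)
      assume "evenperm (Transposition.transpose a b \<circ> p)"
      then show "Transposition.transpose a b \<circ> p \<in> G" using ev swap by blast
    next
      fix c d assume *: "\<not> evenperm (Transposition.transpose a b \<circ> p)" "c \<in> \<Omega>" "d \<in> \<Omega>" "c \<noteq> d"
      then have "p \<in> G" using ev swap by blast
      then have "(Transposition.transpose c d \<circ> Transposition.transpose a b) \<circ> p \<in> G"
        using tt * swap comp_mem by blast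
      then show "Transposition.transpose c d \<circ> (Transposition.transpose a b \<circ> p) \<in> G"
        by (simp add: o_assoc)
    qed
  qed
  then show ?thesis using assms(3) by blast
qed

text \<open>Primality makes the stabiliser primitive on \<open>\<Gamma>\<close>, and the bound on
  \<open>card \<Gamma>\<close> turns the chain into transitivity of degree
  \<open>card \<Gamma> + 1\<close>. So some \<open>g\<close> fixes all of \<open>\<Gamma>\<close>
  except one point \<open>a\<close>, which it moves out of \<open>\<Gamma>\<close>. A commutator of
  \<open>g\<close> with an element of \<open>fixing G \<Gamma>\<close> is then a 3-cycle, and
  conjugation supplies all the others.\<close>

theorem jordan_prime_cycle:
  assumes prim: "prim_on G \<Omega>" and \<Gamma>: "\<Gamma> \<subseteq> \<Omega>" "trans_on (fixing G \<Gamma>) \<Gamma>"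
    and q: "Factorial_Ring.prime (card \<Gamma>)" "card \<Gamma> \<ge> 3" "2 * card \<Gamma> \<le> card \<Omega>"
    and \<pi>: "\<pi> permutes \<Omega>" "evenperm \<pi>"
  shows "\<pi> \<in> G"
proof -
  interpret F: perm_group "fixing G \<Gamma>" \<Gamma> using fixing_perm_group[OF \<Gamma>(1)] .
  obtain \<Delta> where \<Delta>: "\<Delta> \<subseteq> \<Omega>" "card \<Delta> = card \<Omega>"
    "ktrans_on (Suc (card \<Omega> - card \<Gamma>)) (fixing G \<Delta>) \<Delta>"
    using jordan_chain[OF prim \<Gamma>(1) _ F.trans_on_prime_prim_on[OF \<Gamma>(2) q(1)], of "card \<Omega> - card \<Gamma>"] q
      card_mono[OF finite_space \<Gamma>(1)] by auto
  have "\<Delta> = \<Omega>" using \<Delta> finite_space card_subset_eq by blast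
  then have kt: "ktrans_on (Suc (card \<Gamma>)) G \<Omega>"
    using \<Delta>(3) ktrans_on_mono[of _ G \<Omega> "Suc (card \<Gamma>)"] q by (simp add: fixing_self)
  obtain a where a: "a \<in> \<Gamma>" using q(2) by (metis card.empty equals0I not_numeral_le_zero)
  have "\<Gamma> \<noteq> \<Omega>" using q by auto
  then obtain b where b: "b \<in> \<Omega>" "b \<notin> \<Gamma>" using \<Gamma>(1) by blast
  have "\<not> \<Gamma> \<subseteq> {a}" using q(2) card_mono[of "{a}" \<Gamma>] by auto
  then obtain a' where a': "a' \<in> \<Gamma>" "a' \<noteq> a" by auto
  then obtain \<tau> where \<tau>: "\<tau> \<in> fixing G \<Gamma>" "\<tau> a' = a" using \<Gamma>(2) a unfolding trans_on_def by blast
  define d where "d = a'"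
  have d: "d \<in> \<Gamma>" "d \<noteq> a" "\<tau> d = a" using a' \<tau> by (auto simp: d_def)
  obtain rs where rs: "set rs = \<Gamma> - {a}" "distinct rs"
    using F.finite_space finite_distinct_list by (metis finite_Diff)
  then have len: "length rs = card \<Gamma> - 1" using a F.finite_space by (metis card_Diff_singleton distinct_card)
  obtain g where g: "g \<in> G" "map g (a # rs) = b # rs"
    using ktrans_onD[OF kt, of "a # rs" "b # rs"] rs \<Gamma>(1) a b len by auto
  have gfix: "g x = x" if "x \<in> \<Gamma>" "x \<noteq> a" for x
    using g(2) rs that by (metis DiffI list.inject list.simps(9) map_eq_conv map_ident singletonD)
  have ga: "g a = b" using g by simp
  have \<tau>G: "\<tau> \<in> G" and \<tau>p: "\<tau> permutes \<Gamma>" using \<tau> by (auto simp: fixing_def)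
  \<comment> \<open>Conjugating \<open>\<tau>\<close> by \<open>g\<close> only replaces the point
    \<open>a\<close> by \<open>b\<close>, so \<open>c\<close> is the 3-cycle that takes
    \<open>b\<close> to \<open>a\<close>, \<open>a\<close> to \<open>d\<close> and \<open>d\<close>
    to \<open>b\<close>.\<close>
  define c where "c = inv \<tau> \<circ> (g \<circ> \<tau> \<circ> inv g)"
  have cG: "c \<in> G" unfolding c_def by (intro comp_mem inv_mem g \<tau>G)
  have \<tau>inj: "\<tau> x = \<tau> y \<longleftrightarrow> x = y" and ginj: "g x = g y \<longleftrightarrow> x = y" for x y
    using mem_inj[OF \<tau>G] mem_inj[OF g(1)] by (auto dest: injD)
  have cg: "\<tau> (c (g x)) = g (\<tau> x)" for x
    unfolding c_def using inv_apply[OF g(1)] inv_apply[OF \<tau>G] by simp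
  have \<tau>out: "\<tau> x = x" if "x \<notin> \<Gamma>" for x using \<tau>p that by (simp add: permutes_not_in)
  have \<tau>in: "\<tau> x \<in> \<Gamma> \<longleftrightarrow> x \<in> \<Gamma>" for x using \<tau>p by (simp add: permutes_in_image)
  have cb: "c b = a"
  proof -
    have "\<tau> a \<noteq> a" using d \<tau>inj by metis
    then have "\<tau> (c b) = \<tau> a" using cg[of a] ga gfix \<tau>in a by simp
    then show ?thesis using \<tau>inj by simp
  qed
  have cd: "c d = b"
  proof -
    have "\<tau> (c d) = b" using cg[of d] gfix[of d] d ga by simp
    then show ?thesis using \<tau>inj \<tau>out[of b] b by metis
  qed
  have ca: "c a = d"
  proof -
    obtain z where z: "g z = a" using inv_apply[OF g(1)] by metis
    have "z \<notin> \<Gamma>" using z gfix ga a b by metis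
    then have "\<tau> (c a) = a" using cg[of z] z \<tau>out by simp
    then show ?thesis using d \<tau>inj by metis
  qed
  have cx: "c x = x" if "x \<noteq> a" "x \<noteq> b" "x \<noteq> d" for x
  proof -
    obtain z where z: "g z = x" using inv_apply[OF g(1)] by metis
    show ?thesis
    proof (cases "z \<in> \<Gamma>")
      case True
      then have "z = x" using z gfix ga that by metis
      then have "\<tau> (c x) = g (\<tau> x)" using cg[of z] z by simp
      moreover have "\<tau> x \<noteq> a" using d \<tau>inj that by metis
      moreover have "\<tau> x \<in> \<Gamma>" using True \<open>z = x\<close> \<tau>in by simp
      ultimately show ?thesis using gfix \<tau>inj by metis
    next
      case False
      have "x \<notin> \<Gamma>"
      proof
        assume "x \<in> \<Gamma>"
        then have "g x = x" using gfix that by blast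
        then show False using z ginj \<open>x \<in> \<Gamma>\<close> False by metis
      qed
      then show ?thesis using cg[of z] False z \<tau>out \<tau>inj by metis
    qed
  qed
  show ?thesis
  proof (rule three_cycles_alternating[OF _ \<pi>])
    fix x y z assume xyz: "x \<in> \<Omega>" "y \<in> \<Omega>" "z \<in> \<Omega>" "x \<noteq> y" "y \<noteq> z" "x \<noteq> z"
    have "b \<noteq> a" "b \<noteq> d" "a \<in> \<Omega>" "d \<in> \<Omega>" using a b d \<Gamma>(1) by auto
    then obtain k where k: "k \<in> G" "k b = x" "k a = y" "k d = z"
      using ktrans_onD[OF kt, of "[b,a,d]" "[x,y,z]"] q(2) xyz b d by auto
    have kinj: "k u = k v \<longleftrightarrow> u = v" for u v using mem_inj[OF k(1)] by (auto dest: injD)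
    have "(k \<circ> c \<circ> inv k) u = (Transposition.transpose x y \<circ> Transposition.transpose y z) u" for u
    proof -
      obtain v where v: "u = k v" using inv_apply[OF k(1)] by metis
      have "(k \<circ> c \<circ> inv k) u = k (c v)" using v inv_apply[OF k(1)] by simp
      also have "\<dots> = (Transposition.transpose x y \<circ> Transposition.transpose y z) u"
        using k(2-4) v kinj xyz ca cb cd cx[of v]
        by (cases "v = a"; cases "v = b"; cases "v = d") (auto simp: Transposition.transpose_def)
      finally show ?thesis .
    qed
    then have "k \<circ> c \<circ> inv k = Transposition.transpose x y \<circ> Transposition.transpose y z" by blast
    then show "Transposition.transpose x y \<circ> Transposition.transpose y z \<in> G"
      using k(1) cG comp_mem inv_mem by metis
  qed
qed

end

section \<open>Orbits of a permutation and blocks\<close>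

text \<open>Forward iterates suffice: a permutation of a finite set has finite order, so these are
  all the points of its cycle.\<close>

definition orb :: "('a \<Rightarrow> 'a) \<Rightarrow> 'a \<Rightarrow> 'a set" where
  "orb \<sigma> x = range (\<lambda>i. (\<sigma> ^^ i) x)"

lemma orb_self: "x \<in> orb \<sigma> x"
  unfolding orb_def by (metis eq_id_iff funpow_0 rangeI)

lemma funpow_inj: "\<sigma> permutes \<Omega> \<Longrightarrow> inj (\<sigma> ^^ n)"
  by (meson bij_betw_def permutes_bij bij_betw_funpow)

lemma funpow_add_apply: "(f ^^ (m + n)) x = (f ^^ m) ((f ^^ n) x)"
  by (simp add: funpow_add)

text \<open>With \<open>j\<close> the least positive power of \<open>\<sigma>\<close> that returns
  \<open>B\<close> to itself, the translates of \<open>B\<close> under the smaller powers are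
  disjoint and permuted in one cycle of length \<open>j\<close>. Every orbit in their union
  \<open>U\<close> therefore meets all \<open>j\<close> of them in equally many points, which makes
  its length a multiple of \<open>j\<close>.\<close>

lemma block_orbit:
  assumes \<sigma>: "\<sigma> permutes \<Omega>" "finite \<Omega>" and B: "B \<subseteq> \<Omega>" "B \<noteq> {}"
    and blk: "\<And>i. (\<sigma> ^^ i) ` B = B \<or> (\<sigma> ^^ i) ` B \<inter> B = {}"
  obtains j U where "j > 0" "B \<subseteq> U" "U \<subseteq> \<Omega>" "card U = j * card B"
    "\<And>x. x \<in> U \<Longrightarrow> orb \<sigma> x \<subseteq> U" "\<And>x. x \<in> U \<Longrightarrow> card (orb \<sigma> x) = j * card (orb \<sigma> x \<inter> B)"
    "(\<sigma> ^^ j) ` B = B" "U = (\<Union>k<j. (\<sigma> ^^ k) ` B)"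
proof -
  have finB: "finite B" using B \<sigma> finite_subset by blast
  have perm: "permutation \<sigma>" using \<sigma> permutation_permutes by blast
  obtain m where m: "m > 0" "\<sigma> ^^ m = id" using permutation_is_nilpotent[OF perm] by blast
  define j where "j = (LEAST j. j > 0 \<and> (\<sigma> ^^ j) ` B = B)"
  have j: "j > 0" "(\<sigma> ^^ j) ` B = B"
    using LeastI[of "\<lambda>j. j > 0 \<and> (\<sigma> ^^ j) ` B = B" m] m by (auto simp: j_def)
  have jmin: "\<not> (0 < i \<and> (\<sigma> ^^ i) ` B = B)" if "i < j" for i
    using not_less_Least that by (auto simp: j_def)
  note finj = funpow_inj[OF \<sigma>(1)]
  have dis: "(\<sigma> ^^ k) ` B \<inter> (\<sigma> ^^ l) ` B = {}" if "k < l" "l < j" for k l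
  proof (rule ccontr)
    assume "\<not> ?thesis"
    then obtain u v where uv: "u \<in> B" "v \<in> B" "(\<sigma> ^^ k) u = (\<sigma> ^^ l) v" by auto
    have "(\<sigma> ^^ l) v = (\<sigma> ^^ k) ((\<sigma> ^^ (l - k)) v)" using that by (simp flip: funpow_add_apply)
    then have "u = (\<sigma> ^^ (l - k)) v" using uv finj by (metis injD)
    then have "(\<sigma> ^^ (l - k)) ` B = B" using blk[of "l - k"] uv by blast
    then show False using jmin[of "l - k"] that by (simp add: less_imp_diff_less)
  qed
  define U where "U = (\<Union>k<j. (\<sigma> ^^ k) ` B)"
  have disf: "disjoint_family_on (\<lambda>k. (\<sigma> ^^ k) ` B) {..<j}"
    unfolding disjoint_family_on_def using dis by (metis Int_commute lessThan_iff nat_neq_iff)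
  have cardf: "card ((\<sigma> ^^ k) ` A) = card A" for k A
    using finj card_image inj_on_subset by (metis subset_UNIV)
  have cU: "card U = j * card B"
  proof -
    have "card U = (\<Sum>k<j. card ((\<sigma> ^^ k) ` B))"
      unfolding U_def using finB disf by (intro card_UN_disjoint) (auto simp: disjoint_family_on_def)
    then show ?thesis by (simp add: cardf)
  qed
  have U\<Omega>: "U \<subseteq> \<Omega>" using B \<sigma> permutes_in_funpow_image unfolding U_def by fastforce
  have \<sigma>U: "\<sigma> x \<in> U" if "x \<in> U" for x
  proof -
    obtain k b where k: "k < j" "b \<in> B" "x = (\<sigma> ^^ k) b" using \<open>x \<in> U\<close> by (auto simp: U_def)
    show ?thesis
    proof (cases "Suc k < j")
      case True
      then show ?thesis using k by (auto simp: U_def intro!: bexI[of _ "Suc k"])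
    next
      case False
      then have "Suc k = j" using k by simp
      then have "\<sigma> x = (\<sigma> ^^ j) b" using k by auto
      then have "\<sigma> x \<in> B" using j k by blast
      then show ?thesis using j by (auto simp: U_def intro!: bexI[of _ 0])
    qed
  qed
  then have pU: "(\<sigma> ^^ i) x \<in> U" if "x \<in> U" for i x using that by (induction i) auto
  have orbU: "orb \<sigma> x \<subseteq> U" if "x \<in> U" for x using pU that by (auto simp: orb_def)
  have orb_inv: "(\<sigma> ^^ k) ` (orb \<sigma> x) = orb \<sigma> x" for k x
  proof -
    have "(\<sigma> ^^ k) ` (orb \<sigma> x) \<subseteq> orb \<sigma> x" unfolding orb_def by (auto simp flip: funpow_add_apply)
    moreover have "orb \<sigma> x \<subseteq> (\<sigma> ^^ k) ` (orb \<sigma> x)"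
    proof
      fix y assume "y \<in> orb \<sigma> x"
      then obtain i where i: "y = (\<sigma> ^^ i) x" by (auto simp: orb_def)
      \<comment> \<open>Adding a multiple of the order \<open>m\<close> to the exponent makes room
        for subtracting \<open>k\<close>.\<close>
      have "(\<sigma> ^^ (m * t)) = id" for t using m by (simp add: funpow_mult[symmetric] mult.commute)
      then have "y = (\<sigma> ^^ (i + m * k)) x" using i by (simp add: funpow_add)
      also have "i + m * k = k + (i + m * k - k)" using m by (simp add: trans_le_add2)
      finally have "y = (\<sigma> ^^ k) ((\<sigma> ^^ (i + m * k - k)) x)" by (metis funpow_add_apply)
      then show "y \<in> (\<sigma> ^^ k) ` (orb \<sigma> x)" by (auto simp: orb_def)
    qed
    ultimately show ?thesis by blast
  qed
  have "card (orb \<sigma> x) = j * card (orb \<sigma> x \<inter> B)" if "x \<in> U" for x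
  proof -
    have eq: "orb \<sigma> x \<inter> (\<sigma> ^^ k) ` B = (\<sigma> ^^ k) ` (orb \<sigma> x \<inter> B)" for k
      using orb_inv[of k x] finj by (metis image_Int)
    have "orb \<sigma> x = (\<Union>k<j. (\<sigma> ^^ k) ` (orb \<sigma> x \<inter> B))"
      unfolding eq[symmetric] using orbU[OF that] by (auto simp: U_def)
    moreover have "card (\<Union>k<j. (\<sigma> ^^ k) ` (orb \<sigma> x \<inter> B)) = (\<Sum>k<j. card ((\<sigma> ^^ k) ` (orb \<sigma> x \<inter> B)))"
      using finB dis by (intro card_UN_disjoint) (auto, (metis IntI emptyE image_eqI nat_neq_iff)+)
    ultimately show ?thesis by (simp add: cardf)
  qed
  moreover have "B \<subseteq> U" using j by (auto simp: U_def intro!: bexI[of _ 0])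
  ultimately show ?thesis using that[of j U] j cU U\<Omega> orbU U_def by blast
qed

lemma orb_subset: "\<sigma> permutes \<Omega> \<Longrightarrow> x \<in> \<Omega> \<Longrightarrow> orb \<sigma> x \<subseteq> \<Omega>"
  using permutes_in_funpow_image by (fastforce simp: orb_def)

text \<open>A single point is a block; its return time \<open>j\<close> is the length of its
  orbit.\<close>

lemma funpow_card_orb:
  assumes \<sigma>: "\<sigma> permutes \<Omega>" "finite \<Omega>" and x: "x \<in> \<Omega>"
  shows "(\<sigma> ^^ card (orb \<sigma> x)) x = x" "card (orb \<sigma> x) > 0"
proof -
  have "\<exists>j>0. card (orb \<sigma> x) = j \<and> (\<sigma> ^^ j) x = x"
  proof (rule block_orbit[OF \<sigma>, of "{x}"])
    fix j U assume jU: "j > 0" "{x} \<subseteq> U" "(\<sigma> ^^ j) ` {x} = {x}"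
      "\<And>y. y \<in> U \<Longrightarrow> card (orb \<sigma> y) = j * card (orb \<sigma> y \<inter> {x})"
    have "orb \<sigma> x \<inter> {x} = {x}" using orb_self[of x \<sigma>] by auto
    then have "card (orb \<sigma> x) = j" using jU(2) jU(4)[of x] by simp
    then show ?thesis using jU by auto
  qed (use x in auto)
  then show "(\<sigma> ^^ card (orb \<sigma> x)) x = x" "card (orb \<sigma> x) > 0" by auto
qed

lemma orb_sym:
  assumes \<sigma>: "\<sigma> permutes \<Omega>" "finite \<Omega>" and x: "x \<in> \<Omega>" and y: "y \<in> orb \<sigma> x"
  shows "orb \<sigma> y = orb \<sigma> x"
proof -
  have sub: "orb \<sigma> v \<subseteq> orb \<sigma> u" if "v \<in> orb \<sigma> u" for u v
    using that by (auto simp: orb_def simp flip: funpow_add_apply)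
  obtain i where i: "y = (\<sigma> ^^ i) x" using y by (auto simp: orb_def)
  define c where "c = card (orb \<sigma> x)"
  have c: "(\<sigma> ^^ c) x = x" "c > 0" using funpow_card_orb[OF \<sigma> x] by (auto simp: c_def)
  have ck: "(\<sigma> ^^ (c * k)) x = x" for k
    by (induction k) (use c in \<open>auto simp: funpow_add_apply\<close>)
  have "x = (\<sigma> ^^ (c * i - i)) y"
    using ck[of i] c i by (simp flip: funpow_add_apply)
  then have "x \<in> orb \<sigma> y" by (auto simp: orb_def)
  then show ?thesis using sub y by blast
qed

lemma funpow_dvd_orb:
  assumes \<sigma>: "\<sigma> permutes \<Omega>" "finite \<Omega>" and x: "x \<in> \<Omega>" and d: "card (orb \<sigma> x) dvd n"
  shows "(\<sigma> ^^ n) x = x"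
proof -
  obtain k where "n = card (orb \<sigma> x) * k" using d by auto
  moreover have "(\<sigma> ^^ (card (orb \<sigma> x) * k)) x = x" for k
    by (induction k) (use funpow_card_orb[OF \<sigma> x] in \<open>auto simp: funpow_add_apply\<close>)
  ultimately show ?thesis by simp
qed

text \<open>Let \<open>N\<close> be the product of the other orbit lengths. Powers of
  \<open>\<sigma>\<close> with exponent divisible by \<open>N\<close> fix all other orbits
  pointwise, and since \<open>N\<close> is prime to the length \<open>q\<close>, they still realise
  every rotation of the chosen orbit.\<close>

lemma (in perm_group) trans_on_fixing_orb:
  assumes \<sigma>: "\<sigma> \<in> G" and x: "x \<in> \<Omega>" and q: "Factorial_Ring.prime (card (orb \<sigma> x))"
    and other: "\<And>y. y \<in> \<Omega> \<Longrightarrow> orb \<sigma> y \<noteq> orb \<sigma> x \<Longrightarrow> \<not> card (orb \<sigma> x) dvd card (orb \<sigma> y)"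
  shows "trans_on (fixing G (orb \<sigma> x)) (orb \<sigma> x)"
  unfolding trans_on_def
proof (intro ballI)
  fix u v assume u: "u \<in> orb \<sigma> x" and v: "v \<in> orb \<sigma> x"
  define q where "q = card (orb \<sigma> x)"
  note perm = mem_permutes[OF \<sigma>]
  define N where "N = (\<Prod>D\<in>orb \<sigma> ` \<Omega> - {orb \<sigma> x}. card D)"
  have "\<not> q dvd N"
  proof
    assume "q dvd N"
    then have "\<exists>D\<in>orb \<sigma> ` \<Omega> - {orb \<sigma> x}. q dvd card D"
      unfolding N_def using q finite_space by (subst (asm) prime_dvd_prod_iff) (auto simp: q_def)
    then show False using other by (auto simp: q_def)
  qed
  then have cop: "coprime N q" using q by (metis coprime_commute prime_imp_coprime q_def)
  have u\<Omega>: "u \<in> \<Omega>" using u orb_subset[OF perm x] by auto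
  have "v \<in> orb \<sigma> u" using orb_sym[OF perm finite_space x u] v by simp
  then obtain i where i: "v = (\<sigma> ^^ i) u" by (auto simp: orb_def)
  obtain m0 where "[N * m0 = Suc 0] (mod q)" using cong_solve_coprime_nat[OF cop] by blast
  then have "[N * m0 * i = Suc 0 * i] (mod q)" by (rule cong_scalar_right)
  then obtain m where m: "[N * m = i] (mod q)" by (metis mult.assoc mult_1 One_nat_def)
  define h where "h = \<sigma> ^^ (N * m)"
  have hG: "h \<in> G" unfolding h_def by (rule funpow_mem[OF \<sigma>])
  have hu: "h u = v"
  proof -
    have qu: "(\<sigma> ^^ (q * k)) u = u" for k
      using funpow_dvd_orb[OF perm finite_space u\<Omega>] orb_sym[OF perm finite_space x u] by (simp add: q_def)
    have red: "(\<sigma> ^^ k) u = (\<sigma> ^^ (k mod q)) u" for k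
    proof -
      have "k = k mod q + q * (k div q)" by simp
      then have "(\<sigma> ^^ k) u = (\<sigma> ^^ (k mod q)) ((\<sigma> ^^ (q * (k div q))) u)" by (metis funpow_add_apply)
      then show ?thesis by (simp add: qu)
    qed
    show ?thesis unfolding h_def i using red[of "N * m"] red[of i] m by (simp add: cong_def)
  qed
  have "h permutes orb \<sigma> x"
  proof (rule permutes_superset[OF mem_permutes[OF hG]])
    fix y assume y: "y \<in> \<Omega> - orb \<sigma> x"
    then have "orb \<sigma> y \<noteq> orb \<sigma> x" using orb_self by force
    then have "card (orb \<sigma> y) dvd N"
      unfolding N_def using y finite_space by (intro dvd_prodI) auto
    then show "h y = y" unfolding h_def using y by (intro funpow_dvd_orb[OF perm finite_space]) auto
  qed
  then show "\<exists>h\<in>fixing G (orb \<sigma> x). h u = v" using hG hu by (auto simp: fixing_def)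
qed

section \<open>Counting in a graded free commutative monoid\<close>

lemma sum_mset_eq_sum_count:
  fixes f :: "'b \<Rightarrow> nat"
  assumes "finite S" "set_mset A \<subseteq> S"
  shows "(\<Sum>x\<in>#A. f x) = (\<Sum>x\<in>S. count A x * f x)"
  using assms(2)
proof (induction A)
  case (add a A)
  have "(\<Sum>x\<in>S. count (add_mset a A) x * f x) = (\<Sum>x\<in>S. count A x * f x + (if x = a then f x else 0))"
    by (intro sum.cong) auto
  also have "\<dots> = (\<Sum>x\<in>S. count A x * f x) + f a"
    using assms(1) add.prems by (simp add: sum.distrib)
  finally show ?case using add by simp
qed simp

text \<open>An abstract form of the monic polynomials over a field with \<open>Q\<close> elements:
  by unique factorisation they are the multisets of elements of \<open>Pr\<close>, with
  \<open>dg\<close> as the degree. The cardinality \<open>Q ^ n\<close> is the arithmetic input from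
  which all the statistics are derived.\<close>

locale graded_primes =
  fixes Pr :: "'p set" and dg :: "'p \<Rightarrow> nat" and Q :: nat
    and Ms :: "nat \<Rightarrow> 'p multiset set"
  assumes dg_pos: "\<phi> \<in> Pr \<Longrightarrow> dg \<phi> \<ge> 1"
    and Q2: "Q \<ge> 2"
    and Ms_def: "Ms n = {A. set_mset A \<subseteq> Pr \<and> (\<Sum>\<phi>\<in>#A. dg \<phi>) = n}"
    and Ms_card: "card (Ms n) = Q ^ n"
begin

definition wt :: "'p multiset \<Rightarrow> nat" where "wt A = (\<Sum>\<phi>\<in>#A. dg \<phi>)"

definition pr :: "nat \<Rightarrow> ('p multiset \<Rightarrow> bool) \<Rightarrow> real" where
  "pr n P = card {A \<in> Ms n. P A} / real Q ^ n"

lemma Ms_iff: "A \<in> Ms n \<longleftrightarrow> set_mset A \<subseteq> Pr \<and> wt A = n"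
  by (simp add: Ms_def wt_def)

lemma Q_pos: "Q > 0" using Q2 by simp

lemma Ms_finite: "finite (Ms n)"
  using Ms_card[of n] Q_pos by (metis card_gt_0_iff zero_less_power)

lemma wt_add: "wt (A + B) = wt A + wt B"
  by (simp add: wt_def)

lemma wt_replicate: "wt (replicate_mset k \<phi>) = k * dg \<phi>"
  by (simp add: wt_def)

lemma wt_mono: "A \<subseteq># B \<Longrightarrow> wt A \<le> wt B"
  by (metis wt_add le_add1 subset_mset.add_diff_inverse)

lemma Ms_subset: "A \<in> Ms n \<Longrightarrow> B \<subseteq># A \<Longrightarrow> B \<in> Ms (wt B)"
  by (auto simp: Ms_iff dest: mset_subset_eqD)

lemma Ms_0: "Ms 0 = {{#}}"
proof -
  have "A = {#}" if "set_mset A \<subseteq> Pr" "wt A = 0" for A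
  proof (rule ccontr)
    assume "A \<noteq> {#}"
    then obtain \<phi> where "\<phi> \<in># A" by blast
    then show False using that dg_pos[of \<phi>] by (auto simp: wt_def)
  qed
  then show ?thesis by (auto simp: Ms_iff wt_def)
qed

lemma sum_supersets:
  fixes F :: "'p multiset \<Rightarrow> real"
  assumes "B \<in> Ms m" "m \<le> n"
  shows "(\<Sum>A | A \<in> Ms n \<and> B \<subseteq># A. F A) = (\<Sum>C\<in>Ms (n - m). F (B + C))"
proof (rule sum.reindex_bij_witness[where j = "\<lambda>A. A - B" and i = "\<lambda>C. B + C"])
  fix A assume A: "A \<in> {A. A \<in> Ms n \<and> B \<subseteq># A}"
  then obtain C where "A = B + C" by (auto simp: mset_subset_eq_exists_conv)
  then show "B + (A - B) = A" "A - B \<in> Ms (n - m)" "F (B + (A - B)) = F A"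
    using A assms by (auto simp: Ms_iff wt_add)
qed (use assms in \<open>auto simp: Ms_iff wt_add\<close>)

lemma no_supersets: "B \<in> Ms m \<Longrightarrow> n < m \<Longrightarrow> {A. A \<in> Ms n \<and> B \<subseteq># A} = {}"
  by (auto simp: Ms_iff dest!: wt_mono)

text \<open>The multiples of \<open>B\<close> correspond to their cofactors, of which there are
  \<open>Q ^ (n - m)\<close>. For \<open>n < m\<close> there is none, so in general only the
  inequality holds.\<close>

lemma pr_superset:
  assumes "B \<in> Ms m" shows "pr n (\<lambda>A. B \<subseteq># A) \<le> 1 / real Q ^ m"
proof (cases "m \<le> n")
  case True
  have "real (card {A \<in> Ms n. B \<subseteq># A}) = real Q ^ (n - m)"
    using sum_supersets[OF assms True, of "\<lambda>_. 1"] Ms_card by simp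
  then have "pr n (\<lambda>A. B \<subseteq># A) = real Q ^ (n - m) / real Q ^ n" by (simp add: pr_def)
  also have "\<dots> = 1 / real Q ^ m" using True Q_pos by (simp add: power_diff)
  finally show ?thesis by simp
next
  case False
  then have "{A \<in> Ms n. B \<subseteq># A} = {}" using no_supersets[OF assms, of n] by simp
  then have "card {A \<in> Ms n. B \<subseteq># A} = 0" by (simp only: card.empty)
  then show ?thesis unfolding pr_def by (simp only:) simp
qed

lemma pr_superset_eq:
  assumes "B \<in> Ms m" "m \<le> n" shows "pr n (\<lambda>A. B \<subseteq># A) = 1 / real Q ^ m"
proof -
  have "real (card {A \<in> Ms n. B \<subseteq># A}) = real Q ^ (n - m)"
    using sum_supersets[OF assms, of "\<lambda>_. 1"] Ms_card by simp
  then have "pr n (\<lambda>A. B \<subseteq># A) = real Q ^ (n - m) / real Q ^ n" by (simp add: pr_def)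
  also have "\<dots> = 1 / real Q ^ m" using assms(2) Q_pos by (simp add: power_diff)
  finally show ?thesis by simp
qed

lemma pr_mono: "(\<And>A. A \<in> Ms n \<Longrightarrow> P A \<Longrightarrow> R A) \<Longrightarrow> pr n P \<le> pr n R"
  unfolding pr_def using Ms_finite by (auto intro!: divide_right_mono card_mono)

lemma pr_nonneg: "pr n P \<ge> 0"
  by (simp add: pr_def)

lemma pr_disj: "pr n (\<lambda>A. P A \<or> R A) \<le> pr n P + pr n R"
proof -
  have "{A \<in> Ms n. P A \<or> R A} = {A \<in> Ms n. P A} \<union> {A \<in> Ms n. R A}" by auto
  then have "card {A \<in> Ms n. P A \<or> R A} \<le> card {A \<in> Ms n. P A} + card {A \<in> Ms n. R A}"
    by (simp only: card_Un_le)
  then show ?thesis unfolding pr_def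
    by (simp flip: add_divide_distrib) (intro divide_right_mono, linarith, simp)
qed

lemma pr_eq_sum: "pr n P = (\<Sum>A\<in>Ms n. of_bool (P A)) / real Q ^ n"
  using Ms_finite by (simp add: pr_def Int_def sum.If_cases of_bool_def)

lemma pr_Bex:
  assumes "finite I"
  shows "pr n (\<lambda>A. \<exists>i\<in>I. P i A) \<le> (\<Sum>i\<in>I. pr n (P i))"
  using assms
proof (induction I)
  case (insert i I)
  have "pr n (\<lambda>A. \<exists>i\<in>insert i I. P i A) \<le> pr n (P i) + pr n (\<lambda>A. \<exists>i\<in>I. P i A)"
    using pr_disj[of n "P i" "\<lambda>A. \<exists>i\<in>I. P i A"] by simp
  then show ?case using insert by simp
qed (simp add: pr_def)

lemma pr_markov:
  fixes F :: "'p multiset \<Rightarrow> real"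
  assumes "\<And>A. A \<in> Ms n \<Longrightarrow> F A \<ge> 0" "\<And>A. A \<in> Ms n \<Longrightarrow> P A \<Longrightarrow> F A \<ge> t" "t > 0"
  shows "pr n P \<le> (\<Sum>A\<in>Ms n. F A) / real Q ^ n / t"
proof -
  have "t * (\<Sum>A\<in>Ms n. of_bool (P A)) \<le> (\<Sum>A\<in>Ms n. F A)"
    unfolding sum_distrib_left using assms by (intro sum_mono) (auto simp: of_bool_def)
  then show ?thesis unfolding pr_eq_sum using assms(3) Q_pos by (simp add: field_simps)
qed

definition PP :: "nat \<Rightarrow> 'p set" where "PP n = {\<phi> \<in> Pr. dg \<phi> \<le> n}"

definition PrD :: "nat \<Rightarrow> 'p set" where "PrD d = {\<phi> \<in> Pr. dg \<phi> = d}"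

lemma single_Ms: "\<phi> \<in> Pr \<Longrightarrow> {#\<phi>#} \<in> Ms (dg \<phi>)"
  by (simp add: Ms_iff wt_def)

lemma finite_PrD: "finite (PrD d)"
proof -
  have "(\<lambda>\<phi>. {#\<phi>#}) ` PrD d \<subseteq> Ms d" using single_Ms by (auto simp: PrD_def)
  then have "finite ((\<lambda>\<phi>. {#\<phi>#}) ` PrD d)" using Ms_finite finite_subset by blast
  then show ?thesis by (rule finite_imageD) (simp add: inj_on_def)
qed

lemma finite_PP: "finite (PP n)"
proof -
  have "PP n = (\<Union>d\<le>n. PrD d)" by (auto simp: PP_def PrD_def)
  then show ?thesis using finite_PrD by simp
qed

text \<open>The prime powers of weight \<open>m\<close>. Attaching \<open>dg \<phi>\<close> to such
  a pair gives the von Mangoldt function of the monoid.\<close>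

definition KP :: "nat \<Rightarrow> (nat \<times> 'p) set" where
  "KP m = {(k, \<phi>). 1 \<le> k \<and> \<phi> \<in> Pr \<and> k * dg \<phi> = m}"

lemma KP_sub: "KP m \<subseteq> {1..m} \<times> PP m"
proof -
  have "k \<le> m \<and> dg \<phi> \<le> m" if "1 \<le> k" "\<phi> \<in> Pr" "k * dg \<phi> = m" for k \<phi>
  proof
    have "1 \<le> dg \<phi>" using dg_pos that by blast
    then show "k \<le> m" "dg \<phi> \<le> m" using that(1,3) by (auto simp flip: that(3))
  qed
  then show ?thesis by (auto simp: KP_def PP_def)
qed

lemma finite_KP: "finite (KP m)"
  using KP_sub finite_PP by (meson finite_SigmaI finite_atLeastAtMost finite_subset)

text \<open>The identity between the logarithm and the sum of the von Mangoldt function over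
  divisors: \<open>\<phi>\<close> contributes \<open>dg \<phi>\<close> once for each
  \<open>k\<close> up to its multiplicity in \<open>A\<close>.\<close>

lemma wt_eq_sum:
  assumes "A \<in> Ms n"
  shows "real n = (\<Sum>m\<in>{1..n}. \<Sum>(k,\<phi>)\<in>KP m. real (dg \<phi>) * of_bool (replicate_mset k \<phi> \<subseteq># A))"
proof -
  have fin: "finite (SIGMA m:{1..n}. KP m)" using finite_KP by simp
  define S where "S = (SIGMA \<phi>:set_mset A. {1..count A \<phi>})"
  have "real n = (\<Sum>\<phi>\<in>set_mset A. count A \<phi> * dg \<phi>)"
    using assms sum_mset_eq_sum_count[of "set_mset A" A dg]
    by (simp add: Ms_iff wt_def flip: of_nat_mult of_nat_sum)
  also have "\<dots> = (\<Sum>(\<phi>,k)\<in>S. real (dg \<phi>))"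
    unfolding S_def by (subst sum.Sigma[symmetric]) (auto simp: mult.commute)
  also have "\<dots> = (\<Sum>(m,(k,\<phi>))\<in>{x \<in> (SIGMA m:{1..n}. KP m). replicate_mset (fst (snd x)) (snd (snd x)) \<subseteq># A}. real (dg \<phi>))"
  proof (rule sum.reindex_bij_witness[where j = "\<lambda>(\<phi>,k). (k * dg \<phi>, (k, \<phi>))" and i = "\<lambda>(m,(k,\<phi>)). (\<phi>,k)"])
    fix a assume "a \<in> S"
    then obtain \<phi> k where a: "a = (\<phi>, k)" "\<phi> \<in># A" "1 \<le> k" "k \<le> count A \<phi>" by (auto simp: S_def)
    then have sub: "replicate_mset k \<phi> \<subseteq># A" by (simp add: count_le_replicate_mset_subset_eq)
    then have "k * dg \<phi> \<le> n" using wt_mono[OF sub] assms by (simp add: wt_replicate Ms_iff)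
    moreover have \<phi>: "\<phi> \<in> Pr" using a assms by (auto simp: Ms_iff)
    moreover have "1 \<le> k * dg \<phi>" using a dg_pos[OF \<phi>] by simp
    ultimately show "(case a of (\<phi>,k) \<Rightarrow> (k * dg \<phi>, (k, \<phi>))) \<in> {x \<in> (SIGMA m:{1..n}. KP m). replicate_mset (fst (snd x)) (snd (snd x)) \<subseteq># A}"
      using a sub by (simp add: KP_def)
  next
    fix b assume b: "b \<in> {x \<in> (SIGMA m:{1..n}. KP m). replicate_mset (fst (snd x)) (snd (snd x)) \<subseteq># A}"
    then obtain m k \<phi> where "b = (m, (k, \<phi>))" "replicate_mset k \<phi> \<subseteq># A" "1 \<le> k" "m = k * dg \<phi>"
      by (auto simp: KP_def)
    moreover from this have "k \<le> count A \<phi>" by (simp add: count_le_replicate_mset_subset_eq)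
    moreover from this have "\<phi> \<in># A" using \<open>1 \<le> k\<close> by (simp flip: count_greater_zero_iff)
    ultimately show "(case b of (m,(k,\<phi>)) \<Rightarrow> (\<phi>,k)) \<in> S" "(case (case b of (m,(k,\<phi>)) \<Rightarrow> (\<phi>,k)) of (\<phi>,k) \<Rightarrow> (k * dg \<phi>, (k, \<phi>))) = b"
      by (auto simp: S_def)
  qed auto
  also have "\<dots> = (\<Sum>(m,(k,\<phi>))\<in>(SIGMA m:{1..n}. KP m). real (dg \<phi>) * of_bool (replicate_mset k \<phi> \<subseteq># A))"
    using fin by (intro sum.mono_neutral_cong_left) (auto split: prod.splits)
  also have "\<dots> = (\<Sum>m\<in>{1..n}. \<Sum>(k,\<phi>)\<in>KP m. real (dg \<phi>) * of_bool (replicate_mset k \<phi> \<subseteq># A))"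
    using finite_KP by (subst sum.Sigma) auto
  finally show ?thesis .
qed

section \<open>Mean values of completely multiplicative weights\<close>

definition cw :: "('p \<Rightarrow> real) \<Rightarrow> 'p multiset \<Rightarrow> real" where
  "cw x A = (\<Prod>\<phi>\<in>#A. x \<phi>)"

definition tot :: "('p \<Rightarrow> real) \<Rightarrow> nat \<Rightarrow> real" where
  "tot x n = (\<Sum>A\<in>Ms n. cw x A)"

text \<open>The von Mangoldt function twisted by \<open>x\<close> and summed over weight
  \<open>m\<close>: the coefficients of the logarithmic derivative of the generating function of
  \<open>tot x\<close>.\<close>

definition cm :: "('p \<Rightarrow> real) \<Rightarrow> nat \<Rightarrow> real" where
  "cm x m = (\<Sum>(k,\<phi>)\<in>KP m. real (dg \<phi>) * x \<phi> ^ k)"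

text \<open>The logarithmic derivative of the generating function, written as a recursion:
  expand the weight \<open>n\<close> of \<open>A\<close> over the prime powers contained in \<open>A\<close>.\<close>

lemma tot_rec: "n * tot x n = (\<Sum>m\<in>{1..n}. cm x m * tot x (n - m))"
proof -
  have inner: "(\<Sum>A\<in>Ms n. of_bool (replicate_mset k \<phi> \<subseteq># A) * cw x A) = x \<phi> ^ k * tot x (n - m)"
    if "m \<le> n" "(k, \<phi>) \<in> KP m" for m k \<phi>
  proof -
    have r: "replicate_mset k \<phi> \<in> Ms m" using that(2) by (auto simp: KP_def Ms_iff wt_replicate)
    have "(\<Sum>A\<in>Ms n. of_bool (replicate_mset k \<phi> \<subseteq># A) * cw x A)
      = (\<Sum>A | A \<in> Ms n \<and> replicate_mset k \<phi> \<subseteq># A. cw x A)"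
      using Ms_finite by (intro sum.mono_neutral_cong_right) auto
    also have "\<dots> = (\<Sum>C\<in>Ms (n - m). cw x (replicate_mset k \<phi> + C))"
      by (rule sum_supersets[OF r that(1)])
    also have "\<dots> = x \<phi> ^ k * tot x (n - m)"
      by (simp add: cw_def tot_def sum_distrib_left)
    finally show ?thesis .
  qed
  have "n * tot x n = (\<Sum>A\<in>Ms n. real n * cw x A)"
    by (simp add: tot_def sum_distrib_left)
  also have "\<dots> = (\<Sum>A\<in>Ms n. \<Sum>m\<in>{1..n}. \<Sum>(k,\<phi>)\<in>KP m. real (dg \<phi>) * (of_bool (replicate_mset k \<phi> \<subseteq># A) * cw x A))"
  proof (rule sum.cong[OF refl])
    fix A assume "A \<in> Ms n"
    show "real n * cw x A = (\<Sum>m\<in>{1..n}. \<Sum>(k,\<phi>)\<in>KP m. real (dg \<phi>) * (of_bool (replicate_mset k \<phi> \<subseteq># A) * cw x A))"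
      by (subst wt_eq_sum[OF \<open>A \<in> Ms n\<close>])
         (simp add: sum_distrib_right case_prod_beta mult.assoc)
  qed
  also have "\<dots> = (\<Sum>m\<in>{1..n}. \<Sum>(k,\<phi>)\<in>KP m. real (dg \<phi>) * (\<Sum>A\<in>Ms n. of_bool (replicate_mset k \<phi> \<subseteq># A) * cw x A))"
    unfolding sum_distrib_left case_prod_beta
    by (subst sum.swap) (intro sum.cong refl, subst sum.swap, simp)
  also have "\<dots> = (\<Sum>m\<in>{1..n}. cm x m * tot x (n - m))"
    unfolding cm_def sum_distrib_right
    by (intro sum.cong refl) (auto simp: inner mult.assoc)
  finally show ?thesis .
qed

lemma tot_0: "tot x 0 = 1"
  by (simp add: tot_def Ms_0 cw_def)

text \<open>The exact prime number theorem of the monoid. For the trivial weight all totals are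
  known to be \<open>Q ^ k\<close>, and the recursion then determines \<open>cm\<close> one index
  after the other.\<close>

lemma cm_one: "m \<ge> 1 \<Longrightarrow> cm (\<lambda>_. 1) m = real Q ^ m"
proof (induction m rule: less_induct)
  case (less m)
  have t: "tot (\<lambda>_. 1) k = real Q ^ k" for k using Ms_card by (simp add: tot_def cw_def)
  have "real m * real Q ^ m = (\<Sum>i\<in>{1..m}. cm (\<lambda>_. 1) i * real Q ^ (m - i))"
    using tot_rec[of m "\<lambda>_. 1"] by (simp add: t)
  also have "{1..m} = insert m {1..<m}" using less.prems by auto
  also have "(\<Sum>i\<in>insert m {1..<m}. cm (\<lambda>_. 1) i * real Q ^ (m - i))
      = cm (\<lambda>_. 1) m + (\<Sum>i\<in>{1..<m}. cm (\<lambda>_. 1) i * real Q ^ (m - i))" by simp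
  also have "(\<Sum>i\<in>{1..<m}. cm (\<lambda>_. 1) i * real Q ^ (m - i)) = (\<Sum>i\<in>{1..<m}. real Q ^ m)"
    using less.IH by (intro sum.cong) (auto simp flip: power_add)
  also have "\<dots> = (real m - 1) * real Q ^ m" using less.prems by (simp add: of_nat_diff)
  finally show ?case by (simp add: algebra_simps)
qed

lemma sum_KP_le:
  assumes "m \<ge> 1" "S \<subseteq> KP m" shows "(\<Sum>(k,\<phi>)\<in>S. real (dg \<phi>)) \<le> real Q ^ m"
proof -
  have "(\<Sum>(k,\<phi>)\<in>S. real (dg \<phi>)) \<le> (\<Sum>(k,\<phi>)\<in>KP m. real (dg \<phi>))"
    using assms(2) finite_KP by (intro sum_mono2) auto
  then show ?thesis using cm_one[OF assms(1)] by (simp add: cm_def)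
qed

lemma card_PrD_le: "d \<ge> 1 \<Longrightarrow> d * card (PrD d) \<le> Q ^ d"
proof -
  assume d: "d \<ge> 1"
  have "(\<Sum>(k,\<phi>)\<in>Pair (Suc 0) ` PrD d. real (dg \<phi>)) = d * card (PrD d)"
    by (subst sum.reindex) (auto simp: inj_on_def PrD_def)
  moreover have "Pair (Suc 0) ` PrD d \<subseteq> KP d" by (auto simp: PrD_def KP_def)
  ultimately have "real (d * card (PrD d)) \<le> real (Q ^ d)" using sum_KP_le[OF d, of "Pair (Suc 0) ` PrD d"] by simp
  then show ?thesis by (simp only: of_nat_le_iff)
qed

text \<open>In the exact formula for \<open>Q ^ d\<close>, the proper powers come from primes of
  degree at most \<open>d div 2\<close>. They contribute at most \<open>d * Q ^ (d div 2)\<close>,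
  which is at most half of \<open>Q ^ d\<close>.\<close>

lemma card_PrD_ge:
  assumes d: "d \<ge> 8" shows "real d * card (PrD d) \<ge> Q ^ d / 2"
proof -
  have sub: "KP d \<subseteq> Pair (Suc 0) ` PrD d \<union> (\<Union>k\<in>{2..d}. Pair k ` PrD (d div k))"
  proof
    fix a assume a: "a \<in> KP d"
    then obtain k \<phi> where k: "a = (k, \<phi>)" "1 \<le> k" "\<phi> \<in> Pr" "k * dg \<phi> = d" by (auto simp: KP_def)
    have "k \<le> d" using a k KP_sub[of d] by auto
    have "dg \<phi> = d div k" using k by auto
    then have "a \<in> Pair k ` PrD (d div k)" using k by (auto simp: PrD_def)
    moreover have "k = 1 \<or> k \<in> {2..d}" using k \<open>k \<le> d\<close> by auto
    ultimately show "a \<in> Pair (Suc 0) ` PrD d \<union> (\<Union>k\<in>{2..d}. Pair k ` PrD (d div k))" by auto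
  qed
  have s: "(\<Sum>(k,\<phi>)\<in>Pair k ` PrD e. real (dg \<phi>)) = e * card (PrD e)" for k e
    by (subst sum.reindex) (auto simp: inj_on_def PrD_def)
  have b: "real (d div k) * card (PrD (d div k)) \<le> Q ^ (d div 2)" if "k \<in> {2..d}" for k
  proof -
    have "d div k \<ge> 1" using that by (simp add: Suc_le_eq div_greater_zero_iff)
    then have "(d div k) * card (PrD (d div k)) \<le> Q ^ (d div k)" by (rule card_PrD_le)
    also have "\<dots> \<le> Q ^ (d div 2)" using Q_pos that by (intro power_increasing div_le_mono2) auto
    finally show ?thesis by (metis of_nat_le_iff of_nat_mult of_nat_power)
  qed
  have "real Q ^ d = (\<Sum>(k,\<phi>)\<in>KP d. real (dg \<phi>))" using cm_one[of d] d by (simp add: cm_def)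
  also have "\<dots> \<le> (\<Sum>(k,\<phi>)\<in>Pair (Suc 0) ` PrD d \<union> (\<Union>k\<in>{2..d}. Pair k ` PrD (d div k)). real (dg \<phi>))"
    using finite_PrD sub by (intro sum_mono2) auto
  also have "\<dots> \<le> (\<Sum>(k,\<phi>)\<in>Pair (Suc 0) ` PrD d. real (dg \<phi>)) + (\<Sum>(k,\<phi>)\<in>(\<Union>k\<in>{2..d}. Pair k ` PrD (d div k)). real (dg \<phi>))"
    using finite_PrD by (subst sum.union_disjoint) auto
  also have "(\<Sum>(k,\<phi>)\<in>(\<Union>k\<in>{2..d}. Pair k ` PrD (d div k)). real (dg \<phi>))
     = (\<Sum>k\<in>{2..d}. real (d div k) * card (PrD (d div k)))"
    using finite_PrD by (subst sum.UNION_disjoint) (auto simp: s)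
  also have "\<dots> \<le> (\<Sum>k\<in>{2..d}. real Q ^ (d div 2))" using b by (intro sum_mono) simp
  also have "\<dots> \<le> real d * Q ^ (d div 2)" by (simp add: mult_right_mono)
  finally have 1: "real Q ^ d \<le> real d * card (PrD d) + real d * Q ^ (d div 2)" by (simp add: s)
  define h where "h = d - d div 2"
  have h: "4 \<le> h" "d \<le> 2 * h" "d = d div 2 + h" using d by (auto simp: h_def)
  \<comment> \<open>This exponential bound starts at 4, and \<open>d \<ge> 8\<close> guarantees
    \<open>h \<ge> 4\<close>.\<close>
  have "4 * m \<le> 2 ^ m" if "4 \<le> m" for m :: nat using that by (induction rule: dec_induct) auto
  then have "4 * h \<le> 2 ^ h" using h(1) by blast
  then have "2 * d \<le> 2 ^ h" using h(2) by linarith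
  also have "(2::nat) ^ h \<le> Q ^ h" using Q2 by (rule power_mono) simp
  finally have "real (2 * d) \<le> real (Q ^ h)" by (simp only: of_nat_le_iff)
  then have "2 * real d \<le> real Q ^ h" by simp
  then have "2 * real d * Q ^ (d div 2) \<le> real Q ^ h * Q ^ (d div 2)" by (rule mult_right_mono) simp
  also have "real Q ^ h * Q ^ (d div 2) = real Q ^ (h + d div 2)" by (simp add: power_add)
  also have "h + d div 2 = d" using h(3) by linarith
  finally show ?thesis using 1 by simp
qed

text \<open>With equality the recursion defines the coefficients of the power series (1 - z)^(-1/2),
  which are of order t^(-1/2). The proof inserts the claimed bound into the sum and compares with
  the integral of 1 / sqrt.\<close>

lemma sqrt_recursion:
  fixes b :: "nat \<Rightarrow> real"
  assumes "b 0 = 1" and rec: "\<And>t. t \<ge> 1 \<Longrightarrow> t * b t \<le> (\<Sum>s<t. b s) / 2"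
    and "t \<ge> 1"
  shows "b t \<le> 1 / sqrt t"
  using assms(3)
proof (induction t rule: less_induct)
  case (less t)
  \<comment> \<open>The summand -1 on the right offsets the initial value \<open>b 0 = 1\<close> of
    the recursion.\<close>
  have S: "(\<Sum>s\<in>{1..<N}. 1 / sqrt (real s)) \<le> 2 * sqrt (real N - 1) - 1" if "N \<ge> 2" for N :: nat
    using that
  proof (induction N rule: dec_induct)
    case base
    have "{1..<2::nat} = {1}" by auto
    then show ?case by simp
  next
    case (step N)
    have "1 / sqrt N \<le> 2 * (sqrt N - sqrt (real N - 1))"
    proof -
      have "(sqrt N - sqrt (real N - 1)) * (sqrt N + sqrt (real N - 1)) = 1"
        using step by (simp add: algebra_simps)
      moreover have "sqrt N - sqrt (real N - 1) \<ge> 0" by simp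
      moreover have "(sqrt N - sqrt (real N - 1)) * (sqrt N + sqrt (real N - 1))
          \<le> (sqrt N - sqrt (real N - 1)) * (2 * sqrt N)"
        by (intro mult_left_mono) simp_all
      ultimately have "1 \<le> (sqrt N - sqrt (real N - 1)) * (2 * sqrt N)" by linarith
      then show ?thesis using step by (intro mult_imp_div_pos_le) (simp_all only: mult_ac, simp)
    qed
    moreover have "(\<Sum>s\<in>{1..<Suc N}. 1 / sqrt s) = (\<Sum>s\<in>{1..<N}. 1 / sqrt s) + 1 / sqrt N"
      using step by simp
    ultimately show ?case using step by simp
  qed
  show ?case
  proof (cases "t = 1")
    case True
    then show ?thesis using rec[of 1] assms(1) by simp
  next
    case False
    then have t: "t \<ge> 2" using less.prems by simp
    have "(\<Sum>s<t. b s) = b 0 + (\<Sum>s\<in>{1..<t}. b s)"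
      using t by (simp add: lessThan_atLeast0 sum.atLeast_Suc_lessThan)
    also have "\<dots> \<le> 1 + (\<Sum>s\<in>{1..<t}. 1 / sqrt s)"
      using assms(1) less.IH by (intro add_mono sum_mono) auto
    also have "\<dots> \<le> 2 * sqrt (real t - 1)" using S[OF t] by simp
    also have "\<dots> \<le> 2 * sqrt t" by simp
    finally have "t * b t \<le> sqrt t" using rec[of t] t by simp
    then have "b t \<le> sqrt t / t" using t by (simp add: field_simps)
    also have "\<dots> = 1 / sqrt t" using t by (simp add: frac_eq_eq)
    finally show ?thesis .
  qed
qed

lemma cw_nonneg: "(\<And>\<phi>. x \<phi> \<ge> 0) \<Longrightarrow> cw x A \<ge> 0"
  by (induction A) (auto simp: cw_def)

lemma tot_nonneg: "(\<And>\<phi>. x \<phi> \<ge> 0) \<Longrightarrow> tot x n \<ge> 0"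
  unfolding tot_def by (intro sum_nonneg cw_nonneg)

text \<open>Every prime factor costs a factor 1/2, so the twisted von Mangoldt sum is at most half
  of \<open>Q ^ m\<close>, and the normalised totals satisfy the square root recursion.\<close>

lemma tot_half: "t \<ge> 1 \<Longrightarrow> tot (\<lambda>_. 1/2) t / real Q ^ t \<le> 1 / sqrt t"
proof (rule sqrt_recursion)
  fix t :: nat assume t: "t \<ge> 1"
  have c: "cm (\<lambda>_. 1/2) m \<le> real Q ^ m / 2" if "m \<ge> 1" for m
  proof -
    have "cm (\<lambda>_. 1/2) m \<le> (\<Sum>(k,\<phi>)\<in>KP m. real (dg \<phi>) * (1/2))"
      unfolding cm_def
    proof (intro sum_mono, clarify)
      fix k \<phi> assume "(k, \<phi>) \<in> KP m"
      then have "(1/2::real) ^ k \<le> (1/2) ^ 1" by (intro power_decreasing) (auto simp: KP_def)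
      then show "real (dg \<phi>) * (1/2) ^ k \<le> real (dg \<phi>) * (1/2)" by (intro mult_left_mono) auto
    qed
    also have "\<dots> = (\<Sum>(k,\<phi>)\<in>KP m. real (dg \<phi>)) / 2"
      by (simp add: sum_divide_distrib case_prod_beta)
    also have "\<dots> \<le> real Q ^ m / 2" using sum_KP_le[OF that] by fastforce
    finally show ?thesis .
  qed
  have "t * tot (\<lambda>_. 1/2) t \<le> (\<Sum>m\<in>{1..t}. real Q ^ m / 2 * tot (\<lambda>_. 1/2) (t - m))"
    unfolding tot_rec using c tot_nonneg by (intro sum_mono mult_right_mono) auto
  also have "\<dots> = (\<Sum>s<t. real Q ^ (t - s) / 2 * tot (\<lambda>_. 1/2) s)"
    by (rule sum.reindex_bij_witness[where i = "\<lambda>s. t - s" and j = "\<lambda>m. t - m"]) auto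
  also have "\<dots> = real Q ^ t * ((\<Sum>s<t. tot (\<lambda>_. 1/2) s / real Q ^ s) / 2)"
    using Q_pos by (simp add: sum_divide_distrib sum_distrib_left power_diff)
  finally show "t * (tot (\<lambda>_. 1/2) t / real Q ^ t) \<le> (\<Sum>s<t. tot (\<lambda>_. 1/2) s / real Q ^ s) / 2"
    using Q_pos by (simp add: field_simps)
qed (simp_all add: tot_0)

text \<open>Only prime powers of weight divisible by \<open>j\<close> occur, so the recursion runs
  over multiples of \<open>j\<close> and carries a factor \<open>1 / j\<close>. The condition
  \<open>j \<ge> 2\<close> brings it under the square root recursion.\<close>

lemma tot_dvd: 
  assumes j: "j \<ge> 2" and t: "t \<ge> 1"
  shows "tot (\<lambda>\<phi>. of_bool (j dvd dg \<phi>)) (j * t) / real Q ^ (j * t) \<le> 1 / sqrt t"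
proof (rule sqrt_recursion[OF _ _ t])
  let ?x = "\<lambda>\<phi>. of_bool (j dvd dg \<phi>) :: real"
  fix t :: nat assume t: "t \<ge> 1"
  have c0: "cm ?x m = 0" if "\<not> j dvd m" for m
    unfolding cm_def using that by (intro sum.neutral) (auto simp: KP_def)
  have c: "cm ?x m \<le> real Q ^ m" if "m \<ge> 1" for m
  proof -
    have "cm ?x m \<le> (\<Sum>(k,\<phi>)\<in>KP m. real (dg \<phi>))"
      unfolding cm_def by (intro sum_mono) (auto simp: of_bool_def power_0_left)
    also have "\<dots> \<le> real Q ^ m" using sum_KP_le[OF that] by fastforce
    finally show ?thesis .
  qed
  have "real (j * t) * tot ?x (j * t) = (\<Sum>m\<in>(\<lambda>s. j * t - j * s) ` {..<t}. cm ?x m * tot ?x (j * t - m))"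
    unfolding tot_rec
  proof (rule sum.mono_neutral_right)
    show "(\<lambda>s. j * t - j * s) ` {..<t} \<subseteq> {1..j * t}"
      using j by (auto simp: Suc_le_eq)
    show "\<forall>m\<in>{1..j * t} - (\<lambda>s. j * t - j * s) ` {..<t}. cm ?x m * tot ?x (j * t - m) = 0"
    proof
      fix m assume m: "m \<in> {1..j * t} - (\<lambda>s. j * t - j * s) ` {..<t}"
      have "\<not> j dvd m"
      proof
        assume "j dvd m"
        then obtain u where u: "m = j * u" by auto
        then have "u \<le> t" "u \<ge> 1" using m j by auto
        then have "m = j * t - j * (t - u)" "t - u < t"
          using u by (auto simp: diff_mult_distrib2[symmetric])
        then show False using m by blast
      qed
      then show "cm ?x m * tot ?x (j * t - m) = 0" using c0 by simp
    qed
  qed simp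
  also have "\<dots> = (\<Sum>s<t. cm ?x (j * t - j * s) * tot ?x (j * s))"
  proof (subst sum.reindex)
    show "inj_on (\<lambda>s. j * t - j * s) {..<t}"
    proof (rule inj_onI)
      fix x y assume "x \<in> {..<t}" "y \<in> {..<t}" "j * t - j * x = j * t - j * y"
      then have "j * x = j * y" using diff_le_mono2 by (metis diff_diff_cancel lessThan_iff less_imp_le mult_le_mono2)
      then show "x = y" using j by simp
    qed
  qed auto
  also have "\<dots> \<le> (\<Sum>s<t. real Q ^ (j * t - j * s) * tot ?x (j * s))"
  proof (intro sum_mono mult_right_mono)
    fix s assume "s \<in> {..<t}"
    then have "j * t - j * s \<ge> 1" using j by (simp add: Suc_le_eq)
    from c[OF this] show "cm ?x (j * t - j * s) \<le> real Q ^ (j * t - j * s)" by simp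
  qed (auto intro: tot_nonneg)
  also have "\<dots> = real Q ^ (j * t) * (\<Sum>s<t. tot ?x (j * s) / real Q ^ (j * s))"
    unfolding sum_distrib_left
  proof (rule sum.cong[OF refl])
    fix s assume "s \<in> {..<t}"
    then have "j * s \<le> j * t" by simp
    then show "real Q ^ (j * t - j * s) * tot ?x (j * s) = real Q ^ (j * t) * (tot ?x (j * s) / real Q ^ (j * s))"
      using Q_pos by (simp add: power_diff)
  qed
  finally have 1: "real j * (t * (tot ?x (j * t) / real Q ^ (j * t))) \<le> (\<Sum>s<t. tot ?x (j * s) / real Q ^ (j * s))"
    using Q_pos by (simp add: field_simps)
  have "2 * (t * (tot ?x (j * t) / real Q ^ (j * t))) \<le> real j * (t * (tot ?x (j * t) / real Q ^ (j * t)))"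
    using j tot_nonneg[of ?x] by (intro mult_right_mono) auto
  then show "t * (tot ?x (j * t) / real Q ^ (j * t)) \<le> (\<Sum>s<t. tot ?x (j * s) / real Q ^ (j * s)) / 2"
    using 1 by linarith
qed (simp add: tot_0)

text \<open>First moment: each candidate \<open>B\<close> divides \<open>A\<close> with probability
  at most \<open>1 / Q ^ (j * t)\<close>, and \<open>tot_dvd\<close> estimates the number of
  candidates.\<close>

lemma pr_divisor_dvd:
  assumes "j \<ge> 2" "t \<ge> 1"
  shows "pr n (\<lambda>A. \<exists>B. B \<subseteq># A \<and> wt B = j * t \<and> (\<forall>\<phi>\<in>#B. j dvd dg \<phi>)) \<le> 1 / sqrt t"
proof -
  let ?x = "\<lambda>\<phi>. of_bool (j dvd dg \<phi>) :: real"
  let ?D = "{B \<in> Ms (j * t). \<forall>\<phi>\<in>#B. j dvd dg \<phi>}"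
  have "pr n (\<lambda>A. \<exists>B. B \<subseteq># A \<and> wt B = j * t \<and> (\<forall>\<phi>\<in>#B. j dvd dg \<phi>)) \<le> pr n (\<lambda>A. \<exists>B\<in>?D. B \<subseteq># A)"
  proof (rule pr_mono)
    fix A assume "A \<in> Ms n" "\<exists>B. B \<subseteq># A \<and> wt B = j * t \<and> (\<forall>\<phi>\<in>#B. j dvd dg \<phi>)"
    then obtain B where "B \<subseteq># A" "wt B = j * t" "\<forall>\<phi>\<in>#B. j dvd dg \<phi>" "B \<in> Ms (wt B)"
      using Ms_subset by blast
    then show "\<exists>B\<in>?D. B \<subseteq># A" by (intro bexI[of _ B]) auto
  qed
  also have "\<dots> \<le> (\<Sum>B\<in>?D. pr n (\<lambda>A. B \<subseteq># A))" using Ms_finite by (intro pr_Bex) simp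
  also have "\<dots> \<le> (\<Sum>B\<in>?D. 1 / real Q ^ (j * t))" using pr_superset by (intro sum_mono) blast
  also have "\<dots> = card ?D / real Q ^ (j * t)" by simp
  also have "real (card ?D) = tot ?x (j * t)"
  proof -
    have "cw ?x B = of_bool (\<forall>\<phi>\<in>#B. j dvd dg \<phi>)" for B
      unfolding cw_def by (induction B) auto
    then show ?thesis using Ms_finite by (simp add: tot_def Int_def sum.If_cases of_bool_def)
  qed
  also have "tot ?x (j * t) / real Q ^ (j * t) \<le> 1 / sqrt t" using tot_dvd[OF assms] by simp
  finally show ?thesis .
qed

text \<open>A plain union bound over the \<open>Q ^ m\<close> candidates \<open>B\<close> shows no
  decay. The weight \<open>2 ^ T * (1/2) ^ size A\<close> is at least 1 when \<open>A\<close> has at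
  most \<open>T\<close> factors; being completely multiplicative up to the constant, its sum over
  all \<open>A = B + C\<close> splits into two totals that \<open>tot_half\<close> bounds.\<close>

lemma pr_divisor_few:
  assumes "m \<ge> 1" "m < n"
  shows "pr n (\<lambda>A. size A \<le> T \<and> (\<exists>B. B \<subseteq># A \<and> wt B = m)) \<le> 2 ^ T / sqrt (m * (n - m))"
proof -
  let ?h = "\<lambda>_::'p. 1/2::real"
  have h: "cw ?h A = (1/2) ^ size A" for A by (simp add: cw_def)
  let ?F = "\<lambda>A. \<Sum>B | B \<in> Ms m \<and> B \<subseteq># A. (2::real) ^ T * cw ?h A"
  have fin: "finite {B. B \<in> Ms m \<and> B \<subseteq># A}" for A using Ms_finite by simp
  have "pr n (\<lambda>A. size A \<le> T \<and> (\<exists>B. B \<subseteq># A \<and> wt B = m)) \<le> (\<Sum>A\<in>Ms n. ?F A) / real Q ^ n / 1"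
  proof (rule pr_markov)
    fix A assume A: "A \<in> Ms n" "size A \<le> T \<and> (\<exists>B. B \<subseteq># A \<and> wt B = m)"
    then obtain B where B: "B \<in> Ms m" "B \<subseteq># A" using Ms_subset by blast
    have "(1::real) \<le> 2 ^ T * (1/2) ^ size A"
      using A by (simp add: power_one_over field_simps)
    also have "\<dots> = (\<Sum>B\<in>{B}. (2::real) ^ T * cw ?h A)" by (simp add: h)
    also have "\<dots> \<le> ?F A" using B fin by (intro sum_mono2) (auto simp: h)
    finally show "1 \<le> ?F A" .
  qed (auto intro!: sum_nonneg simp: h)
  also have "(\<Sum>A\<in>Ms n. ?F A) = (\<Sum>A\<in>Ms n. \<Sum>B\<in>Ms m. if B \<subseteq># A then 2 ^ T * cw ?h A else 0)"
    using Ms_finite by (intro sum.cong refl sum.mono_neutral_cong_left) auto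
  also have "\<dots> = (\<Sum>B\<in>Ms m. \<Sum>A\<in>Ms n. if B \<subseteq># A then 2 ^ T * cw ?h A else 0)"
    by (rule sum.swap)
  also have "\<dots> = (\<Sum>B\<in>Ms m. \<Sum>A | A \<in> Ms n \<and> B \<subseteq># A. 2 ^ T * cw ?h A)"
    using Ms_finite by (intro sum.cong refl sum.mono_neutral_cong_right) auto
  also have "\<dots> = (\<Sum>B\<in>Ms m. \<Sum>C\<in>Ms (n - m). 2 ^ T * cw ?h (B + C))"
    using assms by (intro sum.cong refl sum_supersets) auto
  also have "\<dots> = 2 ^ T * (tot ?h m * tot ?h (n - m))"
    unfolding tot_def sum_product unfolding sum_distrib_left by (simp add: cw_def)
  also have "2 ^ T * (tot ?h m * tot ?h (n - m)) / real Q ^ n / 1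
    = 2 ^ T * ((tot ?h m / real Q ^ m) * (tot ?h (n - m) / real Q ^ (n - m)))"
    using assms by (simp flip: power_add)
  also have "\<dots> \<le> 2 ^ T * ((1 / sqrt m) * (1 / sqrt (n - m)))"
    using assms tot_half[of m] tot_half[of "n - m"] tot_nonneg[of ?h]
    by (intro mult_left_mono mult_mono) (auto intro!: divide_nonneg_nonneg)
  also have "\<dots> = 2 ^ T / sqrt (m * (n - m))" by (simp add: real_sqrt_mult)
  finally show ?thesis .
qed

end

context graded_primes
begin

subsection \<open>Moments of the number of distinct prime divisors\<close>

definition ex :: "nat \<Rightarrow> ('p multiset \<Rightarrow> real) \<Rightarrow> real" where
  "ex n F = (\<Sum>A\<in>Ms n. F A) / real Q ^ n"

lemma ex_cong: "(\<And>A. A \<in> Ms n \<Longrightarrow> F A = H A) \<Longrightarrow> ex n F = ex n H"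
  unfolding ex_def by (metis (no_types, lifting) sum.cong)

lemma ex_sum: "ex n (\<lambda>A. \<Sum>i\<in>I. F i A) = (\<Sum>i\<in>I. ex n (F i))"
  unfolding ex_def by (subst sum.swap) (simp add: sum_divide_distrib)

lemma ex_cmult: "ex n (\<lambda>A. c * F A) = c * ex n F"
  unfolding ex_def by (simp add: sum_distrib_left)

lemma ex_add: "ex n (\<lambda>A. F A + H A) = ex n F + ex n H"
  unfolding ex_def by (simp add: sum.distrib add_divide_distrib)

lemma ex_const: "ex n (\<lambda>A. c) = c"
  unfolding ex_def using Ms_card Q_pos by simp

lemma pr_ex: "pr n P = ex n (\<lambda>A. of_bool (P A))"
  unfolding pr_eq_sum ex_def ..

lemma pr_markov_ex:
  assumes "\<And>A. A \<in> Ms n \<Longrightarrow> F A \<ge> 0" "\<And>A. A \<in> Ms n \<Longrightarrow> P A \<Longrightarrow> F A \<ge> t" "t > 0"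
  shows "pr n P \<le> ex n F / t"
  using pr_markov[OF assms] by (simp add: ex_def)

definition PrS :: "nat set \<Rightarrow> 'p set" where "PrS S = {\<phi> \<in> Pr. dg \<phi> \<in> S}"

text \<open>Distinct primes are counted, because the membership events have simple probabilities and
  correlations; multiplicities are handled apart, through \<open>rep\<close>.\<close>

definition Nc :: "nat set \<Rightarrow> 'p multiset \<Rightarrow> nat" where
  "Nc S A = card {\<phi> \<in> set_mset A. dg \<phi> \<in> S}"

text \<open>This is the mean of \<open>Nc S\<close> over \<open>Ms n\<close> as long as
  \<open>S\<close> is contained in \<open>{1..n}\<close>.\<close>

definition mu :: "nat set \<Rightarrow> real" where
  "mu S = (\<Sum>d\<in>S. card (PrD d) / real Q ^ d)"

lemma finite_PrS: "finite S \<Longrightarrow> finite (PrS S)"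
proof -
  assume "finite S"
  have "PrS S = (\<Union>d\<in>S. PrD d)" by (auto simp: PrS_def PrD_def)
  then show ?thesis using finite_PrD \<open>finite S\<close> by simp
qed

lemma mu_eq: "finite S \<Longrightarrow> mu S = (\<Sum>\<phi>\<in>PrS S. 1 / real Q ^ dg \<phi>)"
proof -
  assume S: "finite S"
  have "PrS S = (\<Union>d\<in>S. PrD d)" by (auto simp: PrS_def PrD_def)
  then have "(\<Sum>\<phi>\<in>PrS S. 1 / real Q ^ dg \<phi>) = (\<Sum>d\<in>S. \<Sum>\<phi>\<in>PrD d. 1 / real Q ^ dg \<phi>)"
    using S finite_PrD by (simp only:) (subst sum.UNION_disjoint, auto simp: PrD_def)
  also have "\<dots> = mu S" unfolding mu_def by (intro sum.cong refl) (simp add: PrD_def)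
  finally show ?thesis by simp
qed

lemma mu_nonneg: "mu S \<ge> 0"
  unfolding mu_def by (intro sum_nonneg) auto

lemma pr_mem: "\<phi> \<in> Pr \<Longrightarrow> dg \<phi> \<le> n \<Longrightarrow> pr n (\<lambda>A. \<phi> \<in># A) = 1 / real Q ^ dg \<phi>"
  using pr_superset_eq[OF single_Ms] by simp

text \<open>Equality holds for \<open>dg \<phi> + dg \<psi> \<le> n\<close>, and beyond that the
  event is empty. So distinct primes are never positively correlated.\<close>

lemma pr_mem2:
  assumes "\<phi> \<in> Pr" "\<psi> \<in> Pr" "\<phi> \<noteq> \<psi>"
  shows "pr n (\<lambda>A. \<phi> \<in># A \<and> \<psi> \<in># A) \<le> (1 / real Q ^ dg \<phi>) * (1 / real Q ^ dg \<psi>)"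
proof -
  have "{#\<phi>, \<psi>#} \<in> Ms (dg \<phi> + dg \<psi>)" using assms by (simp add: Ms_iff wt_def)
  then have "pr n (\<lambda>A. {#\<phi>, \<psi>#} \<subseteq># A) \<le> 1 / real Q ^ (dg \<phi> + dg \<psi>)" by (rule pr_superset)
  moreover have "{#\<phi>, \<psi>#} \<subseteq># A \<longleftrightarrow> \<phi> \<in># A \<and> \<psi> \<in># A" for A
    using assms(3) by (auto simp: insert_subset_eq_iff in_diff_count dest: in_diffD)
  ultimately show ?thesis by (simp add: power_add)
qed

lemma Nc_eq:
  assumes "A \<in> Ms n" "finite S"
  shows "real (Nc S A) = (\<Sum>\<phi>\<in>PrS S. of_bool (\<phi> \<in># A))"
proof -
  have "{\<phi> \<in> set_mset A. dg \<phi> \<in> S} = {\<phi> \<in> PrS S. \<phi> \<in># A}"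
    using assms by (auto simp: PrS_def Ms_iff)
  then show ?thesis using finite_PrS[OF assms(2)]
    by (simp add: Nc_def Int_def sum.If_cases of_bool_def)
qed

lemma ex_Nc:
  assumes "S \<subseteq> {1..n}" shows "ex n (\<lambda>A. Nc S A) = mu S"
proof -
  have fin: "finite S" using assms finite_subset by blast
  have "ex n (\<lambda>A. Nc S A) = (\<Sum>\<phi>\<in>PrS S. pr n (\<lambda>A. \<phi> \<in># A))"
    unfolding pr_ex ex_sum[symmetric] using Nc_eq[OF _ fin] by (intro ex_cong) blast
  also have "\<dots> = mu S"
    unfolding mu_eq[OF fin] using assms by (intro sum.cong refl pr_mem) (auto simp: PrS_def)
  finally show ?thesis .
qed

lemma ex_Nc2:
  assumes "S \<subseteq> {1..n}" shows "ex n (\<lambda>A. (real (Nc S A))\<^sup>2) \<le> (mu S)\<^sup>2 + mu S"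
proof -
  have fin: "finite S" using assms finite_subset by blast
  have "ex n (\<lambda>A. (real (Nc S A))\<^sup>2) = (\<Sum>\<phi>\<in>PrS S. \<Sum>\<psi>\<in>PrS S. pr n (\<lambda>A. \<phi> \<in># A \<and> \<psi> \<in># A))"
    unfolding pr_ex ex_sum[symmetric]
    by (intro ex_cong) (simp add: Nc_eq[OF _ fin] power2_eq_square sum_product of_bool_conj)
  also have "\<dots> \<le> (\<Sum>\<phi>\<in>PrS S. \<Sum>\<psi>\<in>PrS S. (1 / real Q ^ dg \<phi>) * (1 / real Q ^ dg \<psi>) + (if \<psi> = \<phi> then 1 / real Q ^ dg \<phi> else 0))"
  proof (intro sum_mono)
    fix \<phi> \<psi> assume a: "\<phi> \<in> PrS S" "\<psi> \<in> PrS S"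
    then have p: "\<phi> \<in> Pr" "\<psi> \<in> Pr" "dg \<phi> \<le> n" using assms by (auto simp: PrS_def)
    show "pr n (\<lambda>A. \<phi> \<in># A \<and> \<psi> \<in># A) \<le> (1 / real Q ^ dg \<phi>) * (1 / real Q ^ dg \<psi>) + (if \<psi> = \<phi> then 1 / real Q ^ dg \<phi> else 0)"
    proof (cases "\<psi> = \<phi>")
      case True then show ?thesis using pr_mem[OF p(1,3)] by simp
    next
      case False then show ?thesis using pr_mem2[OF p(1,2)] by simp
    qed
  qed
  also have "\<dots> = (mu S)\<^sup>2 + mu S"
    using finite_PrS[OF fin] by (simp add: mu_eq[OF fin] sum.distrib power2_eq_square sum_product)
  finally show ?thesis .
qed

text \<open>The covariances are at most 0 and the diagonal terms add up to \<open>mu S\<close>, so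
  the variance is at most the mean.\<close>

lemma chebyshev:
  assumes S: "S \<subseteq> {1..n}" and "t > 0"
  shows "pr n (\<lambda>A. \<bar>real (Nc S A) - mu S\<bar> \<ge> t) \<le> mu S / t\<^sup>2"
proof -
  have "pr n (\<lambda>A. \<bar>real (Nc S A) - mu S\<bar> \<ge> t) \<le> ex n (\<lambda>A. (real (Nc S A) - mu S)\<^sup>2) / t\<^sup>2"
  proof (rule pr_markov_ex)
    fix A assume "t \<le> \<bar>real (Nc S A) - mu S\<bar>"
    then show "t\<^sup>2 \<le> (real (Nc S A) - mu S)\<^sup>2" using assms(2) by (metis abs_le_square_iff abs_of_pos)
  qed (use assms in auto)
  also have "ex n (\<lambda>A. (real (Nc S A) - mu S)\<^sup>2) = ex n (\<lambda>A. (real (Nc S A))\<^sup>2 + ((- 2 * mu S) * real (Nc S A) + (mu S)\<^sup>2))"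
    by (intro ex_cong) (simp add: power2_eq_square algebra_simps)
  also have "\<dots> = ex n (\<lambda>A. (real (Nc S A))\<^sup>2) - (mu S)\<^sup>2"
    unfolding ex_add ex_cmult ex_const ex_Nc[OF S] by (simp add: power2_eq_square)
  also have "\<dots> \<le> mu S" using ex_Nc2[OF S] by simp
  finally show ?thesis by (simp add: divide_right_mono)
qed

lemma pr_few:
  assumes S: "S \<subseteq> {1..n}" and "mu S \<ge> 2"
  shows "pr n (\<lambda>A. Nc S A \<le> 1) \<le> 4 / mu S"
proof -
  \<comment> \<open>As \<open>mu S \<ge> 2\<close>, a count of at most 1 is at distance at least
    \<open>mu S / 2\<close> from the mean.\<close>
  have "pr n (\<lambda>A. Nc S A \<le> 1) \<le> pr n (\<lambda>A. \<bar>real (Nc S A) - mu S\<bar> \<ge> mu S / 2)"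
    using assms(2) by (intro pr_mono) linarith
  also have "\<dots> \<le> mu S / (mu S / 2)\<^sup>2" using assms by (intro chebyshev) auto
  also have "\<dots> = 4 / mu S" using assms(2) by (simp add: power2_eq_square)
  finally show ?thesis .
qed

lemma mu_le: "S \<subseteq> {1..} \<Longrightarrow> mu S \<le> (\<Sum>d\<in>S. 1 / d)"
  unfolding mu_def
proof (rule sum_mono)
  fix d assume "S \<subseteq> {1..}" "d \<in> S"
  then have d: "d \<ge> 1" by auto
  have "real (d * card (PrD d)) \<le> real (Q ^ d)" using card_PrD_le[OF d] by (simp only: of_nat_le_iff)
  then show "real (card (PrD d)) / real Q ^ d \<le> 1 / real d"
    using d Q_pos by (simp add: field_simps)
qed

lemma mu_ge: "S \<subseteq> {8..} \<Longrightarrow> mu S \<ge> (\<Sum>d\<in>S. 1 / d) / 2"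
  unfolding mu_def sum_divide_distrib
proof (rule sum_mono)
  fix d assume "S \<subseteq> {8..}" "d \<in> S"
  then have d: "d \<ge> 8" by auto
  show "1 / real d / 2 \<le> real (card (PrD d)) / real Q ^ d"
    using card_PrD_ge[OF d] d Q_pos by (simp add: field_simps)
qed

definition Hn :: "nat \<Rightarrow> real" where "Hn n = (\<Sum>d\<in>{1..n}. 1 / real d)"

lemma sum_inverse_squares: "y \<ge> 2 \<Longrightarrow> (\<Sum>j\<in>{y..n}. 1 / (real j)\<^sup>2) \<le> 1 / (real y - 1)"
proof -
  assume y: "y \<ge> 2"
  have "(\<Sum>j\<in>{y..<y + k}. 1 / (real j)\<^sup>2) \<le> 1 / (real y - 1) - 1 / (real (y + k) - 1)" for k
  proof (induction k)
    case (Suc k)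
    have "1 / (real (y + k))\<^sup>2 \<le> 1 / (real (y + k) - 1) - 1 / real (y + k)"
    proof -
      have p: "0 < real (y + k) - 1" "0 < real (y + k)" using y by auto
      then have "1 / (real (y + k) - 1) - 1 / real (y + k) = 1 / ((real (y + k) - 1) * real (y + k))"
        by (simp add: diff_frac_eq)
      moreover have "(real (y + k) - 1) * real (y + k) \<le> (real (y + k))\<^sup>2"
        by (simp add: power2_eq_square mult_right_mono)
      ultimately show ?thesis using p by (simp add: frac_le)
    qed
    then show ?case using Suc by simp
  qed simp
  from this[of "Suc n - y"] have "(\<Sum>j\<in>{y..<y + (Suc n - y)}. 1 / (real j)\<^sup>2) \<le> 1 / (real y - 1)"
    using y by (smt (verit) add_leD1 le_add_diff_inverse2 of_nat_1 of_nat_le_iff one_le_numeral order_trans zero_le_divide_1_iff le_add1)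
  moreover have "{y..n} \<subseteq> {y..<y + (Suc n - y)}" by auto
  then have "(\<Sum>j\<in>{y..n}. 1 / (real j)\<^sup>2) \<le> (\<Sum>j\<in>{y..<y + (Suc n - y)}. 1 / (real j)\<^sup>2)"
    by (intro sum_mono2) auto
  ultimately show ?thesis by linarith
qed

text \<open>First moment over pairs. For a fixed \<open>j\<close> both degrees are multiples of
  \<open>j\<close>, and the mean number of primes with such a degree is at most
  \<open>Hn n / j\<close>; the squares of these bounds are summable over
  \<open>j \<ge> y\<close>.\<close>

lemma pr_common_divisor:
  assumes y: "y \<ge> 2"
  shows "pr n (\<lambda>A. \<exists>\<phi>\<in>#A. \<exists>\<psi>\<in>#A. \<phi> \<noteq> \<psi> \<and> (\<exists>j\<ge>y. j dvd dg \<phi> \<and> j dvd dg \<psi>)) \<le> (Hn n)\<^sup>2 / (real y - 1)"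
proof -
  define S where "S = (\<lambda>j. {d \<in> {1..n}. j dvd d})"
  define I where "I = (\<lambda>j. {(\<phi>, \<psi>). \<phi> \<in> PrS (S j) \<and> \<psi> \<in> PrS (S j) \<and> \<phi> \<noteq> \<psi>})"
  have finS: "finite (S j)" for j by (simp add: S_def)
  have subI: "I j \<subseteq> PrS (S j) \<times> PrS (S j)" for j by (auto simp: I_def)
  have finI: "finite (I j)" for j using finite_subset[OF subI] finite_PrS[OF finS] by blast
  have "pr n (\<lambda>A. \<exists>\<phi>\<in>#A. \<exists>\<psi>\<in>#A. \<phi> \<noteq> \<psi> \<and> (\<exists>j\<ge>y. j dvd dg \<phi> \<and> j dvd dg \<psi>))
    \<le> pr n (\<lambda>A. \<exists>j\<in>{y..n}. \<exists>p\<in>I j. fst p \<in># A \<and> snd p \<in># A)"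
  proof (rule pr_mono)
    fix A assume A: "A \<in> Ms n"
    assume "\<exists>\<phi>\<in>#A. \<exists>\<psi>\<in>#A. \<phi> \<noteq> \<psi> \<and> (\<exists>j\<ge>y. j dvd dg \<phi> \<and> j dvd dg \<psi>)"
    then obtain \<phi> \<psi> j where p: "\<phi> \<in># A" "\<psi> \<in># A" "\<phi> \<noteq> \<psi>" "j \<ge> y" "j dvd dg \<phi>" "j dvd dg \<psi>" by blast
    have le: "dg \<theta> \<le> n \<and> 1 \<le> dg \<theta> \<and> \<theta> \<in> Pr" if "\<theta> \<in># A" for \<theta>
    proof -
      have "{#\<theta>#} \<subseteq># A" using that by simp
      from wt_mono[OF this] show ?thesis using A that dg_pos by (auto simp: wt_def Ms_iff)
    qed
    have "j \<le> n" using dvd_imp_le[OF p(5)] le[OF p(1)] by simp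
    then show "\<exists>j\<in>{y..n}. \<exists>p\<in>I j. fst p \<in># A \<and> snd p \<in># A"
      using p le by (intro bexI[of _ j] bexI[of _ "(\<phi>,\<psi>)"]) (auto simp: I_def PrS_def S_def)
  qed
  also have "\<dots> \<le> (\<Sum>j\<in>{y..n}. pr n (\<lambda>A. \<exists>p\<in>I j. fst p \<in># A \<and> snd p \<in># A))"
    by (intro pr_Bex) simp
  also have "\<dots> \<le> (\<Sum>j\<in>{y..n}. \<Sum>p\<in>I j. pr n (\<lambda>A. fst p \<in># A \<and> snd p \<in># A))"
    using finI by (intro sum_mono pr_Bex)
  also have "\<dots> \<le> (\<Sum>j\<in>{y..n}. \<Sum>p\<in>I j. (1 / real Q ^ dg (fst p)) * (1 / real Q ^ dg (snd p)))"
    by (intro sum_mono pr_mem2) (auto simp: I_def PrS_def)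
  also have "\<dots> \<le> (\<Sum>j\<in>{y..n}. \<Sum>p\<in>PrS (S j) \<times> PrS (S j). (1 / real Q ^ dg (fst p)) * (1 / real Q ^ dg (snd p)))"
    using subI finite_PrS[OF finS] by (intro sum_mono sum_mono2) auto
  also have "\<dots> = (\<Sum>j\<in>{y..n}. (mu (S j))\<^sup>2)"
    unfolding mu_eq[OF finS] power2_eq_square sum_product by (simp add: sum.cartesian_product case_prod_beta)
  also have "\<dots> \<le> (\<Sum>j\<in>{y..n}. (Hn n / j)\<^sup>2)"
  proof (intro sum_mono power_mono mu_nonneg)
    fix j assume j: "j \<in> {y..n}"
    have "mu (S j) \<le> (\<Sum>d\<in>S j. 1 / d)" by (intro mu_le) (auto simp: S_def)
    also have "\<dots> = (\<Sum>e\<in>{e. j * e \<in> S j}. 1 / (j * e))"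
      using j y by (intro sum.reindex_bij_witness[where i = "\<lambda>e. j * e" and j = "\<lambda>d. d div j"]) (auto simp: S_def)
    also have "\<dots> \<le> (\<Sum>e\<in>{1..n}. 1 / (j * e))"
    proof (rule sum_mono2)
      have "e \<le> n \<and> 1 \<le> e" if "1 \<le> j * e" "j * e \<le> n" for e
      proof -
        have "e \<noteq> 0" using that by (metis mult_0_right not_one_le_zero)
        moreover have "e \<le> j * e" using j y by simp
        ultimately show ?thesis using that by linarith
      qed
      then show "{e. j * e \<in> S j} \<subseteq> {1..n}" by (auto simp: S_def)
    qed auto
    also have "\<dots> = Hn n / j" by (simp add: Hn_def sum_divide_distrib mult.commute)
    finally show "mu (S j) \<le> Hn n / j" .
  qed
  also have "\<dots> = (Hn n)\<^sup>2 * (\<Sum>j\<in>{y..n}. 1 / (real j)\<^sup>2)"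
    by (simp add: sum_distrib_left power_divide)
  also have "\<dots> \<le> (Hn n)\<^sup>2 * (1 / (real y - 1))"
    using sum_inverse_squares[OF y] by (intro mult_left_mono) auto
  finally show ?thesis by simp
qed

section \<open>Repeated factors\<close>

definition rep :: "'p multiset \<Rightarrow> 'p multiset" where
  "rep A = filter_mset (\<lambda>\<phi>. count A \<phi> \<ge> 2) A"

text \<open>\<open>rep\<close> retains all copies of a repeated factor, so what is left has
  multiplicity one and is counted by \<open>Nc\<close>. Each copy inside \<open>rep A\<close> has
  degree at least 1 and is paid for by the weight.\<close>

lemma size_le_Nc:
  assumes "A \<in> Ms n"
  shows "size A \<le> Nc {1..n} A + wt (rep A)"
proof -
  have pos: "1 \<le> dg \<phi> \<and> dg \<phi> \<le> n" if "\<phi> \<in># A" for \<phi>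
  proof -
    have "{#\<phi>#} \<subseteq># A" using that by simp
    from wt_mono[OF this] show ?thesis using assms that dg_pos by (auto simp: wt_def Ms_iff)
  qed
  have le: "size B \<le> wt B" if "set_mset B \<subseteq> Pr" for B
    using that
  proof (induction B)
    case (add x B)
    then show ?case using dg_pos[of x] by (auto simp: wt_def)
  qed simp
  define R where "R = filter_mset (\<lambda>\<phi>. \<not> count A \<phi> \<ge> 2) A"
  have "A = rep A + R" unfolding rep_def R_def by (rule multiset_partition)
  then have "size A = size (rep A) + size R" by (metis size_union)
  moreover have "size (rep A) \<le> wt (rep A)"
    using assms by (intro le) (auto simp: rep_def Ms_iff)
  moreover have "size R \<le> Nc {1..n} A"
  proof -
    have "size R = (\<Sum>\<phi>\<in>set_mset R. count R \<phi>)" by (simp add: size_multiset_overloaded_eq)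
    also have "\<dots> \<le> (\<Sum>\<phi>\<in>set_mset R. 1)"
      by (intro sum_mono) (auto simp: R_def)
    also have "\<dots> \<le> card {\<phi> \<in> set_mset A. dg \<phi> \<in> {1..n}}"
      using pos by (simp, intro card_mono) (auto simp: R_def)
    finally show ?thesis by (simp add: Nc_def)
  qed
  ultimately show ?thesis by simp
qed

text \<open>Markov's inequality, with a mean weight of at most 4. A given prime of degree
  \<open>d\<close> occurs \<open>k\<close> times with probability at most
  \<open>1 / Q ^ (k * d)\<close>, there are at most \<open>Q ^ d / d\<close> such primes, and the
  double series over \<open>k \<ge> 2\<close> and \<open>d\<close> converges.\<close>

lemma pr_rep: 
  assumes w: "w > 0" shows "pr n (\<lambda>A. wt (rep A) \<ge> w) \<le> 4 / w"
proof -
  define F :: "'p multiset \<Rightarrow> real" where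
    "F = (\<lambda>A. \<Sum>k\<in>{2..n}. \<Sum>\<phi>\<in>PP n. 2 * real (dg \<phi>) * of_bool (replicate_mset k \<phi> \<subseteq># A))"
  have le: "wt (rep A) \<le> F A" if A: "A \<in> Ms n" for A
  proof -
    have "set_mset (rep A) \<subseteq> PP n"
    proof
      fix \<phi> assume "\<phi> \<in># rep A"
      then have \<phi>: "\<phi> \<in># A" by (auto simp: rep_def)
      then have "{#\<phi>#} \<subseteq># A" by simp
      from wt_mono[OF this] show "\<phi> \<in> PP n" using A \<phi> by (auto simp: wt_def Ms_iff PP_def)
    qed
    then have "real (wt (rep A)) = (\<Sum>\<phi>\<in>PP n. real (count (rep A) \<phi>) * real (dg \<phi>))"
      unfolding wt_def using sum_mset_eq_sum_count[OF finite_PP] by simp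
    also have "\<dots> \<le> (\<Sum>\<phi>\<in>PP n. \<Sum>k\<in>{2..n}. 2 * real (dg \<phi>) * of_bool (replicate_mset k \<phi> \<subseteq># A))"
    proof (rule sum_mono)
      fix \<phi> assume "\<phi> \<in> PP n"
      then have \<phi>: "1 \<le> dg \<phi>" using dg_pos by (auto simp: PP_def)
      define c where "c = count A \<phi>"
      have "replicate_mset c \<phi> \<subseteq># A" by (simp add: c_def flip: count_le_replicate_mset_subset_eq)
      from wt_mono[OF this] have "c * dg \<phi> \<le> n" using A by (simp add: wt_replicate Ms_iff)
      then have cn: "c \<le> n" using \<phi> by (metis le_trans mult.right_neutral mult_le_mono2)
      \<comment> \<open>A multiplicity \<open>c \<ge> 2\<close> is at most twice the number
        \<open>c - 1\<close> of exponents in \<open>{2..c}\<close>; for \<open>c < 2\<close> the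
        left side is 0.\<close>
      have "real (count (rep A) \<phi>) \<le> 2 * real (card {2..c})"
        by (auto simp: rep_def c_def)
      also have "real (card {2..c}) = (\<Sum>k\<in>{2..n}. of_bool (replicate_mset k \<phi> \<subseteq># A))"
      proof -
        have "{k \<in> {2..n}. replicate_mset k \<phi> \<subseteq># A} = {2..c}"
          using cn by (auto simp: c_def simp flip: count_le_replicate_mset_subset_eq)
        then show ?thesis by (simp add: Int_def sum.If_cases of_bool_def)
      qed
      finally have "real (count (rep A) \<phi>) * real (dg \<phi>) \<le> 2 * (\<Sum>k\<in>{2..n}. of_bool (replicate_mset k \<phi> \<subseteq># A)) * real (dg \<phi>)"
        by (rule mult_right_mono) simp
      then show "real (count (rep A) \<phi>) * real (dg \<phi>) \<le> (\<Sum>k\<in>{2..n}. 2 * real (dg \<phi>) * of_bool (replicate_mset k \<phi> \<subseteq># A))"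
        unfolding sum_distrib_left[symmetric] by (simp only: mult_ac)
    qed
    also have "\<dots> = F A" unfolding F_def by (rule sum.swap)
    finally show ?thesis .
  qed
  have "pr n (\<lambda>A. wt (rep A) \<ge> w) \<le> ex n F / w"
  proof (rule pr_markov_ex)
    fix A assume "A \<in> Ms n" "wt (rep A) \<ge> w"
    then show "real w \<le> F A" using le by (meson of_nat_le_iff order_trans)
  qed (use w in \<open>auto simp: F_def intro!: sum_nonneg\<close>)
  also have "ex n F = (\<Sum>k\<in>{2..n}. \<Sum>\<phi>\<in>PP n. 2 * real (dg \<phi>) * pr n (\<lambda>A. replicate_mset k \<phi> \<subseteq># A))"
    unfolding F_def ex_sum ex_cmult pr_ex ..
  also have "\<dots> \<le> (\<Sum>k\<in>{2..n}. \<Sum>\<phi>\<in>PP n. 2 * real (dg \<phi>) * (1 / real Q ^ (k * dg \<phi>)))"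
    by (intro sum_mono mult_left_mono pr_superset) (auto simp: Ms_iff wt_replicate PP_def)
  also have "\<dots> = (\<Sum>k\<in>{2..n}. \<Sum>d\<in>{1..n}. \<Sum>\<phi>\<in>PrD d. 2 * real (dg \<phi>) * (1 / real Q ^ (k * dg \<phi>)))"
  proof (rule sum.cong[OF refl])
    fix k
    have "PP n = (\<Union>d\<in>{1..n}. PrD d)" using dg_pos by (auto simp: PP_def PrD_def)
    then show "(\<Sum>\<phi>\<in>PP n. 2 * real (dg \<phi>) * (1 / real Q ^ (k * dg \<phi>))) = (\<Sum>d\<in>{1..n}. \<Sum>\<phi>\<in>PrD d. 2 * real (dg \<phi>) * (1 / real Q ^ (k * dg \<phi>)))"
      using finite_PrD by (simp only:) (subst sum.UNION_disjoint, auto simp: PrD_def)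
  qed
  also have "\<dots> = (\<Sum>k\<in>{2..n}. \<Sum>d\<in>{1..n}. 2 * (real d * card (PrD d)) / real Q ^ (k * d))"
    by (intro sum.cong refl) (simp add: PrD_def)
  also have "\<dots> \<le> (\<Sum>k\<in>{2..n}. \<Sum>d\<in>{1..n}. 2 * ((1/2) ^ (k - 2) * (1/2) ^ d))"
  proof (intro sum_mono)
    fix k d assume k: "k \<in> {2..n}" and d: "d \<in> {1..n}"
    have "real (d * card (PrD d)) \<le> real (Q ^ d)" using card_PrD_le[of d] d by (simp only: of_nat_le_iff) simp
    then have "2 * (real d * card (PrD d)) / real Q ^ (k * d) \<le> 2 * real Q ^ d / real Q ^ (k * d)"
      by (intro divide_right_mono) auto
    also have "\<dots> = 2 * (1 / real Q) ^ ((k - 1) * d)"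
    proof -
      have "k * d = d + (k - 1) * d" using k by (cases k) auto
      then show ?thesis using Q_pos by (simp add: power_add power_one_over)
    qed
    also have "\<dots> \<le> 2 * (1 / 2) ^ ((k - 1) * d)"
      using Q2 by (intro mult_left_mono power_mono) (auto simp: field_simps)
    \<comment> \<open>Decoupling the exponents turns the double sum into a product of two geometric
      series, bounded by 2 and 1.\<close>
    also have "\<dots> \<le> 2 * (1 / 2) ^ (k - 2 + d)"
    proof -
      obtain k' d' where kd: "k = k' + 2" "d = d' + 1" using k d by (metis add.commute atLeastAtMost_iff le_Suc_ex)
      then have "k - 2 + d \<le> (k - 1) * d" by simp
      then show ?thesis by (intro mult_left_mono power_decreasing) auto
    qed
    finally show "2 * (real d * card (PrD d)) / real Q ^ (k * d) \<le> 2 * ((1/2) ^ (k - 2) * (1/2) ^ d)"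
      by (simp add: power_add)
  qed
  also have "\<dots> = 2 * ((\<Sum>k\<in>{2..n}. (1/2) ^ (k - 2)) * (\<Sum>d\<in>{1..n}. (1/2) ^ d))"
    unfolding sum_product unfolding sum_distrib_left by simp
  also have "\<dots> \<le> 2 * (2 * 1)"
  proof -
    have g: "(\<Sum>i<N. (1/2::real) ^ i) = 2 - 2 * (1/2) ^ N" for N
      by (induction N) auto
    have "(\<Sum>k\<in>{2..n}. (1/2::real) ^ (k - 2)) = (\<Sum>i<n - 1. (1/2) ^ i)"
      by (rule sum.reindex_bij_witness[where i = "\<lambda>i. i + 2" and j = "\<lambda>k. k - 2"]) auto
    then have 1: "(\<Sum>k\<in>{2..n}. (1/2::real) ^ (k - 2)) \<le> 2" unfolding g by simp
    have "(\<Sum>d\<in>{1..n}. (1/2::real) ^ d) = (\<Sum>i<n. (1/2) * (1/2) ^ i)"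
      by (rule sum.reindex_bij_witness[where i = "\<lambda>i. i + 1" and j = "\<lambda>k. k - 1"]) (auto simp flip: power_Suc)
    then have 2: "(\<Sum>d\<in>{1..n}. (1/2::real) ^ d) \<le> 1" unfolding sum_distrib_left[symmetric] g by simp
    show ?thesis using 1 2 by (intro mult_left_mono mult_mono) (auto intro: sum_nonneg)
  qed
  finally show ?thesis by (simp add: divide_right_mono)
qed

end

section \<open>Reciprocals of primes\<close>

abbreviation primes_le :: "nat \<Rightarrow> nat set" where
  "primes_le N \<equiv> {p. Factorial_Ring.prime p \<and> p \<le> N}"

text \<open>Each prime carries the whole geometric series of \<open>ln p / p ^ k\<close> over
  \<open>k \<ge> 1\<close>. This is the quantity of Mertens' first theorem, with all powers of the
  primes up to \<open>N\<close> included.\<close>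

definition theta :: "nat \<Rightarrow> real" where
  "theta N = (\<Sum>p\<in>primes_le N. ln (real p) / (real p - 1))"

lemma card_multiples_le:
  fixes d N :: nat
  assumes "d \<ge> 1" shows "real (card {m \<in> {1..N}. d dvd m}) \<le> N / d"
proof -
  have sub: "{m \<in> {1..N}. d dvd m} \<subseteq> (\<lambda>k. d * k) ` {1..N div d}"
  proof
    fix m assume m: "m \<in> {m \<in> {1..N}. d dvd m}"
    then obtain k where k: "m = d * k" by blast
    then have "m div d = k" using assms by simp
    then have "k \<le> N div d" using m div_le_mono[of m N d] by simp
    moreover have "k \<noteq> 0" using m k by (intro notI) simp
    ultimately show "m \<in> (\<lambda>k. d * k) ` {1..N div d}" using k by auto
  qed
  have "card {m \<in> {1..N}. d dvd m} \<le> N div d"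
    using card_mono[OF _ sub] card_image_le[of "{1..N div d}" "\<lambda>k. d * k"] by simp
  then have "real (card {m \<in> {1..N}. d dvd m}) \<le> real (N div d)" by simp
  also have "\<dots> \<le> N / d"
  proof -
    have "real (N div d * d) \<le> real N" by (simp only: of_nat_le_iff) simp
    then show ?thesis using assms by (simp add: pos_le_divide_eq)
  qed
  finally show ?thesis .
qed

lemma multiplicity_eq_card:
  assumes p: "Factorial_Ring.prime (p::nat)" and m: "m \<in> {1..N}"
  shows "multiplicity p m = card {k \<in> {1..N}. p ^ k dvd m}"
proof -
  have nu: "m \<noteq> 0" "\<not> is_unit p" using p m by auto
  have iff: "p ^ k dvd m \<longleftrightarrow> k \<le> multiplicity p m" for k
    using nu by (rule power_dvd_iff_le_multiplicity)
  have "multiplicity p m < 2 ^ multiplicity p m" by (rule less_exp)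
  also have "\<dots> \<le> p ^ multiplicity p m" using prime_ge_2_nat[OF p] by (intro power_mono) auto
  also have "\<dots> \<le> m" using multiplicity_dvd[of p m] m by (intro dvd_imp_le) auto
  finally have "multiplicity p m \<le> N" using m by simp
  then have "{k \<in> {1..N}. p ^ k dvd m} = {1..multiplicity p m}" by (auto simp: iff)
  then show ?thesis by simp
qed

text \<open>The left side is the logarithm of N!. By Legendre's formula the exponent of
  \<open>p\<close> in N! is at most the sum of \<open>N / p ^ k\<close>, hence at most
  \<open>N / (p - 1)\<close>.\<close>

lemma sum_ln_le_theta: "(\<Sum>m\<in>{1..N}. ln (real m)) \<le> N * theta N"
proof -
  have fin: "finite (primes_le N)" by simp
  have ln_eq: "ln (real m) = (\<Sum>p\<in>primes_le N. multiplicity p m * ln (real p))" if m: "m \<in> {1..N}" for m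
  proof -
    have "m = (\<Prod>p\<in>prime_factors m. p ^ multiplicity p m)"
      using m by (simp add: prod_prime_factors)
    also have "\<dots> = (\<Prod>p\<in>primes_le N. p ^ multiplicity p m)"
    proof (rule prod.mono_neutral_left[OF fin])
      show "prime_factors m \<subseteq> primes_le N"
        using m by (auto simp: in_prime_factors_iff dest!: dvd_imp_le)
      show "\<forall>i\<in>primes_le N - prime_factors m. i ^ multiplicity i m = 1"
        using m by (auto simp: in_prime_factors_iff not_dvd_imp_multiplicity_0)
    qed
    finally have "real m = (\<Prod>p\<in>primes_le N. real p ^ multiplicity p m)"
      by (metis (no_types, lifting) of_nat_power of_nat_prod prod.cong)
    then have "ln (real m) = (\<Sum>p\<in>primes_le N. ln (real p ^ multiplicity p m))"
      using fin by (simp only:) (subst ln_prod, auto simp: prime_gt_0_nat)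
    also have "\<dots> = (\<Sum>p\<in>primes_le N. multiplicity p m * ln (real p))"
      by (intro sum.cong refl) (auto simp: ln_realpow prime_gt_0_nat)
    finally show ?thesis .
  qed
  have "(\<Sum>m\<in>{1..N}. ln (real m)) = (\<Sum>p\<in>primes_le N. (\<Sum>m\<in>{1..N}. real (multiplicity p m)) * ln (real p))"
    by (subst sum.cong[OF refl ln_eq]) (assumption, subst sum.swap, simp add: sum_distrib_right)
  also have "\<dots> \<le> (\<Sum>p\<in>primes_le N. N * (ln (real p) / (real p - 1)))"
  proof (rule sum_mono)
    fix p assume "p \<in> primes_le N"
    then have p: "Factorial_Ring.prime p" by simp
    have p2: "real p \<ge> 2" using prime_ge_2_nat[OF p] by simp
    have "(\<Sum>m\<in>{1..N}. real (multiplicity p m)) = (\<Sum>m\<in>{1..N}. \<Sum>k\<in>{1..N}. of_bool (p ^ k dvd m))"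
      by (intro sum.cong refl, subst multiplicity_eq_card[OF p], assumption)
        (simp add: Int_def sum.If_cases of_bool_def)
    also have "\<dots> = (\<Sum>k\<in>{1..N}. real (card {m \<in> {1..N}. p ^ k dvd m}))"
      by (subst sum.swap) (simp add: Int_def sum.If_cases of_bool_def)
    also have "\<dots> \<le> (\<Sum>k\<in>{1..N}. N / real p ^ k)"
    proof (rule sum_mono)
      fix k show "real (card {m \<in> {1..N}. p ^ k dvd m}) \<le> N / real p ^ k"
        using card_multiples_le[of "p ^ k" N] prime_gt_0_nat[OF p] by simp
    qed
    also have "\<dots> \<le> N / (real p - 1)"
    proof -
      have "(\<Sum>k\<in>{1..K}. 1 / real p ^ k) \<le> (1 - 1 / real p ^ K) / (real p - 1)" for K
      proof (induction K)
        case (Suc K)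
        have "1 / real p ^ Suc K = (1 / real p ^ K - 1 / real p ^ Suc K) / (real p - 1)"
          using p2 by (simp add: field_simps)
        moreover have "(1 - 1 / real p ^ Suc K) / (real p - 1) =
            (1 - 1 / real p ^ K) / (real p - 1) + (1 / real p ^ K - 1 / real p ^ Suc K) / (real p - 1)"
          unfolding add_divide_distrib[symmetric] by simp
        moreover have "(\<Sum>k\<in>{1..Suc K}. 1 / real p ^ k) = (\<Sum>k\<in>{1..K}. 1 / real p ^ k) + 1 / real p ^ Suc K"
          by simp
        ultimately show ?case using Suc by linarith
      qed simp
      from this[of N] have "(\<Sum>k\<in>{1..N}. 1 / real p ^ k) \<le> 1 / (real p - 1)"
        using p2 by (smt (verit) divide_right_mono zero_le_divide_1_iff zero_le_power)
      then have "N * (\<Sum>k\<in>{1..N}. 1 / real p ^ k) \<le> N * (1 / (real p - 1))" by (rule mult_left_mono) simp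
      then show ?thesis by (simp add: sum_distrib_left)
    qed
    finally have "(\<Sum>m\<in>{1..N}. real (multiplicity p m)) * ln (real p) \<le> N / (real p - 1) * ln (real p)"
      using p2 by (intro mult_right_mono) auto
    then show "(\<Sum>m\<in>{1..N}. real (multiplicity p m)) * ln (real p) \<le> N * (ln (real p) / (real p - 1))" by simp
  qed
  finally show ?thesis by (simp add: theta_def sum_distrib_left)
qed

text \<open>Comparison with the elementary Stirling bound ln N! >= N ln N - N.\<close>

lemma theta_ge: "N \<ge> 1 \<Longrightarrow> theta N \<ge> ln N - 1"
proof -
  assume N: "N \<ge> 1"
  have "(\<Sum>m\<in>{1..N}. ln (real m)) \<ge> N * ln N - N"
    using N
  proof (induction N rule: dec_induct)
    case (step n)
    have "1 + 1 / real n = real (Suc n) / real n" using step by (simp add: field_simps)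
    then have "ln (real (Suc n)) - ln n = ln (1 + 1 / n)" using step by (simp add: ln_div)
    also have "\<dots> \<le> 1 / n" using step by (intro ln_add_one_self_le_self) auto
    finally have "n * (ln (real (Suc n)) - ln n) \<le> real n * (1 / n)" by (rule mult_left_mono) simp
    then have "n * (ln (real (Suc n)) - ln n) \<le> 1" using step by simp
    then have "real (Suc n) * ln (real (Suc n)) - real (Suc n) \<le> real n * ln n - n + ln (real (Suc n))"
      by (simp add: algebra_simps)
    then show ?case using step by simp
  qed simp
  then have "N * ln N - N \<le> N * theta N" using sum_ln_le_theta[of N] by linarith
  then have "N * (ln N - 1) \<le> N * theta N" by (simp add: algebra_simps)
  then show ?thesis using N by simp
qed

lemma sum_inverse_le_ln: "n \<ge> 1 \<Longrightarrow> (\<Sum>d\<in>{1..n}. 1 / real d) \<le> ln n + 1"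
proof (induction n rule: dec_induct)
  case (step n)
  have "1 / real (Suc n) \<le> ln (real (Suc n)) - ln n"
  proof -
    have "ln (real n / real (Suc n)) \<le> real n / real (Suc n) - 1"
      using step by (intro ln_le_minus_one) auto
    then show ?thesis using step by (simp add: ln_div field_simps)
  qed
  then show ?case using step by simp
qed simp

lemma sum_inverse_ge_ln:
  assumes "m \<le> n" shows "(\<Sum>d\<in>{m<..n}. 1 / real d) \<ge> ln ((real n + 1) / (real m + 1))"
  using assms
proof (induction n rule: dec_induct)
  case (step n)
  have "ln ((real (Suc n) + 1) / (real m + 1)) = ln ((real n + 1) / (real m + 1)) + ln (1 + 1 / real (Suc n))"
  proof -
    have "1 + 1 / real (Suc n) = (real (Suc n) + 1) / real (Suc n)" by (simp add: field_simps)
    then show ?thesis by (simp add: ln_div)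
  qed
  also have "ln (1 + 1 / real (Suc n)) \<le> 1 / real (Suc n)" by (intro ln_add_one_self_le_self) auto
  also have "ln ((real n + 1) / (real m + 1)) \<le> (\<Sum>d\<in>{m<..n}. 1 / real d)" using step by simp
  also have "(\<Sum>d\<in>{m<..n}. 1 / real d) + 1 / real (Suc n) = (\<Sum>d\<in>{m<..Suc n}. 1 / real d)"
  proof -
    have "{m<..Suc n} = insert (Suc n) {m<..n}" using step by auto
    then show ?thesis by simp
  qed
  finally show ?case by simp
qed simp

lemma theta_le: "N \<ge> 1 \<Longrightarrow> theta N \<le> ln N * (ln N + 1)"
proof -
  assume N: "N \<ge> 1"
  have "theta N \<le> (\<Sum>p\<in>{2..N}. ln (real p) / (real p - 1))"
    unfolding theta_def by (intro sum_mono2) (auto simp: prime_ge_2_nat)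
  also have "\<dots> \<le> (\<Sum>p\<in>{2..N}. ln (real N) * (1 / real (p - 1)))"
    using N by (intro sum_mono) (auto intro!: divide_right_mono simp: of_nat_diff)
  also have "\<dots> = ln N * (\<Sum>d\<in>{1..N - 1}. 1 / real d)"
    unfolding sum_distrib_left
    by (rule sum.reindex_bij_witness[where i = "\<lambda>d. d + 1" and j = "\<lambda>p. p - 1"]) auto
  also have "(\<Sum>d\<in>{1..N - 1}. 1 / real d) \<le> (\<Sum>d\<in>{1..N}. 1 / real d)" by (intro sum_mono2) auto
  also have "\<dots> \<le> ln N + 1" by (rule sum_inverse_le_ln[OF N])
  finally show ?thesis using N by (simp add: mult_left_mono)
qed

definition prime_recip :: "real \<Rightarrow> real \<Rightarrow> real" where
  "prime_recip x z = (\<Sum>p | Factorial_Ring.prime p \<and> x < real p \<and> real p \<le> z. 1 / real p)"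

lemma finite_primes_between: "finite {p::nat. Factorial_Ring.prime p \<and> x < real p \<and> real p \<le> z}"
proof (rule finite_subset)
  show "{p::nat. Factorial_Ring.prime p \<and> x < real p \<and> real p \<le> z} \<subseteq> {..nat \<lfloor>z\<rfloor>}"
    by (auto simp: le_nat_floor)
qed simp

text \<open>As \<open>theta N\<close> is only located between \<open>ln N - 1\<close> and roughly
  the square of \<open>ln N\<close>, the logarithm of the window's end has to exceed
  \<open>u\<^sup>2\<close>. The factor 4 leaves a surplus of \<open>2 * u\<^sup>2\<close> in
  \<open>theta\<close>, and a prime in the window accounts for at most \<open>2 * v / p\<close> of
  it, where \<open>v = 4 * u\<^sup>2\<close>.\<close>

lemma prime_recip_scale:
  assumes u: "u \<ge> 2" shows "prime_recip (exp u) (exp (4 * u\<^sup>2)) \<ge> 1 / 4"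
proof -
  define v where "v = 4 * u\<^sup>2"
  have uv: "u \<le> v" "v \<ge> 2"
  proof -
    have "u * 1 \<le> u * (4 * u)" using u by (intro mult_left_mono) auto
    then show "u \<le> v" by (simp add: v_def power2_eq_square)
    then show "v \<ge> 2" using u by simp
  qed
  define M N where "M = nat \<lfloor>exp u\<rfloor>" and "N = nat \<lfloor>exp v\<rfloor>"
  have e1: "exp u \<ge> 1" "exp v \<ge> 1" "exp v \<ge> 2" using u uv exp_ge_add_one_self[of v] by (auto simp del: exp_ge_add_one_self)
  have MN: "M \<ge> 1" "N \<ge> 1" using e1 by (auto simp: M_def N_def le_nat_iff)
  have MN_le: "M \<le> N" using uv by (auto simp: M_def N_def intro!: nat_mono floor_mono)
  have rM: "real M \<le> exp u" using e1 by (simp add: M_def)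
  have "real N > exp v - 1" using e1 by (simp add: N_def)
  then have rN: "real N \<ge> exp v / 2" using e1 by linarith
  have rN2: "real N \<le> exp v" using e1 by (simp add: N_def)
  have "ln (real N) \<ge> ln (exp v / 2)" using rN MN by (intro ln_mono) auto
  then have lnN: "ln (real N) \<ge> v - 1" using ln_2_less_1 by (simp add: ln_div)
  have "ln (real M) \<le> ln (exp u)" using rM MN by (intro ln_mono) auto
  then have lnM: "ln (real M) \<le> u" by simp
  have lnM0: "ln (real M) \<ge> 0" using MN by simp
  have "theta M \<le> u * (u + 1)"
    using theta_le[OF MN(1)] lnM lnM0 by (smt (verit) mult_mono)
  moreover have "theta N \<ge> v - 2" using theta_ge[OF MN(2)] lnN by simp
  ultimately have "theta N - theta M \<ge> 3 * u\<^sup>2 - u - 2" by (simp add: v_def power2_eq_square algebra_simps)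
  moreover have "u\<^sup>2 - u - 2 \<ge> 0"
  proof -
    have "u\<^sup>2 - u - 2 = (u - 2) * (u + 1)" by (simp add: power2_eq_square algebra_simps)
    then show ?thesis using u by simp
  qed
  ultimately have low: "theta N - theta M \<ge> 2 * u\<^sup>2" by linarith
  define D where "D = {p::nat. Factorial_Ring.prime p \<and> exp u < real p \<and> real p \<le> exp v}"
  have finD: "finite D" unfolding D_def by (rule finite_primes_between)
  have "primes_le N = primes_le M \<union> D"
  proof -
    have "p \<le> N \<longleftrightarrow> real p \<le> exp v" "p \<le> M \<longleftrightarrow> real p \<le> exp u" for p
      by (auto simp: M_def N_def le_nat_floor le_nat_iff le_floor_iff)
    then show ?thesis using uv by (auto simp: D_def) (meson exp_le_cancel_iff order_trans)
  qed
  moreover have "primes_le M \<inter> D = {}" using rM by (auto simp: D_def)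
  ultimately have "theta N = theta M + (\<Sum>p\<in>D. ln (real p) / (real p - 1))"
    unfolding theta_def using finD by (simp add: sum.union_disjoint)
  also have "(\<Sum>p\<in>D. ln (real p) / (real p - 1)) \<le> (\<Sum>p\<in>D. v * (2 * (1 / real p)))"
  proof (rule sum_mono)
    fix p assume "p \<in> D"
    then have p: "real p \<ge> 2" "real p \<le> exp v" using prime_ge_2_nat by (auto simp: D_def)
    have "ln (real p) \<le> ln (exp v)" using p by (intro ln_mono) auto
    then have a: "ln (real p) \<le> v" by simp
    have "1 / (real p - 1) \<le> 2 * (1 / real p)" using p by (simp add: field_simps)
    then have "ln (real p) * (1 / (real p - 1)) \<le> v * (2 * (1 / real p))"
      using a p uv by (intro mult_mono) auto
    then show "ln (real p) / (real p - 1) \<le> v * (2 * (1 / real p))" by simp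
  qed
  also have "\<dots> = 2 * v * prime_recip (exp u) (exp v)"
    by (simp add: prime_recip_def D_def sum_distrib_left mult_ac)
  finally have "2 * u\<^sup>2 \<le> 2 * v * prime_recip (exp u) (exp v)" using low by linarith
  then have "2 * u\<^sup>2 * (1/4) \<le> 2 * u\<^sup>2 * prime_recip (exp u) (exp v)" by (simp add: v_def)
  then show ?thesis using u by (simp add: v_def mult_le_cancel_left)
qed

lemma prime_recip_mono:
  "x' \<le> x \<Longrightarrow> z \<le> z' \<Longrightarrow> prime_recip x z \<le> prime_recip x' z'"
  unfolding prime_recip_def using finite_primes_between by (intro sum_mono2) auto

lemma prime_recip_add:
  assumes "x \<le> z" "z \<le> w"
  shows "prime_recip x w = prime_recip x z + prime_recip z w"
proof -
  have "{p::nat. Factorial_Ring.prime p \<and> x < real p \<and> real p \<le> w}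
    = {p. Factorial_Ring.prime p \<and> x < real p \<and> real p \<le> z} \<union> {p. Factorial_Ring.prime p \<and> z < real p \<and> real p \<le> w}"
    using assms by auto
  then show ?thesis unfolding prime_recip_def
    using finite_primes_between by (simp only:) (subst sum.union_disjoint, auto)
qed

text \<open>The windows are consecutive: replacing \<open>u\<close> by \<open>4 * u\<^sup>2\<close>
  squares \<open>4 * u\<close>, and each window adds 1/4.\<close>

lemma prime_recip_iterate:
  assumes "u \<ge> 2" shows "prime_recip (exp u) (exp ((4 * u) ^ (2 ^ m) / 4)) \<ge> m / 4"
proof (induction m)
  case 0
  then show ?case by (simp add: prime_recip_def sum_nonneg)
next
  case (Suc m)
  define v where "v = (4 * u) ^ (2 ^ m) / 4"
  have "(4 * u) ^ 1 \<le> (4 * u) ^ (2 ^ m)" using assms by (intro power_increasing) auto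
  then have v: "u \<le> v" by (simp add: v_def)
  have w: "(4 * u) ^ (2 ^ Suc m) / 4 = 4 * v\<^sup>2"
  proof -
    have "(4 * u) ^ (2 ^ Suc m) = ((4 * u) ^ (2 ^ m))\<^sup>2"
      by (simp only: power_Suc mult.commute[of 2] power_mult)
    then show ?thesis by (simp add: v_def power_divide)
  qed
  have "v \<le> 4 * v\<^sup>2"
    using v assms mult_left_mono[of 1 "4 * v" v] by (simp add: power2_eq_square)
  then have "prime_recip (exp u) (exp (4 * v\<^sup>2)) = prime_recip (exp u) (exp v) + prime_recip (exp v) (exp (4 * v\<^sup>2))"
    using v by (intro prime_recip_add) auto
  moreover have "prime_recip (exp v) (exp (4 * v\<^sup>2)) \<ge> 1 / 4" using v assms by (intro prime_recip_scale) simp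
  ultimately have "m / 4 + 1 / 4 \<le> prime_recip (exp u) (exp (4 * v\<^sup>2))"
    using Suc unfolding v_def[symmetric] by linarith
  then show ?case unfolding w of_nat_Suc add_divide_distrib by (simp only: add.commute)
qed

text \<open>A fixed number \<open>m\<close> of windows starting at
  \<open>u = ln (ln n ^ 3 + 1)\<close> ends where the logarithm is a power of
  \<open>ln (ln n)\<close> up to constants, which is below \<open>ln (n / 2)\<close> for large
  \<open>n\<close>.\<close>

lemma prime_recip_at_top:
  "filterlim (\<lambda>n::nat. prime_recip (ln n ^ 3 + 1) (n / 2)) at_top sequentially"
  unfolding filterlim_at_top
proof
  fix Z :: real
  obtain m :: nat where m: "m / 4 \<ge> Z" using real_arch_simple[of "4 * Z"] by (auto simp: field_simps)
  define k :: nat where "k = 2 ^ m"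
  \<comment> \<open>The exponent \<open>e\<close> undoes the power \<open>k\<close>: from
    \<open>4 * u \<le> ln n powr e\<close> the last window ends at or below
    \<open>exp (ln n / 4)\<close>.\<close>
  define e :: real where "e = 1 / k"
  have k: "k > 0" and e: "e > 0" by (auto simp: k_def e_def)
  have "eventually (\<lambda>n::nat. 4 * ln (ln n ^ 3 + 1) \<le> ln n powr e) sequentially" using e by real_asymp
  moreover have "eventually (\<lambda>n::nat. ln n \<le> 4 * ln (n / 2)) sequentially" by real_asymp
  moreover have "eventually (\<lambda>n::nat. ln (ln n ^ 3 + 1) \<ge> 2) sequentially" by real_asymp
  moreover have "eventually (\<lambda>n::nat. n \<ge> 3) sequentially" by (rule eventually_ge_at_top)
  ultimately show "eventually (\<lambda>n::nat. Z \<le> prime_recip (ln n ^ 3 + 1) (n / 2)) sequentially"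
  proof eventually_elim
    case (elim n)
    define u where "u = ln (ln n ^ 3 + 1)"
    have ln: "ln (real n) > 0" using elim by simp
    have "(4 * u) ^ k \<le> (ln n powr e) ^ k" using elim by (intro power_mono) (auto simp: u_def)
    also have "\<dots> = ln n powr (e * k)" using ln by (simp add: powr_powr flip: powr_realpow)
    also have "\<dots> = ln n" using k ln by (simp add: e_def)
    finally have "(4 * u) ^ k / 4 \<le> ln (n / 2)" using elim by simp
    then have 1: "exp ((4 * u) ^ k / 4) \<le> n / 2" using elim by (metis exp_le_cancel_iff exp_ln divide_pos_pos of_nat_0_less_iff zero_less_numeral less_le_trans)
    have "ln n ^ 3 + 1 > 0" using ln by (simp add: add_pos_pos)
    then have 2: "exp u = ln n ^ 3 + 1" by (simp add: u_def)
    have "m / 4 \<le> prime_recip (exp u) (exp ((4 * u) ^ k / 4))"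
      unfolding k_def using elim by (intro prime_recip_iterate) (simp add: u_def)
    also have "\<dots> \<le> prime_recip (ln n ^ 3 + 1) (n / 2)" using 1 2 by (intro prime_recip_mono) auto
    finally show ?case using m by simp
  qed
qed

section \<open>The typical shape of a factorisation\<close>

text \<open>The scales. The repeated part has bounded mean and seldom exceeds \<open>par_w\<close>;
  \<open>par_y\<close> beats the square of the harmonic sum; the degrees from \<open>par_z\<close>
  to \<open>n\<close> still have a large reciprocal sum. \<open>par_T\<close> exceeds
  \<open>ln n\<close> by more than \<open>par_w\<close>, while its power of 2 stays below
  \<open>n powr (19/20)\<close>. \<open>par_K\<close> bounds the number of blocks that the orbit
  argument cannot exclude.\<close>

definition par_y :: "nat \<Rightarrow> nat" where "par_y n = nat \<lceil>ln n ^ 3\<rceil>"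
definition par_w :: "nat \<Rightarrow> nat" where "par_w n = nat \<lfloor>ln n / 10\<rfloor>"
definition par_l :: "nat \<Rightarrow> nat" where "par_l n = nat \<lceil>ln n\<rceil>"
definition par_K :: "nat \<Rightarrow> nat" where "par_K n = par_l n * par_y n"
definition par_T :: "nat \<Rightarrow> nat" where "par_T n = nat \<lfloor>1.3 * ln n\<rfloor>"
definition par_z :: "nat \<Rightarrow> nat" where "par_z n = n div par_l n"

context graded_primes
begin

definition few_repeated where "few_repeated n A \<longleftrightarrow> wt (rep A) \<le> par_w n"
definition no_common_divisor where "no_common_divisor n A \<longleftrightarrow> (\<forall>\<phi>\<in>#A. \<forall>\<psi>\<in>#A. \<forall>j\<ge>par_y n. \<phi> \<noteq> \<psi> \<longrightarrow> \<not> (j dvd dg \<phi> \<and> j dvd dg \<psi>))"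
definition has_prime_degree where "has_prime_degree n A \<longleftrightarrow> (\<exists>\<phi>\<in>#A. Factorial_Ring.prime (dg \<phi>) \<and> par_y n < dg \<phi> \<and> 2 * dg \<phi> \<le> n)"
definition two_long where "two_long n A \<longleftrightarrow> (\<exists>\<phi>\<in>#A. \<exists>\<psi>\<in>#A. \<phi> \<noteq> \<psi> \<and> par_z n < dg \<phi> \<and> par_z n < dg \<psi>)"
definition few_factors where "few_factors n A \<longleftrightarrow> size A \<le> par_T n"
text \<open>A system of \<open>r\<close> blocks on which a Frobenius element has an orbit of length \<open>j\<close> yields such a \<open>B\<close>,
  with \<open>e\<close> the number of roots in that orbit that belong to repeated factors.\<close>

definition no_multiple_block where "no_multiple_block n A \<longleftrightarrow> (\<forall>r j e B. 1 \<le> r \<and> r \<le> par_K n \<and> r dvd n \<and> 2 \<le> j \<and> j \<le> par_K n \<and> e \<le> par_w n \<and>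
   B \<subseteq># A \<and> wt B + e = j * (n div r) \<longrightarrow> \<not> (\<forall>\<phi>\<in>#B. j dvd dg \<phi>))"
text \<open>The case of a block mapped to itself, \<open>j = 1\<close>. No divisibility of degrees
  can be exploited, so the bare value of the total degree has to be excluded; \<open>r = 1\<close>
  would be the set of all roots.\<close>

definition no_invariant_block where "no_invariant_block n A \<longleftrightarrow> (\<forall>r e B. 2 \<le> r \<and> r \<le> par_K n \<and> r dvd n \<and> e \<le> par_w n \<and>
   B \<subseteq># A \<longrightarrow> wt B + e \<noteq> n div r)"

text \<open>\<open>few_factors\<close> is not listed here: it is an auxiliary event in the estimate
  for \<open>no_invariant_block\<close>.\<close>

definition typical :: "nat \<Rightarrow> 'p multiset \<Rightarrow> bool" where
  "typical n A \<longleftrightarrow> few_repeated n A \<and> no_common_divisor n A \<and> has_prime_degree n A \<and> two_long n A \<and> no_multiple_block n A \<and> no_invariant_block n A"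

lemma pr_not_few_repeated: "pr n (\<lambda>A. \<not> few_repeated n A) \<le> 4 / (par_w n + 1)"
  using pr_rep[of "par_w n + 1" n] by (simp add: few_repeated_def not_le Suc_le_eq)

lemma pr_not_no_common_divisor: "par_y n \<ge> 2 \<Longrightarrow> pr n (\<lambda>A. \<not> no_common_divisor n A) \<le> (Hn n)\<^sup>2 / (real (par_y n) - 1)"
  using pr_common_divisor[of "par_y n" n] by (rule order_trans[rotated]) (auto intro!: pr_mono simp: no_common_divisor_def)

lemma pr_not_has_prime_degree:
  assumes "S = {q. Factorial_Ring.prime q \<and> par_y n < q \<and> 2 * q \<le> n}" "mu S \<ge> 2"
  shows "pr n (\<lambda>A. \<not> has_prime_degree n A) \<le> 4 / mu S"
proof -
  have "S \<subseteq> {1..n}" using assms(1) by (auto simp: prime_gt_0_nat Suc_le_eq)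
  then have "pr n (\<lambda>A. Nc S A \<le> 1) \<le> 4 / mu S" using assms(2) by (intro pr_few)
  moreover have "pr n (\<lambda>A. \<not> has_prime_degree n A) \<le> pr n (\<lambda>A. Nc S A \<le> 1)"
  proof (rule pr_mono)
    fix A assume "\<not> has_prime_degree n A"
    then have "{\<phi> \<in> set_mset A. dg \<phi> \<in> S} = {}" using assms(1) by (auto simp: has_prime_degree_def)
    then show "Nc S A \<le> 1" unfolding Nc_def by (simp only: card.empty)
  qed
  ultimately show ?thesis by linarith
qed

lemma pr_not_two_long:
  assumes "S = {par_z n<..n}" "mu S \<ge> 2"
  shows "pr n (\<lambda>A. \<not> two_long n A) \<le> 4 / mu S"
proof -
  have "S \<subseteq> {1..n}" using assms(1) by auto
  then have "pr n (\<lambda>A. Nc S A \<le> 1) \<le> 4 / mu S" using assms(2) by (intro pr_few)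
  moreover have "pr n (\<lambda>A. \<not> two_long n A) \<le> pr n (\<lambda>A. Nc S A \<le> 1)"
  proof (rule pr_mono)
    fix A assume "\<not> two_long n A"
    show "Nc S A \<le> 1"
    proof (rule ccontr)
      assume "\<not> ?thesis"
      then have "card {\<phi> \<in> set_mset A. dg \<phi> \<in> S} \<ge> 2" by (simp add: Nc_def)
      then obtain \<phi> \<psi> where "\<phi> \<in># A" "\<psi> \<in># A" "\<phi> \<noteq> \<psi>" "dg \<phi> \<in> S" "dg \<psi> \<in> S"
        by (auto simp: card_le_Suc_iff numeral_2_eq_2)
      then show False using \<open>\<not> two_long n A\<close> assms(1) by (auto simp: two_long_def)
    qed
  qed
  ultimately show ?thesis by linarith
qed

text \<open>The number of factors is at most \<open>Nc {1..n} A\<close> plus the weight of the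
  repeated part. If the latter is small, too many factors push \<open>Nc\<close> above its mean,
  which is at most \<open>Hn n\<close>, by at least \<open>t\<close>.\<close>

lemma pr_not_few_factors:
  assumes "t = real (par_T n) + 1 - real (par_w n) - Hn n" "t > 0"
  shows "pr n (\<lambda>A. \<not> few_factors n A) \<le> 4 / (par_w n + 1) + Hn n / t\<^sup>2"
proof -
  have mu: "mu {1..n} \<le> Hn n" using mu_le[of "{1..n}"] by (auto simp: Hn_def)
  have "pr n (\<lambda>A. \<not> few_factors n A) \<le> pr n (\<lambda>A. \<not> few_repeated n A \<or> \<bar>real (Nc {1..n} A) - mu {1..n}\<bar> \<ge> t)"
  proof (rule pr_mono)
    fix A assume A: "A \<in> Ms n" "\<not> few_factors n A"
    show "\<not> few_repeated n A \<or> \<bar>real (Nc {1..n} A) - mu {1..n}\<bar> \<ge> t"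
    proof (cases "few_repeated n A")
      case True
      then have "size A \<le> Nc {1..n} A + par_w n" using size_le_Nc[OF A(1)] by (simp add: few_repeated_def)
      then have "real (par_T n) + 1 \<le> real (Nc {1..n} A) + real (par_w n)"
        using A(2) by (simp add: few_factors_def)
      then show ?thesis using assms(1) mu by linarith
    qed simp
  qed
  also have "\<dots> \<le> pr n (\<lambda>A. \<not> few_repeated n A) + pr n (\<lambda>A. \<bar>real (Nc {1..n} A) - mu {1..n}\<bar> \<ge> t)"
    by (rule pr_disj)
  also have "\<dots> \<le> 4 / (par_w n + 1) + mu {1..n} / t\<^sup>2"
    using assms by (intro add_mono pr_not_few_repeated chebyshev) auto
  also have "\<dots> \<le> 4 / (par_w n + 1) + Hn n / t\<^sup>2"
    using mu by (intro add_left_mono divide_right_mono) auto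
  finally show ?thesis .
qed

section \<open>Divisors whose degree fits a system of blocks\<close>

lemma div_ge:
  fixes n r K :: nat
  assumes "1 \<le> r" "r \<le> K" "r dvd n"
  shows "real (n div r) \<ge> real n / real K"
proof -
  have "real (n div r) = real n / real r" using assms(3) by (simp add: real_of_nat_div)
  also have "\<dots> \<ge> real n / real K" using assms by (intro divide_left_mono) auto
  finally show ?thesis .
qed

text \<open>Union bound over the triples \<open>(r, j, e)\<close>. Both \<open>wt B\<close> and
  \<open>j * (n div r)\<close> are multiples of \<open>j\<close>, so \<open>e\<close> must be one as
  well; what remains is a divisor of weight \<open>j * t\<close> with \<open>t \<ge> Y\<close>,
  which \<open>pr_divisor_dvd\<close> makes improbable.\<close>

lemma pr_not_no_multiple_block:
  assumes Y: "Y = n / par_K n - par_w n" "Y > 0"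
  shows "pr n (\<lambda>A. \<not> no_multiple_block n A) \<le> real (par_K n) ^ 2 * (par_w n + 1) / sqrt Y"
proof -
  define K w where "K = par_K n" and "w = par_w n"
  define I where "I = {(r,j,e). r \<in> {1..K} \<and> r dvd n \<and> j \<in> {2..K} \<and> e \<le> w}"
  have sub: "I \<subseteq> {1..K} \<times> {2..K} \<times> {..w}" by (auto simp: I_def)
  then have fin: "finite I" by (rule finite_subset) auto
  have "card I \<le> card ({1..K} \<times> {2..K} \<times> {..w})" using sub by (intro card_mono) auto
  also have "\<dots> \<le> K * (K * (w + 1))" unfolding card_cartesian_product by (intro mult_le_mono) auto
  finally have "real (card I) \<le> real (K * (K * (w + 1)))" by (simp only: of_nat_le_iff)
  then have cI: "real (card I) \<le> real K ^ 2 * (w + 1)"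
    by (simp add: power2_eq_square algebra_simps)
  have "pr n (\<lambda>A. \<not> no_multiple_block n A) \<le> pr n (\<lambda>A. \<exists>p\<in>I. case p of (r,j,e) \<Rightarrow>
      \<exists>B. B \<subseteq># A \<and> wt B + e = j * (n div r) \<and> (\<forall>\<phi>\<in>#B. j dvd dg \<phi>))"
  proof (rule pr_mono)
    fix A assume "\<not> no_multiple_block n A"
    then obtain r j e B where *: "1 \<le> r" "r \<le> K" "r dvd n" "2 \<le> j" "j \<le> K" "e \<le> w"
      "B \<subseteq># A" "wt B + e = j * (n div r)" "\<forall>\<phi>\<in>#B. j dvd dg \<phi>"
      unfolding no_multiple_block_def K_def w_def by blast
    then show "\<exists>p\<in>I. case p of (r,j,e) \<Rightarrow>
      \<exists>B. B \<subseteq># A \<and> wt B + e = j * (n div r) \<and> (\<forall>\<phi>\<in>#B. j dvd dg \<phi>)"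
      by (intro bexI[of _ "(r,j,e)"]) (auto simp: I_def)
  qed
  also have "\<dots> \<le> (\<Sum>p\<in>I. pr n (\<lambda>A. case p of (r,j,e) \<Rightarrow>
      \<exists>B. B \<subseteq># A \<and> wt B + e = j * (n div r) \<and> (\<forall>\<phi>\<in>#B. j dvd dg \<phi>)))"
    by (rule pr_Bex[OF fin])
  also have "\<dots> \<le> (\<Sum>p\<in>I. 1 / sqrt Y)"
  proof (rule sum_mono)
    fix p assume "p \<in> I"
    then obtain r j e where p: "p = (r,j,e)" "1 \<le> r" "r \<le> K" "r dvd n" "2 \<le> j" "j \<le> K" "e \<le> w"
      by (auto simp: I_def)
    have "real (n div r) - e \<ge> Y" using div_ge[OF p(2-4)] p(7) Y by (simp add: K_def w_def)
    then have le: "e < n div r" using Y(2) by linarith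
    have dv: "j dvd wt B" if "\<forall>\<phi>\<in>#B. j dvd dg \<phi>" for B
      using that by (induction B) (auto simp: wt_def)
    show "pr n (\<lambda>A. case p of (r,j,e) \<Rightarrow>
      \<exists>B. B \<subseteq># A \<and> wt B + e = j * (n div r) \<and> (\<forall>\<phi>\<in>#B. j dvd dg \<phi>)) \<le> 1 / sqrt Y"
    proof (cases "j dvd e")
      case False
      have "\<not> (\<exists>B. B \<subseteq># A \<and> wt B + e = j * (n div r) \<and> (\<forall>\<phi>\<in>#B. j dvd dg \<phi>))" for A
        using False dv by (metis dvd_add_right_iff dvd_triv_left)
      then have "pr n (\<lambda>A. case p of (r,j,e) \<Rightarrow>
        \<exists>B. B \<subseteq># A \<and> wt B + e = j * (n div r) \<and> (\<forall>\<phi>\<in>#B. j dvd dg \<phi>)) = 0"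
        unfolding p(1) by (simp only: prod.case pr_def) simp
      then show ?thesis using Y by simp
    next
      case True
      then obtain u where u: "e = j * u" by blast
      define t where "t = n div r - u"
      have "u \<le> e" using u p by simp
      then have t: "t \<ge> 1" "real t \<ge> Y" using le \<open>real (n div r) - e \<ge> Y\<close> by (auto simp: t_def)
      have eq: "j * (n div r) = j * t + e"
      proof -
        have "n div r = t + u" using le \<open>u \<le> e\<close> by (simp add: t_def)
        then show ?thesis using u by (simp add: distrib_left)
      qed
      have "pr n (\<lambda>A. case p of (r,j,e) \<Rightarrow>
        \<exists>B. B \<subseteq># A \<and> wt B + e = j * (n div r) \<and> (\<forall>\<phi>\<in>#B. j dvd dg \<phi>)) \<le> 1 / sqrt t"
        using pr_divisor_dvd[OF p(5) t(1), of n] unfolding p(1) prod.case eq by simp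
      also have "\<dots> \<le> 1 / sqrt Y" using t Y by (intro divide_left_mono) auto
      finally show ?thesis .
    qed
  qed
  also have "\<dots> = real (card I) / sqrt Y" by simp
  also have "\<dots> \<le> real K ^ 2 * (w + 1) / sqrt Y" using cI Y by (intro divide_right_mono) auto
  finally show ?thesis by (simp add: K_def w_def)
qed

text \<open>Union bound over the pairs \<open>(r, e)\<close> by \<open>pr_divisor_few\<close>. As
  \<open>r \<ge> 2\<close>, the degree \<open>m\<close> in question is at most \<open>n / 2\<close>,
  so that \<open>n - m\<close> is at least \<open>n / 2\<close>, while \<open>m\<close> is at least
  \<open>Y\<close>.\<close>

lemma pr_not_no_invariant_block:
  assumes Y: "Y = n / par_K n - par_w n" "Y > 0" and n: "n > 0"
  shows "pr n (\<lambda>A. few_factors n A \<and> \<not> no_invariant_block n A) \<le> real (par_K n) * (par_w n + 1) * (2 ^ par_T n / sqrt (Y * (n / 2)))"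
proof -
  define K w where "K = par_K n" and "w = par_w n"
  define I where "I = {(r,e). r \<in> {2..K} \<and> r dvd n \<and> e \<le> w}"
  have sub: "I \<subseteq> {2..K} \<times> {..w}" by (auto simp: I_def)
  then have fin: "finite I" by (rule finite_subset) auto
  have "card I \<le> card ({2..K} \<times> {..w})" using sub by (intro card_mono) auto
  also have "\<dots> \<le> K * (w + 1)" unfolding card_cartesian_product by (intro mult_le_mono) auto
  finally have cI: "real (card I) \<le> real K * (w + 1)"
    by (simp flip: of_nat_mult of_nat_Suc of_nat_add)
  let ?P = "\<lambda>p A. case p of (r,e) \<Rightarrow> size A \<le> par_T n \<and> (\<exists>B. B \<subseteq># A \<and> wt B = n div r - e)"
  have "pr n (\<lambda>A. few_factors n A \<and> \<not> no_invariant_block n A) \<le> pr n (\<lambda>A. \<exists>p\<in>I. ?P p A)"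
  proof (rule pr_mono)
    fix A assume "few_factors n A \<and> \<not> no_invariant_block n A"
    then obtain r e B where *: "2 \<le> r" "r \<le> K" "r dvd n" "e \<le> w"
      "B \<subseteq># A" "wt B + e = n div r" "size A \<le> par_T n"
      unfolding no_invariant_block_def few_factors_def K_def w_def by blast
    then have "wt B = n div r - e" by simp
    then show "\<exists>p\<in>I. ?P p A"
      using * by (intro bexI[of _ "(r,e)"]) (auto simp: I_def)
  qed
  also have "\<dots> \<le> (\<Sum>p\<in>I. pr n (?P p))"
    by (rule pr_Bex[OF fin])
  also have "\<dots> \<le> (\<Sum>p\<in>I. 2 ^ par_T n / sqrt (Y * (n / 2)))"
  proof (rule sum_mono)
    fix p assume "p \<in> I"
    then obtain r e where p: "p = (r,e)" "2 \<le> r" "r \<le> K" "r dvd n" "e \<le> w"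
      by (auto simp: I_def)
    define m where "m = n div r - e"
    have ge: "real (n div r) - e \<ge> Y" using div_ge[of r K n] p Y by (simp add: K_def w_def)
    then have le: "e < n div r" using Y(2) by linarith
    have m: "m \<ge> 1" "real m \<ge> Y" using le ge by (auto simp: m_def)
    have "n div r \<le> n div 2" using p by (intro div_le_mono2) auto
    then have mn: "2 * m \<le> n" by (simp add: m_def)
    then have mn': "m < n" "real (n - m) \<ge> n / 2" using m n by auto
    have "pr n (?P p) \<le> 2 ^ par_T n / sqrt (m * (n - m))"
      using pr_divisor_few[OF m(1) mn'(1), of "par_T n"] unfolding p(1) prod.case m_def by simp
    also have "\<dots> \<le> 2 ^ par_T n / sqrt (Y * (n / 2))"
    proof (intro divide_left_mono real_sqrt_le_mono)
      show "Y * (real n / 2) \<le> real (m * (n - m))"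
        unfolding of_nat_mult using m mn' Y by (intro mult_mono) auto
      have a: "real (m * (n - m)) > 0" using m mn'(1) by simp
      have b: "Y * (real n / 2) > 0" using Y n by simp
      show "0 < sqrt (real (m * (n - m))) * sqrt (Y * (real n / 2))"
        by (rule mult_pos_pos[OF real_sqrt_gt_zero[OF a] real_sqrt_gt_zero[OF b]])
    qed simp
    finally show "pr n (?P p) \<le> 2 ^ par_T n / sqrt (Y * (n / 2))" .
  qed
  also have "\<dots> = real (card I) * (2 ^ par_T n / sqrt (Y * (n / 2)))" by simp
  also have "\<dots> \<le> real K * (w + 1) * (2 ^ par_T n / sqrt (Y * (n / 2)))"
    using cI Y n by (intro mult_right_mono) (auto intro!: divide_nonneg_nonneg)
  finally show ?thesis by (simp add: K_def w_def)
qed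

lemma pr_not_typical_le:
  "pr n (\<lambda>A. \<not> typical n A) \<le> pr n (\<lambda>A. \<not> few_repeated n A) + pr n (\<lambda>A. \<not> no_common_divisor n A) + pr n (\<lambda>A. \<not> has_prime_degree n A)
    + pr n (\<lambda>A. \<not> two_long n A) + pr n (\<lambda>A. \<not> few_factors n A) + pr n (\<lambda>A. \<not> no_multiple_block n A) + pr n (\<lambda>A. few_factors n A \<and> \<not> no_invariant_block n A)"
proof -
  have "pr n (\<lambda>A. \<not> typical n A) \<le> pr n (\<lambda>A. (((((\<not> few_repeated n A \<or> \<not> no_common_divisor n A) \<or> \<not> has_prime_degree n A) \<or> \<not> two_long n A) \<or> \<not> few_factors n A) \<or> \<not> no_multiple_block n A) \<or> (few_factors n A \<and> \<not> no_invariant_block n A))"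
    by (intro pr_mono) (auto simp: typical_def)
  also have "\<dots> \<le> pr n (\<lambda>A. \<not> few_repeated n A) + pr n (\<lambda>A. \<not> no_common_divisor n A) + pr n (\<lambda>A. \<not> has_prime_degree n A)
    + pr n (\<lambda>A. \<not> two_long n A) + pr n (\<lambda>A. \<not> few_factors n A) + pr n (\<lambda>A. \<not> no_multiple_block n A) + pr n (\<lambda>A. few_factors n A \<and> \<not> no_invariant_block n A)"
    by (intro order_trans[OF pr_disj] add_mono order_refl)
  finally show ?thesis .
qed

end

lemma par_bounds:
  assumes n: "n \<ge> 3"
  shows "real (par_y n) \<ge> ln n ^ 3" "real (par_y n) \<le> ln n ^ 3 + 1"
    "real (par_w n) + 1 \<ge> ln n / 10" "real (par_w n) \<le> ln n / 10"
    "real (par_K n) \<le> (ln n + 1) * (ln n ^ 3 + 1)" "par_K n \<ge> 1"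
    "real (par_T n) + 1 \<ge> 1.3 * ln n" "(2::real) ^ par_T n \<le> n powr (19/20)"
    "real (par_z n) \<le> n / ln n" "real (par_z n) + 1 \<ge> n / (ln n + 1)"
    "par_l n \<ge> 1"
proof -
  have ln: "ln (real n) > 0" using n by simp
  show y: "real (par_y n) \<ge> ln n ^ 3" "real (par_y n) \<le> ln n ^ 3 + 1"
    using ln by (auto simp: par_y_def) (linarith+)?
  show "real (par_w n) + 1 \<ge> ln n / 10" "real (par_w n) \<le> ln n / 10"
    using ln by (auto simp: par_w_def) (linarith+)?
  have l: "real (par_l n) \<ge> ln n" "real (par_l n) \<le> ln n + 1"
    using ln by (auto simp: par_l_def) (linarith+)?
  then show "real (par_K n) \<le> (ln n + 1) * (ln n ^ 3 + 1)"
    unfolding par_K_def of_nat_mult using y ln by (intro mult_mono) auto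
  have "par_y n \<noteq> 0" using y(1) ln by (metis not_le of_nat_0 zero_less_power)
  moreover have l0: "par_l n \<noteq> 0" using l(1) ln by (metis not_le of_nat_0)
  ultimately show "par_K n \<ge> 1" "par_l n \<ge> 1" by (simp_all add: par_K_def)
  show "real (par_T n) + 1 \<ge> 1.3 * ln n" using ln by (auto simp: par_T_def) (linarith+)?
  have "real (par_T n) \<le> 1.3 * ln n" using ln unfolding par_T_def by (intro of_nat_floor) simp
  then have "(2::real) ^ par_T n \<le> 2 powr (1.3 * ln n)" by (simp flip: powr_realpow)
  also have "\<dots> = exp (1.3 * ln 2 * ln n)" by (simp add: powr_def mult_ac)
  \<comment> \<open>1.3 * 25/36 is about 0.903, hence below 19/20.\<close>
  also have "\<dots> \<le> exp (19/20 * ln n)"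
    using ln ln2_le_25_over_36 by (simp only: exp_le_cancel_iff) (intro mult_right_mono, auto)
  finally show "(2::real) ^ par_T n \<le> n powr (19/20)" using n by (simp add: powr_def)
  have "real (par_z n) * par_l n \<le> n"
    unfolding par_z_def by (metis div_times_less_eq_dividend of_nat_le_iff of_nat_mult)
  then have "real (par_z n) * ln n \<le> n" using l(1) by (meson mult_left_mono of_nat_0_le_iff order_trans)
  then show "real (par_z n) \<le> n / ln n" using ln by (simp add: pos_le_divide_eq)
  have "n < (par_z n + 1) * par_l n"
    unfolding par_z_def using l0 by (metis Suc_eq_plus1 dividend_less_div_times mult.commute mult_Suc gr0I)
  then have "real n \<le> (real (par_z n) + 1) * par_l n"
    by (metis less_imp_le of_nat_1 of_nat_add of_nat_le_iff of_nat_mult)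
  also have "\<dots> \<le> (real (par_z n) + 1) * (ln n + 1)" using l by (intro mult_left_mono) auto
  finally show "real (par_z n) + 1 \<ge> n / (ln n + 1)" using ln by (simp add: pos_divide_le_eq)
qed

text \<open>\<open>U\<close> collects the seven bounds in terms of real functions of
  \<open>n\<close>. \<open>Z\<close> rests on the divergence of the reciprocals of primes, and
  \<open>W\<close> grows only like \<open>ln (ln n)\<close>. In the last summand
  \<open>n powr (19/20)\<close> stands against a denominator of order \<open>n\<close> up to powers
  of \<open>ln n\<close>.\<close>

lemma (in graded_primes) typical_tendsto: "(\<lambda>n. pr n (\<lambda>A. \<not> typical n A)) \<longlonglongrightarrow> 0"
proof -
  define Kr :: "nat \<Rightarrow> real" where "Kr = (\<lambda>n. (ln n + 1) * (ln n ^ 3 + 1))"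
  define Yr :: "nat \<Rightarrow> real" where "Yr = (\<lambda>n. n / ((ln n + 1) * (ln n ^ 3 + 1)) - ln n / 10)"
  define Z :: "nat \<Rightarrow> real" where "Z = (\<lambda>n. prime_recip (ln n ^ 3 + 1) (n / 2))"
  define W :: "nat \<Rightarrow> real" where "W = (\<lambda>n. ln ((n + 1) / (n / ln n + 1)))"
  define U :: "nat \<Rightarrow> real" where
    "U = (\<lambda>n. 40 / ln n + (ln n + 1)\<^sup>2 / (ln n ^ 3 - 1) + 8 / Z n + 8 / W n
       + (40 / ln n + (ln n + 1) / (0.2 * ln n - 1)\<^sup>2) + Kr n ^ 2 * (ln n / 10 + 1) / sqrt (Yr n)
       + Kr n * (ln n / 10 + 1) * (n powr (19/20) / sqrt (Yr n * (n / 2))))"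
  have Z: "filterlim Z at_top sequentially" unfolding Z_def by (rule prime_recip_at_top)
  have W: "filterlim W at_top sequentially" unfolding W_def by real_asymp
  have "U \<longlonglongrightarrow> 0 + 0 + 0 + 0 + (0 + 0) + 0 + 0"
    unfolding U_def
  proof (intro tendsto_add)
    show "(\<lambda>n. 8 / Z n) \<longlonglongrightarrow> 0" by (rule tendsto_divide_0[OF tendsto_const filterlim_at_top_imp_at_infinity[OF Z]])
    show "(\<lambda>n. 8 / W n) \<longlonglongrightarrow> 0" by (rule tendsto_divide_0[OF tendsto_const filterlim_at_top_imp_at_infinity[OF W]])
    show "(\<lambda>n. Kr n ^ 2 * (ln n / 10 + 1) / sqrt (Yr n)) \<longlonglongrightarrow> 0" unfolding Kr_def Yr_def by real_asymp
    show "(\<lambda>n. Kr n * (ln n / 10 + 1) * (n powr (19/20) / sqrt (Yr n * (n / 2)))) \<longlonglongrightarrow> 0"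
      unfolding Kr_def Yr_def by real_asymp
  qed real_asymp+
  then have lim: "U \<longlonglongrightarrow> 0" by simp
  have "eventually (\<lambda>n. Z n \<ge> 4) sequentially" "eventually (\<lambda>n. W n \<ge> 4) sequentially"
    using Z W by (auto simp: filterlim_at_top)
  moreover have "eventually (\<lambda>n::nat. ln n ^ 3 \<ge> 8) sequentially" by real_asymp
  moreover have "eventually (\<lambda>n::nat. n / (ln n + 1) \<ge> 9) sequentially" by real_asymp
  moreover have "eventually (\<lambda>n::nat. 0.2 * ln n - 1 > 0) sequentially" by real_asymp
  moreover have "eventually (\<lambda>n. Yr n > 0) sequentially" unfolding Yr_def by real_asymp
  moreover have "eventually (\<lambda>n::nat. n \<ge> 3) sequentially" by (rule eventually_ge_at_top)
  ultimately have "eventually (\<lambda>n. pr n (\<lambda>A. \<not> typical n A) \<le> U n) sequentially"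
  proof eventually_elim
    case (elim n)
    note b = par_bounds[OF \<open>n \<ge> 3\<close>]
    have ln: "ln (real n) > 0" using elim by simp
    have H: "Hn n \<le> ln n + 1" unfolding Hn_def using elim by (intro sum_inverse_le_ln) simp
    have H0: "Hn n \<ge> 0" unfolding Hn_def by (intro sum_nonneg) auto
    have y: "par_y n \<ge> 8"
    proof -
      have "real (par_y n) \<ge> 8" using b(1) elim by linarith
      then show ?thesis by linarith
    qed
    have g0: "4 / (real (par_w n) + 1) \<le> 40 / ln n"
    proof -
      have "4 / (real (par_w n) + 1) \<le> 4 / (ln n / 10)" using b(3) ln by (intro divide_left_mono) auto
      then show ?thesis by simp
    qed
    have p0: "pr n (\<lambda>A. \<not> few_repeated n A) \<le> 40 / ln n" using pr_not_few_repeated[of n] g0 by (simp add: add.commute)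
    have p1: "pr n (\<lambda>A. \<not> no_common_divisor n A) \<le> (ln n + 1)\<^sup>2 / (ln n ^ 3 - 1)"
    proof -
      have "pr n (\<lambda>A. \<not> no_common_divisor n A) \<le> (Hn n)\<^sup>2 / (real (par_y n) - 1)" using y by (intro pr_not_no_common_divisor) simp
      also have "\<dots> \<le> (ln n + 1)\<^sup>2 / (ln n ^ 3 - 1)"
        using b(1) elim H H0 by (intro frac_le power_mono) auto
      finally show ?thesis .
    qed
    define S2 where "S2 = {q. Factorial_Ring.prime q \<and> par_y n < q \<and> 2 * q \<le> n}"
    define S3 where "S3 = {par_z n<..n}"
    have m2: "mu S2 \<ge> Z n / 2"
    proof -
      have "S2 \<subseteq> {..n}" by (auto simp: S2_def)
      then have fin: "finite S2" by (rule finite_subset) simp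
      have "{p::nat. Factorial_Ring.prime p \<and> ln n ^ 3 + 1 < real p \<and> real p \<le> n / 2} \<subseteq> S2"
        using b(2) by (auto simp: S2_def)
      then have "Z n \<le> (\<Sum>d\<in>S2. 1 / real d)"
        unfolding Z_def prime_recip_def using fin by (intro sum_mono2) auto
      moreover have "S2 \<subseteq> {8..}" using y by (auto simp: S2_def)
      ultimately show ?thesis using mu_ge[of S2] by linarith
    qed
    have m3: "mu S3 \<ge> W n / 2"
    proof -
      have "real (par_z n) \<ge> 8" using b(10) elim by linarith
      then have "S3 \<subseteq> {8..}" by (auto simp: S3_def)
      then have "mu S3 \<ge> (\<Sum>d\<in>S3. 1 / real d) / 2" by (rule mu_ge)
      moreover have "(\<Sum>d\<in>S3. 1 / real d) \<ge> ln ((real n + 1) / (real (par_z n) + 1))"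
        unfolding S3_def by (intro sum_inverse_ge_ln) (simp add: par_z_def)
      moreover have "ln ((real n + 1) / (real (par_z n) + 1)) \<ge> W n"
        unfolding W_def using b(9) ln by (intro ln_mono divide_left_mono) (auto simp: add_pos_nonneg)
      ultimately show ?thesis by linarith
    qed
    have p2: "pr n (\<lambda>A. \<not> has_prime_degree n A) \<le> 8 / Z n"
    proof -
      have "pr n (\<lambda>A. \<not> has_prime_degree n A) \<le> 4 / mu S2" using m2 elim by (intro pr_not_has_prime_degree) (auto simp: S2_def)
      also have "\<dots> \<le> 4 / (Z n / 2)" using m2 elim by (intro divide_left_mono) auto
      finally show ?thesis by simp
    qed
    have p3: "pr n (\<lambda>A. \<not> two_long n A) \<le> 8 / W n"
    proof -
      have "pr n (\<lambda>A. \<not> two_long n A) \<le> 4 / mu S3" using m3 elim by (intro pr_not_two_long) (auto simp: S3_def)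
      also have "\<dots> \<le> 4 / (W n / 2)" using m3 elim by (intro divide_left_mono) auto
      finally show ?thesis by simp
    qed
    have p4: "pr n (\<lambda>A. \<not> few_factors n A) \<le> 40 / ln n + (ln n + 1) / (0.2 * ln n - 1)\<^sup>2"
    proof -
      define t where "t = real (par_T n) + 1 - real (par_w n) - Hn n"
      \<comment> \<open>The coefficient is 1.3 - 0.1 - 1, from \<open>par_T\<close>,
        \<open>par_w\<close> and the harmonic sum.\<close>
      have t: "t \<ge> 0.2 * ln n - 1" using b(4,7) H by (simp add: t_def)
      then have "pr n (\<lambda>A. \<not> few_factors n A) \<le> 4 / (par_w n + 1) + Hn n / t\<^sup>2"
        using elim by (intro pr_not_few_factors) (auto simp: t_def)
      also have "Hn n / t\<^sup>2 \<le> (ln n + 1) / (0.2 * ln n - 1)\<^sup>2"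
        using t elim H H0 by (intro frac_le power_mono) auto
      finally show ?thesis using g0 by (simp add: add.commute)
    qed
    define Y where "Y = n / par_K n - par_w n"
    have Kr: "real (par_K n) \<le> Kr n" using b(5) by (simp add: Kr_def)
    have Y: "Y \<ge> Yr n"
    proof -
      have "n / par_K n \<ge> n / Kr n" using Kr b(6) by (intro divide_left_mono) auto
      then show ?thesis using b(4) by (simp add: Y_def Yr_def Kr_def)
    qed
    have Kr0: "Kr n \<ge> 0" using Kr by linarith
    have p5: "pr n (\<lambda>A. \<not> no_multiple_block n A) \<le> Kr n ^ 2 * (ln n / 10 + 1) / sqrt (Yr n)"
    proof -
      have "pr n (\<lambda>A. \<not> no_multiple_block n A) \<le> real (par_K n) ^ 2 * (par_w n + 1) / sqrt Y"
        using Y elim by (intro pr_not_no_multiple_block) (auto simp: Y_def)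
      also have "\<dots> \<le> Kr n ^ 2 * (ln n / 10 + 1) / sqrt (Yr n)"
        using Y elim Kr Kr0 b(4) ln by (intro frac_le mult_mono power_mono) auto
      finally show ?thesis .
    qed
    have p6: "pr n (\<lambda>A. few_factors n A \<and> \<not> no_invariant_block n A) \<le> Kr n * (ln n / 10 + 1) * (n powr (19/20) / sqrt (Yr n * (n / 2)))"
    proof -
      have "pr n (\<lambda>A. few_factors n A \<and> \<not> no_invariant_block n A) \<le> real (par_K n) * (par_w n + 1) * (2 ^ par_T n / sqrt (Y * (n / 2)))"
        using Y elim by (intro pr_not_no_invariant_block) (auto simp: Y_def)
      also have "\<dots> \<le> Kr n * (ln n / 10 + 1) * (n powr (19/20) / sqrt (Yr n * (n / 2)))"
        using Y elim Kr Kr0 b(4,8) ln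
        by (intro frac_le mult_mono real_sqrt_le_mono) (auto intro!: mult_nonneg_nonneg divide_nonneg_nonneg)
      finally show ?thesis .
    qed
    show ?case unfolding U_def using pr_not_typical_le[of n] p0 p1 p2 p3 p4 p5 p6 by linarith
  qed
  then show ?thesis using lim pr_nonneg
    by (intro tendsto_sandwich[OF _ _ tendsto_const lim]) auto
qed

section \<open>Unique factorisation of integer polynomials modulo a prime\<close>

abbreviation pdeg :: "'a::zero poly \<Rightarrow> nat" where "pdeg \<equiv> Polynomial.degree"
abbreviation pcf :: "'a::zero poly \<Rightarrow> nat \<Rightarrow> 'a" where "pcf \<equiv> Polynomial.coeff"

definition monic_p :: "'a::{zero,one} poly \<Rightarrow> bool" where "monic_p f \<longleftrightarrow> pcf f (pdeg f) = 1"

lemma monic_p_mult: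
  fixes f g :: "'a::idom poly"
  assumes "monic_p f" "monic_p g" shows "monic_p (f * g)" "pdeg (f * g) = pdeg f + pdeg g"
proof -
  have "f \<noteq> 0" "g \<noteq> 0" using assms by (auto simp: monic_p_def)
  then show "pdeg (f * g) = pdeg f + pdeg g" by (rule Polynomial.degree_mult_eq)
  then show "monic_p (f * g)" using assms by (simp add: monic_p_def coeff_mult_degree_sum)
qed

lemma monic_p_1: "monic_p (1 :: 'a::comm_semiring_1 poly)"
  by (simp add: monic_p_def)

lemma monic_p_deg0: "monic_p f \<Longrightarrow> pdeg f = 0 \<Longrightarrow> f = (1 :: 'a::comm_semiring_1 poly)"
  by (elim degree_eq_zeroE) (simp add: monic_p_def one_pCons)

text \<open>Pseudo-division by a monic polynomial is genuine division, as it multiplies the dividend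
  by a power of the leading coefficient 1.\<close>

lemma monic_division:
  fixes f h :: "'a::idom poly"
  assumes "monic_p h"
  obtains k r where "f = h * k + r" "r = 0 \<or> pdeg r < pdeg h"
proof -
  have h: "h \<noteq> 0" using assms by (auto simp: monic_p_def)
  obtain k r where kr: "pseudo_divmod f h = (k, r)" by force
  show ?thesis
    using pseudo_divmod[OF h kr] assms that by (simp add: monic_p_def)
qed

lemma monic_p_prod_mset:
  fixes A :: "'a::idom poly multiset"
  assumes "\<And>f. f \<in># A \<Longrightarrow> monic_p f"
  shows "monic_p (prod_mset A)" "pdeg (prod_mset A) = (\<Sum>f\<in>#A. pdeg f)"
proof -
  have "monic_p (prod_mset A) \<and> pdeg (prod_mset A) = (\<Sum>f\<in>#A. pdeg f)"
    using assms by (induction A) (auto simp: monic_p_1 monic_p_mult)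
  then show "monic_p (prod_mset A)" "pdeg (prod_mset A) = (\<Sum>f\<in>#A. pdeg f)" by auto
qed

locale prime_modulus =
  fixes p :: nat
  assumes prime_p: "Factorial_Ring.prime p"
begin

lemma p2: "p \<ge> 2" using prime_p prime_ge_2_nat by blast

section \<open>Integer polynomials up to congruence modulo p\<close>

definition cg :: "int poly \<Rightarrow> int poly \<Rightarrow> bool" where
  "cg f g \<longleftrightarrow> (\<forall>i. int p dvd pcf f i - pcf g i)"

definition red :: "int poly \<Rightarrow> int poly" where
  "red f = map_poly (\<lambda>c. c mod int p) f"

lemma cg_dvd: "cg f g \<longleftrightarrow> [:int p:] dvd f - g"
  by (simp add: cg_def const_poly_dvd_iff)

lemma cg_refl [simp]: "cg f f" by (simp add: cg_def)

lemma cg_sym: "cg f g \<Longrightarrow> cg g f"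
  unfolding cg_def by (subst dvd_minus_iff[symmetric]) simp

lemma cg_trans:
  assumes "cg f g" "cg g h" shows "cg f h"
proof -
  have "pcf f i - pcf h i = (pcf f i - pcf g i) + (pcf g i - pcf h i)" for i by simp
  then show ?thesis using assms unfolding cg_def by (metis dvd_add)
qed

lemma cg_add:
  assumes "cg f g" "cg f' g'" shows "cg (f + f') (g + g')"
proof -
  have "pcf (f + f') i - pcf (g + g') i = (pcf f i - pcf g i) + (pcf f' i - pcf g' i)" for i by simp
  then show ?thesis using assms unfolding cg_def by (metis dvd_add)
qed

lemma cg_diff:
  assumes "cg f g" "cg f' g'" shows "cg (f - f') (g - g')"
proof -
  have "pcf (f - f') i - pcf (g - g') i = (pcf f i - pcf g i) - (pcf f' i - pcf g' i)" for i by simp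
  then show ?thesis using assms unfolding cg_def by (metis dvd_diff)
qed

lemma cg_mult: "cg f g \<Longrightarrow> cg f' g' \<Longrightarrow> cg (f * f') (g * g')"
proof -
  assume a: "cg f g" "cg f' g'"
  have "f * f' - g * g' = (f - g) * f' + g * (f' - g')" by (simp add: algebra_simps)
  then show ?thesis using a unfolding cg_dvd by (metis dvd_add dvd_mult dvd_mult2)
qed

lemma coeff_red: "pcf (red f) i = pcf f i mod int p"
  by (simp add: red_def coeff_map_poly)

lemma cg_red: "cg (red f) f"
  by (simp add: cg_def coeff_red mod_eq_dvd_iff[symmetric])

lemma red_eq_iff: "red f = red g \<longleftrightarrow> cg f g"
  by (auto simp: poly_eq_iff coeff_red cg_def mod_eq_dvd_iff)

lemma red_0: "red f = 0 \<longleftrightarrow> cg f 0"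
  using red_eq_iff[of f 0] by (simp add: red_def)

lemma degree_red_le: "pdeg (red f) \<le> pdeg f"
  unfolding red_def by (rule degree_map_poly_le)

lemma red_monic:
  assumes "monic_p f" shows "monic_p (red f)" "pdeg (red f) = pdeg f"
proof -
  have "pcf (red f) (pdeg f) = 1" using assms p2 by (simp add: coeff_red monic_p_def)
  then show "pdeg (red f) = pdeg f"
    using degree_red_le[of f] le_degree[of "red f" "pdeg f"] by simp
  then show "monic_p (red f)" using \<open>pcf (red f) (pdeg f) = 1\<close> by (simp add: monic_p_def)
qed

definition canon :: "int poly \<Rightarrow> bool" where "canon f \<longleftrightarrow> monic_p f \<and> red f = f"

definition Mon :: "nat \<Rightarrow> int poly set" where "Mon n = {f. canon f \<and> pdeg f = n}"

text \<open>Irreducibility modulo \<open>p\<close>, tested on monic factors only, which is no loss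
  over a field. The elements are canonical representatives, so two irreducibles that are congruent
  are equal.\<close>

definition Irr :: "int poly set" where
  "Irr = {f. canon f \<and> pdeg f \<ge> 1 \<and> (\<forall>a b. monic_p a \<longrightarrow> monic_p b \<longrightarrow> cg (a * b) f \<longrightarrow> pdeg a = 0 \<or> pdeg b = 0)}"

definition dvdp :: "int poly \<Rightarrow> int poly \<Rightarrow> bool" where
  "dvdp f g \<longleftrightarrow> (\<exists>k. cg g (f * k))"

lemma IrrD: "\<phi> \<in> Irr \<Longrightarrow> monic_p a \<Longrightarrow> monic_p b \<Longrightarrow> cg (a * b) \<phi> \<Longrightarrow> pdeg a = 0 \<or> pdeg b = 0"
  by (simp add: Irr_def)

lemma red_red: "red (red f) = red f"
  by (simp add: red_eq_iff cg_red)

lemma canon_red: "monic_p f \<Longrightarrow> canon (red f)"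
  by (simp add: canon_def red_monic red_red)

lemma canon_eqI: "canon f \<Longrightarrow> canon g \<Longrightarrow> cg f g \<Longrightarrow> f = g"
  by (metis canon_def red_eq_iff)

lemma monic_cg_degree:
  assumes "monic_p f" "monic_p g" "cg f g" shows "pdeg f = pdeg g"
  using assms red_monic(2) red_eq_iff by metis

text \<open>Otherwise \<open>f\<close> times the reduced \<open>m\<close> has a leading coefficient
  that is nonzero modulo \<open>p\<close>, in a degree which \<open>r\<close> does not
  reach.\<close>

lemma monic_mult_small:
  assumes f: "monic_p f" and c: "cg r (f * m)" and r: "r = 0 \<or> pdeg r < pdeg f"
  shows "cg m 0"
proof (rule ccontr)
  assume "\<not> cg m 0"
  define m0 where "m0 = red m"
  have m0: "m0 \<noteq> 0" using \<open>\<not> cg m 0\<close> red_0 by (simp add: m0_def)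
  have f0: "f \<noteq> 0" using f by (auto simp: monic_p_def)
  have "cg r (f * m0)" using c cg_mult[OF cg_refl cg_sym[OF cg_red]] cg_trans m0_def by blast
  then have "int p dvd pcf r (pdeg f + pdeg m0) - pcf (f * m0) (pdeg f + pdeg m0)"
    by (simp add: cg_def)
  moreover have "pcf r (pdeg f + pdeg m0) = 0" using r by (auto intro: coeff_eq_0)
  moreover have "pcf (f * m0) (pdeg f + pdeg m0) = pcf m0 (pdeg m0)"
    using f by (simp add: coeff_mult_degree_sum monic_p_def)
  ultimately have "int p dvd pcf m0 (pdeg m0)" by simp
  moreover have "pcf m0 (pdeg m0) mod int p = pcf m0 (pdeg m0)" by (simp add: m0_def coeff_red)
  ultimately have "pcf m0 (pdeg m0) = 0" by simp
  then show False using m0 by simp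
qed

text \<open>The leading coefficient of the reduced polynomial is prime to \<open>p\<close>, hence
  invertible modulo \<open>p\<close>.\<close>

lemma make_monic:
  assumes "\<not> cg r 0"
  obtains c r' where "monic_p r'" "cg r' (Polynomial.smult c r)" "pdeg r' \<le> pdeg r"
proof -
  define r0 where "r0 = red r"
  have r0: "r0 \<noteq> 0" using assms red_0 by (simp add: r0_def)
  define l where "l = pcf r0 (pdeg r0)"
  have "l \<noteq> 0" using r0 by (simp add: l_def)
  moreover have "l mod int p = l" by (simp add: l_def r0_def coeff_red)
  ultimately have "\<not> int p dvd l" by (metis dvd_eq_mod_eq_0)
  then have "coprime l (int p)" using prime_p by (metis coprime_commute prime_imp_coprime prime_nat_int_transfer)
  then obtain c where c: "[l * c = 1] (mod int p)" using cong_solve_coprime_int by blast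
  define r' where "r' = red (Polynomial.smult c r0)"
  have top: "pcf r' (pdeg r0) = 1"
    using c p2 by (simp add: r'_def coeff_red l_def cong_def mult.commute)
  have "pdeg r' \<le> pdeg r0" unfolding r'_def using degree_red_le degree_smult_le order_trans by blast
  moreover from this top have "pdeg r' = pdeg r0" using le_degree[of r' "pdeg r0"] by simp
  ultimately have "monic_p r'" "pdeg r' \<le> pdeg r"
    using top degree_red_le[of r] by (simp_all add: monic_p_def r0_def)
  moreover have "cg r' (Polynomial.smult c r)"
  proof -
    have "cg ([:c:] * r0) ([:c:] * r)" unfolding r0_def by (intro cg_mult cg_refl cg_red)
    then have "cg (Polynomial.smult c r0) (Polynomial.smult c r)" by simp
    then show ?thesis unfolding r'_def using cg_trans[OF cg_red] by blast
  qed
  ultimately show ?thesis using that by blast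
qed

text \<open>A monic \<open>h\<close> of least degree in the ideal generated by \<open>\<phi>\<close>
  and \<open>a\<close> modulo \<open>p\<close> divides both of them. By irreducibility it is 1,
  which is the claim, or congruent to \<open>\<phi>\<close>, which would then divide
  \<open>a\<close>.\<close>

lemma bezout_irr:
  assumes \<phi>: "\<phi> \<in> Irr" and nd: "\<not> dvdp \<phi> a"
  shows "\<exists>u v. cg (u * \<phi> + v * a) 1"
proof -
  define Id where "Id = {x. \<exists>u v. cg x (u * \<phi> + v * a)}"
  define S where "S = {h. monic_p h \<and> h \<in> Id}"
  have IdI: "x - y * k \<in> Id" if x: "x \<in> Id" and y: "y \<in> Id" for x y k
  proof -
    obtain u v u' v' where "cg x (u * \<phi> + v * a)" "cg y (u' * \<phi> + v' * a)"
      using x y unfolding Id_def by blast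
    then have "cg (x - y * k) ((u * \<phi> + v * a) - (u' * \<phi> + v' * a) * k)" by (intro cg_diff cg_mult cg_refl)
    also have "(u * \<phi> + v * a) - (u' * \<phi> + v' * a) * k = (u - u' * k) * \<phi> + (v - v' * k) * a"
      by (simp add: algebra_simps)
    finally show ?thesis by (auto simp: Id_def)
  qed
  have Id_smult: "Polynomial.smult c x \<in> Id" if "x \<in> Id" for c x
  proof -
    have "0 \<in> Id" unfolding Id_def by (auto intro!: exI[of _ 0])
    from IdI[OF this that, of "[:- c:]"] show ?thesis by (simp add: mult.commute)
  qed
  have Id_cg: "y \<in> Id" if "x \<in> Id" "cg y x" for x y
    using that unfolding Id_def by (blast intro: cg_trans)
  have \<phi>m: "monic_p \<phi>" "canon \<phi>" using \<phi> by (auto simp: Irr_def canon_def)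
  have "cg \<phi> (1 * \<phi> + 0 * a)" "cg a (0 * \<phi> + 1 * a)" by simp_all
  then have gen: "\<phi> \<in> Id" "a \<in> Id" unfolding Id_def by blast+
  from gen(1) have "\<phi> \<in> S" using \<phi>m by (simp add: S_def)
  then obtain h where h: "h \<in> S" "\<And>g. g \<in> S \<Longrightarrow> pdeg h \<le> pdeg g"
    using ex_has_least_nat[of "\<lambda>g. g \<in> S" \<phi> pdeg] by blast
  have hm: "monic_p h" "h \<in> Id" using h(1) by (auto simp: S_def)
  have div: "\<exists>k r. x = h * k + r \<and> cg r 0 \<and> (r = 0 \<or> pdeg r < pdeg h)" if x: "x \<in> Id" for x
  proof -
    obtain k r where kr: "x = h * k + r" "r = 0 \<or> pdeg r < pdeg h" using monic_division[OF hm(1)] by blast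
    have "r = x - h * k" using kr by simp
    then have r: "r \<in> Id" using IdI[OF x hm(2)] by simp
    have "cg r 0"
    proof (rule ccontr)
      assume n: "\<not> cg r 0"
      then have "r \<noteq> 0" by auto
      obtain c r' where r': "monic_p r'" "cg r' (Polynomial.smult c r)" "pdeg r' \<le> pdeg r" using make_monic[OF n] by blast
      then have "r' \<in> S" using Id_cg Id_smult r by (auto simp: S_def)
      then show False using h(2)[of r'] r' kr(2) \<open>r \<noteq> 0\<close> by simp
    qed
    then show ?thesis using kr by blast
  qed
  obtain k r where k: "\<phi> = h * k + r" "cg r 0" "r = 0 \<or> pdeg r < pdeg h" using div[OF gen(1)] by blast
  have dh: "pdeg h \<le> pdeg \<phi>" using h(2) \<open>\<phi> \<in> S\<close> by blast
  have \<phi>hk: "cg (h * k) \<phi>"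
  proof -
    have "cg (h * k + 0) (h * k + r)" using k(2) by (intro cg_add cg_refl) (rule cg_sym)
    then show ?thesis using k(1) by simp
  qed
  \<comment> \<open>The definition of \<open>Irr\<close> speaks of monic factors, so the quotient
    has to be shown monic before irreducibility applies.\<close>
  have "monic_p k"
  proof -
    have hk: "h * k = \<phi> - r" using k(1) by simp
    have d1: "pdeg (h * k) = pdeg \<phi>" "pcf (h * k) (pdeg \<phi>) = 1"
    proof -
      have c1: "pcf (\<phi> - r) (pdeg \<phi>) = 1"
        using \<phi>m k(3) dh by (auto simp: monic_p_def intro: coeff_eq_0)
      then show "pcf (h * k) (pdeg \<phi>) = 1" by (simp add: hk)
      have "pdeg (\<phi> - r) \<le> pdeg \<phi>" using k(3) dh by (intro degree_diff_le) auto
      then show "pdeg (h * k) = pdeg \<phi>" using c1 le_degree[of "\<phi> - r" "pdeg \<phi>"] by (simp add: hk)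
    qed
    have "h \<noteq> 0" "k \<noteq> 0" using d1 by auto
    then have "pcf (h * k) (pdeg h + pdeg k) = 1" using d1 Polynomial.degree_mult_eq[of h k] by simp
    then show ?thesis using hm by (simp add: coeff_mult_degree_sum monic_p_def)
  qed
  then have "pdeg h = 0 \<or> pdeg k = 0" by (rule IrrD[OF \<phi> hm(1) _ \<phi>hk])
  then show ?thesis
  proof (rule disjE)
    assume "pdeg h = 0"
    then have "h = 1" using hm monic_p_deg0 by blast
    then show ?thesis using hm(2) cg_sym by (auto simp: Id_def)
  next
    assume "pdeg k = 0"
    then have "k = 1" using \<open>monic_p k\<close> monic_p_deg0 by blast
    then have "cg h \<phi>" using \<phi>hk by simp
    obtain k' r' where k': "a = h * k' + r'" "cg r' 0" using div[OF gen(2)] by blast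
    have "cg (h * k' + r') (\<phi> * k' + 0)" using k'(2) \<open>cg h \<phi>\<close> by (intro cg_add cg_mult cg_refl)
    then have "dvdp \<phi> a" using k'(1) by (auto simp: dvdp_def)
    then show ?thesis using nd by blast
  qed
qed

section \<open>Euclid's lemma and unique factorisation\<close>

lemma dvdp_cg: "dvdp f g \<Longrightarrow> cg g g' \<Longrightarrow> dvdp f g'"
  unfolding dvdp_def using cg_sym cg_trans by blast

lemma dvdp_mult: "dvdp f g \<Longrightarrow> dvdp f (h * g)" "dvdp f g \<Longrightarrow> dvdp f (g * h)"
proof -
  assume "dvdp f g"
  then obtain k where "cg g (f * k)" by (auto simp: dvdp_def)
  then have "cg (h * g) (h * (f * k))" by (intro cg_mult cg_refl)
  then show "dvdp f (h * g)" "dvdp f (g * h)" by (auto simp: dvdp_def ac_simps)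
qed

lemma dvdp_add: "dvdp f g \<Longrightarrow> dvdp f h \<Longrightarrow> dvdp f (g + h)"
  unfolding dvdp_def by (metis cg_add distrib_left)

lemma irr_prime:
  assumes "\<phi> \<in> Irr" "dvdp \<phi> (a * b)" shows "dvdp \<phi> a \<or> dvdp \<phi> b"
proof (rule disjCI)
  assume "\<not> dvdp \<phi> b"
  then obtain u v where "cg (u * \<phi> + v * b) 1" using bezout_irr assms(1) by blast
  then have c: "cg (a * (u * \<phi> + v * b)) (a * 1)" by (intro cg_mult cg_refl)
  have "dvdp \<phi> (a * u * \<phi>)" by (auto simp: dvdp_def intro!: exI[of _ "a * u"] simp: mult.commute)
  moreover have "dvdp \<phi> (v * (a * b))" using assms(2) by (rule dvdp_mult)
  ultimately have "dvdp \<phi> (a * u * \<phi> + v * (a * b))" by (rule dvdp_add)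
  then show "dvdp \<phi> a" using c dvdp_cg by (simp add: algebra_simps)
qed

lemma irr_prime_prod_mset:
  assumes "\<phi> \<in> Irr" "dvdp \<phi> (prod_mset B)" shows "\<exists>\<psi>\<in>#B. dvdp \<phi> \<psi>"
  using assms(2)
proof (induction B)
  case empty
  then obtain k where "cg 1 (\<phi> * k)" by (auto simp: dvdp_def)
  moreover have "monic_p \<phi>" "pdeg \<phi> \<ge> 1" using assms(1) by (auto simp: Irr_def canon_def)
  ultimately have k: "cg k 0" using monic_mult_small[of \<phi> 1 k] by simp
  have "cg (\<phi> * k) (\<phi> * 0)" using k by (intro cg_mult cg_refl)
  then have "cg 1 0" using \<open>cg 1 (\<phi> * k)\<close> cg_trans by simp
  then have "int p dvd 1" by (auto simp: cg_def dest: spec[of _ 0])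
  then show ?case using p2 by simp
next
  case (add x B)
  then show ?case using irr_prime[OF assms(1), of x "prod_mset B"] by auto
qed

text \<open>Division of \<open>\<psi>\<close> by the monic \<open>\<phi>\<close> has a monic
  quotient, whose degree irreducibility forces to be 0. Canonical representatives turn the remaining
  congruence into an equality.\<close>

lemma irr_dvdp_eq:
  assumes \<phi>: "\<phi> \<in> Irr" and \<psi>: "\<psi> \<in> Irr" and d: "dvdp \<phi> \<psi>" shows "\<phi> = \<psi>"
proof -
  have m: "monic_p \<phi>" "monic_p \<psi>" "canon \<phi>" "canon \<psi>" "pdeg \<phi> \<ge> 1" "pdeg \<psi> \<ge> 1"
    using \<phi> \<psi> by (auto simp: Irr_def canon_def)
  obtain m0 where m0: "cg \<psi> (\<phi> * m0)" using d by (auto simp: dvdp_def)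
  obtain k r where k: "\<psi> = \<phi> * k + r" "r = 0 \<or> pdeg r < pdeg \<phi>" using monic_division[OF m(1)] by blast
  have r0: "cg r 0"
  proof -
    have "cg (\<psi> - \<phi> * k) (\<phi> * m0 - \<phi> * k)" using m0 by (intro cg_diff cg_refl)
    then have c: "cg r (\<phi> * (m0 - k))" using k(1) by (simp add: algebra_simps)
    then have "cg (m0 - k) 0" using monic_mult_small[OF m(1) _ k(2)] by blast
    then have "cg (\<phi> * (m0 - k)) (\<phi> * 0)" by (intro cg_mult cg_refl)
    then show ?thesis using c cg_trans by simp
  qed
  have c: "cg (\<phi> * k) \<psi>"
  proof -
    have "cg (\<phi> * k + 0) (\<phi> * k + r)" using r0 by (intro cg_add cg_refl) (rule cg_sym)
    then show ?thesis using k(1) by simp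
  qed
  have dle: "pdeg \<phi> \<le> pdeg \<psi>"
  proof (rule ccontr)
    assume "\<not> ?thesis"
    then have "cg m0 0" using monic_mult_small[OF m(1) m0] by simp
    then have "cg (\<phi> * m0) (\<phi> * 0)" by (intro cg_mult cg_refl)
    then have "red \<psi> = 0" using m0 cg_trans red_0 by simp
    then have "\<psi> = 0" using m(4) by (simp add: canon_def)
    then show False using m(2) by (simp add: monic_p_def)
  qed
  have "monic_p k"
  proof -
    have hk: "\<phi> * k = \<psi> - r" using k(1) by simp
    have c1: "pcf (\<psi> - r) (pdeg \<psi>) = 1"
      using m k(2) dle by (auto simp: monic_p_def intro: coeff_eq_0)
    have "pdeg (\<psi> - r) \<le> pdeg \<psi>" using k(2) dle by (intro degree_diff_le) auto
    then have d1: "pdeg (\<phi> * k) = pdeg \<psi>" "pcf (\<phi> * k) (pdeg \<psi>) = 1"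
      using c1 le_degree[of "\<psi> - r" "pdeg \<psi>"] by (simp_all add: hk)
    have "\<phi> \<noteq> 0" "k \<noteq> 0" using d1 by auto
    then have "pcf (\<phi> * k) (pdeg \<phi> + pdeg k) = 1" using d1 Polynomial.degree_mult_eq[of \<phi> k] by simp
    then show ?thesis using m by (simp add: coeff_mult_degree_sum monic_p_def)
  qed
  then have "pdeg k = 0" using IrrD[OF \<psi> m(1) _ c] m(5) by simp
  then have "k = 1" using \<open>monic_p k\<close> monic_p_deg0 by blast
  then show ?thesis using c canon_eqI m by simp
qed

lemma irr_coprime:
  assumes "\<phi> \<in> Irr" "\<psi> \<in> Irr" "\<phi> \<noteq> \<psi>" shows "\<exists>u v. cg (u * \<phi> + v * \<psi>) 1"
  using bezout_irr irr_dvdp_eq assms by blast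

lemma irr_monic: "\<phi> \<in> Irr \<Longrightarrow> monic_p \<phi>" by (simp add: Irr_def canon_def)

lemma factorization_exists: "monic_p f \<Longrightarrow> \<exists>A. set_mset A \<subseteq> Irr \<and> cg (prod_mset A) f"
proof (induction "pdeg f" arbitrary: f rule: less_induct)
  case less
  show ?case
  proof (cases "pdeg f = 0")
    case True
    then have "f = 1" using less.prems monic_p_deg0 by blast
    then show ?thesis by (intro exI[of _ "{#}"]) simp
  next
    case False
    show ?thesis
    proof (cases "red f \<in> Irr")
      case True
      then show ?thesis using cg_red by (intro exI[of _ "{#red f#}"]) simp
    next
      case nirr: False
      then obtain a b where ab: "monic_p a" "monic_p b" "cg (a * b) (red f)" "pdeg a \<noteq> 0" "pdeg b \<noteq> 0"
        using False canon_red[OF less.prems] red_monic(2)[OF less.prems] by (auto simp: Irr_def)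
      have c: "cg (a * b) f" using ab(3) cg_red cg_trans by blast
      have "pdeg (a * b) = pdeg f" using monic_cg_degree[OF _ less.prems c] monic_p_mult[OF ab(1,2)] by blast
      then have "pdeg a < pdeg f" "pdeg b < pdeg f" using monic_p_mult(2)[OF ab(1,2)] ab(4,5) by auto
      then obtain A B where "set_mset A \<subseteq> Irr" "cg (prod_mset A) a" "set_mset B \<subseteq> Irr" "cg (prod_mset B) b"
        using less.hyps ab(1,2) by metis
      then have "set_mset (A + B) \<subseteq> Irr" "cg (prod_mset (A + B)) f"
        using c cg_mult cg_trans by (auto simp: prod_mset_Un) blast
      then show ?thesis by blast
    qed
  qed
qed

lemma cg_cancel:
  assumes "monic_p f" "cg (f * a) (f * b)" shows "cg a b"
proof -
  have "cg (f * a - f * a) (f * a - f * b)" using assms(2) by (intro cg_diff cg_refl)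
  then have "cg 0 (f * (a - b))" by (simp add: algebra_simps)
  then have "cg (a - b) 0" using monic_mult_small[OF assms(1)] by blast
  then show ?thesis by (simp add: cg_def)
qed

lemma factorization_unique:
  assumes "set_mset A \<subseteq> Irr" "set_mset B \<subseteq> Irr" "cg (prod_mset A) (prod_mset B)"
  shows "A = B"
  using assms
proof (induction A arbitrary: B)
  case empty
  have m: "monic_p (prod_mset B)" "pdeg (prod_mset B) = (\<Sum>f\<in>#B. pdeg f)"
    using empty irr_monic monic_p_prod_mset[of B] by auto
  have "pdeg (prod_mset B) = 0" using monic_cg_degree[OF _ m(1), of 1] empty monic_p_1 by simp
  show ?case
  proof (rule ccontr)
    assume "{#} \<noteq> B"
    then obtain \<psi> where "\<psi> \<in># B" by (metis multiset_nonemptyE)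
    then have "pdeg \<psi> \<ge> 1" "pdeg \<psi> = 0" using empty \<open>pdeg (prod_mset B) = 0\<close> m(2) by (auto simp: Irr_def)
    then show False by simp
  qed
next
  case (add \<phi> A)
  have \<phi>: "\<phi> \<in> Irr" using add by simp
  have "dvdp \<phi> (prod_mset B)"
    using add.prems(3) cg_sym unfolding dvdp_def by (intro exI[of _ "prod_mset A"]) simp
  then obtain \<psi> where "\<psi> \<in># B" "dvdp \<phi> \<psi>" using irr_prime_prod_mset[OF \<phi>] by blast
  then have "\<phi> \<in># B" using irr_dvdp_eq \<phi> add.prems(2) by blast
  then obtain B' where B': "B = add_mset \<phi> B'" by (metis mset_add)
  then have "cg (prod_mset A) (prod_mset B')"
    using add.prems(3) cg_cancel[OF irr_monic[OF \<phi>]] by simp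
  then show ?case using add B' by simp
qed

definition fac :: "int poly \<Rightarrow> int poly multiset" where
  "fac f = (THE A. set_mset A \<subseteq> Irr \<and> cg (prod_mset A) f)"

lemma fac:
  assumes "monic_p f" shows "set_mset (fac f) \<subseteq> Irr" "cg (prod_mset (fac f)) f"
proof -
  have "\<exists>!A. set_mset A \<subseteq> Irr \<and> cg (prod_mset A) f"
    using factorization_exists[OF assms] factorization_unique cg_sym cg_trans by blast
  then have "set_mset (fac f) \<subseteq> Irr \<and> cg (prod_mset (fac f)) f" unfolding fac_def by (rule theI')
  then show "set_mset (fac f) \<subseteq> Irr" "cg (prod_mset (fac f)) f" by auto
qed

lemma fac_eqI:
  assumes "set_mset A \<subseteq> Irr" "cg (prod_mset A) f" shows "fac f = A"
  unfolding fac_def using assms factorization_unique cg_sym cg_trans by (intro the_equality) blast+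

lemma fac_cong: "cg f g \<Longrightarrow> fac f = fac g"
  unfolding fac_def by (metis cg_sym cg_trans)

lemma fac_mult:
  assumes "monic_p f" "monic_p g" shows "fac (f * g) = fac f + fac g"
  using fac[OF assms(1)] fac[OF assms(2)] by (intro fac_eqI) (auto simp: prod_mset_Un intro: cg_mult)

lemma fac_1: "fac 1 = {#}" by (rule fac_eqI) auto

lemma fac_degree: "monic_p f \<Longrightarrow> (\<Sum>\<phi>\<in>#fac f. pdeg \<phi>) = pdeg f"
proof -
  assume f: "monic_p f"
  have m: "monic_p (prod_mset (fac f))" "pdeg (prod_mset (fac f)) = (\<Sum>\<phi>\<in>#fac f. pdeg \<phi>)"
    using monic_p_prod_mset[of "fac f"] fac(1)[OF f] irr_monic by auto
  then show ?thesis using monic_cg_degree[OF m(1) f fac(2)[OF f]] by simp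
qed

lemma mem_fac_dvdp: "monic_p f \<Longrightarrow> \<phi> \<in># fac f \<Longrightarrow> dvdp \<phi> f"
proof -
  assume f: "monic_p f" "\<phi> \<in># fac f"
  then obtain B where "fac f = add_mset \<phi> B" by (metis mset_add)
  then have "cg (\<phi> * prod_mset B) f" using fac(2)[OF f(1)] by simp
  then show ?thesis using cg_sym by (auto simp: dvdp_def)
qed

text \<open>Unique factorisation as a bijection: together with \<open>card_Mon\<close> it supplies
  the cardinality \<open>p ^ n\<close> on which the counting in the graded monoid is based.\<close>

lemma bij_fac: "bij_betw (\<lambda>A. red (prod_mset A)) {A. set_mset A \<subseteq> Irr \<and> (\<Sum>\<phi>\<in>#A. pdeg \<phi>) = n} (Mon n)"
proof (rule bij_betw_byWitness[where f' = fac])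
  show "\<forall>A\<in>{A. set_mset A \<subseteq> Irr \<and> (\<Sum>\<phi>\<in>#A. pdeg \<phi>) = n}. fac (red (prod_mset A)) = A"
    using cg_red cg_sym by (auto intro!: fac_eqI)
  show "\<forall>f\<in>Mon n. red (prod_mset (fac f)) = f"
    using fac(2) by (auto simp: Mon_def canon_def) (metis red_eq_iff)
  show "(\<lambda>A. red (prod_mset A)) ` {A. set_mset A \<subseteq> Irr \<and> (\<Sum>\<phi>\<in>#A. pdeg \<phi>) = n} \<subseteq> Mon n"
    using monic_p_prod_mset irr_monic by (auto simp: Mon_def intro!: canon_red) (metis red_monic(2) subsetD)
  show "fac ` Mon n \<subseteq> {A. set_mset A \<subseteq> Irr \<and> (\<Sum>\<phi>\<in>#A. pdeg \<phi>) = n}"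
    using fac(1) fac_degree by (auto simp: Mon_def canon_def)
qed

definition of_coeffs :: "nat \<Rightarrow> (nat \<Rightarrow> int) \<Rightarrow> int poly" where
  "of_coeffs n a = Polynomial.monom 1 n + (\<Sum>i<n. Polynomial.monom (a i) i)"

lemma coeff_of_coeffs: "pcf (of_coeffs n a) i = (if i < n then a i else if i = n then 1 else 0)"
proof -
  have "(\<Sum>j<n. if j = i then a j else 0) = (if i < n then a i else 0)"
    by (simp add: sum.delta)
  then show ?thesis by (auto simp: of_coeffs_def coeff_sum)
qed

lemma of_coeffs_monic: "monic_p (of_coeffs n a)" "pdeg (of_coeffs n a) = n"
proof -
  show "pdeg (of_coeffs n a) = n"
    by (intro antisym degree_le le_degree) (auto simp: coeff_of_coeffs)
  then show "monic_p (of_coeffs n a)" by (simp add: monic_p_def coeff_of_coeffs)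
qed

lemma bij_of_coeffs: "bij_betw (of_coeffs n) ({..<n} \<rightarrow>\<^sub>E {0..<int p}) (Mon n)"
proof (rule bij_betw_byWitness[where f' = "\<lambda>f. restrict (pcf f) {..<n}"])
  show "\<forall>a\<in>{..<n} \<rightarrow>\<^sub>E {0..<int p}. restrict (pcf (of_coeffs n a)) {..<n} = a"
    by (auto simp: coeff_of_coeffs fun_eq_iff PiE_def extensional_def restrict_def)
  show "\<forall>f\<in>Mon n. of_coeffs n (restrict (pcf f) {..<n}) = f"
    by (auto simp: Mon_def canon_def monic_p_def poly_eq_iff coeff_of_coeffs coeff_eq_0)
  have "red (of_coeffs n a) = of_coeffs n a" if "a \<in> {..<n} \<rightarrow>\<^sub>E {0..<int p}" for a
    using that p2 by (auto simp: poly_eq_iff coeff_red coeff_of_coeffs PiE_iff)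
  then show "of_coeffs n ` ({..<n} \<rightarrow>\<^sub>E {0..<int p}) \<subseteq> Mon n"
    by (auto simp: Mon_def canon_def of_coeffs_monic)
  show "(\<lambda>f. restrict (pcf f) {..<n}) ` Mon n \<subseteq> {..<n} \<rightarrow>\<^sub>E {0..<int p}"
  proof -
    have "0 \<le> pcf f i \<and> pcf f i < int p" if "red f = f" for f i
      using coeff_red[of f i] p2 that by (metis pos_mod_bound pos_mod_sign of_nat_0_less_iff less_le_trans zero_less_numeral)
    then show ?thesis by (auto simp: Mon_def canon_def split: if_splits)
  qed
qed

lemma card_Mon: "card (Mon n) = p ^ n"
  using bij_betw_same_card[OF bij_of_coeffs, of n] by (simp add: card_PiE)

end

section \<open>Algebraic integers\<close>

definition zspan :: "nat \<Rightarrow> (nat \<Rightarrow> complex) \<Rightarrow> complex set" where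
  "zspan n v = {(\<Sum>i<n. of_int (c i) * v i) | c. True}"

lemma zspan_0: "0 \<in> zspan n v"
  unfolding zspan_def by (auto intro!: exI[of _ "\<lambda>_. 0"])

lemma zspan_add: "x \<in> zspan n v \<Longrightarrow> y \<in> zspan n v \<Longrightarrow> x + y \<in> zspan n v"
proof -
  assume "x \<in> zspan n v" "y \<in> zspan n v"
  then obtain c d where "x = (\<Sum>i<n. of_int (c i) * v i)" "y = (\<Sum>i<n. of_int (d i) * v i)"
    by (auto simp: zspan_def)
  then have eq: "x + y = (\<Sum>i<n. of_int (c i + d i) * v i)" by (simp add: sum.distrib algebra_simps)
  show ?thesis unfolding zspan_def by (intro CollectI exI[of _ "\<lambda>i. c i + d i"] conjI eq TrueI)
qed

lemma zspan_scale: "x \<in> zspan n v \<Longrightarrow> of_int k * x \<in> zspan n v"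
proof -
  assume "x \<in> zspan n v"
  then obtain c where "x = (\<Sum>i<n. of_int (c i) * v i)" by (auto simp: zspan_def)
  then have eq: "of_int k * x = (\<Sum>i<n. of_int (k * c i) * v i)" by (simp add: sum_distrib_left mult.assoc)
  show ?thesis unfolding zspan_def by (intro CollectI exI[of _ "\<lambda>i. k * c i"] conjI eq TrueI)
qed

lemma zspan_sum: "(\<And>i. i \<in> I \<Longrightarrow> f i \<in> zspan n v) \<Longrightarrow> sum f I \<in> zspan n v"
  by (induction I rule: infinite_finite_induct) (auto intro: zspan_0 zspan_add)

lemma zspan_base: "i < n \<Longrightarrow> v i \<in> zspan n v"
proof -
  assume "i < n"
  then have "v i = (\<Sum>j<n. of_int (if j = i then 1 else 0) * v j)"
    by (simp add: if_distrib[of of_int] if_distrib[of "\<lambda>x. x * _"] cong: if_cong)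
  then show ?thesis unfolding zspan_def by (intro CollectI exI[of _ "\<lambda>j. if j = i then 1 else 0"]) simp
qed

lemma zspan_stable:
  assumes "\<And>i. i < n \<Longrightarrow> z * v i \<in> zspan n v" "x \<in> zspan n v"
  shows "z * x \<in> zspan n v"
proof -
  obtain c where "x = (\<Sum>i<n. of_int (c i) * v i)" using assms(2) by (auto simp: zspan_def)
  then have "z * x = (\<Sum>i<n. of_int (c i) * (z * v i))" by (simp add: sum_distrib_left mult_ac)
  then show ?thesis using assms(1) by (auto intro!: zspan_sum zspan_scale)
qed

text \<open>The matrix of multiplication by \<open>z\<close> has integer entries and eigenvalue \<open>z\<close>.\<close>

lemma zspan_algebraic_int:
  assumes stable: "\<And>i. i < n \<Longrightarrow> z * v i \<in> zspan n v" and nz: "i0 < n" "v i0 \<noteq> 0"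
  shows "algebraic_int z"
proof -
  have "\<forall>i. \<exists>c. i < n \<longrightarrow> z * v i = (\<Sum>j<n. of_int (c j) * v j)"
    using stable by (fastforce simp: zspan_def)
  then obtain c where c: "\<And>i. i < n \<Longrightarrow> z * v i = (\<Sum>j<n. of_int (c i j) * v j)" by metis
  define A :: "int mat" where "A = mat n n (\<lambda>(i, j). c i j)"
  define B :: "complex mat" where "B = map_mat of_int A"
  define w where "w = vec n v"
  have A: "A \<in> carrier_mat n n" and B: "B \<in> carrier_mat n n" by (auto simp: A_def B_def)
  have "B *\<^sub>v w = z \<cdot>\<^sub>v w"
  proof (rule eq_vecI)
    fix i assume "i < dim_vec (z \<cdot>\<^sub>v w)"
    then have i: "i < n" by (simp add: w_def)
    have "(B *\<^sub>v w) $ i = (\<Sum>j<n. of_int (c i j) * v j)"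
      using i by (simp add: B_def A_def w_def scalar_prod_def lessThan_atLeast0)
    then show "(B *\<^sub>v w) $ i = (z \<cdot>\<^sub>v w) $ i" using c[OF i] i by (simp add: w_def)
  qed (use B in \<open>simp add: w_def\<close>)
  moreover have "w \<noteq> 0\<^sub>v n" using nz by (metis index_vec index_zero_vec(1) w_def)
  moreover have "w \<in> carrier_vec n" by (simp add: w_def)
  ultimately have "eigenvalue B z" using B unfolding eigenvalue_def eigenvector_def by auto
  then have "poly (char_poly B) z = 0" using eigenvalue_root_char_poly[OF B] by simp
  moreover have "char_poly B = map_poly of_int (char_poly A)"
    unfolding B_def by (rule of_int_hom.char_poly_hom[OF A])
  moreover have "Polynomial.lead_coeff (char_poly A) = 1" using degree_monic_char_poly[OF A] by simp
  ultimately show ?thesis by (auto simp: algebraic_int_altdef_ipoly)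
qed

lemma algebraic_int_power_span:
  assumes "algebraic_int (x::complex)"
  obtains m where "m \<ge> 1" "\<exists>c. x ^ m = (\<Sum>i<m. of_int (c i) * x ^ i)"
proof -
  obtain q :: "int poly" where q: "poly (map_poly of_int q) x = 0" "Polynomial.lead_coeff q = 1"
    using assms by (auto simp: algebraic_int_altdef_ipoly)
  define m where "m = pdeg q"
  have "pdeg (map_poly of_int q :: complex poly) = m" by (simp add: m_def)
  then have "(\<Sum>i\<le>m. of_int (pcf q i) * x ^ i) = 0" using q(1) by (simp add: poly_altdef)
  then have "(\<Sum>i<m. of_int (pcf q i) * x ^ i) + x ^ m = 0"
    using q(2) by (simp add: m_def lessThan_Suc_atMost[symmetric])
  then have "x ^ m = - (\<Sum>i<m. of_int (pcf q i) * x ^ i)" by (simp add: add_eq_0_iff)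
  then have "x ^ m = (\<Sum>i<m. of_int (- pcf q i) * x ^ i)" by (simp add: sum_negf)
  moreover have "m \<noteq> 0"
  proof
    assume "m = 0"
    then have "q = 1" using monic_p_deg0[of q] q(2) by (simp add: m_def monic_p_def)
    then show False using q(1) by simp
  qed
  ultimately show ?thesis using that[of m] by (metis One_nat_def Suc_leI neq0_conv)
qed

text \<open>The monomials \<open>x ^ i * y ^ j\<close> with \<open>i < m\<close> and
  \<open>j < k\<close> span a group that is stable under multiplication by \<open>x\<close> and by
  \<open>y\<close>, hence by their sum and product. They are numbered by
  \<open>t = i * k + j\<close>, so that quotient and remainder recover the exponents.\<close>

lemma algebraic_int_add_mult:
  assumes "algebraic_int (x::complex)" "algebraic_int y"
  shows "algebraic_int (x + y)" "algebraic_int (x * y)"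
proof -
  obtain m c where m: "m \<ge> 1" "x ^ m = (\<Sum>i<m. of_int (c i) * x ^ i)"
    using algebraic_int_power_span[OF assms(1)] by metis
  obtain k d where k: "k \<ge> 1" "y ^ k = (\<Sum>i<k. of_int (d i) * y ^ i)"
    using algebraic_int_power_span[OF assms(2)] by metis
  define v where "v = (\<lambda>t. x ^ (t div k) * y ^ (t mod k))"
  define n where "n = m * k"
  have mem: "x ^ i * y ^ j \<in> zspan n v" if "i < m" "j < k" for i j
  proof -
    have "i * k + j < n"
    proof -
      have "i * k + j < (i + 1) * k" using that by simp
      also have "\<dots> \<le> n" unfolding n_def using that by (intro mult_le_mono1) simp
      finally show ?thesis .
    qed
    then have "v (i * k + j) \<in> zspan n v" by (rule zspan_base)
    then show ?thesis using that by (simp add: v_def)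
  qed
  have dm: "t div k < m" "t mod k < k" if "t < n" for t
    using that k(1) by (auto simp: n_def less_mult_imp_div_less)
  have xv: "x * v t \<in> zspan n v" if "t < n" for t
  proof (cases "Suc (t div k) < m")
    case True
    have eq: "x * v t = x ^ Suc (t div k) * y ^ (t mod k)" by (simp add: v_def)
    show ?thesis unfolding eq by (rule mem[OF True dm(2)[OF that]])
  next
    case False
    then have "Suc (t div k) = m" using dm[OF that] by simp
    then have "x * v t = x ^ m * y ^ (t mod k)" by (auto simp: v_def)
    also have "\<dots> = (\<Sum>i<m. of_int (c i) * (x ^ i * y ^ (t mod k)))"
      unfolding m(2) by (simp add: sum_distrib_right mult.assoc)
    also have "\<dots> \<in> zspan n v" using mem dm[OF that] by (intro zspan_sum zspan_scale) auto
    finally show ?thesis .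
  qed
  have yv: "y * v t \<in> zspan n v" if "t < n" for t
  proof (cases "Suc (t mod k) < k")
    case True
    have eq: "y * v t = x ^ (t div k) * y ^ Suc (t mod k)" by (simp add: v_def)
    show ?thesis unfolding eq by (rule mem[OF dm(1)[OF that] True])
  next
    case False
    then have "Suc (t mod k) = k" using dm[OF that] by simp
    then have "y * v t = x ^ (t div k) * y ^ k" by (auto simp: v_def mult.left_commute simp flip: power_Suc)
    also have "\<dots> = (\<Sum>i<k. of_int (d i) * (x ^ (t div k) * y ^ i))"
      unfolding k(2) by (simp add: sum_distrib_left mult_ac)
    also have "\<dots> \<in> zspan n v" using mem dm[OF that] by (intro zspan_sum zspan_scale) auto
    finally show ?thesis .
  qed
  have n0: "0 < n" "v 0 \<noteq> 0" using m k by (auto simp: n_def v_def)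
  show "algebraic_int (x + y)"
    by (rule zspan_algebraic_int[where v = v, OF _ n0]) (simp add: distrib_right zspan_add xv yv)
  show "algebraic_int (x * y)"
  proof (rule zspan_algebraic_int[where v = v, OF _ n0])
    fix t assume "t < n"
    from zspan_stable[OF xv yv[OF this]] show "x * y * v t \<in> zspan n v" by (simp add: mult.assoc)
  qed
qed

lemma algebraic_ex: "algebraic x \<Longrightarrow> \<exists>p. (\<forall>i. pcf p i \<in> \<int>) \<and> p \<noteq> 0 \<and> poly p x = 0"
  by (simp add: algebraic_def)

text \<open>Multiplication by the leading coefficient \<open>c\<close> of a polynomial
  \<open>p\<close> that vanishes at \<open>x\<close> makes \<open>x\<close> integral:
  \<open>c * x\<close> is a root of a monic polynomial with integer coefficients.\<close>

lemma algebraic_times_int: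
  assumes "algebraic (x::complex)"
  obtains N :: int where "N \<noteq> 0" "algebraic_int (of_int N * x)"
proof -
  obtain p where p: "\<And>i. pcf p i \<in> \<int>" "p \<noteq> 0" "poly p x = 0" using algebraic_ex[OF assms] by metis
  define d where "d = pdeg p"
  define c where "c = pcf p d"
  have c0: "c \<noteq> 0" using p(2) by (simp add: c_def d_def)
  have d: "d > 0"
  proof (rule ccontr)
    assume "\<not> d > 0"
    then obtain a where "p = [:a:]" by (auto simp: d_def elim: degree_eq_zeroE)
    then show False using p by simp
  qed
  \<comment> \<open>The powers of \<open>c\<close> are chosen to make \<open>poly q (c * x)\<close>
    equal to \<open>c ^ (d - 1) * poly p x\<close>.\<close>
  define q where "q = Polynomial.monom 1 d + (\<Sum>i<d. Polynomial.monom (pcf p i * c ^ (d - 1 - i)) i)"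
  have cf: "pcf q i = (if i < d then pcf p i * c ^ (d - 1 - i) else if i = d then 1 else 0)" for i
  proof -
    have "(\<Sum>j<d. if j = i then pcf p j * c ^ (d - 1 - j) else 0) = (if i < d then pcf p i * c ^ (d - 1 - i) else 0)"
      by (simp add: sum.delta)
    then show ?thesis by (auto simp: q_def coeff_sum)
  qed
  have dq: "pdeg q = d" by (intro antisym degree_le le_degree) (auto simp: cf)
  have "poly q (c * x) = (c * x) ^ d + (\<Sum>i<d. pcf p i * c ^ (d - 1 - i) * (c * x) ^ i)"
    by (simp add: q_def poly_sum poly_monom)
  also have "(\<Sum>i<d. pcf p i * c ^ (d - 1 - i) * (c * x) ^ i) = (\<Sum>i<d. c ^ (d - 1) * (pcf p i * x ^ i))"
  proof (rule sum.cong[OF refl])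
    fix i assume "i \<in> {..<d}"
    then have "c ^ (d - 1) = c ^ (d - 1 - i) * c ^ i" by (simp flip: power_add)
    then show "pcf p i * c ^ (d - 1 - i) * (c * x) ^ i = c ^ (d - 1) * (pcf p i * x ^ i)"
      by (simp add: power_mult_distrib mult_ac)
  qed
  also have "(c * x) ^ d + (\<Sum>i<d. c ^ (d - 1) * (pcf p i * x ^ i)) = c ^ (d - 1) * (\<Sum>i\<le>d. pcf p i * x ^ i)"
  proof -
    obtain e where e: "d = Suc e" using d by (cases d) auto
    have "(c * x) ^ d = c ^ (d - 1) * (pcf p d * x ^ d)"
      unfolding power_mult_distrib by (simp add: e c_def[unfolded e, symmetric])
    moreover have "(\<Sum>i\<le>d. pcf p i * x ^ i) = pcf p d * x ^ d + (\<Sum>i<d. pcf p i * x ^ i)"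
      by (simp add: lessThan_Suc_atMost[symmetric])
    ultimately show ?thesis by (simp only: distrib_left sum_distrib_left)
  qed
  also have "\<dots> = 0" using p(3) by (simp add: poly_altdef d_def)
  finally have "poly q (c * x) = 0" .
  moreover have "pcf q i \<in> \<int>" for i
    unfolding cf c_def using p(1) by (auto intro!: Ints_mult Ints_power)
  ultimately have "algebraic_int (c * x)" using dq cf by (intro algebraic_int.intros[of q]) auto
  moreover obtain N where "c = of_int N" using p(1)[of d] by (auto simp: c_def elim: Ints_cases)
  ultimately show ?thesis using that[of N] c0 by auto
qed

lemma algebraic_int_times_algebraic:
  assumes "algebraic_int (of_int N * (x::complex))" "N \<noteq> 0" shows "algebraic x"
proof -
  obtain q where q: "\<And>i. pcf q i \<in> \<int>" "q \<noteq> 0" "poly q (of_int N * x) = 0"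
    using algebraic_ex[OF algebraic_int_imp_algebraic[OF assms(1)]] by metis
  have "poly (pcompose q [:0, of_int N:]) x = 0" using q(3) by (simp add: poly_pcompose mult.commute)
  moreover have "pcompose q [:0, of_int N:] \<noteq> 0"
    using q(2) assms(2) by (subst pcompose_eq_0_iff) (auto)
  moreover have "pcf (pcompose q [:0, of_int N:]) i \<in> \<int>" for i
    using q(1) by (simp add: coeff_pcompose_linear Ints_mult Ints_power)
  ultimately show ?thesis by (intro algebraicI) auto
qed

lemma algebraic_add_mult:
  assumes "algebraic (x::complex)" "algebraic y"
  shows "algebraic (x + y)" "algebraic (x * y)"
proof -
  obtain N where N: "N \<noteq> 0" "algebraic_int (of_int N * x)" using algebraic_times_int[OF assms(1)] by blast
  obtain M where M: "M \<noteq> 0" "algebraic_int (of_int M * y)" using algebraic_times_int[OF assms(2)] by blast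
  have "algebraic_int (of_int M * (of_int N * x) + of_int N * (of_int M * y))"
    using algebraic_int_add_mult(1)[OF algebraic_int_add_mult(2)[OF algebraic_int_of_int N(2)]
      algebraic_int_add_mult(2)[OF algebraic_int_of_int M(2)]] .
  then have "algebraic_int (of_int (M * N) * (x + y))" by (simp add: algebra_simps)
  then show "algebraic (x + y)" using N M by (intro algebraic_int_times_algebraic[of "M * N"]) auto
  have "algebraic_int ((of_int N * x) * (of_int M * y))" using algebraic_int_add_mult(2)[OF N(2) M(2)] .
  then have "algebraic_int (of_int (N * M) * (x * y))" by (simp add: mult_ac)
  then show "algebraic (x * y)" using N M by (intro algebraic_int_times_algebraic[of "N * M"]) auto
qed

section \<open>Homomorphisms defined on subrings\<close>

text \<open>Subrings are sets and homomorphisms are total functions, constrained only on the set. In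
  this way the types of complex numbers and of their polynomials serve all the fields and rings that
  occur.\<close>

definition subring_set :: "'a::comm_ring_1 set \<Rightarrow> bool" where
  "subring_set A \<longleftrightarrow> 0 \<in> A \<and> 1 \<in> A \<and> (\<forall>x\<in>A. - x \<in> A) \<and> (\<forall>x\<in>A. \<forall>y\<in>A. x + y \<in> A \<and> x * y \<in> A)"

definition hom_on :: "'a::comm_ring_1 set \<Rightarrow> ('a \<Rightarrow> 'b::comm_ring_1) \<Rightarrow> bool" where
  "hom_on A \<sigma> \<longleftrightarrow> subring_set A \<and> \<sigma> 0 = 0 \<and> \<sigma> 1 = 1 \<and>
     (\<forall>x\<in>A. \<forall>y\<in>A. \<sigma> (x + y) = \<sigma> x + \<sigma> y \<and> \<sigma> (x * y) = \<sigma> x * \<sigma> y)"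

definition polys_over :: "'a::comm_ring_1 set \<Rightarrow> 'a poly set" where
  "polys_over A = {f. \<forall>i. pcf f i \<in> A}"

lemma subring_setD:
  assumes "subring_set A"
  shows "0 \<in> A" "1 \<in> A" "x \<in> A \<Longrightarrow> - x \<in> A" "x \<in> A \<Longrightarrow> y \<in> A \<Longrightarrow> x + y \<in> A"
    "x \<in> A \<Longrightarrow> y \<in> A \<Longrightarrow> x * y \<in> A" "x \<in> A \<Longrightarrow> y \<in> A \<Longrightarrow> x - y \<in> A"
  using assms unfolding subring_set_def by (auto, metis diff_conv_add_uminus)

lemma subring_sum: "subring_set A \<Longrightarrow> (\<And>i. i \<in> I \<Longrightarrow> f i \<in> A) \<Longrightarrow> sum f I \<in> A"
  by (induction I rule: infinite_finite_induct) (auto intro: subring_setD)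

lemma subring_prod: "subring_set A \<Longrightarrow> (\<And>i. i \<in> I \<Longrightarrow> f i \<in> A) \<Longrightarrow> prod f I \<in> A"
  by (induction I rule: infinite_finite_induct) (auto intro: subring_setD)

lemma subring_power: "subring_set A \<Longrightarrow> x \<in> A \<Longrightarrow> x ^ n \<in> A"
  by (induction n) (auto intro: subring_setD)

lemma subring_of_int: "subring_set A \<Longrightarrow> of_int k \<in> A"
proof -
  assume A: "subring_set A"
  have n: "of_nat n \<in> A" for n by (induction n) (auto intro: subring_setD[OF A])
  show ?thesis by (cases k) (use n subring_setD(3)[OF A n] in \<open>auto simp del: of_nat_Suc\<close>)
qed

lemma hom_onD:
  assumes "hom_on A \<sigma>"
  shows "subring_set A" "\<sigma> 0 = 0" "\<sigma> 1 = 1" "x \<in> A \<Longrightarrow> y \<in> A \<Longrightarrow> \<sigma> (x + y) = \<sigma> x + \<sigma> y"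
    "x \<in> A \<Longrightarrow> y \<in> A \<Longrightarrow> \<sigma> (x * y) = \<sigma> x * \<sigma> y"
  using assms by (auto simp: hom_on_def)

lemma hom_on_minus: "hom_on A \<sigma> \<Longrightarrow> x \<in> A \<Longrightarrow> \<sigma> (- x) = - \<sigma> x"
  using hom_onD[of A \<sigma>] subring_setD(3)[of A x] by (metis add.right_inverse add_eq_0_iff)

lemma hom_on_diff:
  assumes "hom_on A \<sigma>" "x \<in> A" "y \<in> A" shows "\<sigma> (x - y) = \<sigma> x - \<sigma> y"
  using hom_onD(4)[OF assms(1,2) subring_setD(3)[OF hom_onD(1)[OF assms(1)] assms(3)]]
    hom_on_minus[OF assms(1,3)] by simp

lemma hom_on_sum: "hom_on A \<sigma> \<Longrightarrow> (\<And>i. i \<in> I \<Longrightarrow> f i \<in> A) \<Longrightarrow> \<sigma> (sum f I) = (\<Sum>i\<in>I. \<sigma> (f i))"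
proof (induction I rule: infinite_finite_induct)
  case (insert x F)
  then show ?case using hom_onD(4)[OF insert.prems(1), of "f x" "sum f F"] subring_sum[OF hom_onD(1)[OF insert.prems(1)], of F f] by simp
qed (auto dest: hom_onD)

lemma hom_on_prod: "hom_on A \<sigma> \<Longrightarrow> (\<And>i. i \<in> I \<Longrightarrow> f i \<in> A) \<Longrightarrow> \<sigma> (prod f I) = (\<Prod>i\<in>I. \<sigma> (f i))"
proof (induction I rule: infinite_finite_induct)
  case (insert x F)
  then show ?case using hom_onD(5)[OF insert.prems(1), of "f x" "prod f F"] subring_prod[OF hom_onD(1)[OF insert.prems(1)], of F f] by simp
qed (auto dest: hom_onD)

lemma hom_on_power: "hom_on A \<sigma> \<Longrightarrow> x \<in> A \<Longrightarrow> \<sigma> (x ^ n) = \<sigma> x ^ n"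
  by (induction n) (auto simp: hom_onD subring_power hom_onD(1))

lemma polys_over_subring: "subring_set A \<Longrightarrow> subring_set (polys_over A)"
  unfolding subring_set_def[of "polys_over A"]
  by (auto simp: polys_over_def coeff_mult coeff_pCons one_pCons subring_setD split: nat.split
      intro!: subring_sum)

lemma hom_on_map_poly:
  assumes "hom_on A \<sigma>" shows "hom_on (polys_over A) (map_poly \<sigma>)"
  unfolding hom_on_def
proof (intro conjI ballI)
  note h = hom_onD[OF assms]
  show "subring_set (polys_over A)" using h(1) by (rule polys_over_subring)
  show "map_poly \<sigma> 0 = 0" by simp
  show "map_poly \<sigma> 1 = 1" using h by (simp add: one_pCons)
  fix f g assume fg: "f \<in> polys_over A" "g \<in> polys_over A"
  then have cf: "pcf f i \<in> A" "pcf g i \<in> A" for i by (auto simp: polys_over_def)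
  show "map_poly \<sigma> (f + g) = map_poly \<sigma> f + map_poly \<sigma> g"
    using h(4) cf by (simp add: poly_eq_iff coeff_map_poly[of \<sigma>, OF h(2)])
  show "map_poly \<sigma> (f * g) = map_poly \<sigma> f * map_poly \<sigma> g"
  proof (rule poly_eqI)
    fix n
    have "pcf (map_poly \<sigma> (f * g)) n = \<sigma> (\<Sum>i\<le>n. pcf f i * pcf g (n - i))"
      by (simp add: coeff_map_poly[of \<sigma>, OF h(2)] coeff_mult)
    also have "\<dots> = (\<Sum>i\<le>n. \<sigma> (pcf f i * pcf g (n - i)))"
      using cf subring_setD(5)[OF h(1)] by (intro hom_on_sum[OF assms]) auto
    also have "\<dots> = (\<Sum>i\<le>n. \<sigma> (pcf f i) * \<sigma> (pcf g (n - i)))" using h(5) cf by simp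
    finally show "pcf (map_poly \<sigma> (f * g)) n = pcf (map_poly \<sigma> f * map_poly \<sigma> g) n"
      by (simp add: coeff_map_poly[of \<sigma>, OF h(2)] coeff_mult)
  qed
qed

lemma poly_in: "subring_set A \<Longrightarrow> f \<in> polys_over A \<Longrightarrow> x \<in> A \<Longrightarrow> poly f x \<in> A"
  by (simp add: poly_altdef polys_over_def subring_sum subring_setD subring_power)

lemma hom_on_poly:
  assumes "hom_on A \<sigma>" "f \<in> polys_over A" "x \<in> A"
  shows "\<sigma> (poly f x) = poly (map_poly \<sigma> f) (\<sigma> x)"
proof -
  note h = hom_onD[OF assms(1)]
  have cf: "pcf f i \<in> A" for i using assms(2) by (auto simp: polys_over_def)
  have "\<sigma> (poly f x) = (\<Sum>i\<le>pdeg f. \<sigma> (pcf f i * x ^ i))"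
    unfolding poly_altdef using cf assms(3) h(1)
    by (intro hom_on_sum[OF assms(1)]) (auto intro: subring_setD subring_power)
  also have "\<dots> = (\<Sum>i\<le>pdeg f. pcf (map_poly \<sigma> f) i * \<sigma> x ^ i)"
    using cf assms h by (simp add: hom_on_power subring_power coeff_map_poly[of \<sigma>, OF h(2)])
  also have "\<dots> = (\<Sum>i\<le>pdeg (map_poly \<sigma> f). pcf (map_poly \<sigma> f) i * \<sigma> x ^ i)"
    by (rule sum.mono_neutral_right) (auto simp: degree_map_poly_le coeff_eq_0)
  finally show ?thesis by (simp add: poly_altdef)
qed

text \<open>Each step subtracts a multiple of the monic \<open>m\<close> by a monomial whose
  coefficient is a leading coefficient over \<open>A\<close>, so that the usual division never
  leaves \<open>A\<close>.\<close>

lemma division_over: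
  assumes A: "subring_set A" and m: "monic_p (m :: 'a::idom poly)" "m \<in> polys_over A" and g: "g \<in> polys_over A"
  shows "\<exists>k\<in>polys_over A. \<exists>r\<in>polys_over A. g = m * k + r \<and> (r = 0 \<or> pdeg r < pdeg m)"
  using g
proof (induction "pdeg g" arbitrary: g rule: less_induct)
  case less
  note P = subring_setD[OF polys_over_subring[OF A]]
  show ?case
  proof (cases "g = 0 \<or> pdeg g < pdeg m")
    case True
    then show ?thesis using less.prems P(1) by (intro bexI[of _ 0] bexI[of _ g]) auto
  next
    case False
    define c where "c = pcf g (pdeg g)"
    define t where "t = Polynomial.monom c (pdeg g - pdeg m)"
    have cA: "c \<in> A" and c0: "c \<noteq> 0" using less.prems False by (auto simp: c_def polys_over_def)
    have t: "t \<in> polys_over A" using cA subring_setD(1)[OF A] by (auto simp: t_def polys_over_def)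
    define g' where "g' = g - m * t"
    have g': "g' \<in> polys_over A" unfolding g'_def using less.prems m t P by auto
    have dmt: "pdeg (m * t) = pdeg g"
      using False c0 m by (subst Polynomial.degree_mult_eq) (auto simp: t_def degree_monom_eq monic_p_def)
    have top: "pcf (m * t) (pdeg g) = c"
    proof -
      have "pcf (m * t) (pdeg m + pdeg t) = c"
        using m(1) c0 unfolding coeff_mult_degree_sum by (simp add: t_def degree_monom_eq monic_p_def)
      moreover have "pdeg m + pdeg t = pdeg g" using False c0 by (simp add: t_def degree_monom_eq)
      ultimately show ?thesis by simp
    qed
    show ?thesis
    proof (cases "g' = 0")
      case True
      then show ?thesis using t P(1) by (intro bexI[of _ t] bexI[of _ 0]) (auto simp: g'_def)
    next
      case ne: False
      have "pcf g' (pdeg g) = 0" by (simp add: g'_def top c_def)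
      moreover have "pdeg g' \<le> pdeg g" unfolding g'_def using dmt by (intro degree_diff_le) auto
      ultimately have "pdeg g' < pdeg g" using ne by (metis le_neq_implies_less leading_coeff_0_iff)
      then obtain k r where kr: "k \<in> polys_over A" "r \<in> polys_over A" "g' = m * k + r" "r = 0 \<or> pdeg r < pdeg m"
        using less.hyps[OF _ g'] by blast
      then have "g = m * (k + t) + r" by (simp add: g'_def algebra_simps)
      then show ?thesis using kr t P(4) by blast
    qed
  qed
qed

section \<open>Extending embeddings of fields of algebraic numbers\<close>

definition alg_field :: "complex set \<Rightarrow> bool" where
  "alg_field A \<longleftrightarrow> subring_set A \<and> \<rat> \<subseteq> A \<and> (\<forall>x\<in>A. algebraic x)"

text \<open>Closure under inverses follows from algebraicity: \<open>x \<noteq> 0\<close> is a root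
  of a polynomial with nonzero constant term \<open>a\<close>, and solving this equation for
  \<open>a\<close> writes the inverse as a polynomial in \<open>x\<close>.\<close>

lemma alg_field_inverse:
  assumes "alg_field A" "x \<in> A" shows "inverse x \<in> A"
proof (cases "x = 0")
  case False
  have "algebraic x" using assms by (auto simp: alg_field_def)
  then obtain p0 :: "int poly" where "pcf p0 0 \<noteq> 0" "poly (of_int_poly p0) x = 0"
    using False by (rule algebraicE'_nonzero)
  then obtain p where p: "\<And>i. pcf p i \<in> \<int>" "pcf p 0 \<noteq> 0" "poly p x = 0"
    by (metis Ints_of_int coeff_map_poly of_int_0 of_int_eq_0_iff)
  have A: "subring_set A" "\<rat> \<subseteq> A" using assms by (auto simp: alg_field_def)
  obtain a q where q: "p = pCons a q" by (cases p)
  have "a \<noteq> 0" using p(2) q by simp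
  have "a \<in> \<rat>" "pcf q i \<in> \<rat>" for i using p(1)[of 0] p(1)[of "Suc i"] q Ints_subset_Rats by auto
  then have qA: "q \<in> polys_over A" and aA: "- inverse a \<in> A" using A by (auto simp: polys_over_def)
  have "a + x * poly q x = 0" using p(3) q by simp
  then have "inverse x = - inverse a * poly q x" using False \<open>a \<noteq> 0\<close> by (simp add: field_simps add_eq_0_iff)
  then show ?thesis using poly_in[OF A(1) qA assms(2)] aA subring_setD(5)[OF A(1)] by metis
qed (use assms in \<open>simp add: alg_field_def subring_setD\<close>)

lemma algebraic_sum: "(\<And>i. i \<in> I \<Longrightarrow> algebraic (f i :: complex)) \<Longrightarrow> algebraic (sum f I)"
  by (induction I rule: infinite_finite_induct) (auto intro: algebraic_add_mult)

lemma algebraic_power': "algebraic (x::complex) \<Longrightarrow> algebraic (x ^ n)"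
  by (induction n) (auto intro: algebraic_add_mult)

lemma minimal_polynomial:
  assumes A: "alg_field A" and \<alpha>: "algebraic \<alpha>"
  obtains m where "monic_p m" "m \<in> polys_over A" "poly m \<alpha> = 0"
    "\<And>g. g \<in> polys_over A \<Longrightarrow> poly g \<alpha> = 0 \<Longrightarrow> g \<noteq> 0 \<Longrightarrow> pdeg m \<le> pdeg g"
    "\<And>g. g \<in> polys_over A \<Longrightarrow> poly g \<alpha> = 0 \<Longrightarrow> \<exists>k\<in>polys_over A. g = m * k"
proof -
  have sA: "subring_set A" "\<rat> \<subseteq> A" using A by (auto simp: alg_field_def)
  define P where "P = (\<lambda>g. g \<in> polys_over A \<and> poly g \<alpha> = 0 \<and> g \<noteq> 0)"
  obtain p where p: "\<And>i. pcf p i \<in> \<int>" "p \<noteq> 0" "poly p \<alpha> = 0" using algebraic_ex[OF \<alpha>] by metis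
  then have "P p" using sA Ints_subset_Rats by (auto simp: P_def polys_over_def)
  then obtain m0 where m0: "P m0" "\<And>g. P g \<Longrightarrow> pdeg m0 \<le> pdeg g"
    using ex_has_least_nat[of P p pdeg] by blast
  define c where "c = inverse (pcf m0 (pdeg m0))"
  define m where "m = Polynomial.smult c m0"
  have c0: "pcf m0 (pdeg m0) \<noteq> 0" using m0 by (simp add: P_def)
  have cA: "c \<in> A" unfolding c_def using m0 by (intro alg_field_inverse[OF A]) (auto simp: P_def polys_over_def)
  have m: "monic_p m" "m \<in> polys_over A" "poly m \<alpha> = 0" "pdeg m = pdeg m0"
    using m0 c0 cA subring_setD(5)[OF sA(1)] by (auto simp: m_def c_def monic_p_def P_def polys_over_def)
  have min: "pdeg m \<le> pdeg g" if "g \<in> polys_over A" "poly g \<alpha> = 0" "g \<noteq> 0" for g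
    using m0(2) m(4) that by (auto simp: P_def)
  have dv: "\<exists>k\<in>polys_over A. g = m * k" if g: "g \<in> polys_over A" "poly g \<alpha> = 0" for g
  proof -
    obtain k r where kr: "k \<in> polys_over A" "r \<in> polys_over A" "g = m * k + r" "r = 0 \<or> pdeg r < pdeg m"
      using division_over[OF sA(1) m(1,2) g(1)] by blast
    have "poly r \<alpha> = 0" using g(2) m(3) kr(3) by simp
    then have "r = 0" using min[OF kr(2)] kr(4) by fastforce
    then show ?thesis using kr by auto
  qed
  show ?thesis using that m min dv by blast
qed

text \<open>The values at \<open>\<alpha>\<close> of polynomials over \<open>A\<close> form the
  quotient of these polynomials by \<open>m\<close>. Applying \<open>\<tau>\<close> to the
  coefficients and evaluating at \<open>\<beta>\<close> is well defined, because polynomials with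
  the same value at \<open>\<alpha>\<close> differ by a multiple of \<open>m\<close>.\<close>

lemma extend_hom:
  assumes A: "alg_field A" and \<tau>: "hom_on A (\<tau> :: complex \<Rightarrow> complex)"
    and m: "m \<in> polys_over A" "\<And>g. g \<in> polys_over A \<Longrightarrow> poly g \<alpha> = 0 \<Longrightarrow> \<exists>k\<in>polys_over A. g = m * k"
    and \<alpha>: "algebraic \<alpha>" and \<beta>: "poly (map_poly \<tau> m) \<beta> = 0"
  obtains A' \<tau>' where "alg_field A'" "hom_on A' \<tau>'" "A \<subseteq> A'" "\<alpha> \<in> A'" "\<And>a. a \<in> A \<Longrightarrow> \<tau>' a = \<tau> a" "\<tau>' \<alpha> = \<beta>"
proof -
  have sA: "subring_set A" "\<rat> \<subseteq> A" "\<And>a. a \<in> A \<Longrightarrow> algebraic a" using A by (auto simp: alg_field_def)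
  note P = subring_setD[OF polys_over_subring[OF sA(1)]]
  note M = hom_on_map_poly[OF \<tau>]
  define A' where "A' = (\<lambda>g. poly g \<alpha>) ` polys_over A"
  have wd: "poly (map_poly \<tau> g) \<beta> = poly (map_poly \<tau> h) \<beta>"
    if gh: "g \<in> polys_over A" "h \<in> polys_over A" "poly g \<alpha> = poly h \<alpha>" for g h
  proof -
    have "g - h \<in> polys_over A" "poly (g - h) \<alpha> = 0" using gh P(6) by auto
    then obtain k where k: "k \<in> polys_over A" "g - h = m * k" using m(2) by blast
    have "map_poly \<tau> (g - h) = map_poly \<tau> m * map_poly \<tau> k" unfolding k(2) using hom_onD(5)[OF M m(1) k(1)] .
    then have "map_poly \<tau> g - map_poly \<tau> h = map_poly \<tau> m * map_poly \<tau> k"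
      using hom_on_diff[OF M gh(1,2)] by simp
    then have "poly (map_poly \<tau> g) \<beta> - poly (map_poly \<tau> h) \<beta> = 0"
      using \<beta> by (metis mult_zero_left poly_diff poly_mult)
    then show ?thesis by simp
  qed
  \<comment> \<open>The choice of a representing polynomial is harmless, by
    \<open>wd\<close>.\<close>
  define \<tau>' where "\<tau>' = (\<lambda>z. poly (map_poly \<tau> (SOME g. g \<in> polys_over A \<and> poly g \<alpha> = z)) \<beta>)"
  have ev: "\<tau>' (poly g \<alpha>) = poly (map_poly \<tau> g) \<beta>" if g: "g \<in> polys_over A" for g
  proof -
    have "(SOME h. h \<in> polys_over A \<and> poly h \<alpha> = poly g \<alpha>) \<in> polys_over A \<and>
      poly (SOME h. h \<in> polys_over A \<and> poly h \<alpha> = poly g \<alpha>) \<alpha> = poly g \<alpha>"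
      by (rule someI[of _ g]) (use g in simp)
    then show ?thesis unfolding \<tau>'_def using wd g by blast
  qed
  have const: "[:a:] \<in> polys_over A" if "a \<in> A" for a
    using that sA(1) by (auto simp: polys_over_def coeff_pCons subring_setD split: nat.split)
  have xin: "[:0, 1:] \<in> polys_over A"
    using sA(1) by (auto simp: polys_over_def coeff_pCons subring_setD split: nat.split)
  have \<tau>0: "\<tau> 0 = 0" "\<tau> 1 = 1" using hom_onD[OF \<tau>] by auto
  have sub: "A \<subseteq> A'"
  proof
    fix a assume "a \<in> A"
    then show "a \<in> A'" unfolding A'_def using const by (intro image_eqI[of _ _ "[:a:]"]) auto
  qed
  have sr: "subring_set A'"
    unfolding subring_set_def
  proof (intro conjI ballI)
    show "0 \<in> A'" "1 \<in> A'" using sub sA(1) by (auto simp: subring_setD)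
    fix x assume "x \<in> A'"
    then obtain g where g: "g \<in> polys_over A" "x = poly g \<alpha>" by (auto simp: A'_def)
    show "- x \<in> A'" unfolding A'_def using g P(3) by (intro image_eqI[of _ _ "- g"]) auto
    fix y assume "y \<in> A'"
    then obtain h where h: "h \<in> polys_over A" "y = poly h \<alpha>" by (auto simp: A'_def)
    show "x + y \<in> A'" unfolding A'_def using g h P(4) by (intro image_eqI[of _ _ "g + h"]) auto
    show "x * y \<in> A'" unfolding A'_def using g h P(5) by (intro image_eqI[of _ _ "g * h"]) auto
  qed
  show ?thesis
  proof (rule that[of A' \<tau>'])
    show "alg_field A'"
      unfolding alg_field_def
    proof (intro conjI ballI sr)
      show "\<rat> \<subseteq> A'" using sub sA by blast
      fix x assume "x \<in> A'"
      then obtain g where "g \<in> polys_over A" "x = (\<Sum>i\<le>pdeg g. pcf g i * \<alpha> ^ i)"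
        unfolding A'_def by (auto simp: poly_altdef)
      moreover have "algebraic (pcf g i * \<alpha> ^ i)" if "g \<in> polys_over A" for i g
        using that by (intro algebraic_add_mult(2) algebraic_power'[OF \<alpha>] sA(3)) (auto simp: polys_over_def)
      ultimately show "algebraic x" using algebraic_sum[of "{..pdeg g}" "\<lambda>i. pcf g i * \<alpha> ^ i"] by simp
    qed
    show eqA: "\<tau>' a = \<tau> a" if "a \<in> A" for a
    proof -
      have "map_poly \<tau> [:a:] = [:\<tau> a:]"
        by (rule poly_eqI) (simp add: coeff_map_poly \<tau>0 coeff_pCons split: nat.split)
      then show ?thesis using ev[OF const[OF that]] by simp
    qed
    have "map_poly \<tau> [:0, 1:] = [:0, 1:]"
      by (rule poly_eqI) (simp add: coeff_map_poly \<tau>0 coeff_pCons split: nat.split)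
    then show "\<tau>' \<alpha> = \<beta>" using ev[OF xin] by simp
    show "\<alpha> \<in> A'" unfolding A'_def using xin by (intro image_eqI[of _ _ "[:0,1:]"]) auto
    show "hom_on A' \<tau>'"
      unfolding hom_on_def
    proof (intro conjI ballI sr)
      show "\<tau>' 0 = 0" "\<tau>' 1 = 1" using eqA sA(1) \<tau>0 by (auto simp: subring_setD)
      fix x y assume "x \<in> A'" "y \<in> A'"
      then obtain g h where g: "g \<in> polys_over A" "x = poly g \<alpha>" and h: "h \<in> polys_over A" "y = poly h \<alpha>"
        by (auto simp: A'_def)
      show "\<tau>' (x + y) = \<tau>' x + \<tau>' y"
        using ev[OF P(4)[OF g(1) h(1)]] ev[OF g(1)] ev[OF h(1)] hom_onD(4)[OF M g(1) h(1)] g(2) h(2) by simp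
      show "\<tau>' (x * y) = \<tau>' x * \<tau>' y"
        using ev[OF P(5)[OF g(1) h(1)]] ev[OF g(1)] ev[OF h(1)] hom_onD(5)[OF M g(1) h(1)] g(2) h(2) by simp
    qed
  qed (rule sub)
qed

text \<open>The elements of \<open>S\<close> are adjoined one at a time; since the complex numbers
  are algebraically closed, the image of each minimal polynomial has a root to serve as the new
  value.\<close>

lemma extend_hom_finite:
  assumes "finite S" "\<And>\<alpha>. \<alpha> \<in> S \<Longrightarrow> algebraic \<alpha>" "alg_field A" "hom_on A (\<tau> :: complex \<Rightarrow> complex)"
  shows "\<exists>A' \<tau>'. alg_field A' \<and> hom_on A' \<tau>' \<and> A \<subseteq> A' \<and> S \<subseteq> A' \<and> (\<forall>a\<in>A. \<tau>' a = \<tau> a)"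
  using assms
proof (induction S)
  case (insert \<alpha> S)
  then obtain B \<rho> where B: "alg_field B" "hom_on B \<rho>" "A \<subseteq> B" "S \<subseteq> B" "\<forall>a\<in>A. \<rho> a = \<tau> a" by auto
  have \<alpha>: "algebraic \<alpha>" using insert by simp
  obtain m where m: "monic_p m" "m \<in> polys_over B" "poly m \<alpha> = 0"
    "\<And>g. g \<in> polys_over B \<Longrightarrow> poly g \<alpha> = 0 \<Longrightarrow> \<exists>k\<in>polys_over B. g = m * k"
    using minimal_polynomial[OF B(1) \<alpha>] by metis
  have "pdeg m \<noteq> 0" using m(1,3) monic_p_deg0 by force
  moreover have "pdeg (map_poly \<rho> m) = pdeg m"
    using m(1) hom_onD(2,3)[OF B(2)] by (intro antisym degree_map_poly_le le_degree) (simp add: coeff_map_poly monic_p_def)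
  ultimately have "\<not> Fundamental_Theorem_Algebra.constant (poly (map_poly \<rho> m))" by (simp add: constant_degree)
  then obtain \<beta> where "poly (map_poly \<rho> m) \<beta> = 0" using fundamental_theorem_of_algebra by blast
  from extend_hom[OF B(1,2) m(2,4) \<alpha> this] obtain A' \<tau>' where
    "alg_field A'" "hom_on A' \<tau>'" "B \<subseteq> A'" "\<alpha> \<in> A'" "\<And>a. a \<in> B \<Longrightarrow> \<tau>' a = \<rho> a" by metis
  then show ?case using B by (intro exI[of _ A'] exI[of _ \<tau>']) (auto; blast)
qed blast

text \<open>The minimal polynomial of \<open>x\<close> over the rationals has degree at least 2, and
  \<open>x\<close> is a simple root, as the derivative is nonzero and of smaller degree. So there is
  another root \<open>\<beta>\<close>, and the embedding that takes \<open>x\<close> to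
  \<open>\<beta>\<close> is extended to \<open>S\<close>.\<close>

lemma move_irrational:
  assumes "algebraic x" "x \<notin> \<rat>" "finite S" "\<And>\<alpha>. \<alpha> \<in> S \<Longrightarrow> algebraic \<alpha>"
  obtains A \<tau> where "alg_field A" "hom_on A (\<tau> :: complex \<Rightarrow> complex)" "S \<subseteq> A" "x \<in> A" "\<tau> x \<noteq> x" "\<And>q. q \<in> \<rat> \<Longrightarrow> \<tau> q = q"
proof -
  have Q: "alg_field \<rat>" by (auto simp: alg_field_def subring_set_def rat_imp_algebraic)
  have id: "hom_on \<rat> (id :: complex \<Rightarrow> complex)" using Q by (auto simp: hom_on_def alg_field_def)
  obtain m where m: "monic_p m" "m \<in> polys_over \<rat>" "poly m x = 0"
    "\<And>g. g \<in> polys_over \<rat> \<Longrightarrow> poly g x = 0 \<Longrightarrow> g \<noteq> 0 \<Longrightarrow> pdeg m \<le> pdeg g"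
    "\<And>g. g \<in> polys_over \<rat> \<Longrightarrow> poly g x = 0 \<Longrightarrow> \<exists>k\<in>polys_over \<rat>. g = m * k"
    using minimal_polynomial[OF Q assms(1)] by metis
  have d2: "pdeg m \<ge> 2"
  proof (rule ccontr)
    assume "\<not> ?thesis"
    then have "pdeg m = 1" using m(1,3) monic_p_deg0[of m] by (cases "pdeg m") auto
    then obtain a b where ab: "m = [:a, b:]" by (metis degree1_coeffs)
    then have "b = 1" using m(1) \<open>pdeg m = 1\<close> by (simp add: monic_p_def)
    then have "x = - a" using m(3) ab by (simp add: add_eq_0_iff)
    moreover have "a \<in> \<rat>" using m(2) ab by (auto simp: polys_over_def dest: spec[of _ 0])
    ultimately show False using assms(2) by simp
  qed
  obtain k where k: "m = [:- x, 1:] * k" using m(3) by (auto simp: poly_eq_0_iff_dvd)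
  have dk: "pdeg m = pdeg k + 1"
  proof -
    have "k \<noteq> 0" using k m(1) by (auto simp: monic_p_def)
    then show ?thesis unfolding k by (subst Polynomial.degree_mult_eq) auto
  qed
  then have "\<not> Fundamental_Theorem_Algebra.constant (poly k)" using d2 by (simp add: constant_degree)
  then obtain \<beta> where \<beta>: "poly k \<beta> = 0" using fundamental_theorem_of_algebra by blast
  have "\<beta> \<noteq> x"
  proof
    assume "\<beta> = x"
    then have "poly (pderiv m) x = 0" using \<beta> by (simp only: k pderiv_mult poly_add poly_mult) simp
    moreover have "pderiv m \<in> polys_over \<rat>" using m(2) by (auto simp: polys_over_def coeff_pderiv)
    moreover have "pderiv m \<noteq> 0" using d2 by (simp add: pderiv_eq_0_iff)
    ultimately have "pdeg m \<le> pdeg (pderiv m)" using m(4) by blast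
    then show False using d2 by (simp add: degree_pderiv)
  qed
  have "map_poly id m = m" by (simp add: map_poly_id)
  then have "poly (map_poly id m) \<beta> = 0" using \<beta> k by simp
  from extend_hom[OF Q id m(2,5) assms(1) this] obtain B \<rho> where B: "alg_field B" "hom_on B \<rho>" "\<rat> \<subseteq> B" "x \<in> B"
    "\<And>a. a \<in> \<rat> \<Longrightarrow> \<rho> a = id a" "\<rho> x = \<beta>" by metis
  obtain A \<tau> where "alg_field A" "hom_on A \<tau>" "B \<subseteq> A" "S \<subseteq> A" "\<forall>a\<in>B. \<tau> a = \<rho> a"
    using extend_hom_finite[OF assms(3,4) B(1,2)] by blast
  then show ?thesis using B \<open>\<beta> \<noteq> x\<close> by (intro that[of A \<tau>]) auto
qed

section \<open>The Galois group of a rational polynomial\<close>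

abbreviation cpoly :: "rat poly \<Rightarrow> complex poly" where "cpoly f \<equiv> map_poly of_rat f"

abbreviation CC :: "complex ring" where "CC \<equiv> ring_of_type_algebra"

lemma CC_simps:
  "carrier CC = UNIV" "\<one>\<^bsub>CC\<^esub> = 1" "\<zero>\<^bsub>CC\<^esub> = 0" "x \<oplus>\<^bsub>CC\<^esub> y = x + y" "x \<otimes>\<^bsub>CC\<^esub> y = x * y"
  by (simp_all add: ring_of_type_algebra_def)

lemma CC_a_inv: "\<ominus>\<^bsub>CC\<^esub> x = - x"
proof -
  interpret C: field CC by (rule field_from_type_algebra)
  show ?thesis by (rule C.minus_equality) (simp_all add: CC_simps)
qed

lemma CC_m_inv: "x \<noteq> 0 \<Longrightarrow> m_inv CC x = inverse x"
proof -
  assume "x \<noteq> 0"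
  interpret C: field CC by (rule field_from_type_algebra)
  show ?thesis by (rule C.inv_unique'[symmetric]) (use \<open>x \<noteq> 0\<close> in \<open>simp_all add: CC_simps\<close>)
qed

definition splitting_carrier :: "rat poly \<Rightarrow> complex set" where
  "splitting_carrier f = generate_field CC (\<rat> \<union> complex_roots f)"

lemma carrier_splitting_field: "carrier (splitting_field f) = splitting_carrier f"
  by (simp add: splitting_field_def splitting_carrier_def)

lemma splitting_field_simps:
  "\<one>\<^bsub>splitting_field f\<^esub> = 1" "x \<oplus>\<^bsub>splitting_field f\<^esub> y = x + y" "x \<otimes>\<^bsub>splitting_field f\<^esub> y = x * y"
  by (simp_all add: splitting_field_def ring_of_type_algebra_def)

lemma splitting_carrier_base: "q \<in> \<rat> \<Longrightarrow> q \<in> splitting_carrier f" "\<alpha> \<in> complex_roots f \<Longrightarrow> \<alpha> \<in> splitting_carrier f"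
  unfolding splitting_carrier_def by (auto intro: generate_field.incl)

lemma splitting_carrier_minimal:
  assumes "subring_set A" "\<And>x. x \<in> A \<Longrightarrow> inverse x \<in> A" "\<rat> \<subseteq> A" "complex_roots f \<subseteq> A"
  shows "splitting_carrier f \<subseteq> A"
proof
  fix x assume "x \<in> splitting_carrier f"
  then have "x \<in> generate_field CC (\<rat> \<union> complex_roots f)" by (simp add: splitting_carrier_def)
  then show "x \<in> A"
  proof (induction rule: generate_field.induct)
    case (m_inv h)
    then show ?case using assms(2) by (simp add: CC_simps CC_m_inv)
  qed (use assms in \<open>auto simp: CC_simps CC_a_inv subring_setD\<close>)
qed

lemma splitting_carrier_subring: "subring_set (splitting_carrier f)"
  unfolding subring_set_def
proof (intro conjI ballI)
  show "0 \<in> splitting_carrier f" "1 \<in> splitting_carrier f" by (auto intro: splitting_carrier_base)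
  fix x assume x: "x \<in> splitting_carrier f"
  show "- x \<in> splitting_carrier f" using generate_field.a_inv[of x CC] x by (simp add: splitting_carrier_def CC_a_inv)
  fix y assume y: "y \<in> splitting_carrier f"
  show "x + y \<in> splitting_carrier f" using generate_field.eng_add[of x CC _ y] x y by (simp add: splitting_carrier_def CC_simps)
  show "x * y \<in> splitting_carrier f" using generate_field.eng_mult[of x CC _ y] x y by (simp add: splitting_carrier_def CC_simps)
qed

lemma alg_field_Qbar: "alg_field {x. algebraic x}"
  by (auto simp: alg_field_def subring_set_def rat_imp_algebraic algebraic_add_mult)

lemma splitting_carrier_alg_min: "alg_field A \<Longrightarrow> complex_roots f \<subseteq> A \<Longrightarrow> splitting_carrier f \<subseteq> A"
  using alg_field_inverse by (intro splitting_carrier_minimal) (auto simp: alg_field_def)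

lemma complex_roots_algebraic:
  assumes "f \<noteq> 0" "\<alpha> \<in> complex_roots f" shows "algebraic \<alpha>"
  using assms by (intro algebraicI'[of "cpoly f"]) (auto simp: complex_roots_def coeff_map_poly)

lemma finite_complex_roots: "f \<noteq> 0 \<Longrightarrow> finite (complex_roots f)"
  unfolding complex_roots_def by (rule poly_roots_finite) simp

lemma splitting_carrier_alg_field: "f \<noteq> 0 \<Longrightarrow> alg_field (splitting_carrier f)"
proof -
  assume f: "f \<noteq> 0"
  have "splitting_carrier f \<subseteq> {x. algebraic x}"
    using complex_roots_algebraic[OF f] by (intro splitting_carrier_alg_min alg_field_Qbar) auto
  then show ?thesis using splitting_carrier_subring splitting_carrier_base by (auto simp: alg_field_def)
qed

lemma hom_on_rat_poly:
  assumes "hom_on A \<tau>" "\<rat> \<subseteq> A" "\<And>q. q \<in> \<rat> \<Longrightarrow> \<tau> q = q" "x \<in> A"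
  shows "\<tau> (poly (cpoly f) x) = poly (cpoly f) (\<tau> x)"
proof -
  have "cpoly f \<in> polys_over A" using assms(2) by (auto simp: polys_over_def coeff_map_poly)
  moreover have "map_poly \<tau> (cpoly f) = cpoly f"
    using hom_onD(2)[OF assms(1)] assms(3) by (intro poly_eqI) (simp add: coeff_map_poly)
  ultimately show ?thesis using hom_on_poly[OF assms(1) _ assms(4)] by metis
qed

lemma hom_on_inverse:
  assumes "hom_on A (\<tau> :: complex \<Rightarrow> complex)" "x \<in> A" "inverse x \<in> A"
  shows "\<tau> (inverse x) = inverse (\<tau> x)"
proof (cases "x = 0")
  case False
  then have "\<tau> x * \<tau> (inverse x) = 1" using hom_onD(3,5)[OF assms(1)] assms by (metis right_inverse)
  then show ?thesis by (metis inverse_unique)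
qed (use hom_onD[OF assms(1)] in simp)

lemma hom_on_inj:
  assumes "hom_on A (\<tau> :: complex \<Rightarrow> complex)" "\<And>x. x \<in> A \<Longrightarrow> inverse x \<in> A"
  shows "inj_on \<tau> A"
proof (rule inj_onI)
  fix x y assume xy: "x \<in> A" "y \<in> A" "\<tau> x = \<tau> y"
  then have d: "x - y \<in> A" "\<tau> (x - y) = 0"
    using hom_on_diff[OF assms(1)] subring_setD(6)[OF hom_onD(1)[OF assms(1)]] by auto
  show "x = y"
  proof (rule ccontr)
    assume "x \<noteq> y"
    then have "\<tau> ((x - y) * inverse (x - y)) = 1" using hom_onD(3)[OF assms(1)] by simp
    then show False using hom_onD(5)[OF assms(1) d(1) assms(2)[OF d(1)]] d(2) by simp
  qed
qed

text \<open>An embedding of a larger field of algebraic numbers that fixes the rationals permutes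
  the roots of \<open>f\<close>, hence maps the field generated by them onto itself. This turns
  extended embeddings into automorphisms.\<close>

lemma restrict_galois_group:
  assumes f: "f \<noteq> 0" and A: "alg_field A" "complex_roots f \<subseteq> A"
    and \<tau>: "hom_on A (\<tau> :: complex \<Rightarrow> complex)" "\<And>q. q \<in> \<rat> \<Longrightarrow> \<tau> q = q"
  shows "restrict \<tau> (splitting_carrier f) \<in> galois_group f"
proof -
  note h = hom_onD[OF \<tau>(1)]
  have sub: "splitting_carrier f \<subseteq> A" by (rule splitting_carrier_alg_min[OF A])
  have QA: "\<rat> \<subseteq> A" using A by (auto simp: alg_field_def)
  have invA: "inverse x \<in> A" if "x \<in> A" for x using alg_field_inverse[OF A(1) that] .
  have inj: "inj_on \<tau> A" using hom_on_inj[OF \<tau>(1)] invA by blast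
  have invK: "inverse x \<in> splitting_carrier f" if "x \<in> splitting_carrier f" for x using alg_field_inverse[OF splitting_carrier_alg_field[OF f] that] .
  have roots: "\<tau> \<alpha> \<in> complex_roots f" if "\<alpha> \<in> complex_roots f" for \<alpha>
  proof -
    have "poly (cpoly f) (\<tau> \<alpha>) = \<tau> (poly (cpoly f) \<alpha>)"
      using hom_on_rat_poly[OF \<tau>(1) QA \<tau>(2)] that A(2) by (metis subsetD)
    then show ?thesis using that h(2) by (simp add: complex_roots_def)
  qed
  \<comment> \<open>Injectivity on a finite set gives surjectivity on the roots, and from there
    surjectivity on the field.\<close>
  have "\<tau> ` complex_roots f = complex_roots f"
    using roots finite_complex_roots[OF f] inj A(2)
    by (metis card_image card_subset_eq image_subsetI inj_on_subset)
  note rootseq = this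
  have K1: "splitting_carrier f \<subseteq> {x \<in> splitting_carrier f. \<tau> x \<in> splitting_carrier f}"
  proof (rule splitting_carrier_minimal)
    show "subring_set {x \<in> splitting_carrier f. \<tau> x \<in> splitting_carrier f}"
      unfolding subring_set_def using splitting_carrier_subring[of f] sub h hom_on_minus[OF \<tau>(1)]
      by (auto simp: subring_setD subsetD)
    fix x assume "x \<in> {x \<in> splitting_carrier f. \<tau> x \<in> splitting_carrier f}"
    then show "inverse x \<in> {x \<in> splitting_carrier f. \<tau> x \<in> splitting_carrier f}"
      using invK hom_on_inverse[OF \<tau>(1)] sub invA by auto
  qed (use splitting_carrier_base \<tau>(2) roots in auto)
  have K2: "splitting_carrier f \<subseteq> \<tau> ` splitting_carrier f"
  proof (rule splitting_carrier_minimal)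
    show "subring_set (\<tau> ` splitting_carrier f)"
      unfolding subring_set_def
    proof (intro conjI ballI)
      show "0 \<in> \<tau> ` splitting_carrier f" using h(2) splitting_carrier_subring[of f] by (metis imageI subring_setD(1))
      show "1 \<in> \<tau> ` splitting_carrier f" using h(3) splitting_carrier_subring[of f] by (metis imageI subring_setD(2))
      fix x assume "x \<in> \<tau> ` splitting_carrier f"
      then obtain u where u: "u \<in> splitting_carrier f" "x = \<tau> u" by blast
      show "- x \<in> \<tau> ` splitting_carrier f"
        using u hom_on_minus[OF \<tau>(1), of u] sub subring_setD(3)[OF splitting_carrier_subring] by (metis imageI subsetD)
      fix y assume "y \<in> \<tau> ` splitting_carrier f"
      then obtain v where v: "v \<in> splitting_carrier f" "y = \<tau> v" by blast
      have "u \<in> A" "v \<in> A" using u v sub by auto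
      then have "\<tau> (u + v) = x + y" "\<tau> (u * v) = x * y" using h(4,5)[of u v] u v by simp_all
      then show "x + y \<in> \<tau> ` splitting_carrier f" "x * y \<in> \<tau> ` splitting_carrier f"
        using subring_setD(4,5)[OF splitting_carrier_subring u(1) v(1)] by (metis imageI)+
    qed
    fix x assume "x \<in> \<tau> ` splitting_carrier f"
    then obtain u where u: "u \<in> splitting_carrier f" "x = \<tau> u" by blast
    then have "inverse x = \<tau> (inverse u)" using hom_on_inverse[OF \<tau>(1)] sub invA by auto
    then show "inverse x \<in> \<tau> ` splitting_carrier f" using invK u by auto
  next
    show "\<rat> \<subseteq> \<tau> ` splitting_carrier f" using splitting_carrier_base(1) \<tau>(2) by (metis imageI subsetI)
    show "complex_roots f \<subseteq> \<tau> ` splitting_carrier f" using rootseq splitting_carrier_base(2) by (metis image_mono subsetI)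
  qed
  have "bij_betw (restrict \<tau> (splitting_carrier f)) (splitting_carrier f) (splitting_carrier f)"
    using K1 K2 inj_on_subset[OF inj sub] by (auto simp: bij_betw_def inj_on_def)
  then show ?thesis
    unfolding galois_group_def ring_iso_def Ring.ring_hom_def carrier_splitting_field splitting_field_simps
    using K1 h sub splitting_carrier_base(1) \<tau>(2) splitting_carrier_subring[of f] by (auto simp: subring_setD subsetD)
qed

lemma galois_groupD:
  assumes "f \<noteq> 0" "\<sigma> \<in> galois_group f"
  shows "hom_on (splitting_carrier f) \<sigma>" "\<And>q. q \<in> \<rat> \<Longrightarrow> \<sigma> q = q" "bij_betw \<sigma> (splitting_carrier f) (splitting_carrier f)"
    "\<And>\<alpha>. \<alpha> \<in> complex_roots f \<Longrightarrow> \<sigma> \<alpha> \<in> complex_roots f"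
    "bij_betw \<sigma> (complex_roots f) (complex_roots f)"
proof -
  have \<sigma>: "\<And>x y. x \<in> splitting_carrier f \<Longrightarrow> y \<in> splitting_carrier f \<Longrightarrow> \<sigma> (x + y) = \<sigma> x + \<sigma> y \<and> \<sigma> (x * y) = \<sigma> x * \<sigma> y"
    "\<sigma> 1 = 1"
    using assms(2) unfolding galois_group_def ring_iso_def Ring.ring_hom_def carrier_splitting_field splitting_field_simps
    by auto
  show Q: "\<And>q. q \<in> \<rat> \<Longrightarrow> \<sigma> q = q" using assms(2) unfolding galois_group_def by auto
  show bij: "bij_betw \<sigma> (splitting_carrier f) (splitting_carrier f)"
    using assms(2) unfolding galois_group_def ring_iso_def carrier_splitting_field by auto
  show hom: "hom_on (splitting_carrier f) \<sigma>" using \<sigma> Q[of 0] splitting_carrier_subring by (auto simp: hom_on_def)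
  show roots: "\<sigma> \<alpha> \<in> complex_roots f" if "\<alpha> \<in> complex_roots f" for \<alpha>
  proof -
    have "poly (cpoly f) (\<sigma> \<alpha>) = \<sigma> (poly (cpoly f) \<alpha>)"
      using hom_on_rat_poly[OF hom _ Q] that splitting_carrier_base by (metis subsetI)
    then show ?thesis using that hom_onD(2)[OF hom] by (simp add: complex_roots_def)
  qed
  have inj: "inj_on \<sigma> (complex_roots f)"
    using bij splitting_carrier_base(2) by (meson bij_betw_imp_inj_on inj_on_subset subsetI)
  then show "bij_betw \<sigma> (complex_roots f) (complex_roots f)"
    unfolding bij_betw_def using roots endo_inj_surj[OF finite_complex_roots[OF assms(1)] _ inj] by blast
qed

text \<open>An irrational \<open>x\<close> is moved by some embedding of a field containing all the
  roots, and the restriction of that embedding is an element of the Galois group.\<close>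

lemma fixed_field:
  assumes f: "f \<noteq> 0" and x: "x \<in> splitting_carrier f" "\<And>\<sigma>. \<sigma> \<in> galois_group f \<Longrightarrow> \<sigma> x = x"
  shows "x \<in> \<rat>"
proof (rule ccontr)
  assume nx: "x \<notin> \<rat>"
  have "algebraic x" using splitting_carrier_alg_field[OF f] x by (auto simp: alg_field_def)
  then obtain A \<tau> where A: "alg_field A" "hom_on A \<tau>" "complex_roots f \<subseteq> A" "\<tau> x \<noteq> x" "\<And>q. q \<in> \<rat> \<Longrightarrow> \<tau> q = q"
    using move_irrational[OF _ nx finite_complex_roots[OF f] complex_roots_algebraic[OF f]] by metis
  have "restrict \<tau> (splitting_carrier f) \<in> galois_group f" by (rule restrict_galois_group[OF f A(1,3,2,5)])
  then show False using x A(4) by force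
qed

lemma galois_perms_perm_group:
  assumes f: "f \<noteq> 0" shows "perm_group (galois_perms f) (complex_roots f)"
proof -
  let ?R = "complex_roots f"
  have perm: "g permutes ?R" if g: "g \<in> galois_perms f" for g
  proof -
    obtain \<sigma> where \<sigma>: "\<sigma> \<in> galois_group f" "g = perm_restrict \<sigma> ?R" using g by (auto simp: galois_perms_def)
    have "bij_betw g ?R ?R"
      using galois_groupD(5)[OF f \<sigma>(1)] unfolding \<sigma>(2) by (rule bij_betw_cong[THEN iffD1, rotated]) (simp add: perm_restrict_def)
    then show ?thesis by (rule bij_imp_permutes) (simp add: \<sigma>(2) perm_restrict_def)
  qed
  have idm: "id \<in> galois_perms f"
  proof -
    have "hom_on (splitting_carrier f) id" using splitting_carrier_subring by (auto simp: hom_on_def)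
    then have "restrict id (splitting_carrier f) \<in> galois_group f"
      by (intro restrict_galois_group[OF f splitting_carrier_alg_field[OF f]]) (auto intro: splitting_carrier_base)
    moreover have "id = perm_restrict (restrict id (splitting_carrier f)) ?R"
      using splitting_carrier_base(2) by (auto simp: perm_restrict_def fun_eq_iff)
    ultimately show ?thesis unfolding galois_perms_def by blast
  qed
  have comp: "g \<circ> h \<in> galois_perms f" if gh: "g \<in> galois_perms f" "h \<in> galois_perms f" for g h
  proof -
    obtain \<sigma> \<tau> where \<sigma>: "\<sigma> \<in> galois_group f" "g = perm_restrict \<sigma> ?R" and \<tau>: "\<tau> \<in> galois_group f" "h = perm_restrict \<tau> ?R"
      using gh by (auto simp: galois_perms_def)
    note S = galois_groupD[OF f \<sigma>(1)] and T = galois_groupD[OF f \<tau>(1)]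
    have TK: "\<tau> x \<in> splitting_carrier f" if "x \<in> splitting_carrier f" for x using T(3) that by (auto simp: bij_betw_def)
    have "hom_on (splitting_carrier f) (\<sigma> \<circ> \<tau>)"
      unfolding hom_on_def using hom_onD[OF S(1)] hom_onD[OF T(1)] TK by auto
    then have "restrict (\<sigma> \<circ> \<tau>) (splitting_carrier f) \<in> galois_group f"
      by (intro restrict_galois_group[OF f splitting_carrier_alg_field[OF f]]) (auto intro: splitting_carrier_base simp: S(2) T(2))
    moreover have "g \<circ> h = perm_restrict (restrict (\<sigma> \<circ> \<tau>) (splitting_carrier f)) ?R"
      using splitting_carrier_base(2) T(4) by (auto simp: perm_restrict_def fun_eq_iff \<sigma>(2) \<tau>(2))
    ultimately show ?thesis unfolding galois_perms_def by blast
  qed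
  have "inv g \<in> galois_perms f" if g: "g \<in> galois_perms f" for g
  proof -
    \<comment> \<open>Inverses are obtained as powers, because the permutation has finite
      order.\<close>
    have pow: "g ^^ k \<in> galois_perms f" for k
    proof (induction k)
      case 0 show ?case using idm by (simp only: funpow.simps(1))
    next
      case (Suc k) show ?case using comp[OF g Suc] by (simp only: funpow.simps(2))
    qed
    have "permutation g" using perm[OF g] finite_complex_roots[OF f] permutation_permutes by blast
    then obtain m where m: "g ^^ m = id" "m > 0" using permutation_is_nilpotent by blast
    then have "g \<circ> g ^^ (m - 1) = id" by (cases m) auto
    then have "inv g = g ^^ (m - 1)" using perm[OF g] by (metis inv_o_cancel o_assoc permutes_inj id_o o_id comp_id)
    then show ?thesis using pow by simp
  qed
  then show ?thesis using finite_complex_roots[OF f] idm perm comp by unfold_locales auto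
qed

section \<open>A place above a prime\<close>

abbreviation AI :: "complex set" where "AI \<equiv> {x. algebraic_int x}"

lemma AI_subring: "subring_set AI"
  by (auto simp: subring_set_def algebraic_int_add_mult)

definition ideal_set :: "complex set \<Rightarrow> bool" where
  "ideal_set I \<longleftrightarrow> I \<subseteq> AI \<and> 0 \<in> I \<and> (\<forall>x\<in>I. \<forall>y\<in>I. x + y \<in> I) \<and> (\<forall>x\<in>I. \<forall>a\<in>AI. x * a \<in> I)"

text \<open>A prime ideal above \<open>p\<close> in the ring of all algebraic integers, not of one
  number field: a single choice serves every splitting field.\<close>

locale prime_place = prime_modulus +
  fixes P :: "complex set"
  assumes ideal: "ideal_set P"
    and p_mem: "of_nat p \<in> P"
    and one_notin: "1 \<notin> P"
    and prime_ideal: "a \<in> AI \<Longrightarrow> b \<in> AI \<Longrightarrow> a * b \<in> P \<Longrightarrow> a \<in> P \<or> b \<in> P"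

text \<open>Zorn's lemma for the ideals that contain \<open>p\<close> but not 1. The ideal generated
  by \<open>p\<close> is one of them, because \<open>1 / p\<close> is rational and not an integer,
  hence not an algebraic integer. A maximal one is prime.\<close>

lemma (in prime_modulus) ex_prime_place: "\<exists>P. prime_place p P"
proof -
  define C where "C = {I. ideal_set I \<and> of_nat p \<in> I \<and> 1 \<notin> I}"
  define I0 where "I0 = (\<lambda>a. of_nat p * a) ` AI"
  have p0: "(of_nat p :: complex) \<noteq> 0" using p2 by simp
  have "1 \<notin> I0"
  proof
    assume "1 \<in> I0"
    then obtain a where a': "1 = of_nat p * a" "a \<in> AI" unfolding I0_def by (rule imageE)
    then have a: "algebraic_int a" "of_nat p * a = 1" by simp_all
    then have "a = 1 / of_nat p" using p0 by (simp add: field_simps)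
    then have "a \<in> \<rat>" by simp
    then have "a \<in> \<int>" using a(1) by (intro rational_algebraic_int_is_int)
    then obtain z where "a = of_int z" by (elim Ints_cases)
    then have "of_int (int p * z) = (1::complex)" using a by simp
    then have "int p * z = 1" by (simp only: of_int_eq_1_iff)
    then show False using p2 pos_zmult_eq_1_iff[of "int p" z] by auto
  qed
  moreover have "ideal_set I0"
    unfolding ideal_set_def
  proof (intro conjI ballI subsetI)
    fix x assume "x \<in> I0"
    then obtain a where a: "algebraic_int a" "x = of_nat p * a" by (auto simp: I0_def)
    then show "x \<in> AI" by (auto intro: algebraic_int_add_mult)
    fix b assume "b \<in> AI"
    then have "algebraic_int (a * b)" using a by (auto intro: algebraic_int_add_mult)
    then show "x * b \<in> I0" using a unfolding I0_def by (intro image_eqI[of _ _ "a * b"]) auto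
  next
    fix x y assume "x \<in> I0" "y \<in> I0"
    then obtain a b where a: "algebraic_int a" "x = of_nat p * a" "algebraic_int b" "y = of_nat p * b"
      by (auto simp: I0_def)
    then have "algebraic_int (a + b)" by (auto intro: algebraic_int_add_mult)
    then show "x + y \<in> I0" using a unfolding I0_def by (intro image_eqI[of _ _ "a + b"]) (auto simp: algebra_simps)
  qed (auto simp: I0_def)
  moreover have "of_nat p \<in> I0" unfolding I0_def by (intro image_eqI[of _ _ 1]) auto
  ultimately have "C \<noteq> {}" by (auto simp: C_def)
  have "\<exists>M\<in>C. \<forall>J\<in>C. M \<subseteq> J \<longrightarrow> J = M"
  proof (rule subset_Zorn_nonempty[OF \<open>C \<noteq> {}\<close>])
    fix \<C> assume c: "\<C> \<noteq> {}" "subset.chain C \<C>"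
    then have sub: "\<And>I. I \<in> \<C> \<Longrightarrow> I \<in> C" and lin: "\<And>I J. I \<in> \<C> \<Longrightarrow> J \<in> \<C> \<Longrightarrow> I \<subseteq> J \<or> J \<subseteq> I"
      by (auto simp: subset_chain_def)
    have "ideal_set (\<Union>\<C>)"
      unfolding ideal_set_def
    proof (intro conjI ballI subsetI)
      show "0 \<in> \<Union>\<C>" using c(1) sub by (fastforce simp: C_def ideal_set_def)
      fix x assume "x \<in> \<Union>\<C>"
      then obtain I where I: "I \<in> \<C>" "x \<in> I" by blast
      then have iI: "ideal_set I" using sub by (auto simp: C_def)
      then show "x \<in> AI" using I by (auto simp: ideal_set_def)
      fix y
      { assume "y \<in> AI" then have "x * y \<in> I" using I iI by (auto simp: ideal_set_def)
        then show "x * y \<in> \<Union>\<C>" using I(1) by blast }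
      assume "y \<in> \<Union>\<C>"
      then obtain J where J: "J \<in> \<C>" "y \<in> J" by blast
      then have iJ: "ideal_set J" using sub by (auto simp: C_def)
      from lin[OF I(1) J(1)] show "x + y \<in> \<Union>\<C>"
        using I J iI iJ unfolding ideal_set_def by (metis UnionI subsetD)
    qed
    then show "\<Union>\<C> \<in> C" using sub c(1) by (auto simp: C_def)
  qed
  then obtain M where M: "M \<in> C" "\<And>J. J \<in> C \<Longrightarrow> M \<subseteq> J \<Longrightarrow> J = M" by blast
  have iM: "ideal_set M" "of_nat p \<in> M" "1 \<notin> M" using M(1) by (auto simp: C_def)
  have "a \<in> M \<or> b \<in> M" if a: "a \<in> AI" and b: "b \<in> AI" and ab: "a * b \<in> M" for a b
  proof (rule disj_imp[THEN iffD2, OF impI])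
    assume na: "a \<notin> M"
    \<comment> \<open>The ideal generated by \<open>M\<close> and \<open>a\<close>, which contains 1
      by maximality of \<open>M\<close>.\<close>
    define J where "J = {c + a * d | c d. c \<in> M \<and> d \<in> AI}"
    have "ideal_set J"
      unfolding ideal_set_def
    proof (intro conjI ballI subsetI)
      show "0 \<in> J" unfolding J_def using iM(1) by (auto simp: ideal_set_def intro!: exI[of _ 0])
      fix x assume "x \<in> J"
      then obtain c d where x: "x = c + a * d" "c \<in> M" "d \<in> AI" by (auto simp: J_def)
      then show "x \<in> AI" using iM(1) a by (auto simp: ideal_set_def intro!: algebraic_int_add_mult)
      fix y
      { assume "y \<in> AI"
        then have "c * y \<in> M" "d * y \<in> AI" "x * y = c * y + a * (d * y)"
          using x iM(1) by (auto simp: ideal_set_def algebra_simps intro: algebraic_int_add_mult)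
        then show "x * y \<in> J" unfolding J_def by blast }
      assume "y \<in> J"
      then obtain c' d' where y: "y = c' + a * d'" "c' \<in> M" "d' \<in> AI" by (auto simp: J_def)
      have "x + y = (c + c') + a * (d + d')" "c + c' \<in> M" "d + d' \<in> AI"
        using x y iM(1) by (auto simp: ideal_set_def algebra_simps intro: algebraic_int_add_mult)
      then show "x + y \<in> J" unfolding J_def by blast
    qed
    moreover have MJ: "M \<subseteq> J"
    proof
      fix c assume "c \<in> M"
      then show "c \<in> J" unfolding J_def by (intro CollectI exI[of _ c] exI[of _ 0]) auto
    qed
    moreover have "a \<in> J" unfolding J_def using iM(1)
      by (intro CollectI exI[of _ 0] exI[of _ 1]) (auto simp: ideal_set_def)
    ultimately have "1 \<in> J" using M(2)[of J] na iM(2) by (auto simp: C_def)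
    then obtain c d where cd: "1 = c + a * d" "c \<in> M" "d \<in> AI" by (auto simp: J_def)
    have "b = b * (c + a * d)" using cd(1) by simp
    also have "\<dots> = c * b + (a * b) * d" by (simp add: algebra_simps)
    also have "\<dots> \<in> M"
    proof -
      have "c * b \<in> M" "(a * b) * d \<in> M" using iM(1) cd b ab unfolding ideal_set_def by blast+
      then show ?thesis using iM(1) unfolding ideal_set_def by blast
    qed
    finally show "b \<in> M" .
  qed
  then have "prime_place p M" using iM by unfold_locales auto
  then show ?thesis by blast
qed

section \<open>Congruence modulo p and the p-th power map\<close>

context prime_modulus
begin

text \<open>Congruence modulo the ideal generated by \<open>p\<close> in an arbitrary subring
  \<open>S\<close>, since it is needed for integers, for algebraic integers and for polynomials over
  the latter.\<close>

definition cgp :: "'a::comm_ring_1 set \<Rightarrow> 'a \<Rightarrow> 'a \<Rightarrow> bool" where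
  "cgp S u v \<longleftrightarrow> (\<exists>s\<in>S. u - v = of_nat p * s)"

lemma cgp_refl: "subring_set S \<Longrightarrow> cgp S u u"
  unfolding cgp_def by (intro bexI[of _ 0]) (auto simp: subring_setD)

lemma cgp_sym: "subring_set S \<Longrightarrow> cgp S u v \<Longrightarrow> cgp S v u"
  unfolding cgp_def by (metis minus_diff_eq mult_minus_right subring_setD(3))

lemma cgp_trans: "subring_set S \<Longrightarrow> cgp S u v \<Longrightarrow> cgp S v w \<Longrightarrow> cgp S u w"
proof -
  assume S: "subring_set S" and "cgp S u v" "cgp S v w"
  then obtain s t where st: "s \<in> S" "t \<in> S" "u - v = of_nat p * s" "v - w = of_nat p * t" by (auto simp: cgp_def)
  have "u - w = (u - v) + (v - w)" by simp
  also have "\<dots> = of_nat p * (s + t)" unfolding st(3,4) by (simp add: distrib_left)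
  finally show ?thesis using st S by (auto simp: cgp_def subring_setD)
qed

lemma cgp_add: "subring_set S \<Longrightarrow> cgp S u v \<Longrightarrow> cgp S u' v' \<Longrightarrow> cgp S (u + u') (v + v')"
proof -
  assume S: "subring_set S" and "cgp S u v" "cgp S u' v'"
  then obtain s t where st: "s \<in> S" "t \<in> S" "u - v = of_nat p * s" "u' - v' = of_nat p * t" by (auto simp: cgp_def)
  have "(u + u') - (v + v') = (u - v) + (u' - v')" by simp
  also have "\<dots> = of_nat p * (s + t)" unfolding st(3,4) by (simp add: distrib_left)
  finally show ?thesis using st S by (auto simp: cgp_def subring_setD)
qed

lemma cgp_mult:
  assumes S: "subring_set S" and "cgp S u v" "cgp S u' v'" "u' \<in> S" "v \<in> S"
  shows "cgp S (u * u') (v * v')"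
proof -
  obtain s t where st: "s \<in> S" "t \<in> S" "u - v = of_nat p * s" "u' - v' = of_nat p * t"
    using assms by (auto simp: cgp_def)
  have "u * u' - v * v' = (u - v) * u' + v * (u' - v')" by (simp add: algebra_simps)
  also have "\<dots> = of_nat p * (s * u' + v * t)" unfolding st(3,4) by (simp add: algebra_simps)
  finally show ?thesis using st assms by (auto simp: cgp_def subring_setD)
qed

lemma cgp_sum:
  assumes S: "subring_set S" and "\<And>i. i \<in> I \<Longrightarrow> cgp S (f i) (g i)"
  shows "cgp S (sum f I) (sum g I)"
  using assms(2) by (induction I rule: infinite_finite_induct) (auto intro: cgp_refl[OF S] cgp_add[OF S])

lemma cgp_power:
  assumes S: "subring_set S" and "cgp S u v" "u \<in> S" "v \<in> S"
  shows "cgp S (u ^ n) (v ^ n)"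
proof (induction n)
  case (Suc n)
  then show ?case using cgp_mult[OF S assms(2) Suc] assms subring_power[OF S] by simp
qed (simp add: cgp_refl[OF S])

lemma p_dvd_choose: "0 < k \<Longrightarrow> k < p \<Longrightarrow> p dvd (p choose k)"
proof -
  assume k: "0 < k" "k < p"
  then obtain k' where k': "k = Suc k'" by (cases k) auto
  have "k * (p choose k) = p * ((p - 1) choose k')" unfolding k' by (rule binomial_absorption)
  then have "p dvd k * (p choose k)" by simp
  then have "p dvd k \<or> p dvd (p choose k)" using prime_p prime_dvd_mult_iff by blast
  then show ?thesis using k by (auto dest: dvd_imp_le)
qed

lemma freshman2:
  assumes S: "subring_set S" and x: "x \<in> S" and y: "y \<in> S"
  shows "cgp S ((x + y) ^ p) (x ^ p + y ^ p)"
proof -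
  define s where "s = (\<Sum>k\<in>{1..<p}. of_nat ((p choose k) div p) * x ^ k * y ^ (p - k))"
  have "{..p} = insert 0 (insert p {1..<p})" using p2 by auto
  then have "(x + y) ^ p = y ^ p + (x ^ p + (\<Sum>k\<in>{1..<p}. of_nat (p choose k) * x ^ k * y ^ (p - k)))"
    unfolding binomial_ring using p2 by simp
  also have "(\<Sum>k\<in>{1..<p}. of_nat (p choose k) * x ^ k * y ^ (p - k)) = of_nat p * s"
    unfolding s_def sum_distrib_left
  proof (rule sum.cong[OF refl])
    fix k assume "k \<in> {1..<p}"
    then have "p choose k = p * ((p choose k) div p)" using p_dvd_choose[of k] by auto
    then have "(of_nat (p choose k) :: 'a) = of_nat p * of_nat ((p choose k) div p)" by (metis of_nat_mult)
    then show "of_nat (p choose k) * x ^ k * y ^ (p - k) = of_nat p * (of_nat ((p choose k) div p) * x ^ k * y ^ (p - k))"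
      by (simp add: mult.assoc)
  qed
  finally have "(x + y) ^ p - (x ^ p + y ^ p) = of_nat p * s" by simp
  moreover have "s \<in> S"
    unfolding s_def using x y subring_of_int[OF S, of "int _"]
    by (intro subring_sum[OF S] subring_setD(5)[OF S] subring_power[OF S]) auto
  ultimately show ?thesis by (auto simp: cgp_def)
qed

lemma freshman_sum:
  assumes S: "subring_set S" and "\<And>i. i \<in> I \<Longrightarrow> f i \<in> S"
  shows "cgp S ((sum f I) ^ p) (\<Sum>i\<in>I. f i ^ p)"
  using assms(2)
proof (induction I rule: infinite_finite_induct)
  case (insert x F)
  have "cgp S ((f x + sum f F) ^ p) (f x ^ p + sum f F ^ p)"
    using insert.prems by (intro freshman2[OF S] subring_sum[OF S]) auto
  moreover have "cgp S (f x ^ p + sum f F ^ p) (f x ^ p + (\<Sum>i\<in>F. f i ^ p))"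
    using insert by (intro cgp_add[OF S] cgp_refl[OF S]) auto
  ultimately have "cgp S ((f x + sum f F) ^ p) (f x ^ p + (\<Sum>i\<in>F. f i ^ p))" by (rule cgp_trans[OF S])
  then show ?case by (simp only: sum.insert[OF insert.hyps])
next
  case (infinite A)
  have "(0 :: 'a) ^ p = 0" using p2 by (simp add: zero_power)
  then show ?case using infinite.hyps cgp_refl[OF S, of 0] by simp
next
  case empty
  have "(0 :: 'a) ^ p = 0" using p2 by (simp add: zero_power)
  then show ?case using cgp_refl[OF S, of 0] by simp
qed

text \<open>Expanding \<open>(x + - x) ^ p = 0\<close> treats odd \<open>p\<close> and
  \<open>p = 2\<close> alike.\<close>

lemma freshman_minus:
  assumes S: "subring_set S" and x: "x \<in> S" shows "cgp S ((- x) ^ p) (- (x ^ p))"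
proof -
  have "- x \<in> S" using x subring_setD(3)[OF S] by blast
  then have "cgp S ((x + - x) ^ p) (x ^ p + (- x) ^ p)" by (rule freshman2[OF S x])
  moreover have "(x + - x) ^ p = 0" using p2 by (simp add: zero_power)
  ultimately have "cgp S 0 (x ^ p + (- x) ^ p)" by (simp only:)
  then obtain t where "t \<in> S" "0 - (x ^ p + (- x) ^ p) = of_nat p * t" by (auto simp: cgp_def)
  then have "- t \<in> S" "(- x) ^ p - - (x ^ p) = of_nat p * - t"
    using subring_setD(3)[OF S] by (auto simp: algebra_simps)
  then show ?thesis unfolding cgp_def by blast
qed

lemma fermat_cgp:
  assumes S: "subring_set S" shows "cgp S (of_int k ^ p) (of_int k)"
proof -
  have n: "cgp S (of_nat n ^ p) (of_nat n)" for n
  proof (induction n)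
    case 0 then show ?case using p2 by (simp add: zero_power cgp_refl[OF S])
  next
    case (Suc n)
    have "of_nat n \<in> S" using subring_of_int[OF S, of "int n"] by simp
    then have "cgp S ((of_nat n + 1) ^ p) (of_nat n ^ p + 1 ^ p)" by (intro freshman2[OF S]) (auto simp: subring_setD[OF S])
    moreover have "cgp S (of_nat n ^ p + 1 ^ p) (of_nat n + 1)" using Suc by (intro cgp_add[OF S]) (auto simp: cgp_refl[OF S])
    ultimately show ?case using cgp_trans[OF S] by (metis add.commute of_nat_Suc)
  qed
  show ?thesis
  proof (cases "k \<ge> 0")
    case True
    then obtain n where "k = int n" using nonneg_eq_int by blast
    then show ?thesis using n[of n] by simp
  next
    case False
    then obtain n where k: "k = - int n" by (metis int_cases2 linorder_not_le of_nat_0_le_iff)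
    have nS: "of_nat n \<in> S" using subring_of_int[OF S, of "int n"] by simp
    have "cgp S (- (of_nat n ^ p)) (- of_nat n)"
      using n[of n] unfolding cgp_def by (metis (no_types, lifting) S minus_diff_minus mult_minus_right subring_setD(3))
    then show ?thesis using freshman_minus[OF S nS] cgp_trans[OF S] by (simp add: k)
  qed
qed

definition inflate :: "'a::comm_ring_1 poly \<Rightarrow> 'a poly" where
  "inflate q = pcompose q (Polynomial.monom 1 p)"

lemma inflate_eq: "inflate q = (\<Sum>i\<le>pdeg q. Polynomial.monom (pcf q i) (p * i))"
proof -
  have "[:c:] * Polynomial.monom 1 p ^ i = Polynomial.monom c (p * i)" for c :: 'a and i
    by (simp add: monom_power smult_monom mult.commute)
  then show ?thesis
    unfolding inflate_def pcompose_altdef poly_altdef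
    by (simp add: degree_map_poly coeff_map_poly)
qed

lemma coeff_inflate: "pcf (inflate q) (p * i) = pcf q i"
proof -
  have "pcf (inflate q) (p * i) = (\<Sum>j\<le>pdeg q. if j = i then pcf q j else 0)"
    unfolding inflate_eq coeff_sum using p2 by (intro sum.cong) auto
  also have "\<dots> = pcf q i" by (auto simp: sum.delta coeff_eq_0)
  finally show ?thesis .
qed

lemma inflate_hom: "inflate (f + g) = inflate f + inflate g" "inflate (f * g) = inflate f * inflate g" "inflate (f - g) = inflate f - inflate g"
  "inflate (sum h I) = (\<Sum>i\<in>I. inflate (h i))" "inflate (prod h I) = (\<Prod>i\<in>I. inflate (h i))" "inflate (of_nat k) = of_nat k"
proof -
  show "inflate (of_nat k) = of_nat k" by (simp add: inflate_def of_nat_poly)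
qed (simp_all add: inflate_def pcompose_add pcompose_mult pcompose_diff pcompose_sum pcompose_prod)

lemma inflate_power: "inflate (f ^ n) = inflate f ^ n"
  by (induction n) (auto simp: inflate_hom inflate_def pcompose_1 pcompose_mult)

lemma inflate_over: "subring_set S \<Longrightarrow> q \<in> polys_over S \<Longrightarrow> inflate q \<in> polys_over S"
  unfolding inflate_eq polys_over_def by (auto simp: coeff_sum subring_setD intro!: subring_sum)

lemma monom_over: "subring_set S \<Longrightarrow> c \<in> S \<Longrightarrow> Polynomial.monom c i \<in> polys_over S"
  by (auto simp: polys_over_def subring_setD)

text \<open>Modulo \<open>p\<close> the p-th power of a sum of monomials is the sum of their p-th
  powers, which raises the coefficients to the power \<open>p\<close> and substitutes X^p for
  X.\<close>

lemma power_cgp_inflate: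
  assumes S: "subring_set S" and q: "q \<in> polys_over S"
  shows "cgp (polys_over S) (q ^ p) (inflate (map_poly (\<lambda>c. c ^ p) q))"
proof -
  have qs: "q = (\<Sum>i\<le>pdeg q. Polynomial.monom (pcf q i) i)" by (simp add: poly_as_sum_of_monoms)
  have "cgp (polys_over S) ((\<Sum>i\<le>pdeg q. Polynomial.monom (pcf q i) i) ^ p)
     (\<Sum>i\<le>pdeg q. Polynomial.monom (pcf q i) i ^ p)"
    using q by (intro freshman_sum polys_over_subring S monom_over) (auto simp: polys_over_def)
  also have "(\<Sum>i\<le>pdeg q. Polynomial.monom (pcf q i) i ^ p) = inflate (map_poly (\<lambda>c. c ^ p) q)"
  proof -
    have z: "(0::'a) ^ p = 0" using p2 by (simp add: zero_power)
    have "inflate (map_poly (\<lambda>c. c ^ p) q) = (\<Sum>i\<le>pdeg (map_poly (\<lambda>c. c ^ p) q). Polynomial.monom (pcf q i ^ p) (p * i))"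
      unfolding inflate_eq by (simp add: coeff_map_poly z)
    also have "\<dots> = (\<Sum>i\<le>pdeg q. Polynomial.monom (pcf q i ^ p) (p * i))"
    proof (rule sum.mono_neutral_left)
      show "\<forall>i\<in>{..pdeg q} - {..pdeg (map_poly (\<lambda>c. c ^ p) q)}. Polynomial.monom (pcf q i ^ p) (p * i) = 0"
      proof
        fix i assume "i \<in> {..pdeg q} - {..pdeg (map_poly (\<lambda>c. c ^ p) q)}"
        then have "pcf (map_poly (\<lambda>c. c ^ p) q) i = 0" by (intro coeff_eq_0) auto
        then show "Polynomial.monom (pcf q i ^ p) (p * i) = 0" by (simp add: coeff_map_poly z)
      qed
    qed (auto simp: degree_map_poly_le)
    finally show ?thesis by (simp add: monom_power mult.commute)
  qed
  finally show ?thesis by (simp only: qs[symmetric])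
qed

lemma cgp_inflate:
  assumes S: "subring_set S" and "cgp (polys_over S) u v"
  shows "cgp (polys_over S) (inflate u) (inflate v)"
proof -
  obtain s where s: "s \<in> polys_over S" "u - v = of_nat p * s" using assms(2) by (auto simp: cgp_def)
  then have "inflate u - inflate v = of_nat p * inflate s" by (metis inflate_hom(2,3,6))
  then show ?thesis using inflate_over[OF S s(1)] by (auto simp: cgp_def)
qed

lemma cgp_polyI:
  assumes "\<And>i. cgp S (pcf u i) (pcf v i)" and S: "subring_set S"
  shows "cgp (polys_over S) u v"
proof -
  obtain s where s: "\<And>i. s i \<in> S" "\<And>i. pcf u i - pcf v i = of_nat p * s i" using assms(1) unfolding cgp_def by metis
  define n where "n = max (pdeg u) (pdeg v)"
  define t where "t = (\<Sum>i\<le>n. Polynomial.monom (s i) i)"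
  have ct: "pcf t i = (if i \<le> n then s i else 0)" for i
  proof -
    have "pcf t i = (\<Sum>j\<le>n. if j = i then s j else 0)" by (simp add: t_def coeff_sum)
    then show ?thesis by (simp add: sum.delta)
  qed
  have "u - v = of_nat p * t"
  proof (rule poly_eqI)
    fix i
    have "pcf (of_nat p * t) i = of_nat p * pcf t i" by (simp add: of_nat_poly)
    also have "\<dots> = pcf u i - pcf v i"
      using s(2)[of i] by (auto simp: ct n_def coeff_eq_0)
    finally show "pcf (u - v) i = pcf (of_nat p * t) i" by simp
  qed
  moreover have "t \<in> polys_over S" using s(1) S by (auto simp: polys_over_def ct subring_setD)
  ultimately show ?thesis by (auto simp: cgp_def)
qed

end

section \<open>Arithmetic modulo the prime ideal\<close>

context prime_place
begin

lemma P_0: "0 \<in> P" and P_add: "x \<in> P \<Longrightarrow> y \<in> P \<Longrightarrow> x + y \<in> P"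
  and P_mult: "x \<in> P \<Longrightarrow> a \<in> AI \<Longrightarrow> x * a \<in> P" "x \<in> P \<Longrightarrow> a \<in> AI \<Longrightarrow> a * x \<in> P"
  using ideal by (auto simp: ideal_set_def mult.commute[of a x])

lemma P_minus: "x \<in> P \<Longrightarrow> - x \<in> P"
  using P_mult(1)[of x "-1"] by auto

lemma P_diff: "x \<in> P \<Longrightarrow> y \<in> P \<Longrightarrow> x - y \<in> P"
  using P_add[of x "- y"] P_minus by simp

lemma P_sum: "(\<And>i. i \<in> I \<Longrightarrow> f i \<in> P) \<Longrightarrow> sum f I \<in> P"
  by (induction I rule: infinite_finite_induct) (auto intro: P_0 P_add)

lemma cgp_P: "cgp AI u v \<Longrightarrow> u - v \<in> P"
  unfolding cgp_def using P_mult(1)[OF p_mem] by auto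

lemma of_int_P: "of_int k \<in> P \<longleftrightarrow> int p dvd k"
proof
  assume k: "of_int k \<in> P"
  show "int p dvd k"
  proof (rule ccontr)
    assume "\<not> int p dvd k"
    then have "coprime (int p) k" using prime_p by (metis prime_imp_coprime prime_nat_int_transfer)
    then obtain u v where "u * int p + v * k = 1" by (metis bezout_int coprime_iff_gcd_eq_1)
    then have "of_int u * of_nat p + of_int v * of_int k = (1::complex)"
      by (metis of_int_1 of_int_add of_int_mult of_int_of_nat_eq)
    moreover have "of_int u * of_nat p \<in> P" "of_int v * of_int k \<in> P"
      using P_mult(2)[OF p_mem] P_mult(2)[OF k] by auto
    ultimately show False using P_add one_notin by metis
  qed
next
  assume "int p dvd k"
  then obtain m where "k = int p * m" by blast
  then show "of_int k \<in> P" using P_mult(1)[OF p_mem, of "of_int m"] by simp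
qed

lemma P_prod: "finite I \<Longrightarrow> (\<And>i. i \<in> I \<Longrightarrow> f i \<in> AI) \<Longrightarrow> prod f I \<in> P \<Longrightarrow> \<exists>i\<in>I. f i \<in> P"
proof (induction I rule: finite_induct)
  case (insert x F)
  have "prod f F \<in> AI" using insert by (intro subring_prod[OF AI_subring]) auto
  then show ?case using insert prime_ideal[of "f x" "prod f F"] by auto
qed (use one_notin in auto)

text \<open>Gauss's lemma. Let \<open>i\<close> and \<open>j\<close> be the first indices with a
  coefficient outside \<open>P\<close>; in the product, all terms of degree \<open>i + j\<close>
  except one lie in \<open>P\<close>.\<close>

lemma polys_P_prime:
  assumes u: "u \<in> polys_over AI" and v: "v \<in> polys_over AI" and uv: "u * v \<in> polys_over P"
  shows "u \<in> polys_over P \<or> v \<in> polys_over P"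
proof (rule ccontr)
  assume "\<not> ?thesis"
  then have ex: "\<exists>i. pcf u i \<notin> P" "\<exists>j. pcf v j \<notin> P" by (auto simp: polys_over_def)
  define i where "i = (LEAST i. pcf u i \<notin> P)"
  define j where "j = (LEAST j. pcf v j \<notin> P)"
  have i: "pcf u i \<notin> P" "\<And>k. k < i \<Longrightarrow> pcf u k \<in> P"
    unfolding i_def by (rule LeastI_ex[OF ex(1)], meson not_less_Least)
  have j: "pcf v j \<notin> P" "\<And>k. k < j \<Longrightarrow> pcf v k \<in> P"
    unfolding j_def by (rule LeastI_ex[OF ex(2)], meson not_less_Least)
  have A: "pcf u k \<in> AI" "pcf v k \<in> AI" for k using u v by (auto simp: polys_over_def)
  have "pcf (u * v) (i + j) = (\<Sum>k\<le>i + j. pcf u k * pcf v (i + j - k))" by (simp add: coeff_mult)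
  also have "\<dots> = pcf u i * pcf v j + (\<Sum>k\<in>{..i + j} - {i}. pcf u k * pcf v (i + j - k))"
    by (subst sum.remove[of _ i]) auto
  finally have "pcf u i * pcf v j = pcf (u * v) (i + j) - (\<Sum>k\<in>{..i + j} - {i}. pcf u k * pcf v (i + j - k))"
    by simp
  moreover have "pcf (u * v) (i + j) \<in> P" using uv by (auto simp: polys_over_def)
  moreover have "(\<Sum>k\<in>{..i + j} - {i}. pcf u k * pcf v (i + j - k)) \<in> P"
  proof (rule P_sum)
    fix k assume k: "k \<in> {..i + j} - {i}"
    then consider "k < i" | "i + j - k < j" by (auto simp: nat_neq_iff)
    then show "pcf u k * pcf v (i + j - k) \<in> P" using i(2) j(2) A P_mult by cases auto
  qed
  ultimately have "pcf u i * pcf v j \<in> P" using P_diff by metis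
  then show False using prime_ideal A i(1) j(1) by blast
qed

lemma polys_P_prime_prod:
  "finite I \<Longrightarrow> (\<And>i. i \<in> I \<Longrightarrow> f i \<in> polys_over AI) \<Longrightarrow> prod f I \<in> polys_over P \<Longrightarrow> \<exists>i\<in>I. f i \<in> polys_over P"
proof (induction I rule: finite_induct)
  case empty
  then have "pcf (1 :: complex poly) 0 \<in> P" by (simp only: prod.empty polys_over_def mem_Collect_eq)
  then show ?case using one_notin by simp
next
  case (insert x F)
  have "prod f F \<in> polys_over AI" using insert by (intro subring_prod polys_over_subring AI_subring) auto
  then show ?case using insert polys_P_prime[of "f x" "prod f F"] by auto
qed

end

section \<open>Frobenius elements\<close>

abbreviation ip :: "int poly \<Rightarrow> complex poly" where "ip \<equiv> map_poly of_int"

lemma coeff_ip: "pcf (ip f) i = of_int (pcf f i)"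
  by (simp add: coeff_map_poly)

lemma hom_ip: "hom_on UNIV ip"
proof -
  have "hom_on (UNIV :: int set) (of_int :: int \<Rightarrow> complex)" by (auto simp: hom_on_def subring_set_def)
  from hom_on_map_poly[OF this] show ?thesis by (simp add: polys_over_def)
qed

lemma ip_simps: "ip (f * g) = ip f * ip g" "ip (f + g) = ip f + ip g" "ip (f - g) = ip f - ip g"
  "ip (prod h I) = (\<Prod>i\<in>I. ip (h i))" "ip 1 = 1" "ip 0 = 0" "ip (f ^ n) = ip f ^ n"
  using hom_onD(2-5)[OF hom_ip] hom_on_diff[OF hom_ip] hom_on_prod[OF hom_ip] hom_on_power[OF hom_ip] by auto

lemma ip_inj: "ip f = ip g \<Longrightarrow> f = g"
  by (metis coeff_ip of_int_eq_iff poly_eqI)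

lemma ip_over: "ip f \<in> polys_over AI"
  by (auto simp: polys_over_def coeff_ip)

lemma degree_ip: "pdeg (ip f) = pdeg f"
  by simp

lemma monic_ip: "monic_p (ip f) \<longleftrightarrow> monic_p f"
  by (simp add: monic_p_def coeff_ip)

lemma linear_over: "subring_set S \<Longrightarrow> u \<in> S \<Longrightarrow> [:- u, 1:] \<in> polys_over S"
  by (auto simp: polys_over_def coeff_pCons subring_setD split: nat.split)

lemma monic_prod:
  fixes f :: "'b \<Rightarrow> 'a::idom poly"
  assumes "\<And>i. i \<in> I \<Longrightarrow> monic_p (f i)"
  shows "monic_p (prod f I)" "pdeg (prod f I) = (\<Sum>i\<in>I. pdeg (f i))"
proof -
  have "monic_p (prod f I) \<and> pdeg (prod f I) = (\<Sum>i\<in>I. pdeg (f i))"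
    using assms by (induction I rule: infinite_finite_induct) (auto simp: monic_p_1 monic_p_mult)
  then show "monic_p (prod f I)" "pdeg (prod f I) = (\<Sum>i\<in>I. pdeg (f i))" by auto
qed

lemma monic_linear: "monic_p [:- a, 1 :: 'a :: comm_ring_1:]"
  by (simp add: monic_p_def)

context prime_modulus
begin

text \<open>Lagrange's bound: dividing by the linear factor of one root modulo \<open>p\<close>
  lowers the degree and keeps the other roots.\<close>

lemma roots_mod:
  fixes u :: "int poly"
  assumes "finite S" "\<And>x. x \<in> S \<Longrightarrow> int p dvd poly u x"
    "\<And>x y. x \<in> S \<Longrightarrow> y \<in> S \<Longrightarrow> x \<noteq> y \<Longrightarrow> \<not> int p dvd x - y" "u = 0 \<or> pdeg u < card S"
  shows "int p dvd pcf u i"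
  using assms
proof (induction S arbitrary: u i rule: finite_induct)
  case (insert x S)
  define q where "q = synthetic_div u x"
  have u: "u = [:- x, 1:] * q + [:poly u x:]" unfolding q_def by (rule synthetic_div_correct'[symmetric])
  have q: "int p dvd pcf q i" for i
  proof (rule insert.IH)
    fix y assume y: "y \<in> S"
    then have "y \<noteq> x" using insert.hyps by auto
    then have nd: "\<not> int p dvd y - x" using insert.prems(2) y by auto
    have "poly u y = (y - x) * poly q y + poly u x" by (subst u) (simp add: algebra_simps)
    then have "int p dvd (y - x) * poly q y"
      using insert.prems(1)[of y] insert.prems(1)[of x] y by (metis dvd_add_left_iff insertCI)
    then show "int p dvd poly q y" using nd prime_p by (metis prime_dvd_mult_iff prime_nat_int_transfer)
  next
    show "q = 0 \<or> pdeg q < card S"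
    proof (cases "pdeg u = 0")
      case True then show ?thesis by (simp add: q_def synthetic_div_eq_0_iff)
    next
      case False
      then show ?thesis using insert by (auto simp: q_def degree_synthetic_div)
    qed
  qed (use insert.prems in auto)
  have "pcf u i = pcf [:- x, 1:] 0 * pcf q i + (if i = 0 then 0 else pcf q (i - 1)) + pcf [:poly u x:] i"
    by (subst u) (auto simp: coeff_pCons split: nat.split)
  then show ?case using q insert.prems(1)[of x] by (auto simp: coeff_pCons split: nat.split)
qed simp

text \<open>Its vanishing modulo \<open>p\<close> expresses the factorisation of X^p - X into linear
  factors over the field with \<open>p\<close> elements.\<close>

definition fermat_poly :: "int poly" where
  "fermat_poly = (\<Prod>k<p. [:- int k, 1:]) - (Polynomial.monom 1 p - Polynomial.monom 1 1)"

lemma fermat_poly_dvd: "int p dvd pcf fermat_poly i"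
proof (rule roots_mod[of "int ` {..<p}"])
  show "finite (int ` {..<p})" by simp
  fix x assume x: "x \<in> int ` {..<p}"
  have "poly (\<Prod>k<p. [:- int k, 1:]) x = 0" using x by (auto simp: poly_prod)
  moreover have "int p dvd x ^ p - x"
    using fermat_cgp[of "UNIV :: int set" x] by (auto simp: cgp_def subring_set_def)
  ultimately show "int p dvd poly fermat_poly x"
    by (simp add: fermat_poly_def poly_monom) (metis dvd_minus_iff minus_diff_eq)
  fix y assume "y \<in> int ` {..<p}" "x \<noteq> y"
  then show "\<not> int p dvd x - y" using x by (auto dest!: zdvd_imp_le[rotated] simp: zdvd_not_zless) (metis (no_types, opaque_lifting) mod_eq_dvd_iff of_nat_0_le_iff of_nat_less_iff mod_pos_pos_trivial of_nat_eq_iff)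
next
  have m: "monic_p (\<Prod>k<p. [:- int k, 1:])" "pdeg (\<Prod>k<p. [:- int k, 1:]) = p"
    using monic_prod[of "{..<p}" "\<lambda>k. [:- int k, 1:]"] by (auto simp: monic_linear)
  \<comment> \<open>Both terms are monic of degree \<open>p\<close>, so the degree of the difference
    is less than the number \<open>p\<close> of roots.\<close>
  have "pcf fermat_poly p = 0" using m p2 by (simp add: fermat_poly_def monic_p_def)
  moreover have "pdeg fermat_poly \<le> p"
    unfolding fermat_poly_def using m p2 by (intro degree_diff_le) (auto simp: degree_monom_eq)
  ultimately have "fermat_poly = 0 \<or> pdeg fermat_poly < p" by (metis le_neq_implies_less leading_coeff_0_iff)
  then show "fermat_poly = 0 \<or> pdeg fermat_poly < card (int ` {..<p})" by (simp add: card_image)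
qed

lemma fac_prod:
  "(\<And>i. i \<in> I \<Longrightarrow> monic_p (f i)) \<Longrightarrow> fac (prod f I) = (\<Sum>i\<in>I. fac (f i))"
  by (induction I rule: infinite_finite_induct) (auto simp: fac_1 fac_mult monic_prod)

end

context prime_place
begin

lemma polys_P_add: "u \<in> polys_over P \<Longrightarrow> v \<in> polys_over P \<Longrightarrow> u + v \<in> polys_over P"
  and polys_P_diff: "u \<in> polys_over P \<Longrightarrow> v \<in> polys_over P \<Longrightarrow> u - v \<in> polys_over P"
  by (auto simp: polys_over_def P_add P_diff)

lemma polys_P_mult: "u \<in> polys_over P \<Longrightarrow> v \<in> polys_over AI \<Longrightarrow> u * v \<in> polys_over P"
  "u \<in> polys_over P \<Longrightarrow> v \<in> polys_over AI \<Longrightarrow> v * u \<in> polys_over P"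
proof -
  assume "u \<in> polys_over P" "v \<in> polys_over AI"
  then have "pcf u i \<in> P" "pcf v i \<in> AI" for i by (auto simp: polys_over_def)
  then show "u * v \<in> polys_over P" unfolding polys_over_def
    by (auto simp only: coeff_mult mem_Collect_eq intro!: P_sum P_mult(1))
  then show "v * u \<in> polys_over P" by (simp only: mult.commute)
qed

lemma cgp_polys_P: "cgp (polys_over AI) u v \<Longrightarrow> u - v \<in> polys_over P"
proof -
  assume "cgp (polys_over AI) u v"
  then obtain s where s: "s \<in> polys_over AI" "u - v = of_nat p * s" by (auto simp: cgp_def)
  have "pcf (of_nat p * s) i = of_nat p * pcf s i" for i by (simp add: of_nat_poly)
  then show ?thesis unfolding s(2) using s(1) P_mult(1)[OF p_mem] by (auto simp: polys_over_def)
qed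

lemma polys_P_prod_congr:
  assumes "\<And>i. i \<in> I \<Longrightarrow> f i \<in> polys_over AI" "\<And>i. i \<in> I \<Longrightarrow> g i \<in> polys_over AI"
    "\<And>i. i \<in> I \<Longrightarrow> f i - g i \<in> polys_over P"
  shows "prod f I - prod g I \<in> polys_over P"
  using assms
proof (induction I rule: infinite_finite_induct)
  case (insert x F)
  have "prod f F \<in> polys_over AI" using insert.prems by (intro subring_prod polys_over_subring AI_subring) auto
  moreover have "prod f (insert x F) - prod g (insert x F) = (f x - g x) * prod f F + g x * (prod f F - prod g F)"
    using insert.hyps by (simp add: algebra_simps)
  moreover have "f x - g x \<in> polys_over P" "g x \<in> polys_over AI" "prod f F - prod g F \<in> polys_over P"
    using insert by auto
  ultimately show ?case by (simp only: polys_P_add polys_P_mult)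
qed (auto simp: polys_over_def P_0)

lemma poly_P: "u \<in> polys_over P \<Longrightarrow> a \<in> AI \<Longrightarrow> poly u a \<in> P"
proof -
  assume "u \<in> polys_over P" and a: "a \<in> AI"
  then have "pcf u i \<in> P" for i by (auto simp: polys_over_def)
  then show ?thesis unfolding poly_altdef by (intro P_sum P_mult(1) subring_power[OF AI_subring a])
qed

lemma poly_congr: "q \<in> polys_over AI \<Longrightarrow> a \<in> AI \<Longrightarrow> b \<in> AI \<Longrightarrow> a - b \<in> P \<Longrightarrow> poly q a - poly q b \<in> P"
proof (induction q)
  case (pCons c q)
  have q: "q \<in> polys_over AI"
  proof -
    have "pcf (pCons c q) (Suc i) \<in> AI" for i using pCons.prems(1) by (simp only: polys_over_def mem_Collect_eq)
    then show ?thesis by (simp add: polys_over_def)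
  qed
  have "poly (pCons c q) a - poly (pCons c q) b = a * (poly q a - poly q b) + (a - b) * poly q b"
    by (simp add: algebra_simps)
  moreover have "poly q b \<in> AI" using poly_in[OF AI_subring q] pCons.prems by blast
  moreover have "poly q a - poly q b \<in> P" by (rule pCons.IH[OF q pCons.prems(2-4)])
  ultimately show ?case using P_add[OF P_mult(2) P_mult(1)] pCons.prems(2,4) by (simp only:)
qed (simp add: P_0)

lemma cg_eval: "cg u v \<Longrightarrow> a \<in> AI \<Longrightarrow> poly (ip u) a - poly (ip v) a \<in> P"
proof -
  assume c: "cg u v" and a: "a \<in> AI"
  have "ip u - ip v \<in> polys_over P" using c by (auto simp: polys_over_def coeff_ip cg_def of_int_P simp flip: of_int_diff)
  from poly_P[OF this a] show ?thesis by simp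
qed

text \<open>Modulo \<open>P\<close> an element equal to its p-th power is a root of X^p - X, which
  is a product of linear factors X - k; as \<open>P\<close> is prime, one of the factors
  vanishes.\<close>

lemma frobenius_fixed:
  assumes c: "c \<in> AI" and "c ^ p - c \<in> P" shows "\<exists>k::int. c - of_int k \<in> P"
proof -
  have "ip fermat_poly \<in> polys_over P"
    using fermat_poly_dvd by (auto simp: polys_over_def coeff_ip of_int_P)
  from poly_P[OF this c] have 1: "poly (ip fermat_poly) c \<in> P" .
  have ipm: "ip (Polynomial.monom 1 k) = Polynomial.monom 1 k" for k
    by (rule poly_eqI) (simp add: coeff_ip)
  have ipl: "ip [:- int k, 1:] = [:- of_nat k, 1:]" for k
    by (rule poly_eqI) (simp add: coeff_ip coeff_pCons split: nat.split)
  have "poly (ip fermat_poly) c = (\<Prod>k<p. c - of_nat k) - (c ^ p - c)"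
    by (simp add: fermat_poly_def ip_simps ipm ipl poly_prod poly_monom)
  then have "(\<Prod>k<p. c - of_nat k) \<in> P" using P_add[OF 1 assms(2)] by simp
  then obtain k where "c - of_nat k \<in> P"
    using P_prod[of "{..<p}" "\<lambda>k. c - of_nat k"] c subring_setD(6)[OF AI_subring] by auto
  then show ?thesis by (intro exI[of _ "int k"]) simp
qed

lemma galois_invariant_int:
  assumes f: "f \<noteq> 0" and "x \<in> splitting_carrier f" "\<And>\<sigma>. \<sigma> \<in> galois_group f \<Longrightarrow> \<sigma> x = x" "algebraic_int x"
  shows "x \<in> \<int>"
proof (rule rational_algebraic_int_is_int[OF assms(4)])
  show "x \<in> \<rat>" by (rule fixed_field[OF f assms(2)]) (rule assms(3))
qed

text \<open>The polynomial \<open>F\<close> of the proof has the conjugates of the generic combination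
  \<open>\<Sum> \<alpha>\<^sub>i Y\<^sup>i\<close> of the roots as its roots, hence integer coefficients. Modulo \<open>P\<close> it therefore
  also vanishes at \<open>\<Sum> \<alpha>\<^sub>i\<^sup>p Y\<^sup>i\<close>, which must then agree with one of the conjugates.\<close>

theorem frobenius_exists:
  assumes f: "f \<noteq> 0" and AIr: "\<And>\<alpha>. \<alpha> \<in> complex_roots f \<Longrightarrow> algebraic_int \<alpha>"
  shows "\<exists>\<sigma>\<in>galois_perms f. \<forall>\<alpha>\<in>complex_roots f. \<alpha> ^ p - \<sigma> \<alpha> \<in> P"
proof -
  let ?R = "complex_roots f" and ?G = "galois_perms f"
  interpret G: perm_group ?G ?R by (rule galois_perms_perm_group[OF f])
  have "?G \<subseteq> {g. g permutes ?R}" using G.mem_permutes by blast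
  then have finG: "finite ?G" using finite_permutations[OF G.finite_space] finite_subset by blast
  obtain rs where rs: "set rs = ?R" "distinct rs" using finite_distinct_list[OF G.finite_space] by blast
  define n where "n = length rs"
  \<comment> \<open>The variable keeps the roots apart: the coefficients of \<open>th \<pi>\<close>
    are the images of the single roots, so one congruence between such polynomials is a congruence
    for all roots at once, with the same \<open>\<pi>\<close>.\<close>
  define th where "th = (\<lambda>\<pi>. \<Sum>i<n. Polynomial.monom (\<pi> (rs ! i) :: complex) i)"
  have cth: "pcf (th \<pi>) i = (if i < n then \<pi> (rs ! i) else 0)" for \<pi> i
  proof -
    have "pcf (th \<pi>) i = (\<Sum>j<n. if j = i then \<pi> (rs ! j) else 0)" by (simp add: th_def coeff_sum)
    then show ?thesis by (simp add: sum.delta)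
  qed
  have rsR: "rs ! i \<in> ?R" if "i < n" for i
    using nth_mem[of i rs] that unfolding n_def rs(1) .
  have thS: "th \<pi> \<in> polys_over S" if "\<pi> \<in> ?G" "subring_set S" "?R \<subseteq> S" for \<pi> S
  proof -
    have "\<pi> (rs ! i) \<in> S" if "i < n" for i using G.mem_in[OF \<open>\<pi> \<in> ?G\<close> rsR[OF that]] \<open>?R \<subseteq> S\<close> by blast
    then show ?thesis using subring_setD(1)[OF that(2)] by (simp add: polys_over_def cth)
  qed
  have RA: "?R \<subseteq> AI" using AIr by auto
  have RK: "?R \<subseteq> splitting_carrier f" using splitting_carrier_base by auto
  define F where "F = (\<Prod>\<pi>\<in>?G. [:- th \<pi>, 1:])"
  have FS: "F \<in> polys_over (polys_over S)" if "subring_set S" "?R \<subseteq> S" for S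
    unfolding F_def using that thS
    by (intro subring_prod polys_over_subring linear_over) auto
  have inv: "map_poly (map_poly \<sigma>) F = F" if \<sigma>: "\<sigma> \<in> galois_group f" for \<sigma>
  proof -
    note D = galois_groupD[OF f \<sigma>]
    define s where "s = perm_restrict \<sigma> ?R"
    have sG: "s \<in> ?G" using \<sigma> by (auto simp: s_def galois_perms_def)
    note h1 = hom_on_map_poly[OF D(1)]
    note h2 = hom_on_map_poly[OF h1]
    have \<sigma>0: "\<sigma> 0 = 0" using hom_onD(2)[OF D(1)] .
    have thmap: "map_poly \<sigma> (th \<pi>) = th (s \<circ> \<pi>)" if "\<pi> \<in> ?G" for \<pi>
    proof (rule poly_eqI)
      fix i show "pcf (map_poly \<sigma> (th \<pi>)) i = pcf (th (s \<circ> \<pi>)) i"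
        using G.mem_in[OF that] rsR[of i] by (simp add: coeff_map_poly \<sigma>0 cth s_def perm_restrict_def)
    qed
    have lin: "map_poly (map_poly \<sigma>) [:- th \<pi>, 1:] = [:- th (s \<circ> \<pi>), 1:]" if "\<pi> \<in> ?G" for \<pi>
    proof (rule poly_eqI)
      fix i
      have "map_poly \<sigma> (- th \<pi>) = - th (s \<circ> \<pi>)"
        using hom_on_minus[OF h1 thS[OF that splitting_carrier_subring RK]] thmap[OF that] by simp
      then show "pcf (map_poly (map_poly \<sigma>) [:- th \<pi>, 1:]) i = pcf [:- th (s \<circ> \<pi>), 1:] i"
        using hom_onD(3)[OF h1] by (simp add: coeff_map_poly coeff_pCons split: nat.split)
    qed
    have "map_poly (map_poly \<sigma>) F = (\<Prod>\<pi>\<in>?G. map_poly (map_poly \<sigma>) [:- th \<pi>, 1:])"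
      unfolding F_def using thS[OF _ splitting_carrier_subring RK]
      by (intro hom_on_prod[OF h2] linear_over polys_over_subring splitting_carrier_subring) auto
    also have "\<dots> = (\<Prod>\<pi>\<in>?G. [:- th (s \<circ> \<pi>), 1:])" using lin by (intro prod.cong) auto
    also have "\<dots> = F" unfolding F_def
    proof (rule prod.reindex_bij_witness[of _ "\<lambda>\<pi>. inv s \<circ> \<pi>" "\<lambda>\<pi>. s \<circ> \<pi>"])
      show "inv s \<circ> (s \<circ> \<pi>) = \<pi>" "s \<circ> (inv s \<circ> \<pi>) = \<pi>" for \<pi>
        using G.inv_apply[OF sG] by (auto simp: fun_eq_iff)
    qed (use sG G.comp_mem G.inv_mem in auto)
    finally show ?thesis .
  qed
  have cint: "pcf (pcf F k) l \<in> \<int>" for k l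
  proof (rule galois_invariant_int[OF f])
    show "pcf (pcf F k) l \<in> splitting_carrier f" using FS[OF splitting_carrier_subring RK] by (auto simp: polys_over_def)
    show "algebraic_int (pcf (pcf F k) l)" using FS[OF AI_subring RA] by (auto simp: polys_over_def)
    fix \<sigma> assume \<sigma>: "\<sigma> \<in> galois_group f"
    have \<sigma>0: "\<sigma> 0 = 0" using hom_onD(2)[OF galois_groupD(1)[OF f \<sigma>]] .
    have "pcf (pcf (map_poly (map_poly \<sigma>) F) k) l = \<sigma> (pcf (pcf F k) l)"
      by (simp add: coeff_map_poly \<sigma>0)
    then show "\<sigma> (pcf (pcf F k) l) = pcf (pcf F k) l" using inv[OF \<sigma>] by simp
  qed
  let ?S = "polys_over AI"
  have S: "subring_set ?S" by (rule polys_over_subring[OF AI_subring])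
  have CS: "pcf F k \<in> ?S" for k using FS[OF AI_subring RA] by (auto simp: polys_over_def)
  \<comment> \<open>By Fermat the integers \<open>pcf (pcf F k) l\<close> are congruent to their
    p-th powers, so that raising a coefficient of \<open>F\<close> to the power \<open>p\<close>
    only replaces Y by Y^p.\<close>
  have CE: "cgp ?S (pcf F k ^ p) (inflate (pcf F k))" for k
  proof -
    have "cgp AI (pcf (map_poly (\<lambda>c. c ^ p) (pcf F k)) l) (pcf (pcf F k) l)" for l
    proof -
      obtain z where z: "pcf (pcf F k) l = of_int z" using cint[of k l] by (elim Ints_cases)
      show ?thesis using fermat_cgp[OF AI_subring, of z] p2 by (simp add: coeff_map_poly zero_power z)
    qed
    then have "cgp ?S (map_poly (\<lambda>c. c ^ p) (pcf F k)) (pcf F k)" by (rule cgp_polyI[OF _ AI_subring])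
    then show ?thesis using cgp_trans[OF S power_cgp_inflate[OF AI_subring CS] cgp_inflate[OF AI_subring]] by blast
  qed
  define t where "t = th id"
  define tp where "tp = map_poly (\<lambda>c. c ^ p) t"
  have tS: "t \<in> ?S" unfolding t_def by (rule thS[OF G.id_mem AI_subring RA])
  have tpS: "tp \<in> ?S"
    using tS p2 subring_power[OF AI_subring] by (auto simp: tp_def polys_over_def coeff_map_poly zero_power)
  have tE: "cgp ?S (t ^ p) (inflate tp)" unfolding tp_def by (rule power_cgp_inflate[OF AI_subring tS])
  have ctp: "pcf tp i = (if i < n then (rs ! i) ^ p else 0)" for i
    using p2 by (simp add: tp_def coeff_map_poly zero_power t_def cth)
  have "poly F t = (\<Prod>\<pi>\<in>?G. t - th \<pi>)" by (simp add: F_def poly_prod)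
  also have "\<dots> = 0" using finG G.id_mem by (auto simp: t_def)
  \<comment> \<open>Raising the relation \<open>poly F t = 0\<close> to the power \<open>p\<close>
    gives, modulo \<open>p\<close>, the relation \<open>poly F tp = 0\<close> with Y^p in place of
    Y.\<close>
  finally have F0: "(\<Sum>k\<le>pdeg F. pcf F k * t ^ k) ^ p = 0" using p2 by (simp add: poly_altdef zero_power)
  have mem: "pcf F k * t ^ k \<in> ?S" for k using CS tS S by (auto intro: subring_setD subring_power)
  have "cgp ?S ((\<Sum>k\<le>pdeg F. pcf F k * t ^ k) ^ p) (\<Sum>k\<le>pdeg F. (pcf F k * t ^ k) ^ p)"
    using mem by (intro freshman_sum[OF S])
  moreover have "cgp ?S (\<Sum>k\<le>pdeg F. (pcf F k * t ^ k) ^ p) (\<Sum>k\<le>pdeg F. inflate (pcf F k) * inflate tp ^ k)"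
  proof (rule cgp_sum[OF S])
    fix k
    have "cgp ?S ((t ^ p) ^ k) (inflate tp ^ k)"
      by (rule cgp_power[OF S tE subring_power[OF S tS] inflate_over[OF AI_subring tpS]])
    moreover have "(t ^ p) ^ k \<in> ?S" by (intro subring_power[OF S] tS)
    ultimately have "cgp ?S (pcf F k ^ p * (t ^ p) ^ k) (inflate (pcf F k) * inflate tp ^ k)"
      by (intro cgp_mult[OF S CE]) (auto intro: inflate_over[OF AI_subring CS])
    moreover have "(pcf F k * t ^ k) ^ p = pcf F k ^ p * (t ^ p) ^ k"
      by (simp add: power_mult_distrib mult.commute flip: power_mult)
    ultimately show "cgp ?S ((pcf F k * t ^ k) ^ p) (inflate (pcf F k) * inflate tp ^ k)" by simp
  qed
  moreover have "(\<Sum>k\<le>pdeg F. inflate (pcf F k) * inflate tp ^ k) = inflate (poly F tp)"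
    by (simp add: poly_altdef inflate_hom inflate_power)
  ultimately have "cgp ?S 0 (inflate (poly F tp))" unfolding F0 using cgp_trans[OF S] by metis
  then have "inflate (poly F tp) - 0 \<in> polys_over P" by (rule cgp_polys_P[OF cgp_sym[OF S]])
  \<comment> \<open>Reading off the coefficients at multiples of \<open>p\<close> undoes the
    substitution of Y^p.\<close>
  then have "pcf (inflate (poly F tp)) (p * i) \<in> P" for i by (auto simp: polys_over_def)
  then have "poly F tp \<in> polys_over P" by (auto simp: polys_over_def coeff_inflate)
  moreover have "poly F tp = (\<Prod>\<pi>\<in>?G. tp - th \<pi>)" by (simp add: F_def poly_prod)
  ultimately have "\<exists>\<pi>\<in>?G. tp - th \<pi> \<in> polys_over P"
    using thS[OF _ AI_subring RA] tpS subring_setD(6)[OF S]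
    by (intro polys_P_prime_prod[OF finG]) auto
  then obtain \<pi> where \<pi>: "\<pi> \<in> ?G" "tp - th \<pi> \<in> polys_over P" by blast
  have "\<alpha> ^ p - \<pi> \<alpha> \<in> P" if "\<alpha> \<in> ?R" for \<alpha>
  proof -
    have "\<alpha> \<in> set rs" using that by (simp only: rs(1))
    then obtain i where i: "i < n" "rs ! i = \<alpha>" unfolding n_def in_set_conv_nth by blast
    have "pcf (tp - th \<pi>) i \<in> P" using \<pi>(2) by (simp only: polys_over_def mem_Collect_eq)
    then show ?thesis using i by (simp add: ctp cth)
  qed
  then show ?thesis using \<pi>(1) by blast
qed

text \<open>Let \<open>g\<close> be the product of the factors X - \<alpha>. Modulo \<open>P\<close>
  its p-th power is the product of the X^p - \<sigma> \<alpha>, which is g(X^p) because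
  \<open>\<sigma>\<close> permutes \<open>D\<close>. It is also the polynomial in X^p whose
  coefficients are the p-th powers of those of \<open>g\<close>. So the coefficients are fixed by
  Frobenius and congruent to integers.\<close>

lemma orbit_polynomial:
  assumes D: "finite D" "\<And>\<alpha>. \<alpha> \<in> D \<Longrightarrow> algebraic_int \<alpha>" and \<sigma>: "bij_betw \<sigma> D D" "\<And>\<alpha>. \<alpha> \<in> D \<Longrightarrow> \<alpha> ^ p - \<sigma> \<alpha> \<in> P"
  shows "\<exists>\<gamma>. monic_p \<gamma> \<and> pdeg \<gamma> = card D \<and> (\<Prod>\<alpha>\<in>D. [:- \<alpha>, 1:]) - ip \<gamma> \<in> polys_over P"
proof -
  let ?S = "polys_over AI"
  have S: "subring_set ?S" by (rule polys_over_subring[OF AI_subring])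
  define g where "g = (\<Prod>\<alpha>\<in>D. [:- \<alpha>, 1:])"
  have \<sigma>D: "\<sigma> \<alpha> \<in> D" if "\<alpha> \<in> D" for \<alpha> using \<sigma>(1) that by (auto simp: bij_betw_def)
  have gS: "g \<in> ?S" unfolding g_def using D(2) by (intro subring_prod[OF S] linear_over[OF AI_subring]) auto
  have g: "monic_p g" "pdeg g = card D"
    using monic_prod[of D "\<lambda>\<alpha>. [:- \<alpha>, 1:]"] by (auto simp: g_def monic_linear)
  have lin: "[:- \<alpha>, 1:] ^ p - inflate [:- \<sigma> \<alpha>, 1:] \<in> polys_over P" if \<alpha>: "\<alpha> \<in> D" for \<alpha>
  proof -
    have a: "\<alpha> \<in> AI" using D(2) \<alpha> by auto
    have l: "[:- \<alpha>, 1:] \<in> ?S" using a by (intro linear_over[OF AI_subring])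
    have "[:- \<alpha>, 1:] ^ p - inflate (map_poly (\<lambda>c. c ^ p) [:- \<alpha>, 1:]) \<in> polys_over P"
      by (intro cgp_polys_P power_cgp_inflate[OF AI_subring l])
    moreover have "inflate (map_poly (\<lambda>c. c ^ p) [:- \<alpha>, 1:]) - inflate [:- \<sigma> \<alpha>, 1:] \<in> polys_over P"
    proof -
      have "(- \<alpha>) ^ p - - \<sigma> \<alpha> \<in> P"
      proof -
        have "(- \<alpha>) ^ p - - (\<alpha> ^ p) \<in> P" using a by (intro cgp_P freshman_minus[OF AI_subring])
        then have "((- \<alpha>) ^ p - - (\<alpha> ^ p)) - (\<alpha> ^ p - \<sigma> \<alpha>) \<in> P" using \<sigma>(2)[OF \<alpha>] by (rule P_diff)
        then show ?thesis by simp
      qed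
      moreover have "map_poly (\<lambda>c. c ^ p) [:- \<alpha>, 1:] = [:(- \<alpha>) ^ p, 1:]"
        using p2 by (intro poly_eqI) (simp add: coeff_map_poly coeff_pCons zero_power split: nat.split)
      moreover have "inflate [:a, 1:] = [:a:] + Polynomial.monom 1 p" for a :: complex
        by (simp add: inflate_def pcompose_pCons)
      ultimately show ?thesis by (auto simp: polys_over_def coeff_pCons P_0 split: nat.split)
    qed
    ultimately show ?thesis using polys_P_add by fastforce
  qed
  have "(\<Prod>\<alpha>\<in>D. [:- \<alpha>, 1:] ^ p) - (\<Prod>\<alpha>\<in>D. inflate [:- \<sigma> \<alpha>, 1:]) \<in> polys_over P"
    using lin D(2) \<sigma>D
    by (intro polys_P_prod_congr subring_power[OF S] inflate_over[OF AI_subring] linear_over[OF AI_subring]) auto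
  moreover have "(\<Prod>\<alpha>\<in>D. inflate [:- \<sigma> \<alpha>, 1:]) = inflate g"
  proof -
    have "(\<Prod>\<alpha>\<in>D. [:- \<sigma> \<alpha>, 1:]) = g" unfolding g_def by (rule prod.reindex_bij_betw[OF \<sigma>(1)])
    then show ?thesis by (metis inflate_hom(5))
  qed
  moreover have "(\<Prod>\<alpha>\<in>D. [:- \<alpha>, 1:] ^ p) = g ^ p" by (simp add: g_def prod_power_distrib)
  ultimately have 1: "g ^ p - inflate g \<in> polys_over P" by simp
  have 2: "g ^ p - inflate (map_poly (\<lambda>c. c ^ p) g) \<in> polys_over P" by (intro cgp_polys_P power_cgp_inflate[OF AI_subring gS])
  have "\<exists>k::int. pcf g i - of_int k \<in> P" for i
  proof (rule frobenius_fixed)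
    show "pcf g i \<in> AI" using gS by (simp only: polys_over_def mem_Collect_eq)
    have "(g ^ p - inflate g) - (g ^ p - inflate (map_poly (\<lambda>c. c ^ p) g)) \<in> polys_over P" using 1 2 by (rule polys_P_diff)
    then have "pcf (inflate (map_poly (\<lambda>c. c ^ p) g) - inflate g) (p * i) \<in> P" by (simp add: polys_over_def)
    then show "pcf g i ^ p - pcf g i \<in> P" using p2 by (simp add: coeff_inflate coeff_map_poly zero_power)
  qed
  then obtain k where k: "\<And>i. pcf g i - of_int (k i) \<in> P" by metis
  define \<gamma> where "\<gamma> = of_coeffs (card D) k"
  have "pcf (g - ip \<gamma>) i \<in> P" for i
  proof -
    consider "i < card D" | "i = card D" | "i > card D" by linarith
    then show ?thesis
    proof cases
      case 1 then show ?thesis using k by (simp add: \<gamma>_def coeff_ip coeff_of_coeffs)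
    next
      case 2 then show ?thesis using g by (simp add: \<gamma>_def coeff_ip coeff_of_coeffs monic_p_def P_0)
    next
      case 3 then show ?thesis using g by (simp add: \<gamma>_def coeff_ip coeff_of_coeffs coeff_eq_0 P_0)
    qed
  qed
  then show ?thesis unfolding g_def[symmetric]
    by (intro exI[of _ \<gamma>]) (auto simp: \<gamma>_def of_coeffs_monic polys_over_def)
qed

lemma int_poly_frobenius:
  assumes a: "a \<in> AI" shows "poly (ip \<phi>) a ^ p - poly (ip \<phi>) (a ^ p) \<in> P"
proof -
  have ap: "a ^ i \<in> AI" for i using a by (rule subring_power[OF AI_subring])
  have mem: "of_int z * a ^ i \<in> AI" for z i by (intro subring_setD(5)[OF AI_subring] ap) simp
  have "cgp AI ((\<Sum>i\<le>pdeg \<phi>. of_int (pcf \<phi> i) * a ^ i) ^ p) (\<Sum>i\<le>pdeg \<phi>. (of_int (pcf \<phi> i) * a ^ i) ^ p)"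
    using mem by (intro freshman_sum[OF AI_subring])
  moreover have "cgp AI (\<Sum>i\<le>pdeg \<phi>. (of_int (pcf \<phi> i) * a ^ i) ^ p) (\<Sum>i\<le>pdeg \<phi>. of_int (pcf \<phi> i) * (a ^ p) ^ i)"
  proof (rule cgp_sum[OF AI_subring])
    fix i
    have "cgp AI (of_int (pcf \<phi> i) ^ p * (a ^ p) ^ i) (of_int (pcf \<phi> i) * (a ^ p) ^ i)"
      by (intro cgp_mult[OF AI_subring fermat_cgp[OF AI_subring] cgp_refl[OF AI_subring]] subring_power[OF AI_subring] a) simp
    moreover have "(of_int (pcf \<phi> i) * a ^ i) ^ p = of_int (pcf \<phi> i) ^ p * (a ^ p) ^ i"
      by (simp add: power_mult_distrib mult.commute flip: power_mult)
    ultimately show "cgp AI ((of_int (pcf \<phi> i) * a ^ i) ^ p) (of_int (pcf \<phi> i) * (a ^ p) ^ i)" by simp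
  qed
  ultimately have "cgp AI ((\<Sum>i\<le>pdeg \<phi>. of_int (pcf \<phi> i) * a ^ i) ^ p) (\<Sum>i\<le>pdeg \<phi>. of_int (pcf \<phi> i) * (a ^ p) ^ i)"
    using cgp_trans[OF AI_subring] by blast
  from cgp_P[OF this] show ?thesis by (simp add: poly_altdef coeff_ip)
qed

text \<open>A root of an irreducible factor of \<open>\<gamma>\<close> is congruent to a member of
  the orbit, and Frobenius spreads the vanishing modulo \<open>P\<close> over the whole orbit. Two
  different irreducible factors would then both vanish at \<open>x\<close>, which a Bezout relation
  forbids. A proper power can occur, since distinct roots may coincide modulo
  \<open>P\<close>.\<close>

lemma orbit_factor:
  assumes perm: "\<sigma> permutes R" "finite R" and x: "x \<in> R" and AIr: "\<And>\<alpha>. \<alpha> \<in> R \<Longrightarrow> algebraic_int \<alpha>"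
    and fr: "\<And>\<alpha>. \<alpha> \<in> R \<Longrightarrow> \<alpha> ^ p - \<sigma> \<alpha> \<in> P"
    and \<gamma>: "monic_p \<gamma>" "pdeg \<gamma> = card (orb \<sigma> x)" "(\<Prod>\<alpha>\<in>orb \<sigma> x. [:- \<alpha>, 1:]) - ip \<gamma> \<in> polys_over P"
  shows "\<exists>\<phi> k. \<phi> \<in> Irr \<and> k \<ge> 1 \<and> k * pdeg \<phi> = card (orb \<sigma> x) \<and> fac \<gamma> = replicate_mset k \<phi>"
proof -
  let ?D = "orb \<sigma> x"
  have DR: "?D \<subseteq> R" by (rule orb_subset[OF perm(1) x])
  have xA: "x \<in> AI" using AIr[OF x] by simp
  have root: "poly (ip \<phi>) x \<in> P" if \<phi>: "\<phi> \<in># fac \<gamma>" for \<phi>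
  proof -
    have \<phi>I: "\<phi> \<in> Irr" using fac(1)[OF \<gamma>(1)] \<phi> by auto
    then have \<phi>m: "monic_p \<phi>" "pdeg \<phi> \<ge> 1" by (auto simp: Irr_def canon_def)
    then have "\<not> Fundamental_Theorem_Algebra.constant (poly (ip \<phi>))" by (simp add: constant_degree)
    \<comment> \<open>A complex root replaces a root in the residue field; it is an algebraic
      integer because \<open>\<phi>\<close> is monic.\<close>
    then obtain \<beta> where \<beta>: "poly (ip \<phi>) \<beta> = 0" using fundamental_theorem_of_algebra by blast
    then have \<beta>A: "\<beta> \<in> AI" using \<phi>m(1) by (auto simp: algebraic_int_altdef_ipoly monic_p_def)
    obtain k where "cg \<gamma> (\<phi> * k)" using mem_fac_dvdp[OF \<gamma>(1) \<phi>] by (auto simp: dvdp_def)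
    from cg_eval[OF this \<beta>A] have 1: "poly (ip \<gamma>) \<beta> \<in> P" using \<beta> by (simp add: ip_simps)
    have "poly ((\<Prod>\<alpha>\<in>?D. [:- \<alpha>, 1:]) - ip \<gamma>) \<beta> \<in> P" by (rule poly_P[OF \<gamma>(3) \<beta>A])
    then have "(\<Prod>\<alpha>\<in>?D. \<beta> - \<alpha>) \<in> P" using P_add[OF _ 1] by (fastforce simp: poly_prod)
    moreover have "finite ?D" using DR perm(2) finite_subset by blast
    moreover have "\<beta> - \<alpha> \<in> AI" if "\<alpha> \<in> ?D" for \<alpha>
      using \<beta>A AIr DR that by (intro subring_setD(6)[OF AI_subring]) auto
    ultimately obtain \<alpha> where \<alpha>: "\<alpha> \<in> ?D" "\<beta> - \<alpha> \<in> P" using P_prod[of ?D "\<lambda>\<alpha>. \<beta> - \<alpha>"] by blast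
    have \<alpha>R: "\<alpha> \<in> R" using \<alpha>(1) DR by auto
    have \<alpha>A: "\<alpha> \<in> AI" using AIr[OF \<alpha>R] by simp
    have "poly (ip \<phi>) \<beta> - poly (ip \<phi>) \<alpha> \<in> P" by (rule poly_congr[OF ip_over \<beta>A \<alpha>A \<alpha>(2)])
    then have \<alpha>P: "poly (ip \<phi>) \<alpha> \<in> P" using \<beta> P_minus by fastforce
    have step: "poly (ip \<phi>) (\<sigma> a) \<in> P" if a: "a \<in> R" "poly (ip \<phi>) a \<in> P" for a
    proof -
      have aA: "a \<in> AI" "a ^ p \<in> AI" "\<sigma> a \<in> AI"
        using AIr a(1) perm(1) subring_power[OF AI_subring, of a p] by (auto simp: permutes_in_image)
      have "poly (ip \<phi>) a ^ p \<in> P"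
        using P_mult(1)[OF a(2), of "poly (ip \<phi>) a ^ (p - 1)"] p2 poly_in[OF AI_subring ip_over aA(1)]
          subring_power[OF AI_subring] by (simp flip: power_Suc)
      then have "poly (ip \<phi>) (a ^ p) \<in> P" using P_diff[OF _ int_poly_frobenius[OF aA(1), of \<phi>]] by fastforce
      then show ?thesis using P_diff[OF _ poly_congr[OF ip_over[of \<phi>] aA(2,3) fr[OF a(1)]]] by fastforce
    qed
    have all: "poly (ip \<phi>) ((\<sigma> ^^ i) \<alpha>) \<in> P \<and> (\<sigma> ^^ i) \<alpha> \<in> R" for i
      using \<alpha>P \<alpha>R step perm(1) by (induction i) (auto simp: permutes_in_image)
    have "x \<in> orb \<sigma> \<alpha>" using orb_sym[OF perm x \<alpha>(1)] orb_self by simp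
    then show ?thesis using all by (auto simp: orb_def)
  qed
  have same: "\<phi> = \<psi>" if "\<phi> \<in># fac \<gamma>" "\<psi> \<in># fac \<gamma>" for \<phi> \<psi>
  proof (rule ccontr)
    assume "\<phi> \<noteq> \<psi>"
    moreover have "\<phi> \<in> Irr" "\<psi> \<in> Irr" using that fac(1)[OF \<gamma>(1)] by auto
    ultimately obtain u v where uv: "cg (u * \<phi> + v * \<psi>) 1" using irr_coprime by blast
    have "poly (ip (u * \<phi> + v * \<psi>)) x \<in> P"
      using root[OF that(1)] root[OF that(2)] poly_in[OF AI_subring ip_over xA]
      by (auto simp: ip_simps intro!: P_add P_mult(2))
    then have "poly (ip 1) x \<in> P" using P_diff[OF _ cg_eval[OF uv xA]] by fastforce
    then show False using one_notin by (simp add: ip_simps)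
  qed
  have pos: "card ?D > 0" by (rule funpow_card_orb(2)[OF perm x])
  then have "fac \<gamma> \<noteq> {#}" using fac_degree[OF \<gamma>(1)] \<gamma>(2) by auto
  then obtain \<phi> where \<phi>: "\<phi> \<in># fac \<gamma>" by blast
  have eq: "fac \<gamma> = replicate_mset (size (fac \<gamma>)) \<phi>"
    using same[OF _ \<phi>] by (intro set_mset_subset_singletonD) auto
  define k where "k = size (fac \<gamma>)"
  have "k * pdeg \<phi> = card ?D" using fac_degree[OF \<gamma>(1)] \<gamma>(2) eq by (metis k_def sum_mset_replicate_mset image_replicate_mset of_nat_id)
  moreover have "k \<ge> 1" using \<open>fac \<gamma> \<noteq> {#}\<close> by (simp add: k_def Suc_le_eq nonempty_has_size)
  moreover have "\<phi> \<in> Irr" using fac(1)[OF \<gamma>(1)] \<phi> by auto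
  ultimately show ?thesis using eq k_def by blast
qed

end

section \<open>The factorisation pattern of a Frobenius element\<close>

lemma cpoly_nonzero: "cpoly f = ip fz \<Longrightarrow> monic_p fz \<Longrightarrow> f \<noteq> 0"
proof
  assume a: "cpoly f = ip fz" "monic_p fz" and "f = 0"
  then have "ip fz = ip 0" by simp
  then have "fz = 0" by (rule ip_inj)
  then show False using a(2) by (simp add: monic_p_def)
qed

lemma roots_algebraic_int:
  assumes "cpoly f = ip fz" "monic_p fz" "\<alpha> \<in> complex_roots f"
  shows "algebraic_int \<alpha>"
  using assms by (auto simp: complex_roots_def algebraic_int_altdef_ipoly monic_p_def)

lemma cpoly_prod_roots:
  assumes "cpoly f = ip fz" "monic_p fz" "card (complex_roots f) = pdeg fz"
  shows "ip fz = (\<Prod>\<alpha>\<in>complex_roots f. [:- \<alpha>, 1:])"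
proof -
  let ?R = "complex_roots f"
  have fin: "finite ?R" by (rule finite_complex_roots[OF cpoly_nonzero[OF assms(1,2)]])
  have m: "monic_p (\<Prod>\<alpha>\<in>?R. [:- \<alpha>, 1:])" "pdeg (\<Prod>\<alpha>\<in>?R. [:- \<alpha>, 1:]) = card ?R"
    using monic_prod[of ?R "\<lambda>\<alpha>. [:- \<alpha>, 1:]"] by (auto simp: monic_linear)
  have d: "pcf (ip fz) (card ?R) = 1" "pdeg (ip fz) = card ?R"
    using assms(2,3) by (simp_all add: coeff_ip monic_p_def)
  show ?thesis
  proof (rule poly_eqI_degree_lead_coeff[where n = "card ?R" and A = ?R])
    show "pcf (ip fz) (card ?R) = pcf (\<Prod>\<alpha>\<in>?R. [:- \<alpha>, 1:]) (card ?R)"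
      using d m by (simp add: monic_p_def)
    fix z assume z: "z \<in> ?R"
    have "poly (\<Prod>\<alpha>\<in>?R. [:- \<alpha>, 1:]) z = 0" using z fin by (auto simp: poly_prod)
    moreover have "poly (ip fz) z = 0" using z assms(1) by (simp add: complex_roots_def)
    ultimately show "poly (ip fz) z = poly (\<Prod>\<alpha>\<in>?R. [:- \<alpha>, 1:]) z" by simp
  qed (use d m in simp_all)
qed

context prime_place
begin

text \<open>The polynomials of the orbits multiply to \<open>fz\<close> modulo \<open>P\<close>,
  hence modulo \<open>p\<close>, since both sides have integer coefficients; each of them is a power
  of one irreducible.\<close>

lemma frobenius_profile:
  assumes f: "cpoly f = ip fz" "monic_p fz" and c: "card (complex_roots f) = pdeg fz"
  obtains \<sigma> \<Phi> \<kappa> where "\<sigma> \<in> galois_perms f"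
    "\<And>D. D \<in> orb \<sigma> ` complex_roots f \<Longrightarrow> \<kappa> D \<ge> (1::nat) \<and> \<Phi> D \<in> Irr \<and> \<kappa> D * pdeg (\<Phi> D) = card D"
    "fac fz = (\<Sum>D\<in>orb \<sigma> ` complex_roots f. replicate_mset (\<kappa> D) (\<Phi> D))"
proof -
  let ?R = "complex_roots f"
  have f0: "f \<noteq> 0" by (rule cpoly_nonzero[OF f])
  have fin: "finite ?R" by (rule finite_complex_roots[OF f0])
  note AIr = roots_algebraic_int[OF f]
  interpret G: perm_group "galois_perms f" ?R by (rule galois_perms_perm_group[OF f0])
  obtain \<sigma> where \<sigma>: "\<sigma> \<in> galois_perms f" "\<And>\<alpha>. \<alpha> \<in> ?R \<Longrightarrow> \<alpha> ^ p - \<sigma> \<alpha> \<in> P"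
    using frobenius_exists[OF f0 AIr] by blast
  have perm: "\<sigma> permutes ?R" by (rule G.mem_permutes[OF \<sigma>(1)])
  let ?O = "orb \<sigma> ` ?R"
  have OR: "D \<subseteq> ?R" if "D \<in> ?O" for D using that orb_subset[OF perm] by blast
  have finD: "finite D" if "D \<in> ?O" for D using OR[OF that] fin finite_subset by blast
  have "\<exists>\<gamma>. monic_p \<gamma> \<and> pdeg \<gamma> = card D \<and> (\<Prod>\<alpha>\<in>D. [:- \<alpha>, 1:]) - ip \<gamma> \<in> polys_over P" if D: "D \<in> ?O" for D
  proof (rule orbit_polynomial[where \<sigma> = \<sigma>])
    have "\<sigma> ` D \<subseteq> D"
    proof -
      obtain x where x: "D = orb \<sigma> x" using D by blast
      have "\<sigma> ((\<sigma> ^^ i) x) \<in> orb \<sigma> x" for i unfolding orb_def by (rule range_eqI[of _ _ "Suc i"]) simp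
      then show ?thesis unfolding x by (auto simp: orb_def)
    qed
    moreover have "inj_on \<sigma> D" using permutes_inj[OF perm] inj_on_subset by blast
    ultimately show "bij_betw \<sigma> D D"
      using finD[OF D] by (simp add: bij_betw_def endo_inj_surj)
    show "finite D" by (rule finD[OF D])
  qed (use OR[OF D] AIr \<sigma>(2) in blast)+
  then obtain \<gamma> where \<gamma>: "\<And>D. D \<in> ?O \<Longrightarrow> monic_p (\<gamma> D)" "\<And>D. D \<in> ?O \<Longrightarrow> pdeg (\<gamma> D) = card D"
    "\<And>D. D \<in> ?O \<Longrightarrow> (\<Prod>\<alpha>\<in>D. [:- \<alpha>, 1:]) - ip (\<gamma> D) \<in> polys_over P" by metis
  have "\<exists>\<phi> k. \<phi> \<in> Irr \<and> k \<ge> 1 \<and> k * pdeg \<phi> = card D \<and> fac (\<gamma> D) = replicate_mset k \<phi>" if D: "D \<in> ?O" for D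
  proof -
    obtain x where x: "x \<in> ?R" "D = orb \<sigma> x" using D by blast
    show ?thesis
      using orbit_factor[OF perm fin x(1) AIr \<sigma>(2), of "\<gamma> D"] \<gamma>[OF D] unfolding x(2) by blast
  qed
  then obtain \<Phi> \<kappa> where \<Phi>: "\<And>D. D \<in> ?O \<Longrightarrow> \<Phi> D \<in> Irr \<and> \<kappa> D \<ge> (1::nat) \<and> \<kappa> D * pdeg (\<Phi> D) = card D \<and> fac (\<gamma> D) = replicate_mset (\<kappa> D) (\<Phi> D)"
    by metis
  have "(\<Prod>\<alpha>\<in>\<Union>?O. [:- \<alpha>, 1:]) = (\<Prod>D\<in>?O. \<Prod>\<alpha>\<in>D. [:- \<alpha>, 1:])"
  proof (subst prod.Union_disjoint)
    show "\<forall>A\<in>?O. \<forall>B\<in>?O. A \<noteq> B \<longrightarrow> A \<inter> B = {}"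
    proof (intro ballI impI)
      fix A B assume "A \<in> ?O" "B \<in> ?O" "A \<noteq> B"
      then obtain x y where xy: "x \<in> ?R" "y \<in> ?R" "A = orb \<sigma> x" "B = orb \<sigma> y" by blast
      show "A \<inter> B = {}"
      proof (rule ccontr)
        assume "A \<inter> B \<noteq> {}"
        then obtain z where "z \<in> orb \<sigma> x" "z \<in> orb \<sigma> y" using xy by blast
        then show False using orb_sym[OF perm fin xy(1)] orb_sym[OF perm fin xy(2)] xy \<open>A \<noteq> B\<close> by metis
      qed
    qed
  qed (use finD in auto)
  moreover have "\<Union>?O = ?R"
  proof
    show "\<Union>?O \<subseteq> ?R" using OR by blast
    show "?R \<subseteq> \<Union>?O" using orb_self by fast
  qed
  ultimately have prod: "ip fz = (\<Prod>D\<in>?O. \<Prod>\<alpha>\<in>D. [:- \<alpha>, 1:])"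
    using cpoly_prod_roots[OF f c] by (simp only:)
  have "(\<Prod>D\<in>?O. \<Prod>\<alpha>\<in>D. [:- \<alpha>, 1:]) - (\<Prod>D\<in>?O. ip (\<gamma> D)) \<in> polys_over P"
  proof (rule polys_P_prod_congr)
    fix D assume D: "D \<in> ?O"
    have "\<alpha> \<in> AI" if "\<alpha> \<in> D" for \<alpha> using AIr[of \<alpha>] OR[OF D] that by auto
    then show "(\<Prod>\<alpha>\<in>D. [:- \<alpha>, 1:]) \<in> polys_over AI"
      by (intro subring_prod polys_over_subring linear_over AI_subring)
  qed (use \<gamma>(3) ip_over in auto)
  then have "ip fz - ip (\<Prod>D\<in>?O. \<gamma> D) \<in> polys_over P" unfolding prod ip_simps(4) .
  then have "of_int (pcf fz i - pcf (\<Prod>D\<in>?O. \<gamma> D) i) \<in> P" for i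
    by (simp add: polys_over_def coeff_ip)
  then have "cg fz (\<Prod>D\<in>?O. \<gamma> D)" unfolding cg_def of_int_P by blast
  then have "fac fz = fac (\<Prod>D\<in>?O. \<gamma> D)" by (rule fac_cong)
  also have "\<dots> = (\<Sum>D\<in>?O. fac (\<gamma> D))" by (rule fac_prod) (rule \<gamma>(1))
  also have "\<dots> = (\<Sum>D\<in>?O. replicate_mset (\<kappa> D) (\<Phi> D))" using \<Phi> by (intro sum.cong) auto
  finally show ?thesis using that[OF \<sigma>(1), of \<kappa> \<Phi>] \<Phi> by blast
qed

end

text \<open>Division by the monic \<open>u\<close> over the integers leaves a remainder that is a
  multiple of \<open>u\<close> over the complex numbers and thus vanishes by its degree.\<close>

lemma ip_dvd_descend:
  assumes u: "monic_p u" and v: "monic_p v" and h: "ip v = ip u * h"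
  obtains k where "v = u * k" "monic_p k"
proof -
  obtain k r where kr: "v = u * k + r" "r = 0 \<or> pdeg r < pdeg u" using monic_division[OF u] by blast
  have "ip u * (h - ip k) = ip r" using h kr(1) by (simp add: ip_simps algebra_simps)
  moreover have "ip u \<noteq> 0" using u monic_ip[of u] by (auto simp: monic_p_def)
  ultimately have "ip r = 0" using kr(2) degree_mult_eq[of "ip u" "h - ip k"]
    by (metis degree_ip ip_simps(6) le_add1 linorder_not_le mult_zero_right)
  then have "r = 0" using ip_inj[of r 0] by (simp add: ip_simps)
  then have v': "v = u * k" using kr by simp
  have "pcf v (pdeg v) = pcf u (pdeg u) * pcf k (pdeg k)" unfolding v' by (rule lead_coeff_mult)
  then have "monic_p k" using u v by (simp add: monic_p_def)
  with v' show ?thesis by (rule that)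
qed

lemma (in prime_modulus) fac_power_subset:
  "monic_p g \<Longrightarrow> monic_p (g ^ N) \<and> set_mset (fac (g ^ N)) \<subseteq> set_mset (fac g)"
  by (induction N) (auto simp: fac_1 fac_mult monic_p_1 monic_p_mult)

lemma pderiv_cpoly: "pderiv (cpoly f) = cpoly (pderiv f)"
  by (rule poly_eqI) (simp add: coeff_pderiv coeff_map_poly of_rat_mult flip: of_nat_Suc)

context prime_place
begin

text \<open>The product over the distinct roots is invariant under the Galois group and has
  algebraic integers as coefficients, so these are rational integers.\<close>

lemma radical_integral:
  assumes f: "cpoly f = ip fz" "monic_p fz"
  obtains g where "monic_p g" "ip g = (\<Prod>\<alpha>\<in>complex_roots f. [:- \<alpha>, 1:])"
proof -
  let ?R = "complex_roots f" and ?g = "\<Prod>\<alpha>\<in>complex_roots f. [:- \<alpha>, 1:]"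
  have f0: "f \<noteq> 0" by (rule cpoly_nonzero[OF f])
  have RK: "?R \<subseteq> splitting_carrier f" using splitting_carrier_base by auto
  have gS: "?g \<in> polys_over S" if "subring_set S" "?R \<subseteq> S" for S
    using that by (intro subring_prod polys_over_subring linear_over) auto
  have "pcf ?g i \<in> \<int>" for i
  proof (rule galois_invariant_int[OF f0])
    show "pcf ?g i \<in> splitting_carrier f" using gS[OF splitting_carrier_subring RK] by (simp only: polys_over_def mem_Collect_eq)
    have "?R \<subseteq> AI" using roots_algebraic_int[OF f] by auto
    then show "algebraic_int (pcf ?g i)" using gS[OF AI_subring] by (simp add: polys_over_def)
    fix \<sigma> assume \<sigma>: "\<sigma> \<in> galois_group f"
    note D = galois_groupD[OF f0 \<sigma>]
    note h1 = hom_on_map_poly[OF D(1)]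
    have \<sigma>0: "\<sigma> 0 = 0" using hom_onD(2)[OF D(1)] .
    have lin: "map_poly \<sigma> [:- \<alpha>, 1:] = [:- \<sigma> \<alpha>, 1:]" if "\<alpha> \<in> ?R" for \<alpha>
    proof (rule poly_eqI)
      fix i
      have "\<sigma> (- \<alpha>) = - \<sigma> \<alpha>" using hom_on_minus[OF D(1)] that RK by blast
      then show "pcf (map_poly \<sigma> [:- \<alpha>, 1:]) i = pcf [:- \<sigma> \<alpha>, 1:] i"
        using hom_onD(3)[OF D(1)] \<sigma>0 by (simp add: coeff_map_poly coeff_pCons split: nat.split)
    qed
    have "map_poly \<sigma> ?g = (\<Prod>\<alpha>\<in>?R. map_poly \<sigma> [:- \<alpha>, 1:])"
      using RK by (intro hom_on_prod[OF h1] linear_over splitting_carrier_subring) auto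
    also have "\<dots> = (\<Prod>\<alpha>\<in>?R. [:- \<sigma> \<alpha>, 1:])" using lin by (intro prod.cong) auto
    also have "\<dots> = ?g" by (rule prod.reindex_bij_betw[OF D(5)])
    finally have "pcf (map_poly \<sigma> ?g) i = pcf ?g i" by simp
    then show "\<sigma> (pcf ?g i) = pcf ?g i" by (simp add: coeff_map_poly \<sigma>0)
  qed
  then have "\<exists>k. \<forall>i. pcf ?g i = of_int (k i)" by (intro choice) (auto elim: Ints_cases)
  then obtain k where k: "\<And>i. pcf ?g i = of_int (k i)" by blast
  have m: "monic_p ?g" "pdeg ?g = card ?R"
    using monic_prod[of ?R "\<lambda>\<alpha>. [:- \<alpha>, 1:]"] by (auto simp: monic_linear)
  have "ip (of_coeffs (card ?R) k) = ?g"
  proof (rule poly_eqI)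
    fix i
    consider "i < card ?R" | "i = card ?R" | "i > card ?R" by linarith
    then show "pcf (ip (of_coeffs (card ?R) k)) i = pcf ?g i"
    proof cases
      case 1 then show ?thesis by (simp add: coeff_ip coeff_of_coeffs k)
    next
      case 2 then show ?thesis using m by (simp add: coeff_ip coeff_of_coeffs monic_p_def)
    next
      case 3 then show ?thesis using m by (simp add: coeff_ip coeff_of_coeffs coeff_eq_0)
    qed
  qed
  then show ?thesis using that of_coeffs_monic(1) by blast
qed

text \<open>One multiple root is a zero of the derivative, and transitivity makes every root
  multiple. With \<open>g\<close> the product over the distinct roots, \<open>g ^ 2\<close> divides
  \<open>fz\<close>, and \<open>fz\<close> divides a power of \<open>g\<close>. So an irreducible
  factor of \<open>fz\<close> modulo \<open>p\<close> divides \<open>g\<close>, and therefore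
  divides \<open>fz\<close> at least twice.\<close>

lemma repeated_roots:
  assumes f: "cpoly f = ip fz" "monic_p fz" and tr: "galois_transitive f"
    and c: "card (complex_roots f) \<noteq> pdeg fz" and \<phi>: "\<phi> \<in># fac fz"
  shows "count (fac fz) \<phi> \<ge> 2"
proof -
  let ?R = "complex_roots f"
  have f0: "f \<noteq> 0" by (rule cpoly_nonzero[OF f])
  have F: "monic_p (ip fz)" "ip fz \<noteq> 0" "pcf (ip fz) (pdeg (ip fz)) = 1" using f(2) monic_ip[of fz] by (auto simp: monic_p_def)
  have R: "?R = {z. poly (ip fz) z = 0}" by (simp add: complex_roots_def f(1))
  have fin: "finite ?R" by (rule finite_complex_roots[OF f0])
  let ?g = "\<Prod>\<alpha>\<in>?R. [:- \<alpha>, 1:]"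
  have dec: "ip fz = (\<Prod>\<alpha>\<in>?R. [:- \<alpha>, 1:] ^ Polynomial.order \<alpha> (ip fz))"
    using complex_poly_decompose[of "ip fz"] F(3) unfolding R by simp
  have "\<not> rsquarefree (ip fz)"
  proof
    assume "rsquarefree (ip fz)"
    from complex_poly_decompose_rsquarefree[OF this] F(3) have "ip fz = ?g" unfolding R by simp
    then have "pdeg fz = pdeg ?g" by (metis degree_ip)
    then show False using c monic_prod(2)[of ?R "\<lambda>\<alpha>. [:- \<alpha>, 1:]"] by (simp add: monic_linear)
  qed
  then obtain a where a: "a \<in> ?R" "poly (pderiv (ip fz)) a = 0" by (auto simp: rsquarefree_roots R)
  have pd: "pderiv (ip fz) = cpoly (pderiv f)" by (metis f(1) pderiv_cpoly)
  have ord: "Polynomial.order b (ip fz) \<ge> 2" if b: "b \<in> ?R" for b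
  proof -
    obtain g where "g \<in> galois_perms f" "g a = b" using tr a(1) b by (auto simp: galois_transitive_def)
    then obtain \<sigma> where \<sigma>: "\<sigma> \<in> galois_group f" "\<sigma> a = b" using a(1) by (auto simp: galois_perms_def perm_restrict_def)
    note D = galois_groupD[OF f0 \<sigma>(1)]
    have "\<sigma> (poly (cpoly (pderiv f)) a) = poly (cpoly (pderiv f)) (\<sigma> a)"
      by (rule hom_on_rat_poly[OF D(1)]) (use splitting_carrier_base a(1) D(2) in auto)
    then have pb: "poly (pderiv (ip fz)) b = 0" using a(2) \<sigma>(2) hom_onD(2)[OF D(1)] by (simp add: pd)
    have "pdeg (ip fz) \<noteq> 0"
    proof
      assume "pdeg (ip fz) = 0"
      then have "ip fz = 1" by (rule monic_p_deg0[OF F(1)])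
      then show False using b by (simp add: R)
    qed
    then have "pderiv (ip fz) \<noteq> 0" by (simp add: pderiv_eq_0_iff)
    then have "Polynomial.order b (pderiv (ip fz)) \<noteq> 0" using pb order_root by blast
    moreover have "Polynomial.order b (ip fz) = Suc (Polynomial.order b (pderiv (ip fz)))"
      using b F(2) by (intro order_pderiv) (auto simp: R)
    ultimately show ?thesis by simp
  qed
  obtain g where g: "monic_p g" "ip g = ?g" using radical_integral[OF f] by blast
  define N where "N = pdeg (ip fz)"
  have "ip fz = (\<Prod>\<alpha>\<in>?R. [:- \<alpha>, 1:] ^ 2 * [:- \<alpha>, 1:] ^ (Polynomial.order \<alpha> (ip fz) - 2))"
    by (subst dec, rule prod.cong[OF refl]) (simp only: power_add[symmetric] le_add_diff_inverse ord)
  then have eq: "ip fz = ip (g ^ 2) * (\<Prod>\<alpha>\<in>?R. [:- \<alpha>, 1:] ^ (Polynomial.order \<alpha> (ip fz) - 2))"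
    by (simp only: prod.distrib ip_simps g(2) prod_power_distrib)
  have mg: "monic_p (g ^ i)" for i using fac_power_subset[OF g(1)] by blast
  obtain k where k: "fz = g ^ 2 * k" "monic_p k"
    by (rule ip_dvd_descend[OF mg f(2) eq])
  have "ip (g ^ N) = (\<Prod>\<alpha>\<in>?R. [:- \<alpha>, 1:] ^ Polynomial.order \<alpha> (ip fz) * [:- \<alpha>, 1:] ^ (N - Polynomial.order \<alpha> (ip fz)))"
    unfolding ip_simps g(2) prod_power_distrib
    by (rule prod.cong[OF refl]) (simp only: N_def power_add[symmetric] le_add_diff_inverse order_degree[OF F(2)])
  then have eq': "ip (g ^ N) = ip fz * (\<Prod>\<alpha>\<in>?R. [:- \<alpha>, 1:] ^ (N - Polynomial.order \<alpha> (ip fz)))"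
    by (simp only: prod.distrib dec[symmetric])
  obtain k' where k': "g ^ N = fz * k'" "monic_p k'"
    by (rule ip_dvd_descend[OF f(2) mg eq'])
  have "\<phi> \<in># fac (g ^ N)" using \<phi> k' f(2) by (simp add: fac_mult)
  then have "\<phi> \<in># fac g" using fac_power_subset[OF g(1)] by blast
  then have "count (fac g) \<phi> \<ge> 1" by (simp add: count_greater_eq_one_iff)
  moreover have "fac fz = fac g + fac g + fac k"
    unfolding k(1) power2_eq_square using g(1) k(2) by (simp add: fac_mult monic_p_mult)
  then have "count (fac fz) \<phi> = count (fac g) \<phi> + count (fac g) \<phi> + count (fac k) \<phi>" by simp
  ultimately show ?thesis by linarith
qed

end

section \<open>Permutation groups with a typical element\<close>

text \<open>An abstract form of a Galois group with a Frobenius element: the orbit \<open>D\<close>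
  reduces to the power \<open>\<kappa> D\<close> of the irreducible \<open>\<Phi> D\<close>. The
  group-theoretic argument uses only this link to the polynomial.\<close>

locale orbit_profile = graded_primes Pr dg Q Ms + perm_group G \<Omega>
  for Pr :: "'p set" and dg Q Ms and G :: "('a \<Rightarrow> 'a) set" and \<Omega> +
  fixes \<sigma> :: "'a \<Rightarrow> 'a" and \<Phi> :: "'a set \<Rightarrow> 'p" and \<kappa> :: "'a set \<Rightarrow> nat"
  assumes \<sigma>: "\<sigma> \<in> G"
    and \<kappa>_pos: "D \<in> orb \<sigma> ` \<Omega> \<Longrightarrow> \<kappa> D \<ge> 1"
    and \<Phi>_prime: "D \<in> orb \<sigma> ` \<Omega> \<Longrightarrow> \<Phi> D \<in> Pr"
    and card_orbit: "D \<in> orb \<sigma> ` \<Omega> \<Longrightarrow> card D = \<kappa> D * dg (\<Phi> D)"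
begin

abbreviation "orbits \<equiv> orb \<sigma> ` \<Omega>"

definition profile :: "'a set set \<Rightarrow> 'p multiset" where
  "profile \<D> = (\<Sum>D\<in>\<D>. replicate_mset (\<kappa> D) (\<Phi> D))"

text \<open>This covers an orbit with \<open>\<kappa> D \<ge> 2\<close> as well as one whose
  irreducible factor also belongs to another orbit.\<close>

definition multiple :: "'a set \<Rightarrow> bool" where
  "multiple D \<longleftrightarrow> count (profile orbits) (\<Phi> D) \<ge> 2"

lemma perm: "\<sigma> permutes \<Omega>" by (rule mem_permutes[OF \<sigma>])

lemma finite_orbits: "finite orbits" using finite_space by simp

lemma orbit_sub: "D \<in> orbits \<Longrightarrow> D \<subseteq> \<Omega>" using orb_subset[OF perm] by blast

lemma finite_orbit: "D \<in> orbits \<Longrightarrow> finite D" using orbit_sub finite_space finite_subset by blast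

lemma orbit_eq: "D \<in> orbits \<Longrightarrow> x \<in> D \<Longrightarrow> D = orb \<sigma> x"
  using orb_sym[OF perm finite_space] by blast

lemma card_orbit_pos: "D \<in> orbits \<Longrightarrow> card D > 0"
  using funpow_card_orb(2)[OF perm finite_space] by blast

lemma profile_mono: "\<D> \<subseteq> \<E> \<Longrightarrow> \<E> \<subseteq> orbits \<Longrightarrow> profile \<D> \<subseteq># profile \<E>"
proof -
  assume s: "\<D> \<subseteq> \<E>" "\<E> \<subseteq> orbits"
  have "finite \<E>" using s finite_orbits finite_subset by blast
  then have "profile \<E> = profile (\<E> - \<D>) + profile \<D>" unfolding profile_def using s by (intro sum.subset_diff)
  then show ?thesis by simp
qed

lemma wt_profile: "\<D> \<subseteq> orbits \<Longrightarrow> wt (profile \<D>) = (\<Sum>D\<in>\<D>. card D)"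
proof -
  assume s: "\<D> \<subseteq> orbits"
  have "finite \<D>" using s finite_orbits finite_subset by blast
  then show ?thesis using s unfolding profile_def
  proof (induction \<D> rule: finite_induct)
    case empty show ?case by (simp add: wt_def)
  next
    case (insert D \<D>)
    then show ?case using card_orbit[of D] by (simp add: wt_add wt_replicate)
  qed
qed

lemma mem_profile: "\<D> \<subseteq> orbits \<Longrightarrow> \<phi> \<in># profile \<D> \<longleftrightarrow> (\<exists>D\<in>\<D>. \<Phi> D = \<phi>)"
proof -
  assume s: "\<D> \<subseteq> orbits"
  have "finite \<D>" using s finite_orbits finite_subset by blast
  then show ?thesis using s unfolding profile_def
  proof (induction \<D> rule: finite_induct)
    case (insert D \<D>)
    then show ?case using \<kappa>_pos[of D] by auto
  qed simp
qed

lemma profile_two: "D \<in> orbits \<Longrightarrow> E \<in> orbits \<Longrightarrow> D \<noteq> E \<Longrightarrow> \<Phi> D = \<Phi> E \<Longrightarrow> multiple D"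
proof -
  assume a: "D \<in> orbits" "E \<in> orbits" "D \<noteq> E" "\<Phi> D = \<Phi> E"
  have "profile {D, E} \<subseteq># profile orbits" using a by (intro profile_mono) auto
  then have "count (profile {D, E}) (\<Phi> D) \<le> count (profile orbits) (\<Phi> D)" by (rule mset_subset_eq_count)
  moreover have "count (profile {D, E}) (\<Phi> D) = \<kappa> D + \<kappa> E" using a by (simp add: profile_def)
  ultimately show ?thesis using \<kappa>_pos[OF a(1)] \<kappa>_pos[OF a(2)] by (simp add: multiple_def)
qed

lemma simple_card: "D \<in> orbits \<Longrightarrow> \<not> multiple D \<Longrightarrow> card D = dg (\<Phi> D)"
proof -
  assume a: "D \<in> orbits" "\<not> multiple D"
  have "profile {D} \<subseteq># profile orbits" using a by (intro profile_mono) auto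
  then have "count (profile {D}) (\<Phi> D) \<le> count (profile orbits) (\<Phi> D)" by (rule mset_subset_eq_count)
  then have "\<kappa> D \<le> 1" using a(2) by (simp add: profile_def multiple_def)
  then show ?thesis using \<kappa>_pos[OF a(1)] card_orbit[OF a(1)] by simp
qed

lemma multiple_total:
  assumes "\<D> \<subseteq> orbits" "\<And>D. D \<in> \<D> \<Longrightarrow> multiple D"
  shows "(\<Sum>D\<in>\<D>. card D) \<le> wt (rep (profile orbits))"
proof -
  have "filter_mset (\<lambda>\<phi>. count (profile orbits) \<phi> \<ge> 2) (profile \<D>) = profile \<D>"
    using assms(2) mem_profile[OF assms(1)] by (intro filter_mset_eq_conv[THEN iffD2]) (auto simp: multiple_def)
  moreover have "filter_mset (\<lambda>\<phi>. count (profile orbits) \<phi> \<ge> 2) (profile \<D>) \<subseteq># rep (profile orbits)"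
    unfolding rep_def by (intro multiset_filter_mono profile_mono[OF assms(1)]) simp
  ultimately have "profile \<D> \<subseteq># rep (profile orbits)" by simp
  then have "wt (profile \<D>) \<le> wt (rep (profile orbits))" by (rule wt_mono)
  then show ?thesis using wt_profile[OF assms(1)] by simp
qed

lemma sum_orbits_card:
  assumes "U \<subseteq> \<Omega>" "\<And>x. x \<in> U \<Longrightarrow> orb \<sigma> x \<subseteq> U"
  shows "(\<Sum>D\<in>orb \<sigma> ` U. card D) = card U"
proof -
  have "\<Union>(orb \<sigma> ` U) = U"
  proof
    show "\<Union>(orb \<sigma> ` U) \<subseteq> U" using assms(2) by blast
    show "U \<subseteq> \<Union>(orb \<sigma> ` U)" using orb_self by fast
  qed
  moreover have "card (\<Union>(orb \<sigma> ` U)) = (\<Sum>D\<in>orb \<sigma> ` U. card D)"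
  proof (rule card_Union_disjoint)
    show "pairwise disjnt (orb \<sigma> ` U)"
      unfolding pairwise_def disjnt_def using assms(1) orbit_eq by blast
  qed (use assms(1) finite_orbit in blast)
  ultimately show ?thesis by simp
qed

text \<open>If there are blocks of size \<open>s\<close>, the orbit of prime length lies in one of
  them, so \<open>s > par_y n\<close>. If \<open>s * par_y n\<close> were at most
  \<open>par_z n\<close>, each long orbit would be a union of blocks, and two of them would share
  the divisor \<open>s\<close>. So there are at most \<open>par_K n\<close> blocks, and the orbits
  that meet one cycle of blocks then contradict \<open>no_invariant_block\<close> or
  \<open>no_multiple_block\<close>.\<close>

theorem typical_even_perms:
  assumes n: "n = card \<Omega>" and tr: "trans_on G \<Omega>" and ty: "typical n (profile orbits)"
    and large: "par_w n < par_y n" "3 \<le> par_y n" "1 \<le> par_l n"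
    and \<pi>: "\<pi> permutes \<Omega>" "evenperm \<pi>"
  shows "\<pi> \<in> G"
proof -
  let ?A = "profile orbits"
  have few_repeated: "wt (rep ?A) \<le> par_w n" using ty by (simp add: typical_def few_repeated_def)
  have no_common_divisor: "\<And>\<phi> \<psi> j. \<lbrakk>\<phi> \<in># ?A; \<psi> \<in># ?A; j \<ge> par_y n; \<phi> \<noteq> \<psi>; j dvd dg \<phi>; j dvd dg \<psi>\<rbrakk> \<Longrightarrow> False"
    using ty unfolding typical_def no_common_divisor_def by meson
  have small: "card D \<le> par_w n" if "D \<in> orbits" "multiple D" for D
    using multiple_total[of "{D}"] that few_repeated by simp
  have memA: "\<Phi> D \<in># ?A" if "D \<in> orbits" for D using that mem_profile[of orbits] by blast
  \<comment> \<open>A common divisor \<open>j\<close> of size at least \<open>par_y n\<close> makes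
    both orbits too long to be \<open>multiple\<close>; they then belong to different factors, whose
    degrees share \<open>j\<close>.\<close>
  have apart: False if D: "D \<in> orbits" "E \<in> orbits" "D \<noteq> E" "j \<ge> par_y n" "j dvd card D" "j dvd card E" for D E j
  proof -
    have "\<not> multiple C" if C: "C \<in> orbits" "j dvd card C" for C
      using small[OF C(1)] dvd_imp_le[OF C(2) card_orbit_pos[OF C(1)]] D(4) large(1) by linarith
    then have "\<not> multiple D" "\<not> multiple E" using D by auto
    then show False
      using no_common_divisor[OF memA[OF D(1)] memA[OF D(2)] D(4)] profile_two[OF D(1-3)] D simple_card by metis
  qed
  have big: "\<exists>D\<in>orbits. \<Phi> D = \<phi> \<and> dg \<phi> \<le> card D" if "\<phi> \<in># ?A" for \<phi>
  proof -
    obtain D where "D \<in> orbits" "\<Phi> D = \<phi>" using \<open>\<phi> \<in># ?A\<close> mem_profile[of orbits] by blast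
    then show ?thesis using \<kappa>_pos[of D] card_orbit[of D] by auto
  qed
  obtain \<phi> where \<phi>: "\<phi> \<in># ?A" "Factorial_Ring.prime (dg \<phi>)" "par_y n < dg \<phi>" "2 * dg \<phi> \<le> n"
    using ty by (auto simp: typical_def has_prime_degree_def)
  obtain D where D: "D \<in> orbits" "\<Phi> D = \<phi>" "dg \<phi> \<le> card D" using big[OF \<phi>(1)] by blast
  have "\<not> multiple D" using small[OF D(1)] D(3) \<phi>(3) large(1) by linarith
  then have q: "card D = dg \<phi>" using simple_card[OF D(1)] D(2) by simp
  obtain x where x: "x \<in> \<Omega>" "D = orb \<sigma> x" using D(1) by blast
  have D\<Omega>: "D \<subseteq> \<Omega>" by (rule orbit_sub[OF D(1)])
  have trD: "trans_on (fixing G D) D"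
    unfolding x(2)
  proof (rule trans_on_fixing_orb[OF \<sigma> x(1)])
    show "Factorial_Ring.prime (card (orb \<sigma> x))" using q \<phi>(2) x(2) by simp
    fix y assume y: "y \<in> \<Omega>" "orb \<sigma> y \<noteq> orb \<sigma> x"
    show "\<not> card (orb \<sigma> x) dvd card (orb \<sigma> y)"
    proof
      assume d: "card (orb \<sigma> x) dvd card (orb \<sigma> y)"
      have "card (orb \<sigma> x) \<ge> par_y n" using q \<phi>(3) x(2) by simp
      from apart[OF _ D(1)[unfolded x(2)] y(2) this d dvd_refl] y(1) show False by blast
    qed
  qed
  show "\<pi> \<in> G"
  proof (cases "prim_on G \<Omega>")
    case True
    show ?thesis
      by (rule jordan_prime_cycle[OF True D\<Omega> trD]) (use q \<phi> large(2) n \<pi> in auto)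
  next
    case False
    then obtain B where B: "B \<subseteq> \<Omega>" "block G B" "\<not> card B \<le> 1" "B \<noteq> \<Omega>" using tr unfolding prim_on_def by blast
    define s where "s = card B"
    have s2: "s \<ge> 2" using B(3) by (simp add: s_def)
    have move: "\<exists>C\<subseteq>\<Omega>. block G C \<and> v \<in> C \<and> card C = s" if v: "v \<in> \<Omega>" for v
    proof -
      have "B \<noteq> {}" using B(3) by auto
      then obtain b where b: "b \<in> B" by blast
      obtain g where g: "g \<in> G" "g b = v" using tr b B(1) v unfolding trans_on_def by blast
      show ?thesis
      proof (intro exI conjI)
        show "g ` B \<subseteq> \<Omega>" using B(1) mem_in[OF g(1)] by blast
        show "block G (g ` B)" by (rule block_translate[OF B(2) g(1)])
        show "v \<in> g ` B" using b g(2) by blast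
        show "card (g ` B) = s" unfolding s_def by (rule card_image_mem[OF g(1)])
      qed
    qed
    have orbit_hull: "\<exists>j U. j > 0 \<and> C \<subseteq> U \<and> U \<subseteq> \<Omega> \<and> card U = j * s \<and> (\<forall>v\<in>U. orb \<sigma> v \<subseteq> U \<and> card (orb \<sigma> v) = j * card (orb \<sigma> v \<inter> C))"
      if C: "C \<subseteq> \<Omega>" "block G C" "card C = s" for C
    proof (rule block_orbit[OF perm finite_space C(1)])
      show "C \<noteq> {}" using C(3) s2 by auto
      show "(\<sigma> ^^ i) ` C = C \<or> (\<sigma> ^^ i) ` C \<inter> C = {}" for i
        using C(2) funpow_mem[OF \<sigma>] unfolding block_def by blast
      fix j U assume "j > 0" "C \<subseteq> U" "U \<subseteq> \<Omega>" "card U = j * card C" "\<And>v. v \<in> U \<Longrightarrow> orb \<sigma> v \<subseteq> U"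
        "\<And>v. v \<in> U \<Longrightarrow> card (orb \<sigma> v) = j * card (orb \<sigma> v \<inter> C)"
      then show ?thesis using C(3) by (intro exI[of _ j] exI[of _ U]) auto
    qed
    obtain C where C: "C \<subseteq> \<Omega>" "block G C" "x \<in> C" "card C = s" using move[OF x(1)] by (elim exE conjE) (rule that)
    have "D \<subseteq> C"
    proof (rule block_contains_cycle[OF D\<Omega> _ C(2)])
      interpret F: perm_group "fixing G D" D by (rule fixing_perm_group[OF D\<Omega>])
      show "prim_on (fixing G D) D" by (rule F.trans_on_prime_prim_on[OF trD]) (use q \<phi>(2) in simp)
      show "C \<inter> D \<noteq> {}" using C(3) orb_self[of x \<sigma>] unfolding x(2) by blast
      show "2 \<le> card C" using C(4) s2 by simp
    qed
    then have "card D \<le> s" using card_mono[OF finite_subset[OF C(1) finite_space]] C(4) by simp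
    then have sy: "s > par_y n" using q \<phi>(3) by simp
    have "s dvd n" unfolding s_def n using B by (intro card_block_dvd[OF tr B(2,1)]) auto
    then obtain r where r: "n = s * r" by blast
    have "s < n" unfolding s_def n using psubset_card_mono[OF finite_space psubsetI[OF B(1,4)]] .
    then have r2: "r \<ge> 2" using r s2 by (cases r) (auto simp: not_less_eq_eq[symmetric] intro: ccontr)
    \<comment> \<open>A long orbit needs a cycle of \<open>j > par_y n\<close> blocks to contain it.
      All orbits in the hull \<open>U\<close> of this cycle have length divisible by
      \<open>j\<close>, so by \<open>apart\<close> there is only one; hence \<open>U\<close> is
      \<open>E\<close> and has \<open>j * s\<close> points.\<close>
    have long: "s dvd card E" if E: "E \<in> orbits" "card E > par_z n" and sz: "s * par_y n \<le> par_z n" for E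
    proof -
      obtain v where v: "v \<in> \<Omega>" "E = orb \<sigma> v" using E(1) by blast
      obtain C' where C': "C' \<subseteq> \<Omega>" "block G C'" "v \<in> C'" "card C' = s" using move[OF v(1)] by (elim exE conjE) (rule that)
      obtain j U where U: "j > 0" "C' \<subseteq> U" "U \<subseteq> \<Omega>" "card U = j * s"
        "\<And>v. v \<in> U \<Longrightarrow> orb \<sigma> v \<subseteq> U" "\<And>v. v \<in> U \<Longrightarrow> card (orb \<sigma> v) = j * card (orb \<sigma> v \<inter> C')"
        using orbit_hull[OF C'(1,2,4)] by (elim exE conjE) (rule that, auto)
      have vU: "v \<in> U" using C'(3) U(2) by blast
      have "card (E \<inter> C') \<le> s" 
        using card_mono[OF finite_subset[OF C'(1) finite_space] Int_lower2[of E]] C'(4) by simp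
      then have "card E \<le> j * s" using U(6)[OF vU] v(2) by simp
      then have "s * par_y n < s * j" using E(2) sz unfolding mult.commute[of s j] by linarith
      then have "par_y n < j" by (simp only: mult_less_cancel1)
      then have jy: "j \<ge> par_y n" by (rule less_imp_le)
      have "U = E"
      proof (rule ccontr)
        assume "U \<noteq> E"
        moreover have "E \<subseteq> U" using U(5)[OF vU] v(2) by simp
        ultimately obtain u where u: "u \<in> U" "u \<notin> E" by blast
        have "orb \<sigma> u \<noteq> E" using u(2) orb_self by metis
        moreover have "orb \<sigma> u \<in> orbits" using u(1) U(3) by blast
        moreover have "j dvd card (orb \<sigma> u)" "j dvd card E" using U(6)[OF u(1)] U(6)[OF vU] v(2) by simp_all
        ultimately show False using apart[OF _ E(1) _ jy] by blast
      qed
      then show ?thesis using U(4) by simp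
    qed
    obtain \<psi>1 \<psi>2 where \<psi>: "\<psi>1 \<in># ?A" "\<psi>2 \<in># ?A" "\<psi>1 \<noteq> \<psi>2" "par_z n < dg \<psi>1" "par_z n < dg \<psi>2"
      using ty by (auto simp: typical_def two_long_def)
    obtain E1 E2 where E: "E1 \<in> orbits" "\<Phi> E1 = \<psi>1" "dg \<psi>1 \<le> card E1" "E2 \<in> orbits" "\<Phi> E2 = \<psi>2" "dg \<psi>2 \<le> card E2"
      using big[OF \<psi>(1)] big[OF \<psi>(2)] by blast
    have sz: "s * par_y n > par_z n"
    proof (rule ccontr)
      assume "\<not> ?thesis"
      then have sz: "s * par_y n \<le> par_z n" by simp
      have "s dvd card E1" "s dvd card E2" using long[OF E(1) _ sz] long[OF E(4) _ sz] E \<psi> by linarith+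
      moreover have "E1 \<noteq> E2" using E(2,5) \<psi>(3) by blast
      ultimately show False using apart[OF E(1,4) _ less_imp_le[OF sy]] by blast
    qed
    \<comment> \<open>\<open>par_z n\<close> is the quotient rounded down, which explains the added
      1; the strict inequality \<open>sz\<close> absorbs it.\<close>
    have "n < par_l n * (par_z n + 1)"
      using large(3) dividend_less_times_div[of "par_l n" n] by (simp add: par_z_def)
    also have "\<dots> \<le> par_l n * (s * par_y n)" using sz by (intro mult_le_mono2) simp
    also have "\<dots> = s * par_K n" by (simp add: par_K_def)
    finally have "s * r < s * par_K n" unfolding r .
    then have rK: "r \<le> par_K n" by simp
    have nr: "n div r = s" using r r2 by simp
    have rn: "r dvd n" using r by simp
    obtain j U where U: "j > 0" "C \<subseteq> U" "U \<subseteq> \<Omega>" "card U = j * s"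
      "\<And>v. v \<in> U \<Longrightarrow> orb \<sigma> v \<subseteq> U" "\<And>v. v \<in> U \<Longrightarrow> card (orb \<sigma> v) = j * card (orb \<sigma> v \<inter> C)"
      using orbit_hull[OF C(1,2,4)] by (elim exE conjE) (rule that, auto)
    have "j * s \<le> n" using card_mono[OF finite_space U(3)] U(4) n by simp
    then have "j \<le> r" using r s2 by (simp add: mult.commute)
    then have jK: "j \<le> par_K n" using rK by simp
    \<comment> \<open>The total length of the orbits in \<open>\<M>\<close>, whose reduction is
      ambiguous, is the error term \<open>e\<close>; the other orbits yield the sub-multiset of
      factors.\<close>
    define \<S> \<M> where "\<S> = {D \<in> orb \<sigma> ` U. \<not> multiple D}" and "\<M> = {D \<in> orb \<sigma> ` U. multiple D}"
    have sub: "\<S> \<subseteq> orbits" "\<M> \<subseteq> orbits" using U(3) by (auto simp: \<S>_def \<M>_def)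
    have "finite U" using U(3) finite_space finite_subset by blast
    then have fin: "finite \<S>" "finite \<M>" by (auto simp: \<S>_def \<M>_def)
    have "orb \<sigma> ` U = \<S> \<union> \<M>" "\<S> \<inter> \<M> = {}" by (auto simp: \<S>_def \<M>_def)
    then have "(\<Sum>D\<in>\<S>. card D) + (\<Sum>D\<in>\<M>. card D) = card U"
      using sum_orbits_card[OF U(3,5)] sum.union_disjoint[OF fin] by metis
    then have total: "wt (profile \<S>) + (\<Sum>D\<in>\<M>. card D) = j * (n div r)"
      using wt_profile[OF sub(1)] U(4) nr by simp
    have e: "(\<Sum>D\<in>\<M>. card D) \<le> par_w n"
      using multiple_total[OF sub(2)] few_repeated by (auto simp: \<M>_def)
    have pS: "profile \<S> \<subseteq># ?A" using sub(1) by (intro profile_mono) auto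
    have div: "j dvd dg \<phi>" if \<phi>: "\<phi> \<in># profile \<S>" for \<phi>
    proof -
      obtain D where D: "D \<in> \<S>" "\<Phi> D = \<phi>" using \<phi> mem_profile[OF sub(1)] by blast
      then obtain v where v: "v \<in> U" "D = orb \<sigma> v" "\<not> multiple D" by (auto simp: \<S>_def)
      have "dg \<phi> = card D" using simple_card[OF _ v(3)] D sub(1) by auto
      then show ?thesis using U(6)[OF v(1)] v(2) by simp
    qed
    \<comment> \<open>\<open>j = 1\<close> means that \<open>\<sigma>\<close> preserves the block
      \<open>C\<close>; for larger \<open>j\<close> all degrees in \<open>profile \<S>\<close> are
      divisible by \<open>j\<close>.\<close>
    show ?thesis
    proof (cases "j = 1")
      case True
      then have "wt (profile \<S>) + (\<Sum>D\<in>\<M>. card D) = n div r" using total by simp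
      then show ?thesis using ty r2 rK rn e pS unfolding typical_def no_invariant_block_def by blast
    next
      case False
      then have j2: "2 \<le> j" using U(1) by simp
      have "1 \<le> r" using r2 by simp
      then show ?thesis using ty rK rn j2 jK e pS total div unfolding typical_def no_multiple_block_def by blast
    qed
  qed
qed

end

section \<open>Random polynomials\<close>

sublocale prime_modulus \<subseteq> fp: graded_primes Irr pdeg p "\<lambda>n. {A. set_mset A \<subseteq> Irr \<and> (\<Sum>\<phi>\<in>#A. pdeg \<phi>) = n}"
proof unfold_locales
  show "pdeg \<phi> \<ge> 1" if "\<phi> \<in> Irr" for \<phi> using that by (auto simp: Irr_def)
  show "p \<ge> 2" by (rule p2)
  show "card {A. set_mset A \<subseteq> Irr \<and> (\<Sum>\<phi>\<in>#A. pdeg \<phi>) = n} = p ^ n" for n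
    using bij_betw_same_card[OF bij_fac[of n]] card_Mon by simp
qed simp

text \<open>\<open>par_w n < n\<close> excludes that all factors are repeated; the other
  inequalities are those that \<open>typical_even_perms\<close> asks for.\<close>

definition large :: "nat \<Rightarrow> bool" where
  "large n \<longleftrightarrow> par_w n < par_y n \<and> par_w n < n \<and> 3 \<le> par_y n \<and> 1 \<le> par_l n"

lemma eventually_large: "eventually large sequentially"
proof -
  have "eventually (\<lambda>n::nat. ln n \<ge> 2) sequentially" by real_asymp
  moreover have "eventually (\<lambda>n::nat. ln n < n) sequentially" by real_asymp
  ultimately show ?thesis
  proof eventually_elim
    case (elim n)
    have c: "ln n * 4 \<le> ln n ^ 3"
    proof -
      have "2 * 2 \<le> ln n * ln n" using elim(1) by (intro mult_mono) auto
      then have "ln n * 4 \<le> ln n * (ln n * ln n)" using elim(1) by (intro mult_left_mono) auto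
      then show ?thesis by (simp add: power3_eq_cube)
    qed
    have w: "real (par_w n) \<le> ln n / 10" unfolding par_w_def using elim(1) by (intro of_nat_floor) simp
    have y: "ln n ^ 3 \<le> real (par_y n)" unfolding par_y_def by (rule real_nat_ceiling_ge)
    have l: "ln n \<le> real (par_l n)" unfolding par_l_def by (rule real_nat_ceiling_ge)
    have "real (par_w n) < real (par_y n)" "real (par_w n) < real n" "real 3 \<le> real (par_y n)" "real 1 \<le> real (par_l n)"
      using c w y l elim by linarith+
    then show ?case unfolding large_def of_nat_less_iff of_nat_le_iff by blast
  qed
qed

text \<open>If roots coincide, all factors modulo \<open>p\<close> are repeated, and a repeated part
  of weight \<open>n\<close> is not typical. Otherwise the group contains all even permutations, and
  a single odd member completes the symmetric group.\<close>

lemma (in prime_place) typical_galois: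
  assumes f: "cpoly f = ip fz" "monic_p fz" and n: "n = pdeg fz" and tr: "galois_transitive f"
    and ty: "fp.typical n (fac fz)" and large: "large n"
  shows "galois_alternating n f \<or> galois_symmetric n f"
proof -
  let ?R = "complex_roots f" and ?G = "galois_perms f"
  have wt: "fp.wt (fac fz) = n" using fac_degree[OF f(2)] n by (simp add: fp.wt_def)
  have card: "card ?R = pdeg fz"
  proof (rule ccontr)
    assume "card ?R \<noteq> pdeg fz"
    then have "fp.rep (fac fz) = fac fz"
      unfolding fp.rep_def filter_mset_eq_conv using repeated_roots[OF f tr] by auto
    then show False using ty wt large by (simp add: fp.typical_def fp.few_repeated_def large_def)
  qed
  have f0: "f \<noteq> 0" by (rule cpoly_nonzero[OF f])
  interpret G: perm_group ?G ?R by (rule galois_perms_perm_group[OF f0])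
  obtain \<sigma> \<Phi> \<kappa> where \<sigma>: "\<sigma> \<in> ?G"
    "\<And>D. D \<in> orb \<sigma> ` ?R \<Longrightarrow> \<kappa> D \<ge> (1::nat) \<and> \<Phi> D \<in> Irr \<and> \<kappa> D * pdeg (\<Phi> D) = card D"
    "fac fz = (\<Sum>D\<in>orb \<sigma> ` ?R. replicate_mset (\<kappa> D) (\<Phi> D))"
    by (rule frobenius_profile[OF f card]) (rule that)
  interpret O: orbit_profile Irr pdeg p "\<lambda>n. {A. set_mset A \<subseteq> Irr \<and> (\<Sum>\<phi>\<in>#A. pdeg \<phi>) = n}" ?G ?R \<sigma> \<Phi> \<kappa>
  proof unfold_locales
    show "\<sigma> \<in> ?G" by (rule \<sigma>(1))
  qed (use \<sigma>(2) in auto)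
  have tr': "trans_on ?G ?R" using tr by (simp add: galois_transitive_def trans_on_def)
  have even: "\<pi> \<in> ?G" if "\<pi> permutes ?R" "evenperm \<pi>" for \<pi>
    by (rule O.typical_even_perms[OF _ tr' _ _ _ _ that, of n])
      (use n card ty \<sigma>(3) large in \<open>simp_all add: O.profile_def large_def\<close>)
  have cn: "card ?R = n" using card n by simp
  show ?thesis
  proof (cases "\<forall>g\<in>?G. evenperm g")
    case True
    then have "?G = {g. g permutes ?R \<and> evenperm g}" using even G.mem_permutes by blast
    then show ?thesis using cn by (simp add: galois_alternating_def)
  next
    case False
    then obtain g where g: "g \<in> ?G" "\<not> evenperm g" by blast
    have perm: "permutation \<pi>" if "\<pi> permutes ?R" for \<pi>
      using that G.finite_space by (auto simp: permutation_permutes)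
    have pg: "g permutes ?R" by (rule G.mem_permutes[OF g(1)])
    have "\<pi> \<in> ?G" if \<pi>: "\<pi> permutes ?R" for \<pi>
    proof (cases "evenperm \<pi>")
      case True then show ?thesis using even \<pi> by blast
    next
      case odd: False
      have ig: "inv g permutes ?R" by (rule permutes_inv[OF pg])
      have "evenperm (inv g \<circ> \<pi>)"
        using odd g(2) evenperm_comp[OF perm[OF ig] perm[OF \<pi>]] evenperm_inv[OF perm[OF pg]] by simp
      then have "inv g \<circ> \<pi> \<in> ?G" using even permutes_compose[OF \<pi> ig] by blast
      then have "g \<circ> (inv g \<circ> \<pi>) \<in> ?G" by (rule G.comp_mem[OF g(1)])
      moreover have "g \<circ> (inv g \<circ> \<pi>) = \<pi>" using G.inv_apply(2)[OF g(1)] by (simp add: fun_eq_iff)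
      ultimately show ?thesis by simp
    qed
    then have "?G = {\<pi>. \<pi> permutes ?R}" using G.mem_permutes by blast
    then show ?thesis using cn by (simp add: galois_symmetric_def)
  qed
qed

lemma (in prime_modulus) cpoly_monic_poly: "cpoly (monic_poly n a) = ip (of_coeffs n (\<lambda>i. int (a i)))"
proof (rule poly_eqI)
  fix i
  have "pcf (\<Sum>j<n. Polynomial.monom (of_nat (a j) :: rat) j) i = (\<Sum>j<n. if j = i then of_nat (a j) else 0)"
    by (simp add: coeff_sum)
  also have "\<dots> = (if i < n then of_nat (a i) else 0)" by (simp add: sum.delta)
  finally show "pcf (cpoly (monic_poly n a)) i = pcf (ip (of_coeffs n (\<lambda>i. int (a i)))) i"
    by (simp add: coeff_map_poly monic_poly_def coeff_ip coeff_of_coeffs)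
qed

lemma card_residue_class:
  fixes p L c :: nat
  assumes p: "p \<ge> 1" "p dvd L" and c: "c < p"
  shows "card {k \<in> {1..L}. k mod p = c} * p = L"
proof -
  obtain m where L: "L = p * m" using p(2) by blast
  \<comment> \<open>The interval starts at 1, so the class of 0 is represented by
    \<open>p\<close>.\<close>
  define c' where "c' = (if c = 0 then p else c)"
  have c': "1 \<le> c'" "c' \<le> p" "c' mod p = c" using p c by (auto simp: c'_def)
  have "{k \<in> {1..L}. k mod p = c} = (\<lambda>j. p * j + c') ` {..<m}"
  proof
    show "(\<lambda>j. p * j + c') ` {..<m} \<subseteq> {k \<in> {1..L}. k mod p = c}"
    proof clarify
      fix j assume "j < m"
      then have "p * j + p \<le> p * m" by (metis Suc_leI mult_Suc_right add.commute mult_le_mono2)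
      then show "p * j + c' \<in> {1..L} \<and> (p * j + c') mod p = c" using c' by (simp add: L)
    qed
    show "{k \<in> {1..L}. k mod p = c} \<subseteq> (\<lambda>j. p * j + c') ` {..<m}"
    proof clarify
      fix k assume k: "k \<in> {1..L}" "c = k mod p"
      define j r where "j = (k - 1) div p" and "r = (k - 1) mod p"
      have "k - 1 = p * j + r" "k \<ge> 1" using k(1) by (simp_all add: j_def r_def)
      then have kj: "k = p * j + (r + 1)" by linarith
      have r: "r + 1 \<le> p" using p by (simp add: r_def Suc_le_eq)
      have "c = (r + 1) mod p" using k(2) unfolding kj by simp
      then have "c' = r + 1" using r by (cases "r + 1 = p") (auto simp: c'_def)
      moreover have "j < m" using k p unfolding j_def L by (intro div_less_iff_less_mult[THEN iffD2]) (auto simp: mult.commute)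
      ultimately show "k \<in> (\<lambda>j. p * j + c') ` {..<m}" using kj by blast
    qed
  qed
  moreover have "inj_on (\<lambda>j. p * j + c') {..<m}" using p by (auto simp: inj_on_def)
  ultimately show ?thesis by (simp add: card_image L)
qed

text \<open>The reduced coefficient vector is uniform on \<open>p ^ n\<close> values. The bad event
  is covered by the cylinder events \<open>C a\<close>, all of the same probability, with one
  \<open>a\<close> for each reduced polynomial whose factorisation is not typical.\<close>

lemma (in prime_place) bad_probability:
  fixes \<zeta> :: "nat \<Rightarrow> 'a \<Rightarrow> nat"
  assumes M: "prob_space M" and ind: "prob_space.indep_vars M (\<lambda>_. count_space UNIV) \<zeta> {..<n}"
    and unif: "\<And>i. i < n \<Longrightarrow> distr M (count_space UNIV) (\<zeta> i) = measure_pmf (pmf_of_set {1..L})"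
    and L: "L \<ge> 1" "p dvd L" and n: "n \<ge> 1" and large: "large n"
  shows "measure M {\<omega> \<in> space M. let f = monic_poly n (\<lambda>i. \<zeta> i \<omega>)
      in galois_transitive f \<and> \<not> galois_alternating n f \<and> \<not> galois_symmetric n f}
    \<le> fp.pr n (\<lambda>A. \<not> fp.typical n A)"
proof -
  interpret prob_space M by (rule M)
  let ?Bad = "{\<omega> \<in> space M. let f = monic_poly n (\<lambda>i. \<zeta> i \<omega>)
      in galois_transitive f \<and> \<not> galois_alternating n f \<and> \<not> galois_symmetric n f}"
  let ?E = "{..<n} \<rightarrow>\<^sub>E {0..<int p}"
  define S where "S = {a \<in> ?E. \<not> fp.typical n (fac (of_coeffs n a))}"
  define W where "W = (\<lambda>a::nat \<Rightarrow> int. \<lambda>i. {k::nat. int k mod int p = a i})"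
  define C where "C = (\<lambda>a. \<Inter>i\<in>{..<n}. \<zeta> i -` W a i \<inter> space M)"
  have rv: "\<zeta> i \<in> measurable M (count_space UNIV)" if "i < n" for i
    using ind that unfolding indep_vars_def by auto
  have ne: "{..<n} \<noteq> {}" using n by (simp add: lessThan_empty_iff)
  have finE: "finite ?E" by (intro finite_PiE) auto
  then have finS: "finite S" by (simp add: S_def)
  have Cm: "C a \<in> sets M" for a
    unfolding C_def using ne by (intro sets.finite_INT) (auto intro: measurable_sets[OF rv])
  have prob_C: "prob (C a) = 1 / real p ^ n" if a: "a \<in> ?E" for a
  proof -
    have one: "prob (\<zeta> i -` W a i \<inter> space M) = 1 / real p" if i: "i < n" for i
    proof -
      have ai: "a i \<in> {0..<int p}" using PiE_mem[OF a, of i] i by simp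
      have "prob (\<zeta> i -` W a i \<inter> space M) = measure (distr M (count_space UNIV) (\<zeta> i)) (W a i)"
        by (intro measure_distr[symmetric] rv i) simp
      also have "\<dots> = card ({1..L} \<inter> W a i) / card {1..L}"
        unfolding unif[OF i] using L(1) by (intro measure_pmf_of_set) auto
      also have "{1..L} \<inter> W a i = {k \<in> {1..L}. k mod p = nat (a i)}"
      proof -
        have "int k mod int p = a i \<longleftrightarrow> k mod p = nat (a i)" for k
          unfolding of_nat_mod[symmetric] using ai by auto
        then show ?thesis by (auto simp: W_def)
      qed
      also have "card {k \<in> {1..L}. k mod p = nat (a i)} / card {1..L} = 1 / real p"
      proof -
        have "card {k \<in> {1..L}. k mod p = nat (a i)} * p = L"
          using card_residue_class[OF _ L(2), of "nat (a i)"] ai p2 by (simp add: nat_less_iff)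
        then have "real (card {k \<in> {1..L}. k mod p = nat (a i)}) * real p = real L" by (metis of_nat_mult)
        then show ?thesis using L(1) p2 by (simp add: field_simps)
      qed
      finally show ?thesis .
    qed
    have "prob (C a) = (\<Prod>i\<in>{..<n}. prob (\<zeta> i -` W a i \<inter> space M))"
      unfolding C_def using ne by (intro indep_varsD[OF ind]) auto
    also have "\<dots> = 1 / real p ^ n" using one by (simp add: power_one_over)
    finally show ?thesis .
  qed
  have sub: "?Bad \<subseteq> (\<Union>a\<in>S. C a)"
  proof
    fix \<omega> assume \<omega>: "\<omega> \<in> ?Bad"
    define f where "f = monic_poly n (\<lambda>i. \<zeta> i \<omega>)"
    define fz where "fz = of_coeffs n (\<lambda>i. int (\<zeta> i \<omega>))"
    define a where "a = restrict (\<lambda>i. int (\<zeta> i \<omega>) mod int p) {..<n}"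
    have f: "cpoly f = ip fz" "monic_p fz" "n = pdeg fz"
      unfolding f_def fz_def by (rule cpoly_monic_poly) (simp_all add: of_coeffs_monic)
    have b: "\<omega> \<in> space M" "galois_transitive f" "\<not> (galois_alternating n f \<or> galois_symmetric n f)"
      using \<omega> by (auto simp: f_def Let_def)
    have "\<not> fp.typical n (fac fz)" using typical_galois[OF f b(2) _ large] b(3) by blast
    moreover have "cg fz (of_coeffs n a)"
      unfolding cg_def fz_def by (auto simp: coeff_of_coeffs a_def dvd_minus_mod)
    then have "fac fz = fac (of_coeffs n a)" by (rule fac_cong)
    moreover have "a \<in> ?E" using p2 by (auto simp: a_def)
    ultimately have "a \<in> S" by (simp add: S_def)
    moreover have "\<omega> \<in> C a" using b(1) n by (auto simp: C_def W_def a_def)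
    ultimately show "\<omega> \<in> (\<Union>a\<in>S. C a)" by blast
  qed
  \<comment> \<open>The factorisation determines the reduced polynomial, and this determines
    \<open>a\<close>.\<close>
  have "card S \<le> card {A \<in> {A. set_mset A \<subseteq> Irr \<and> (\<Sum>\<phi>\<in>#A. pdeg \<phi>) = n}. \<not> fp.typical n A}"
  proof (rule card_inj_on_le[where f = "\<lambda>a. fac (of_coeffs n a)"])
    show "inj_on (\<lambda>a. fac (of_coeffs n a)) S"
    proof (rule inj_onI)
      fix a b assume ab: "a \<in> S" "b \<in> S" "fac (of_coeffs n a) = fac (of_coeffs n b)"
      then have "cg (of_coeffs n a) (of_coeffs n b)"
        using fac(2)[OF of_coeffs_monic(1)] cg_sym cg_trans by metis
      moreover have mon: "of_coeffs n a \<in> Mon n" "of_coeffs n b \<in> Mon n"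
        using ab bij_of_coeffs[of n] by (auto simp: S_def bij_betw_def)
      ultimately have "of_coeffs n a = of_coeffs n b" by (intro canon_eqI) (auto simp: Mon_def)
      then show "a = b" using ab bij_of_coeffs[of n] unfolding S_def bij_betw_def inj_on_def by blast
    qed
    show "(\<lambda>a. fac (of_coeffs n a)) ` S \<subseteq> {A \<in> {A. set_mset A \<subseteq> Irr \<and> (\<Sum>\<phi>\<in>#A. pdeg \<phi>) = n}. \<not> fp.typical n A}"
      using fac(1)[OF of_coeffs_monic(1)] fac_degree[OF of_coeffs_monic(1)]
      by (auto simp: S_def of_coeffs_monic)
    show "finite {A \<in> {A. set_mset A \<subseteq> Irr \<and> (\<Sum>\<phi>\<in>#A. pdeg \<phi>) = n}. \<not> fp.typical n A}"
      by (rule finite_subset[OF _ fp.Ms_finite[of n]]) auto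
  qed
  then have S_le: "real (card S) / real p ^ n \<le> fp.pr n (\<lambda>A. \<not> fp.typical n A)"
    unfolding fp.pr_def by (intro divide_right_mono) auto
  have "measure M ?Bad \<le> measure M (\<Union>a\<in>S. C a)"
    using sub Cm finS by (intro finite_measure_mono sets.finite_UN) auto
  also have "\<dots> \<le> (\<Sum>a\<in>S. measure M (C a))"
    using finS Cm by (intro finite_measure_subadditive_finite) auto
  also have "\<dots> = (\<Sum>a\<in>S. 1 / real p ^ n)" using prob_C by (intro sum.cong) (auto simp: S_def)
  also have "\<dots> = real (card S) / real p ^ n" by simp
  finally show ?thesis using S_le by linarith
qed

theorem theorem2:
  fixes L :: nat
    and M :: "nat \<Rightarrow> 'a measure"
    and \<zeta> :: "nat \<Rightarrow> nat \<Rightarrow> 'a \<Rightarrow> nat"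
  assumes "L \<ge> 2"
    and "\<And>n. n \<ge> 1 \<Longrightarrow> prob_space (M n)"
    and "\<And>n. n \<ge> 1 \<Longrightarrow>
           prob_space.indep_vars (M n) (\<lambda>_. count_space UNIV) (\<zeta> n) {..<n}"
    and "\<And>n i. n \<ge> 1 \<Longrightarrow> i < n \<Longrightarrow>
           distr (M n) (count_space UNIV) (\<zeta> n i) = measure_pmf (pmf_of_set {1..L})"
  shows "(\<lambda>n. measure (M n)
            {\<omega> \<in> space (M n).
               let f = monic_poly n (\<lambda>i. \<zeta> n i \<omega>)
               in galois_transitive f \<and> \<not> galois_alternating n f \<and> \<not> galois_symmetric n f})
         \<longlonglongrightarrow> 0"
proof -
  \<comment> \<open>Any prime divisor of \<open>L\<close> will do; divisibility is what makes the
    coefficients uniform modulo \<open>p\<close>. Both \<open>p\<close> and \<open>P\<close> are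
    chosen before \<open>n\<close>, so a single sequence of probabilities serves as the upper
    bound.\<close>
  obtain p where p: "Factorial_Ring.prime p" "p dvd L" using prime_factor_nat[of L] assms(1) by auto
  interpret prime_modulus p by unfold_locales (rule p(1))
  obtain P where P: "prime_place p P" using ex_prime_place by blast
  interpret prime_place p P by (rule P)
  show ?thesis
  proof (rule tendsto_sandwich[OF _ _ tendsto_const fp.typical_tendsto])
    show "eventually (\<lambda>n. measure (M n) {\<omega> \<in> space (M n). let f = monic_poly n (\<lambda>i. \<zeta> n i \<omega>)
        in galois_transitive f \<and> \<not> galois_alternating n f \<and> \<not> galois_symmetric n f}
      \<le> fp.pr n (\<lambda>A. \<not> fp.typical n A)) sequentially"
      using eventually_large eventually_ge_at_top[of 1]
    proof eventually_elim
      case (elim n)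
      show ?case
        by (rule bad_probability[OF assms(2-4)]) (use elim assms(1) p(2) in auto)
    qed
  qed (intro always_eventually allI measure_nonneg)
qed

end
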